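(* Any nonsingular pair of metrics $g_1^{ij}(u)$, $g_2^{ij}(u)$ is compatible if and only if there exist local coordinates $u=(u^1,\dots,u^N)$ such that $$g_2^{ij}(u)=g^i(u)\,\delta^{ij},\qquad g_1^{ij}(u)=f^i(u^i)\,g^i(u)\,\delta^{ij}\quad\text{(no summation)},$$ where $f^i(u^i)$, $i=1,\dots,N$, are some (generally speaking, complex) functions of single variables, not identically equal to zero. (For nonsingular pairs all the functions $f^i$ must be distinct, and they cannot be equal to one another if they are constants; nevertheless, also in the case when some of them are equal constants, metrics of the form $g_2^{ij}(u)=g^i(u)\,\delta^{ij}$, $g_1^{ij}(u)=f^i(u^i)\,g^i(u)\,\delta^{ij}$ are compatible.)
   Context: A contravariant metric $g^{ij}(u)$ is a smooth symmetric nondegenerate (Riemannian or pseudo-Riemannian) contravariant 2-tensor, with inverse $g_{ij}(u)$; subscripts $1,2$ refer to $g_1,g_2$. $\Gamma^i_{jk}$ are the Christoffel symbols of the Levi-Civita connection of $g$ and $$\Gamma^{ij}_k=g^{is}\Gamma^j_{sk},\qquad R^i_{jkl}=\frac{\partial\Gamma^i_{jl}}{\partial u^k}-\frac{\partial\Gamma^i_{jk}}{\partial u^l}+\Gamma^i_{pk}\Gamma^p_{jl}-\Gamma^i_{pl}\Gamma^p_{jk},\qquad R^{ij}_{kl}=g^{is}R^j_{skl}.$$ Two metrics are called compatible if for every linear combination $g^{ij}=\lambda_1g_1^{ij}+\lambda_2g_2^{ij}$ ($\lambda_1,\lambda_2$ constants with $\det(g^{ij})\not\equiv0$) both $\Gamma^{ij}_k=\lambda_1\Gamma^{ij}_{1,k}+\lambda_2\Gamma^{ij}_{2,k}$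 and $R^{ij}_{kl}=\lambda_1R^{ij}_{1,kl}+\lambda_2R^{ij}_{2,kl}$ hold. A pair of metrics is called nonsingular if its eigenvalues, i.e. the roots $\lambda$ of $\det(g_1^{ij}(u)-\lambda g_2^{ij}(u))=0$, are distinct. The eigenvalues may be complex, in which case the diagonalizing coordinates and the functions $f^i,g^i$ are allowed to be complex. *)

theory Defs
  imports "HOL-Analysis.Analysis"
begin

primrec times_differentiable_on ::
  "nat \<Rightarrow> ('a::real_normed_vector \<Rightarrow> 'b::real_normed_vector) \<Rightarrow> 'a set \<Rightarrow> bool" where
  "times_differentiable_on 0 f S \<longleftrightarrow> continuous_on S f"
| "times_differentiable_on (Suc n) f S \<longleftrightarrow>
     (\<forall>x\<in>S. f differentiable (at x)) \<and>
     (\<forall>v. times_differentiable_on n (\<lambda>x. frechet_derivative f (at x) v) S)"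

text \<open>Class $C^\infty$ on an open set, in the real sense also when the values are complex.\<close>

definition smooth_on :: "('a::real_normed_vector \<Rightarrow> 'b::real_normed_vector) \<Rightarrow> 'a set \<Rightarrow> bool" where
  "smooth_on f S \<longleftrightarrow> (\<forall>n. times_differentiable_on n f S)"

definition partial :: "'n::finite \<Rightarrow> (real^'n \<Rightarrow> 'b::real_normed_vector) \<Rightarrow> real^'n \<Rightarrow> 'b" where
  "partial k F u = frechet_derivative F (at u) (axis k 1)"

text \<open>The argument of a tensor field is the coordinate vector of a point of a domain in
  $\mathbb{R}^N$, with \<open>N = CARD('n)\<close>; its value is the matrix of upper-index components.\<close>

type_synonym 'n tensor2 = "real^'n \<Rightarrow> real^'n^'n"

definition contravariant_metric_on :: "(real^'n::finite) set \<Rightarrow> 'n tensor2 \<Rightarrow> bool" where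
  "contravariant_metric_on U g \<longleftrightarrow>
     (\<forall>i j. smooth_on (\<lambda>u. g u $ i $ j) U) \<and>
     (\<forall>u\<in>U. transpose (g u) = g u \<and> det (g u) \<noteq> 0)"

definition lower :: "('n::finite) tensor2 \<Rightarrow> 'n \<Rightarrow> 'n \<Rightarrow> real^'n \<Rightarrow> real" where
  "lower g i j u = matrix_inv (g u) $ i $ j"

text \<open>\<open>christoffel g i j k\<close> is $\Gamma^i_{jk}$, \<open>contra_christoffel g i j k\<close> is
  $\Gamma^{ij}_k$, \<open>riemann g i j k l\<close> is $R^i_{jkl}$ and \<open>contra_riemann g i j k l\<close>
  is $R^{ij}_{kl}$.  They are meaningful at the points where \<open>g\<close> is smooth and
  nondegenerate.\<close>

definition christoffel :: "('n::finite) tensor2 \<Rightarrow> 'n \<Rightarrow> 'n \<Rightarrow> 'n \<Rightarrow> real^'n \<Rightarrow> real" where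
  "christoffel g i j k u =
     (\<Sum>s\<in>UNIV. (1/2) * g u $ i $ s *
        (partial j (lower g s k) u + partial k (lower g j s) u - partial s (lower g j k) u))"

definition contra_christoffel :: "('n::finite) tensor2 \<Rightarrow> 'n \<Rightarrow> 'n \<Rightarrow> 'n \<Rightarrow> real^'n \<Rightarrow> real" where
  "contra_christoffel g i j k u = (\<Sum>s\<in>UNIV. g u $ i $ s * christoffel g j s k u)"

definition riemann :: "('n::finite) tensor2 \<Rightarrow> 'n \<Rightarrow> 'n \<Rightarrow> 'n \<Rightarrow> 'n \<Rightarrow> real^'n \<Rightarrow> real" where
  "riemann g i j k l u =
     partial k (christoffel g i j l) u - partial l (christoffel g i j k) u
     + (\<Sum>p\<in>UNIV. christoffel g i p k u * christoffel g p j l u)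
     - (\<Sum>p\<in>UNIV. christoffel g i p l u * christoffel g p j k u)"

definition contra_riemann ::
  "('n::finite) tensor2 \<Rightarrow> 'n \<Rightarrow> 'n \<Rightarrow> 'n \<Rightarrow> 'n \<Rightarrow> real^'n \<Rightarrow> real" where
  "contra_riemann g i j k l u = (\<Sum>s\<in>UNIV. g u $ i $ s * riemann g j s k l u)"

definition pencil :: "real \<Rightarrow> real \<Rightarrow> ('n::finite) tensor2 \<Rightarrow> 'n tensor2 \<Rightarrow> 'n tensor2" where
  "pencil l1 l2 g1 g2 u = l1 *\<^sub>R g1 u + l2 *\<^sub>R g2 u"

text \<open>A linear combination whose determinant is not identically zero may still degenerate at
  some points; the connection and the curvature exist, and the identities are imposed, at the
  points where it does not.\<close>

definition compatible_on :: "(real^'n::finite) set \<Rightarrow> 'n tensor2 \<Rightarrow> 'n tensor2 \<Rightarrow> bool" where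
  "compatible_on U g1 g2 \<longleftrightarrow>
     (\<forall>l1 l2. (\<exists>u\<in>U. det (pencil l1 l2 g1 g2 u) \<noteq> 0) \<longrightarrow>
       (\<forall>u\<in>U. det (pencil l1 l2 g1 g2 u) \<noteq> 0 \<longrightarrow>
         (\<forall>i j k. contra_christoffel (pencil l1 l2 g1 g2) i j k u =
            l1 * contra_christoffel g1 i j k u + l2 * contra_christoffel g2 i j k u) \<and>
         (\<forall>i j k l. contra_riemann (pencil l1 l2 g1 g2) i j k l u =
            l1 * contra_riemann g1 i j k l u + l2 * contra_riemann g2 i j k l u)))"

definition pair_eigenvalues :: "('n::finite) tensor2 \<Rightarrow> 'n tensor2 \<Rightarrow> real^'n \<Rightarrow> complex set" where
  "pair_eigenvalues g1 g2 u =
     {z. det (\<chi> i j. complex_of_real (g1 u $ i $ j) - z * complex_of_real (g2 u $ i $ j)) = 0}"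

text \<open>For nondegenerate \<open>g2\<close> the determinant above has degree $N$ in \<open>z\<close>, so its roots are
  distinct iff there are $N$ of them.\<close>

definition nonsingular_pair_on :: "(real^'n::finite) set \<Rightarrow> 'n tensor2 \<Rightarrow> 'n tensor2 \<Rightarrow> bool" where
  "nonsingular_pair_on U g1 g2 \<longleftrightarrow> (\<forall>u\<in>U. card (pair_eigenvalues g1 g2 u) = CARD('n))"

text \<open>Possibly complex local coordinates on the open set \<open>V\<close>: the complex differentials of the
  $N$ coordinate functions are linearly independent over the complex numbers at each point.
  If all the coordinate functions are real-valued, these are ordinary local coordinates.\<close>

definition complex_coordinates_on :: "(real^'n::finite) set \<Rightarrow> (real^'n \<Rightarrow> complex^'n) \<Rightarrow> bool" where
  "complex_coordinates_on V \<phi> \<longleftrightarrow>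
     open V \<and> smooth_on \<phi> V \<and> inj_on \<phi> V \<and>
     (\<forall>u\<in>V. det (\<chi> i k. partial k (\<lambda>x. \<phi> x $ i) u) \<noteq> 0)"

text \<open>The components of the tensor \<open>g\<close> in the coordinates \<open>\<phi>\<close>, at the point \<open>u\<close>.\<close>

definition components_in ::
  "(real^'n::finite \<Rightarrow> complex^'n) \<Rightarrow> 'n tensor2 \<Rightarrow> 'n \<Rightarrow> 'n \<Rightarrow> real^'n \<Rightarrow> complex" where
  "components_in \<phi> g i j u =
     (\<Sum>k\<in>UNIV. \<Sum>l\<in>UNIV. partial k (\<lambda>x. \<phi> x $ i) u * partial l (\<lambda>x. \<phi> x $ j) u *
        complex_of_real (g u $ k $ l))"

text \<open>\<open>f i\<close> is a function of the $i$-th coordinate alone.  For a complex coordinate this includes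
  independence of the conjugate coordinate, that is, complex differentiability.  On the range of a
  real coordinate, \<open>holomorphic_on\<close> is just differentiability of a (complex-valued) function of a
  real variable.  Further smoothness of the functions is automatic: $f^i = g_1^{ii}/g_2^{ii}$ along
  the coordinates.\<close>

definition diagonal_form_on ::
  "(real^'n::finite) set \<Rightarrow> (real^'n \<Rightarrow> complex^'n) \<Rightarrow> ('n \<Rightarrow> complex \<Rightarrow> complex) \<Rightarrow>
   ('n \<Rightarrow> complex^'n \<Rightarrow> complex) \<Rightarrow> 'n tensor2 \<Rightarrow> 'n tensor2 \<Rightarrow> bool" where
  "diagonal_form_on V \<phi> f g g1 g2 \<longleftrightarrow>
     complex_coordinates_on V \<phi> \<and>
     (\<forall>i. f i holomorphic_on ((\<lambda>u. \<phi> u $ i) ` V) \<and> (\<exists>u\<in>V. f i (\<phi> u $ i) \<noteq> 0)) \<and>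
     (\<forall>u\<in>V. \<forall>i j.
        components_in \<phi> g2 i j u = (if i = j then g i (\<phi> u) else 0) \<and>
        components_in \<phi> g1 i j u = (if i = j then f i (\<phi> u $ i) * g i (\<phi> u) else 0))"

text \<open>Complex coordinates are only allowed for complex eigenvalues: if the eigenvalue \<open>f i\<close> is real
  then so are the coordinate \<open>i\<close> and the function \<open>g i\<close>.\<close>

definition real_for_real_eigenvalues ::
  "(real^'n::finite) set \<Rightarrow> (real^'n \<Rightarrow> complex^'n) \<Rightarrow> ('n \<Rightarrow> complex \<Rightarrow> complex) \<Rightarrow>
   ('n \<Rightarrow> complex^'n \<Rightarrow> complex) \<Rightarrow> bool" where
  "real_for_real_eigenvalues V \<phi> f g \<longleftrightarrow>
     (\<forall>i. (\<forall>u\<in>V. f i (\<phi> u $ i) \<in> \<real>) \<longrightarrow> (\<forall>u\<in>V. \<phi> u $ i \<in> \<real> \<and> g i (\<phi> u) \<in> \<real>))"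

end

theory Submission
  imports Defs "HOL-Analysis.Analysis"
begin

text \<open>The eigenvalues \<open>\<lambda>\<^sub>i\<close> and eigencovectors \<open>\<omega>\<^sub>i\<close> of a nonsingular pair depend smoothly on the point.
  Comparing the symmetry of the Levi-Civita connections of \<open>g\<^sub>1\<close>, \<open>g\<^sub>2\<close> and of a member of the pencil shows that,
  for a compatible pair, the two connections agree on pairs of distinct eigenvectors. Differentiating
  \<open>g\<^sub>1 \<omega>\<^sub>i = \<lambda>\<^sub>i g\<^sub>2 \<omega>\<^sub>i\<close> then gives that \<open>d\<lambda>\<^sub>i\<close> and \<open>d\<omega>\<^sub>i\<close> vanish on the kernel of \<open>\<omega>\<^sub>i\<close>. So \<open>\<omega>\<^sub>i\<close> is
  proportional to some \<open>d\<phi>\<^sub>i\<close> and \<open>\<lambda>\<^sub>i\<close> is a function of \<open>\<phi>\<^sub>i\<close>: if \<open>\<lambda>\<^sub>i\<close> is real this is the theorem of Frobenius;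
  otherwise a flow along the real part of the kernel reduces it to a Beltrami equation in the plane,
  solved by a Neumann series of Fourier series, and \<open>\<lambda>\<^sub>i\<close> is holomorphic in \<open>\<phi>\<^sub>i\<close>. The \<open>\<phi>\<^sub>i\<close> are the
  diagonalizing coordinates.

  Conversely, for metrics with components \<open>h\<^sub>i(\<phi>\<^sub>i) \<gamma>\<^sub>i \<delta>\<^sub>i\<^sub>j\<close> the contravariant Christoffel symbols and the
  contravariant curvature are linear in the functions \<open>h\<^sub>i\<close> and their derivatives.\<close>

section \<open>Smooth maps\<close>

text \<open>The metrics are only smooth, so a complex eigenvalue cannot be treated by passing to
  complex points. The kernel of a covector that is not proportional to a real one is not spanned by
  real vectors; its real part has codimension 2, and the remaining complex direction imposes a
  genuine elliptic equation. Solved by Fourier series on a torus, that equation yields smoothness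
  directly, as rapid decay of coefficients, with no separate regularity theory. Smoothness of flows
  and of inverse functions rests on one bootstrap, \<open>linear_fixed_point_Ck\<close>: the
  derivative of a solution of a linear fixed point equation solves an equation of the same kind.
  Complex coordinates are not a chart of the real domain. The tensor computations therefore never
  change variables: real tensors are contracted with complex frames and coframes at a point, and the
  second derivatives of the coordinates enter as an explicit inhomogeneous term,
  \<open>flat\<close>. In the converse the obstacle to linearity is the quadratic part of the
  curvature, which is a quotient by the functions that should enter linearly.\<close>

abbreviation Ck_on :: "nat \<Rightarrow> ('a::real_normed_vector \<Rightarrow> 'b::real_normed_vector) \<Rightarrow> 'a set \<Rightarrow> bool"
  where "Ck_on \<equiv> times_differentiable_on"

lemma Ck_on_cong:
  assumes "open S" "\<And>x. x \<in> S \<Longrightarrow> f x = g x" "Ck_on k f S"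
  shows "Ck_on k g S"
  using assms(2,3)
proof (induction k arbitrary: f g)
  case 0
  have "continuous_on S f = continuous_on S g" by (rule continuous_on_cong) (use 0 in auto)
  then show ?case using 0 by simp
next
  case (Suc k)
  have d: "(g has_derivative frechet_derivative f (at x)) (at x)" if "x \<in> S" for x
  proof (rule has_derivative_transform_within_open[OF _ assms(1) that])
    show "(f has_derivative frechet_derivative f (at x)) (at x)"
      using Suc.prems that by (auto simp: frechet_derivative_works)
  qed (use Suc.prems in auto)
  show ?case
    unfolding times_differentiable_on.simps
  proof (intro conjI ballI allI)
    fix x assume "x \<in> S" then show "g differentiable at x"
      using d differentiable_def by blast
  next
    fix v
    have "Ck_on k (\<lambda>x. frechet_derivative f (at x) v) S" using Suc.prems by auto
    then show "Ck_on k (\<lambda>x. frechet_derivative g (at x) v) S"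
      using Suc.IH[of "\<lambda>x. frechet_derivative f (at x) v" "\<lambda>x. frechet_derivative g (at x) v"]
        frechet_derivative_at[OF d] by metis
  qed
qed

text \<open>The definition speaks of the chosen value \<open>frechet_derivative\<close>. By
  uniqueness of derivatives any explicit formula \<open>f'\<close> may take its place, and the later
  regularity proofs enter through this rule.\<close>

lemma Ck_on_SucI:
  assumes "open S" "\<And>x. x \<in> S \<Longrightarrow> (f has_derivative f' x) (at x)"
    "\<And>v. Ck_on k (\<lambda>x. f' x v) S"
  shows "Ck_on (Suc k) f S"
  unfolding times_differentiable_on.simps
proof (intro conjI ballI allI)
  fix v
  show "Ck_on k (\<lambda>x. frechet_derivative f (at x) v) S"
    by (rule Ck_on_cong[OF assms(1) _ assms(3)[of v]]) (metis assms(2) frechet_derivative_at)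
qed (use assms(2) differentiable_def in blast)

lemma Ck_on_SucD: "Ck_on (Suc k) f S \<Longrightarrow> Ck_on k f S"
proof (induction k arbitrary: f)
  case 0
  then show ?case
    by (auto intro!: continuous_at_imp_continuous_on differentiable_imp_continuous_within)
qed auto

lemma Ck_on_has_derivative:
  "Ck_on (Suc k) f S \<Longrightarrow> x \<in> S \<Longrightarrow> (f has_derivative frechet_derivative f (at x)) (at x)"
  by (auto simp: frechet_derivative_works)

lemma Ck_on_frechet: "Ck_on (Suc k) f S \<Longrightarrow> Ck_on k (\<lambda>x. frechet_derivative f (at x) v) S"
  by simp

lemma Ck_on_continuous: "Ck_on k f S \<Longrightarrow> continuous_on S f"
  by (induction k) (auto dest: Ck_on_SucD simp del: times_differentiable_on.simps(2))

lemma Ck_on_subset: "Ck_on k f S \<Longrightarrow> T \<subseteq> S \<Longrightarrow> Ck_on k f T"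
  by (induction k arbitrary: f) (auto intro: continuous_on_subset)

lemma Ck_on_const: "open S \<Longrightarrow> Ck_on k (\<lambda>x. c) S"
proof (induction k arbitrary: c)
  case (Suc k)
  then show ?case by (intro Ck_on_SucI[where f' = "\<lambda>x v. 0"]) auto
qed auto

lemma Ck_on_linear_compose:
  assumes "bounded_linear L" "open S" "Ck_on k f S"
  shows "Ck_on k (\<lambda>x. L (f x)) S"
  using assms(3)
proof (induction k arbitrary: f)
  case 0
  then show ?case using bounded_linear.continuous_on[OF assms(1)] by simp
next
  case (Suc k)
  show ?case
  proof (rule Ck_on_SucI[OF assms(2), where f' = "\<lambda>x v. L (frechet_derivative f (at x) v)"])
    fix x assume "x \<in> S" then show "((\<lambda>x. L (f x)) has_derivative
        (\<lambda>v. L (frechet_derivative f (at x) v))) (at x)"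
      by (rule bounded_linear.has_derivative[OF assms(1) Ck_on_has_derivative[OF Suc.prems]])
  qed (use Suc in auto)
qed

lemma Ck_on_linear:
  assumes "bounded_linear L" "open S"
  shows "Ck_on k L S"
proof (cases k)
  case 0
  then show ?thesis using assms by (simp add: linear_continuous_on)
next
  case (Suc m)
  show ?thesis unfolding Suc
    by (rule Ck_on_SucI[OF assms(2), where f' = "\<lambda>x v. L v"])
      (use assms in \<open>auto intro!: bounded_linear_imp_has_derivative Ck_on_const\<close>)
qed

lemma Ck_on_id: "open S \<Longrightarrow> Ck_on k (\<lambda>x. x) S"
  by (rule Ck_on_linear[OF bounded_linear_ident])

lemma Ck_on_add:
  assumes "open S" "Ck_on k f S" "Ck_on k g S"
  shows "Ck_on k (\<lambda>x. f x + g x) S"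
  using assms(2,3)
proof (induction k arbitrary: f g)
  case 0
  then show ?case by (auto intro: continuous_on_add)
next
  case (Suc k)
  show ?case
    by (rule Ck_on_SucI[OF assms(1), where f' = "\<lambda>x v. frechet_derivative f (at x) v
      + frechet_derivative g (at x) v"])
      (rule has_derivative_add Suc.IH Ck_on_has_derivative Ck_on_frechet Suc.prems | assumption)+
qed

lemma Ck_on_minus: "open S \<Longrightarrow> Ck_on k f S \<Longrightarrow> Ck_on k (\<lambda>x. - f x) S"
  by (rule Ck_on_linear_compose[OF bounded_linear_minus[OF bounded_linear_ident]])

lemma Ck_on_diff:
  assumes "open S" "Ck_on k f S" "Ck_on k g S"
  shows "Ck_on k (\<lambda>x. f x - g x) S"
  using Ck_on_add[OF assms(1,2) Ck_on_minus[OF assms(1,3)]] by simp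

lemma Ck_on_sum:
  assumes "open S" "\<And>i. i \<in> I \<Longrightarrow> Ck_on k (f i) S"
  shows "Ck_on k (\<lambda>x. \<Sum>i\<in>I. f i x) S"
  using assms(2)
  by (induction I rule: infinite_finite_induct) (auto intro: Ck_on_const Ck_on_add assms(1))

lemma (in bounded_bilinear) Ck_on_bilinear:
  assumes "open S" "Ck_on k f S" "Ck_on k g S"
  shows "Ck_on k (\<lambda>x. prod (f x) (g x)) S"
  using assms(2,3)
proof (induction k arbitrary: f g)
  case 0
  then show ?case by (auto intro: continuous_on)
next
  case (Suc k)
  note Ck = Suc.prems[THEN Ck_on_SucD]
  show ?case
    by (rule Ck_on_SucI[OF assms(1), where f' = "\<lambda>x v. prod (f x) (frechet_derivative g (at x) v)
      + prod (frechet_derivative f (at x) v) (g x)"])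
      (rule FDERIV Ck_on_add[OF assms(1)] Suc.IH Ck_on_has_derivative Ck_on_frechet Ck
        Suc.prems | assumption)+
qed

lemmas Ck_on_scaleR = bounded_bilinear.Ck_on_bilinear[OF bounded_bilinear_scaleR]
lemmas Ck_on_mult = bounded_bilinear.Ck_on_bilinear[OF bounded_bilinear_mult]
lemmas Ck_on_inner = bounded_bilinear.Ck_on_bilinear[OF bounded_bilinear_inner]

lemma Ck_on_prod:
  fixes f :: "'i \<Rightarrow> 'a::real_normed_vector \<Rightarrow> 'b::real_normed_field"
  assumes "open S" "\<And>i. i \<in> I \<Longrightarrow> Ck_on k (f i) S"
  shows "Ck_on k (\<lambda>x. \<Prod>i\<in>I. f i x) S"
  using assms(2)
  by (induction I rule: infinite_finite_induct) (auto intro: Ck_on_const Ck_on_mult assms(1))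

lemma frechet_derivative_basis_sum:
  fixes g :: "'b::euclidean_space \<Rightarrow> 'c::real_normed_vector"
  assumes "g differentiable at x"
  shows "frechet_derivative g (at x) w = (\<Sum>b\<in>Basis. (w \<bullet> b) *\<^sub>R frechet_derivative g (at x) b)"
proof -
  have l: "linear (frechet_derivative g (at x))"
    using assms by (rule linear_frechet_derivative)
  show ?thesis
    by (subst (1) euclidean_representation[of w, symmetric])
      (simp add: linear_sum[OF l] linear_cmul[OF l])
qed

text \<open>The definition controls derivatives in fixed directions only, while the chain rule
  produces the derivative of \<open>g\<close> in the moving direction
  \<open>frechet_derivative f (at x) v\<close>. Expanding that direction in a basis of the middle
  space gives a sum of products to which the induction hypothesis applies.\<close>

lemma Ck_on_compose:
  fixes g :: "'b::euclidean_space \<Rightarrow> 'c::real_normed_vector"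
  assumes "open S" "open T" "\<And>x. x \<in> S \<Longrightarrow> f x \<in> T" "Ck_on k g T" "Ck_on k f S"
  shows "Ck_on k (\<lambda>x. g (f x)) S"
  using assms(4,5)
proof (induction k arbitrary: g)
  case 0
  then show ?case using assms(3) by (auto intro: continuous_on_compose2)
next
  case (Suc k)
  show ?case
  proof (rule Ck_on_SucI[OF assms(1), where f' = "\<lambda>x v. \<Sum>b\<in>Basis.
      (frechet_derivative f (at x) v \<bullet> b) *\<^sub>R frechet_derivative g (at (f x)) b"])
    fix x assume x: "x \<in> S"
    have "((\<lambda>x. g (f x)) has_derivative
        (\<lambda>v. frechet_derivative g (at (f x)) (frechet_derivative f (at x) v))) (at x)"
      using has_derivative_compose[of f _ x UNIV g] Ck_on_has_derivative[OF Suc.prems(2) x]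
        Ck_on_has_derivative[OF Suc.prems(1) assms(3)[OF x]] by blast
    moreover have "g differentiable at (f x)" using Suc.prems assms(3)[OF x] by auto
    ultimately show "((\<lambda>x. g (f x)) has_derivative (\<lambda>v. \<Sum>b\<in>Basis.
        (frechet_derivative f (at x) v \<bullet> b) *\<^sub>R frechet_derivative g (at (f x)) b)) (at x)"
      by (simp flip: frechet_derivative_basis_sum)
  next
    fix v
    show "Ck_on k (\<lambda>x. \<Sum>b\<in>Basis. (frechet_derivative f (at x) v \<bullet> b) *\<^sub>R
        frechet_derivative g (at (f x)) b) S"
      using Suc.prems Ck_on_SucD[OF Suc.prems(2)]
      by (intro Ck_on_sum Ck_on_scaleR Ck_on_inner Ck_on_const Suc.IH assms(1)) auto
  qed
qed

lemma Ck_on_inverse_fun: "Ck_on k (inverse :: 'a::real_normed_field \<Rightarrow> 'a) (- {0})"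
proof (induction k)
  case 0
  then show ?case by (auto intro!: continuous_intros)
next
  case (Suc k)
  show ?case
    by (rule Ck_on_SucI[where f' = "\<lambda>x v. - (inverse x * v * inverse x)"])
      (auto intro!: has_derivative_inverse' Ck_on_minus Ck_on_mult Ck_on_const Suc)
qed

lemma Ck_on_inverse:
  fixes f :: "'a::real_normed_vector \<Rightarrow> 'b::{real_normed_field, euclidean_space}"
  assumes "open S" "Ck_on k f S" "\<And>x. x \<in> S \<Longrightarrow> f x \<noteq> 0"
  shows "Ck_on k (\<lambda>x. inverse (f x)) S"
  by (rule Ck_on_compose[OF assms(1) _ _ Ck_on_inverse_fun assms(2)]) (use assms in auto)

lemma Ck_on_divide:
  fixes f :: "'a::real_normed_vector \<Rightarrow> 'b::{real_normed_field, euclidean_space}"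
  assumes "open S" "Ck_on k f S" "Ck_on k g S" "\<And>x. x \<in> S \<Longrightarrow> g x \<noteq> 0"
  shows "Ck_on k (\<lambda>x. f x / g x) S"
  unfolding divide_inverse by (intro Ck_on_mult Ck_on_inverse assms)

lemma Ck_on_vec_lambda:
  fixes f :: "'a::real_normed_vector \<Rightarrow> 'i::finite \<Rightarrow> 'b::{real_normed_vector}"
  assumes "open S" "\<And>i. Ck_on k (\<lambda>x. f x i) S"
  shows "Ck_on k (\<lambda>x. \<chi> i. f x i) S"
proof -
  have 1: "bounded_linear (\<lambda>c::'b. axis i c)" for i :: 'i
  proof (rule bounded_linear_intro[where K=1])
    fix c :: 'b
    have "norm (axis i c) \<le> (\<Sum>j\<in>UNIV. norm (axis i c $ j))"
      unfolding norm_vec_def by (rule L2_set_le_sum) simp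
    also have "\<dots> = norm c" by (simp add: axis_def if_distrib[of norm] cong: if_cong)
    finally show "norm (axis i c) \<le> norm c * 1" by simp
  qed (auto simp: axis_def vec_eq_iff)
  have "Ck_on k (\<lambda>x. \<Sum>i\<in>UNIV. axis i (f x i)) S"
    by (intro Ck_on_sum assms Ck_on_linear_compose[OF 1])
  moreover have "(\<Sum>i\<in>UNIV. axis i (f x i)) = (\<chi> i. f x i)" for x
    by (simp add: vec_eq_iff axis_def sum.delta)
  ultimately show ?thesis by simp
qed

lemma smooth_onD: "smooth_on f S \<Longrightarrow> Ck_on k f S"
  by (simp add: smooth_on_def)

lemma smooth_on_cong:
  "open S \<Longrightarrow> (\<And>x. x \<in> S \<Longrightarrow> f x = g x) \<Longrightarrow> smooth_on f S \<Longrightarrow> smooth_on g S"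
  unfolding smooth_on_def using Ck_on_cong by blast

lemma smooth_on_subset: "smooth_on f S \<Longrightarrow> T \<subseteq> S \<Longrightarrow> smooth_on f T"
  unfolding smooth_on_def using Ck_on_subset by blast

lemma smooth_on_const: "open S \<Longrightarrow> smooth_on (\<lambda>x. c) S"
  and smooth_on_id: "open S \<Longrightarrow> smooth_on (\<lambda>x. x) S"
  and smooth_on_add: "open S \<Longrightarrow> smooth_on f S \<Longrightarrow> smooth_on g S \<Longrightarrow> smooth_on (\<lambda>x. f x + g x) S"
  and smooth_on_diff: "open S \<Longrightarrow> smooth_on f S \<Longrightarrow> smooth_on g S \<Longrightarrow> smooth_on (\<lambda>x. f x - g x) S"
  and smooth_on_minus: "open S \<Longrightarrow> smooth_on f S \<Longrightarrow> smooth_on (\<lambda>x. - f x) S"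
  and smooth_on_linear_compose:
    "bounded_linear L \<Longrightarrow> open S \<Longrightarrow> smooth_on f S \<Longrightarrow> smooth_on (\<lambda>x. L (f x)) S"
  unfolding smooth_on_def
  by (auto intro: Ck_on_const Ck_on_id Ck_on_add Ck_on_diff Ck_on_minus Ck_on_linear_compose)

lemma smooth_on_linear: "bounded_linear L \<Longrightarrow> open S \<Longrightarrow> smooth_on L S"
  unfolding smooth_on_def by (auto intro: Ck_on_linear)

lemma smooth_on_sum:
  "open S \<Longrightarrow> (\<And>i. i \<in> I \<Longrightarrow> smooth_on (f i) S) \<Longrightarrow> smooth_on (\<lambda>x. \<Sum>i\<in>I. f i x) S"
  unfolding smooth_on_def by (auto intro: Ck_on_sum)

lemma smooth_on_scaleR:
  "open S \<Longrightarrow> smooth_on f S \<Longrightarrow> smooth_on g S \<Longrightarrow> smooth_on (\<lambda>x. f x *\<^sub>R g x) S"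
  unfolding smooth_on_def by (auto intro: Ck_on_scaleR)

lemma smooth_on_mult:
  fixes f g :: "'a::real_normed_vector \<Rightarrow> 'b::real_normed_algebra"
  shows "open S \<Longrightarrow> smooth_on f S \<Longrightarrow> smooth_on g S \<Longrightarrow> smooth_on (\<lambda>x. f x * g x) S"
  unfolding smooth_on_def by (auto intro: Ck_on_mult)

lemma smooth_on_prod:
  fixes f :: "'i \<Rightarrow> 'a::real_normed_vector \<Rightarrow> 'b::real_normed_field"
  shows "open S \<Longrightarrow> (\<And>i. i \<in> I \<Longrightarrow> smooth_on (f i) S) \<Longrightarrow> smooth_on (\<lambda>x. \<Prod>i\<in>I. f i x) S"
  unfolding smooth_on_def by (auto intro: Ck_on_prod)

lemma smooth_on_divide:
  fixes f :: "'a::real_normed_vector \<Rightarrow> 'b::{real_normed_field, euclidean_space}"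
  shows "open S \<Longrightarrow> smooth_on f S \<Longrightarrow> smooth_on g S \<Longrightarrow> (\<And>x. x \<in> S \<Longrightarrow> g x \<noteq> 0) \<Longrightarrow>
    smooth_on (\<lambda>x. f x / g x) S"
  unfolding smooth_on_def by (auto intro: Ck_on_divide)

lemma smooth_on_vec_lambda:
  "open S \<Longrightarrow> (\<And>i. smooth_on (\<lambda>x. f x i) S) \<Longrightarrow> smooth_on (\<lambda>x. \<chi> i. f x i) S"
  unfolding smooth_on_def by (auto intro: Ck_on_vec_lambda)

lemma smooth_on_compose:
  fixes g :: "'b::euclidean_space \<Rightarrow> 'c::real_normed_vector"
  shows "open S \<Longrightarrow> open T \<Longrightarrow> (\<And>x. x \<in> S \<Longrightarrow> f x \<in> T) \<Longrightarrow> smooth_on g T \<Longrightarrow> smooth_on f S \<Longrightarrow>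
    smooth_on (\<lambda>x. g (f x)) S"
  unfolding smooth_on_def by (auto intro: Ck_on_compose)

lemma smooth_on_frechet: "smooth_on f S \<Longrightarrow> smooth_on (\<lambda>x. frechet_derivative f (at x) v) S"
  unfolding smooth_on_def using Ck_on_frechet by blast

lemma smooth_on_partial: "smooth_on f S \<Longrightarrow> smooth_on (partial k f) S"
  unfolding partial_def[abs_def] by (rule smooth_on_frechet)

lemma smooth_on_differentiable: "smooth_on f S \<Longrightarrow> x \<in> S \<Longrightarrow> f differentiable at x"
  unfolding smooth_on_def using times_differentiable_on.simps(2) by blast

lemma smooth_on_has_derivative:
  "smooth_on f S \<Longrightarrow> x \<in> S \<Longrightarrow> (f has_derivative frechet_derivative f (at x)) (at x)"
  using smooth_on_differentiable frechet_derivative_works by blast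

lemma smooth_on_continuous: "smooth_on f S \<Longrightarrow> continuous_on S f"
  unfolding smooth_on_def using Ck_on_continuous by blast

lemma smooth_on_vec_nth:
  "open S \<Longrightarrow> smooth_on f S \<Longrightarrow> smooth_on (\<lambda>x. f x $ i) S"
  by (rule smooth_on_linear_compose[OF bounded_linear_vec_nth])

lemma smooth_on_of_real: "open S \<Longrightarrow> smooth_on f S \<Longrightarrow> smooth_on (\<lambda>x. complex_of_real (f x)) S"
  by (rule smooth_on_linear_compose[OF bounded_linear_of_real])

lemmas smooth_intros = smooth_on_const smooth_on_id smooth_on_add smooth_on_diff smooth_on_minus
  smooth_on_sum smooth_on_scaleR smooth_on_mult smooth_on_prod smooth_on_divide
  smooth_on_vec_lambda smooth_on_partial smooth_on_vec_nth smooth_on_of_real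

lemma smooth_on_det:
  fixes A :: "'a::real_normed_vector \<Rightarrow> 'n::finite \<Rightarrow> 'n \<Rightarrow> 'b::{real_normed_field}"
  assumes "open S" "\<And>i j. smooth_on (\<lambda>x. A x i j) S"
  shows "smooth_on (\<lambda>x. det (\<chi> i j. A x i j)) S"
  unfolding det_def using assms by (auto intro!: smooth_intros)


section \<open>Symmetry of second derivatives\<close>

lemma second_difference_bound:
  fixes f :: "'a::real_normed_vector \<Rightarrow> real"
  assumes S: "\<And>s t. 0 \<le> s \<Longrightarrow> s \<le> h \<Longrightarrow> 0 \<le> t \<Longrightarrow> t \<le> h \<Longrightarrow> x + s *\<^sub>R v + t *\<^sub>R w \<in> S"
    and f: "\<And>y. y \<in> S \<Longrightarrow> (f has_derivative f' y) (at y)"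
    and f': "\<And>y. y \<in> S \<Longrightarrow> ((\<lambda>y. f' y v) has_derivative f'' y) (at y)"
    and h: "h > 0"
  obtains s t where "0 \<le> s" "s \<le> h" "0 \<le> t" "t \<le> h"
    "f (x + h *\<^sub>R v + h *\<^sub>R w) - f (x + h *\<^sub>R v) - f (x + h *\<^sub>R w) + f x
      = h * h * f'' (x + s *\<^sub>R v + t *\<^sub>R w) w"
proof -
  define g where "g s = f (x + s *\<^sub>R v + h *\<^sub>R w) - f (x + s *\<^sub>R v + 0 *\<^sub>R w)" for s
  have g: "(g has_real_derivative (f' (x + s *\<^sub>R v + h *\<^sub>R w) v - f' (x + s *\<^sub>R v + 0 *\<^sub>R w) v)) (at s)"
    if s: "0 \<le> s" "s \<le> h" for s
  proof -
    have A: "((\<lambda>s. f (x + s *\<^sub>R v + c *\<^sub>R w)) has_derivative (\<lambda>r. f' (x + s *\<^sub>R v + c *\<^sub>R w) (r *\<^sub>R v))) (at s)"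
      if c: "0 \<le> c" "c \<le> h" for c
      by (rule has_derivative_compose[of "\<lambda>s. x + s *\<^sub>R v + c *\<^sub>R w" _ _ UNIV, simplified])
        (auto intro!: derivative_eq_intros f S s c)
    then have B: "((\<lambda>s. f (x + s *\<^sub>R v + c *\<^sub>R w)) has_real_derivative f' (x + s *\<^sub>R v + c *\<^sub>R w) v) (at s)"
      if c: "0 \<le> c" "c \<le> h" for c
    proof -
      have "(\<lambda>r. f' (x + s *\<^sub>R v + c *\<^sub>R w) (r *\<^sub>R v)) = (*) (f' (x + s *\<^sub>R v + c *\<^sub>R w) v)"
        using linear_cmul[OF has_derivative_linear[OF f[OF S[OF s c]]]] by (auto simp: fun_eq_iff)
      then show ?thesis unfolding has_field_derivative_def using A[OF c] by simp
    qed
    show ?thesis unfolding g_def by (rule DERIV_diff[OF B B]) (use h in auto)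
  qed
  obtain s where s: "0 < s" "s < h"
      "g h - g 0 = (h - 0) * (f' (x + s *\<^sub>R v + h *\<^sub>R w) v - f' (x + s *\<^sub>R v + 0 *\<^sub>R w) v)"
    using MVT2[OF h g] by auto
  define k where "k t = f' (x + s *\<^sub>R v + t *\<^sub>R w) v" for t
  have k: "(k has_real_derivative (f'' (x + s *\<^sub>R v + t *\<^sub>R w) w)) (at t)"
    if t: "0 \<le> t" "t \<le> h" for t
  proof -
    have "((\<lambda>t. f' (x + s *\<^sub>R v + t *\<^sub>R w) v) has_derivative (\<lambda>r. f'' (x + s *\<^sub>R v + t *\<^sub>R w) (r *\<^sub>R w))) (at t)"
      by (rule has_derivative_compose[of "\<lambda>t. x + s *\<^sub>R v + t *\<^sub>R w" _ _ UNIV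
            "\<lambda>y. f' y v", simplified])
        (use s t in \<open>auto intro!: derivative_eq_intros f' S\<close>)
    then show ?thesis
      unfolding has_field_derivative_def k_def
      using linear_cmul[OF has_derivative_linear[OF f'[OF S]], of s t] s t
      by (simp add: mult_commute_abs)
  qed
  obtain t where t: "0 < t" "t < h" "k h - k 0 = (h - 0) * f'' (x + s *\<^sub>R v + t *\<^sub>R w) w"
    using MVT2[OF h k] by auto
  show thesis
    by (rule that[of s t]) (use s t in \<open>auto simp: g_def k_def algebra_simps\<close>)
qed

text \<open>Two applications of the mean value theorem in \<open>second_difference_bound\<close>
  write the second difference over a small parallelogram as \<open>h * h\<close> times a mixed
  derivative at one of its points. The second difference does not change when \<open>v\<close> and
  \<open>w\<close> are exchanged, so the two mixed derivatives take equal values at two points close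
  to \<open>x\<close>; by continuity they cannot differ at \<open>x\<close>.\<close>

lemma symmetric_second_derivative_real:
  fixes f :: "'a::real_normed_vector \<Rightarrow> real"
  assumes "open S" "smooth_on f S" "x \<in> S"
  shows "frechet_derivative (\<lambda>y. frechet_derivative f (at y) v) (at x) w
       = frechet_derivative (\<lambda>y. frechet_derivative f (at y) w) (at x) v"
proof (rule ccontr)
  define D where "D v w y = frechet_derivative (\<lambda>y. frechet_derivative f (at y) v) (at y) w" for v w y
  assume "\<not> ?thesis"
  then have "0 < \<bar>D v w x - D w v x\<bar> / 2" (is "0 < ?e") by (simp add: D_def)
  have D: "continuous_on S (D v w)" for v w
    unfolding D_def by (intro smooth_on_continuous smooth_on_frechet assms)
  have "\<exists>d>0. ball x d \<subseteq> S \<and> (\<forall>y\<in>ball x d. \<bar>D v w y - D v w x\<bar> < ?e)" if "?e > 0" for v w and e'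
  proof -
    obtain d1 where d1: "d1 > 0" "ball x d1 \<subseteq> S" using assms by (auto simp: open_contains_ball)
    obtain d2 where d2: "d2 > 0" "\<forall>y\<in>S. dist y x < d2 \<longrightarrow> dist (D v w y) (D v w x) < ?e"
      using D[of v w] assms(3) \<open>0 < ?e\<close> unfolding continuous_on_iff by blast
    show ?thesis
      by (rule exI[of _ "min d1 d2"]) (use d1 d2 in \<open>auto simp: dist_real_def dist_commute subset_iff\<close>)
  qed
  note near = this[OF \<open>0 < ?e\<close>]
  obtain d1 where d1: "d1 > 0" "ball x d1 \<subseteq> S" "\<forall>y\<in>ball x d1. \<bar>D v w y - D v w x\<bar> < ?e"
    using near by blast
  obtain d2 where d2: "d2 > 0" "ball x d2 \<subseteq> S" "\<forall>y\<in>ball x d2. \<bar>D w v y - D w v x\<bar> < ?e"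
    using near by blast
  define d where "d = min d1 d2"
  \<comment> \<open>The parallelogram spanned by \<open>h *\<^sub>R v\<close> and
    \<open>h *\<^sub>R w\<close> fits into the ball of radius \<open>d\<close>; the added 1 covers
    \<open>v = w = 0\<close>.\<close>
  define h where "h = d / (2 * (norm v + norm w + 1))"
  have pos: "norm v + norm w + 1 > 0" using norm_ge_zero[of v] norm_ge_zero[of w] by linarith
  have d: "d > 0" using d1 d2 by (simp add: d_def)
  have h: "h > 0" using d pos by (simp add: h_def)
  have hd: "h * (norm v + norm w) < d"
  proof -
    have "h * (norm v + norm w) \<le> h * (norm v + norm w + 1)" using h by simp
    also have "\<dots> = d / 2" unfolding h_def using pos by (auto simp: field_simps)
    finally show ?thesis using d by simp
  qed
  have ball: "x + s *\<^sub>R v + t *\<^sub>R w \<in> ball x d" "x + t *\<^sub>R w + s *\<^sub>R v \<in> ball x d"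
    if "0 \<le> s" "s \<le> h" "0 \<le> t" "t \<le> h" for s t
  proof -
    have "norm (s *\<^sub>R v + t *\<^sub>R w) \<le> s * norm v + t * norm w"
      using norm_triangle_ineq[of "s *\<^sub>R v" "t *\<^sub>R w"] that by simp
    also have "\<dots> \<le> h * norm v + h * norm w" using that by (intro add_mono mult_right_mono) auto
    finally have "norm (s *\<^sub>R v + t *\<^sub>R w) < d" using hd by (simp add: algebra_simps)
    then show "x + s *\<^sub>R v + t *\<^sub>R w \<in> ball x d" "x + t *\<^sub>R w + s *\<^sub>R v \<in> ball x d"
      by (auto simp: dist_norm norm_minus_commute algebra_simps)
  qed
  have sub: "ball x d \<subseteq> S" "ball x d \<subseteq> ball x d1" "ball x d \<subseteq> ball x d2" using d1 by (auto simp: d_def)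
  have f: "(f has_derivative frechet_derivative f (at y)) (at y)"
      "((\<lambda>y. frechet_derivative f (at y) v) has_derivative (\<lambda>w. D v w y)) (at y)" if "y \<in> S" for y v
    unfolding D_def using that assms(2)
    by (auto intro!: smooth_on_has_derivative smooth_on_frechet)
  obtain s t where st: "0 \<le> s" "s \<le> h" "0 \<le> t" "t \<le> h"
    "f (x + h *\<^sub>R v + h *\<^sub>R w) - f (x + h *\<^sub>R v) - f (x + h *\<^sub>R w) + f x
      = h * h * D v w (x + s *\<^sub>R v + t *\<^sub>R w)"
    by (rule second_difference_bound[of h x v w S f "\<lambda>y. frechet_derivative f (at y)"
          "\<lambda>y w. D v w y"]) (use ball sub f h in auto)
  obtain s' t' where st': "0 \<le> s'" "s' \<le> h" "0 \<le> t'" "t' \<le> h"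
    "f (x + h *\<^sub>R w + h *\<^sub>R v) - f (x + h *\<^sub>R w) - f (x + h *\<^sub>R v) + f x
      = h * h * D w v (x + s' *\<^sub>R w + t' *\<^sub>R v)"
    by (rule second_difference_bound[of h x w v S f "\<lambda>y. frechet_derivative f (at y)"
          "\<lambda>y v. D w v y"]) (use ball sub f h in auto)
  have "h * h * D v w (x + s *\<^sub>R v + t *\<^sub>R w) = h * h * D w v (x + s' *\<^sub>R w + t' *\<^sub>R v)"
    using st(5) st'(5) by (simp add: algebra_simps)
  then have "D v w (x + s *\<^sub>R v + t *\<^sub>R w) = D w v (x + s' *\<^sub>R w + t' *\<^sub>R v)" using h by simp
  moreover have "\<bar>D v w (x + s *\<^sub>R v + t *\<^sub>R w) - D v w x\<bar> < ?e" using d1 ball st sub by blast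
  moreover have "\<bar>D w v (x + s' *\<^sub>R w + t' *\<^sub>R v) - D w v x\<bar> < ?e" using d2 ball st' sub by blast
  ultimately show False by argo
qed

lemma frechet_derivative_linear_compose:
  assumes "bounded_linear L" "f differentiable at x"
  shows "frechet_derivative (\<lambda>y. L (f y)) (at x) v = L (frechet_derivative f (at x) v)"
  using bounded_linear.has_derivative[OF assms(1), of f "frechet_derivative f (at x)" "at x"] assms(2)
  by (metis frechet_derivative_at frechet_derivative_works)

lemma frechet_derivative_cong:
  assumes "open S" "x \<in> S" "\<And>y. y \<in> S \<Longrightarrow> f y = g y"
  shows "frechet_derivative f (at x) = frechet_derivative g (at x)"
proof -
  have "(f has_derivative D) (at x) = (g has_derivative D) (at x)" for D
    using has_derivative_transform_within_open[of f D x UNIV S g]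
      has_derivative_transform_within_open[of g D x UNIV S f] assms by auto
  then show ?thesis unfolding frechet_derivative_def by simp
qed

lemma symmetric_second_derivative:
  fixes f :: "'a::real_normed_vector \<Rightarrow> 'b::euclidean_space"
  assumes "open S" "smooth_on f S" "x \<in> S"
  shows "frechet_derivative (\<lambda>y. frechet_derivative f (at y) v) (at x) w
       = frechet_derivative (\<lambda>y. frechet_derivative f (at y) w) (at x) v"
proof (rule euclidean_eqI)
  fix b :: 'b
  note bl = bounded_linear_inner_left[of b]
  have *: "frechet_derivative (\<lambda>y. frechet_derivative f (at y) v) (at x) w \<bullet> b
      = frechet_derivative (\<lambda>y. frechet_derivative (\<lambda>y. f y \<bullet> b) (at y) v) (at x) w" for v w
  proof -
    have "frechet_derivative (\<lambda>y. frechet_derivative (\<lambda>y. f y \<bullet> b) (at y) v) (at x)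
      = frechet_derivative (\<lambda>y. frechet_derivative f (at y) v \<bullet> b) (at x)"
      by (rule frechet_derivative_cong[OF assms(1,3)])
        (rule frechet_derivative_linear_compose[OF bl smooth_on_differentiable[OF assms(2)]])
    then show ?thesis
      using frechet_derivative_linear_compose[OF bl
          smooth_on_differentiable[OF smooth_on_frechet[OF assms(2)] assms(3)]] by simp
  qed
  show "frechet_derivative (\<lambda>y. frechet_derivative f (at y) v) (at x) w \<bullet> b
       = frechet_derivative (\<lambda>y. frechet_derivative f (at y) w) (at x) v \<bullet> b"
    unfolding * by (rule symmetric_second_derivative_real[OF assms(1)
          smooth_on_linear_compose[OF bl assms(1,2)] assms(3)])
qed

lemma partial_commute:
  fixes f :: "real^'n::finite \<Rightarrow> 'b::euclidean_space"
  assumes "open S" "smooth_on f S" "x \<in> S"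
  shows "partial i (partial j f) x = partial j (partial i f) x"
  unfolding partial_def[abs_def] by (rule symmetric_second_derivative[OF assms])

section \<open>Linear fixed point equations and smooth inverse functions\<close>

lemma neumann_inverse:
  fixes L :: "'x::banach \<Rightarrow>\<^sub>L 'x"
  assumes "norm L \<le> 1/2"
  obtains M :: "'x \<Rightarrow>\<^sub>L 'x" where "\<And>w z. z = w + blinfun_apply L z \<longleftrightarrow> z = blinfun_apply M w"
proof -
  \<comment> \<open>\<open>M\<close> will be the inverse of \<open>1 - L\<close>. The contraction
    principle gives it pointwise; its linearity follows from uniqueness of the fixed point, its
    bound 2 from absorbing half of the norm.\<close>
  have "\<exists>!z. w + blinfun_apply L z = z" for w
  proof (rule banach_fix_type[where c = "1/2"])
    show "\<forall>x y. dist (w + blinfun_apply L x) (w + blinfun_apply L y) \<le> 1/2 * dist x y"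
    proof (intro allI)
      fix x y
      have "norm (blinfun_apply L (x - y)) \<le> norm L * norm (x - y)" by (rule norm_blinfun)
      also have "\<dots> \<le> 1/2 * norm (x - y)" using assms by (intro mult_right_mono) auto
      finally show "dist (w + blinfun_apply L x) (w + blinfun_apply L y) \<le> 1/2 * dist x y"
        by (simp add: dist_norm blinfun.diff_right)
    qed
  qed auto
  then obtain m where m: "\<And>w z. w + blinfun_apply L z = z \<longleftrightarrow> z = m w" by metis
  have m': "m w = w + blinfun_apply L (m w)" for w using m[of w "m w"] by simp
  have "bounded_linear m"
  proof (rule bounded_linear_intro[where K = 2])
    show "m (v + w) = m v + m w" for v w
    proof -
      have "m v + m w = (v + blinfun_apply L (m v)) + (w + blinfun_apply L (m w))"
        using m' by metis
      also have "\<dots> = (v + w) + blinfun_apply L (m v + m w)" by (simp add: blinfun.add_right)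
      finally show ?thesis using m[of "v + w" "m v + m w"] by simp
    qed
    show "m (r *\<^sub>R v) = r *\<^sub>R m v" for r v
    proof -
      have "r *\<^sub>R m v = r *\<^sub>R v + blinfun_apply L (r *\<^sub>R m v)"
        by (subst m') (simp add: blinfun.scaleR_right scaleR_add_right)
      then show ?thesis using m[of "r *\<^sub>R v" "r *\<^sub>R m v"] by simp
    qed
    show "norm (m v) \<le> norm v * 2" for v
    proof -
      have "norm (m v) \<le> norm v + norm (blinfun_apply L (m v))"
        by (subst m') (rule norm_triangle_ineq)
      also have "norm (blinfun_apply L (m v)) \<le> 1/2 * norm (m v)"
        by (rule order_trans[OF norm_blinfun]) (use assms in \<open>intro mult_right_mono, auto\<close>)
      finally show ?thesis by simp
    qed
  qed
  then show thesis using m by (intro that[of "Blinfun m"]) (simp add: bounded_linear_Blinfun_apply, metis)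
qed

lemma has_derivative_locally_Lipschitz_at:
  assumes "(f has_derivative f') (at x)"
  obtains C d where "C > 0" "d > 0" "\<And>y. norm (y - x) < d \<Longrightarrow> norm (f y - f x) \<le> C * norm (y - x)"
proof -
  obtain d where d: "d > 0" "\<And>y. norm (y - x) < d \<Longrightarrow>
      norm (f y - f x - f' (y - x)) \<le> 1 * norm (y - x)"
    using assms unfolding has_derivative_within_alt by (metis UNIV_I zero_less_one)
  interpret bounded_linear f' using assms by (rule has_derivative_bounded_linear)
  obtain K where K: "K > 0" "\<And>v. norm (f' v) \<le> norm v * K" using pos_bounded by blast
  show thesis
  proof (rule that[of "1 + K" d])
    fix y assume y: "norm (y - x) < d"
    have "norm (f y - f x) \<le> norm (f y - f x - f' (y - x)) + norm (f' (y - x))"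
      using norm_triangle_ineq[of "f y - f x - f' (y - x)" "f' (y - x)"] by simp
    then show "norm (f y - f x) \<le> (1 + K) * norm (y - x)"
      using d(2)[OF y] K(2)[of "y - x"] by (simp add: algebra_simps)
  qed (use K d in auto)
qed

text \<open>Where \<open>f\<close> vanishes, continuity of \<open>g\<close> suffices: the error is a
  product of a factor of order \<open>norm (x - p)\<close> and a factor tending to 0. This
  differentiates products whose second factor is the unknown and is so far only known to be
  continuous.\<close>

lemma (in bounded_bilinear) has_derivative_zero_left:
  assumes f: "(f has_derivative f') (at p)" and f0: "f p = 0" and g: "isCont g p"
  shows "((\<lambda>x. prod (f x) (g x)) has_derivative (\<lambda>v. prod (f' v) (g p))) (at p)"
proof -
  obtain C d where C: "C > 0" "d > 0" "\<And>y. norm (y - p) < d \<Longrightarrow> norm (f y - f p) \<le> C * norm (y - p)"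
    using has_derivative_locally_Lipschitz_at[OF f] by blast
  obtain K where K: "K > 0" "\<And>a b. norm (prod a b) \<le> norm a * norm b * K" using pos_bounded by blast
  have "((\<lambda>x. prod (f x) (g x - g p)) has_derivative (\<lambda>v. 0)) (at p)"
    unfolding has_derivative_within_alt
  proof (intro conjI allI impI)
    fix e :: real assume "e > 0"
    then have "e / (C * K) > 0" using C K by simp
    then obtain d' where d': "d' > 0" "\<And>y. dist y p < d' \<Longrightarrow> dist (g y) (g p) < e / (C * K)"
      using g unfolding continuous_at_eps_delta by blast
    show "\<exists>d>0. \<forall>y\<in>UNIV. norm (y - p) < d \<longrightarrow>
        norm (prod (f y) (g y - g p) - prod (f p) (g p - g p) - 0) \<le> e * norm (y - p)"
    proof (intro exI[of _ "min d d'"] conjI ballI impI)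
      fix y assume y: "norm (y - p) < min d d'"
      have "norm (prod (f y) (g y - g p)) \<le> norm (f y) * norm (g y - g p) * K" by (rule K)
      also have "\<dots> \<le> (C * norm (y - p)) * (e / (C * K)) * K"
        using C(3)[of y] d'(2)[of y] y f0 K C \<open>e > 0\<close> by (intro mult_mono) (auto simp: dist_norm)
      also have "\<dots> = e * norm (y - p)" using C K by simp
      finally show "norm (prod (f y) (g y - g p) - prod (f p) (g p - g p) - 0) \<le> e * norm (y - p)"
        by (simp add: zero_right)
    qed (use C d' in auto)
  qed simp
  moreover have "((\<lambda>x. prod (f x) (g p)) has_derivative (\<lambda>v. prod (f' v) (g p))) (at p)"
    by (rule bounded_linear.has_derivative[OF bounded_linear_left f])
  ultimately have "((\<lambda>x. prod (f x) (g p) + prod (f x) (g x - g p)) has_derivative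
      (\<lambda>v. prod (f' v) (g p) + 0)) (at p)" by (intro has_derivative_add)
  then show ?thesis by (simp add: diff_right)
qed

text \<open>Formal differentiation gives an equation for the derivative with the same
  \<open>L\<close> and a right-hand side that contains only \<open>z\<close> itself. Regularity
  therefore climbs by one order at each step, and the inverse of \<open>1 - L\<close> never has to
  be differentiated.\<close>

lemma linear_fixed_point_Ck:
  fixes L :: "'p::real_normed_vector \<Rightarrow> 'x::banach \<Rightarrow>\<^sub>L 'x"
  assumes P: "open P" and L: "\<And>p. p \<in> P \<Longrightarrow> norm (L p) \<le> 1/2"
    and z: "\<And>p. p \<in> P \<Longrightarrow> z p = b p + blinfun_apply (L p) (z p)"
    and Ck: "Ck_on k L P" "Ck_on k b P"
  shows "Ck_on k z P"
  using z Ck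
proof (induction k arbitrary: z b)
  case (0 z b)
  have "isCont z p" if p: "p \<in> P" for p
  proof -
    define e where "e q = b q - b p + blinfun_apply (L q - L p) (z p)" for q
    have "isCont L p" "isCont b p" using 0(2,3) p P by (simp_all add: continuous_on_eq_continuous_at)
    then have "isCont e p" unfolding e_def by (intro continuous_intros)
    then have e: "(e \<longlongrightarrow> 0) (at p)" by (simp add: isCont_def e_def)
    have "norm (z q - z p) \<le> 2 * norm (e q)" if q: "q \<in> P" for q
    proof -
      have eq: "z q - z p = e q + blinfun_apply (L q) (z q - z p)"
      proof -
        have "z q - z p = (b q + blinfun_apply (L q) (z q)) - (b p + blinfun_apply (L p) (z p))"
          using 0(1)[OF q] 0(1)[OF p] by metis
        also have "\<dots> = e q + blinfun_apply (L q) (z q - z p)"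
          by (simp add: e_def blinfun.diff_left blinfun.diff_right)
        finally show ?thesis .
      qed
      have "norm (z q - z p) \<le> norm (e q) + norm (blinfun_apply (L q) (z q - z p))"
        by (subst eq) (rule norm_triangle_ineq)
      also have "norm (blinfun_apply (L q) (z q - z p)) \<le> 1/2 * norm (z q - z p)"
        by (rule order_trans[OF norm_blinfun]) (use L[OF q] in \<open>intro mult_right_mono, auto\<close>)
      finally show ?thesis by simp
    qed
    then have "\<forall>\<^sub>F q in at p. norm (z q - z p) \<le> norm (e q) * 2"
      by (intro eventually_mono[OF eventually_at_in_open'[OF P p]]) (simp add: mult.commute)
    then have "((\<lambda>q. z q - z p) \<longlongrightarrow> 0) (at p)"
      by (rule tendsto_0_le[OF e])
    then show ?thesis by (simp add: isCont_def LIM_zero_iff)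
  qed
  then show ?case using P by (simp add: continuous_on_eq_continuous_at)
next
  case (Suc k)
  note 1 = Suc.prems(2,3)[THEN Ck_on_SucD]
  have zk: "Ck_on k z P" by (rule Suc.IH[OF Suc.prems(1) 1])
  \<comment> \<open>Inhomogeneity of the differentiated equation. It contains \<open>z\<close> but
    not its derivative, hence is of class \<open>k\<close>.\<close>
  define w where "w v p = frechet_derivative b (at p) v
      + blinfun_apply (frechet_derivative L (at p) v) (z p)" for v p
  have wk: "Ck_on k (w v) P" for v
    unfolding w_def
    by (intro Ck_on_add[OF P] Ck_on_frechet Suc.prems
        bounded_bilinear.Ck_on_bilinear[OF bounded_bilinear_blinfun_apply] P zk)
  have "\<exists>z'. (z has_derivative z') (at p) \<and> (\<forall>v. z' v = w v p + blinfun_apply (L p) (z' v))"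
    if p: "p \<in> P" for p
  proof -
    obtain M :: "'x \<Rightarrow>\<^sub>L 'x" where M: "\<And>w z. z = w + blinfun_apply (L p) z \<longleftrightarrow> z = blinfun_apply M w"
      using neumann_inverse[OF L[OF p]] by blast
    \<comment> \<open>The equations at \<open>q\<close> and \<open>p\<close> are subtracted and
      solved for \<open>z q - z p\<close> with the inverse belonging to \<open>p\<close>. The
      unknown \<open>z q\<close> survives only behind \<open>L q - L p\<close>, which vanishes at
      \<open>p\<close>.\<close>
    have eq: "z q = z p + blinfun_apply M (b q - b p + blinfun_apply (L q - L p) (z q))"
      if q: "q \<in> P" for q
    proof -
      have "z q - z p = (b q - b p + blinfun_apply (L q - L p) (z q)) + blinfun_apply (L p) (z q - z p)"
      proof -
        have "z q - z p = (b q + blinfun_apply (L q) (z q)) - (b p + blinfun_apply (L p) (z p))"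
          using Suc.prems(1)[OF q] Suc.prems(1)[OF p] by metis
        also have "\<dots> = (b q - b p + blinfun_apply (L q - L p) (z q)) + blinfun_apply (L p) (z q - z p)"
          by (simp add: blinfun.diff_left blinfun.diff_right)
        finally show ?thesis .
      qed
      then show ?thesis using M by (metis add_diff_cancel_left' add.commute diff_add_cancel)
    qed
    have cz: "isCont z p" using Ck_on_continuous[OF zk] P p by (simp add: continuous_on_eq_continuous_at)
    have dL: "((\<lambda>q. L q - L p) has_derivative frechet_derivative L (at p)) (at p)"
      using has_derivative_diff[OF Ck_on_has_derivative[OF Suc.prems(2) p] has_derivative_const] by simp
    have db: "((\<lambda>q. b q - b p) has_derivative frechet_derivative b (at p)) (at p)"
      using has_derivative_diff[OF Ck_on_has_derivative[OF Suc.prems(3) p] has_derivative_const] by simp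
    have "((\<lambda>q. b q - b p + blinfun_apply (L q - L p) (z q)) has_derivative (\<lambda>v. w v p)) (at p)"
      unfolding w_def
      by (intro has_derivative_add db bounded_bilinear.has_derivative_zero_left[OF bounded_bilinear_blinfun_apply]
          dL cz) auto
    then have "((\<lambda>q. z p + blinfun_apply M (b q - b p + blinfun_apply (L q - L p) (z q))) has_derivative
       (\<lambda>v. 0 + blinfun_apply M (w v p))) (at p)"
      by (intro has_derivative_add has_derivative_const bounded_linear.has_derivative[OF blinfun.bounded_linear_right])
    then have "(z has_derivative (\<lambda>v. blinfun_apply M (w v p))) (at p)"
      unfolding add_0_left by (rule has_derivative_transform_within_open[OF _ P p eq[symmetric]])
    then show ?thesis using M by blast
  qed
  then obtain z' where z': "\<And>p. p \<in> P \<Longrightarrow> (z has_derivative z' p) (at p)"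
    "\<And>p v. p \<in> P \<Longrightarrow> z' p v = w v p + blinfun_apply (L p) (z' p v)" by metis
  show ?case
    by (rule Ck_on_SucI[OF P z'(1)]) (assumption, rule Suc.IH[OF z'(2) 1(1) wk])
qed

text \<open>The total derivative as an element of the space of operators; written as a basis sum it
  is visibly a smooth function of \<open>x\<close>.\<close>

definition blinfun_derivative :: "('a::euclidean_space \<Rightarrow> 'b::real_normed_vector) \<Rightarrow> 'a \<Rightarrow> 'a \<Rightarrow>\<^sub>L 'b" where
  "blinfun_derivative H x =
    (\<Sum>b\<in>Basis. blinfun_compose (blinfun_scaleR_left (frechet_derivative H (at x) b)) (blinfun_inner_left b))"

lemma blinfun_derivative_apply:
  assumes "H differentiable at x"
  shows "blinfun_apply (blinfun_derivative H x) = frechet_derivative H (at x)"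
  by (rule ext, subst frechet_derivative_basis_sum[OF assms])
    (simp add: blinfun_derivative_def blinfun.sum_left blinfun_inner_left.rep_eq)

lemma smooth_on_blinfun_derivative:
  assumes "open S" "smooth_on H S"
  shows "smooth_on (blinfun_derivative H) S"
  unfolding blinfun_derivative_def[abs_def]
  by (intro smooth_on_sum assms smooth_on_linear_compose[OF
        bounded_linear_compose[OF bounded_bilinear.bounded_linear_left[OF bounded_bilinear_blinfun_compose]
          bounded_linear_blinfun_scaleR_left]] smooth_on_frechet)

text \<open>The inverse function theorem gives a differentiable \<open>K\<close>. Its derivative
  solves a linear fixed point equation whose operator depends on \<open>K\<close> alone, so if
  \<open>K\<close> is of class \<open>k\<close> then so is its derivative, and \<open>K\<close> is
  of class \<open>k + 1\<close>.\<close>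

lemma smooth_inverse_function:
  fixes H :: "'a::euclidean_space \<Rightarrow> 'a"
  assumes W: "open W" and H: "smooth_on H W" and x0: "x0 \<in> W"
    and inj: "\<And>v. frechet_derivative H (at x0) v = 0 \<Longrightarrow> v = 0"
  obtains U V K where "open U" "U \<subseteq> W" "x0 \<in> U" "open V" "homeomorphism U V H K" "smooth_on K V"
proof -
  let ?D = "blinfun_derivative H"
  have dH: "(H has_derivative blinfun_apply (?D x)) (at x)" if "x \<in> W" for x
    using smooth_on_has_derivative[OF H that] blinfun_derivative_apply smooth_on_differentiable[OF H that]
    by metis
  have "linear (blinfun_apply (?D x0))" by (simp add: blinfun.bounded_linear_right bounded_linear.linear)
  moreover have "inj (blinfun_apply (?D x0))"
    using calculation inj blinfun_derivative_apply[OF smooth_on_differentiable[OF H x0]]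
    by (simp add: linear_injective_0)
  ultimately obtain iv where iv: "linear iv" "iv \<circ> blinfun_apply (?D x0) = id"
    using linear_injective_left_inverse by blast
  define I where "I = Blinfun iv"
  have I: "blinfun_apply I = iv" unfolding I_def
    by (rule bounded_linear_Blinfun_apply) (use iv linear_conv_bounded_linear in blast)
  have I0: "I o\<^sub>L ?D x0 = id_blinfun" using iv(2) by (intro blinfun_eqI) (simp add: I pointfree_idE)
  obtain U V K K' where U: "open U" "U \<subseteq> W" "x0 \<in> U" "open V" "H x0 \<in> V" "homeomorphism U V H K"
    and K: "\<And>y. y \<in> V \<Longrightarrow> (K has_derivative (K' y)) (at y)"
    "\<And>y. y \<in> V \<Longrightarrow> K' y = inv (blinfun_apply (?D (K y)))"
    "\<And>y. y \<in> V \<Longrightarrow> bij (blinfun_apply (?D (K y)))"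
    by (rule inverse_function_theorem[OF W dH smooth_on_continuous[OF smooth_on_blinfun_derivative[OF W H]]
          x0 I0]) blast+
  \<comment> \<open>The derivative is preconditioned by the inverse \<open>I\<close> of its value at
    \<open>x0\<close>; thus \<open>L\<close> vanishes at \<open>H x0\<close> and has norm at most
    1/2 nearby.\<close>
  define L where "L y = id_blinfun - (I o\<^sub>L ?D (K y))" for y
  have KU: "K y \<in> U" "H (K y) = y" if "y \<in> V" for y
    using U(6) that by (auto simp: homeomorphism_def)
  have K0: "K (H x0) = x0" using U by (auto simp: homeomorphism_def)
  have LCk: "Ck_on k L S" if "Ck_on k K S" "S \<subseteq> V" "open S" for k S
    unfolding L_def
  proof (rule Ck_on_diff[OF that(3) Ck_on_const[OF that(3)]])
    show "Ck_on k (\<lambda>y. I o\<^sub>L ?D (K y)) S"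
      by (rule Ck_on_linear_compose[OF bounded_bilinear.bounded_linear_right[OF bounded_bilinear_blinfun_compose] that(3)])
        (rule Ck_on_compose[OF that(3) W _ smooth_onD[OF smooth_on_blinfun_derivative[OF W H]] that(1)],
          use KU U that in blast)
  qed
  have "continuous_on V K" using U(6) by (auto simp: homeomorphism_def)
  then have "Ck_on 0 L V" by (intro LCk) (use U in auto)
  then have "continuous_on V (\<lambda>y. norm (L y))" by (auto intro: continuous_intros)
  then have op: "open (V \<inter> (\<lambda>y. norm (L y)) -` {..<1/2})"
    by (rule continuous_open_preimage[OF _ U(4) open_lessThan])
  define V' where "V' = V \<inter> (\<lambda>y. norm (L y)) -` {..<1/2}"
  have V': "open V'" "V' \<subseteq> V" using op by (auto simp: V'_def)
  have HV: "H x0 \<in> V'" using U(5) by (simp add: V'_def L_def K0 I0)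
  have "Ck_on k K V'" for k
  proof (induction k)
    case 0
    then show ?case using \<open>continuous_on V K\<close> V' continuous_on_subset by auto
  next
    case (Suc k)
    show ?case
    proof (rule Ck_on_SucI[OF V'(1)])
      fix x assume "x \<in> V'" then show "(K has_derivative K' x) (at x)" using K V' by blast
    next
      fix v
      show "Ck_on k (\<lambda>x. K' x v) V'"
      proof (rule linear_fixed_point_Ck[OF V'(1), of L _ "\<lambda>_. blinfun_apply I v"])
        fix y assume y: "y \<in> V'"
        then show "norm (L y) \<le> 1/2" by (simp add: V'_def)
        have "blinfun_apply (?D (K y)) (K' y v) = v"
          using K(2,3)[of y] y V' by (metis bij_is_surj subsetD surj_f_inv_f)
        then show "K' y v = blinfun_apply I v + blinfun_apply (L y) (K' y v)"
          by (simp add: L_def blinfun.diff_left)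
      qed (use V' Suc LCk Ck_on_const in auto)
    qed
  qed
  then have "smooth_on K V'" by (simp add: smooth_on_def)
  moreover have "homeomorphism (K ` V') V' H K"
  proof (rule homeomorphism_of_subsets[OF U(6)])
    show "H ` K ` V' = V'" using KU(2) V' by (force simp: image_image)
  qed (use KU V' in auto)
  moreover have "open (K ` V')"
  proof -
    have "K ` V' = U \<inter> H -` V'" using U(6) V' unfolding homeomorphism_def by force
    moreover have "continuous_on U H" using U(6) by (simp add: homeomorphism_def)
    ultimately show ?thesis using continuous_open_preimage[OF _ U(1) V'(1)] by simp
  qed
  moreover have "K ` V' \<subseteq> W" using KU V' U by blast
  moreover have "x0 \<in> K ` V'" using HV K0 by force
  ultimately show thesis using that V' by blast
qed

section \<open>Cutoff functions and uniform Taylor bounds\<close>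

lemma Ck_on_Un:
  assumes "open S" "open T" "Ck_on k f S" "Ck_on k f T"
  shows "Ck_on k f (S \<union> T)"
  using assms(3,4)
  by (induction k arbitrary: f) (auto intro: continuous_on_open_Un assms(1,2))

lemma smooth_on_Un:
  "open S \<Longrightarrow> open T \<Longrightarrow> smooth_on f S \<Longrightarrow> smooth_on f T \<Longrightarrow> smooth_on f (S \<union> T)"
  unfolding smooth_on_def using Ck_on_Un by blast

text \<open>The powers of \<open>inverse t\<close> are included so that the family is closed under
  differentiation, which turns smoothness into an induction over all \<open>n\<close> at
  once.\<close>

definition flat_exp :: "nat \<Rightarrow> real \<Rightarrow> real" where
  "flat_exp n t = (if t \<le> 0 then 0 else inverse t ^ n * exp (- inverse t))"

lemma flat_exp_derivative:
  "(flat_exp n has_real_derivative (flat_exp (n + 2) t - n * flat_exp (n + 1) t)) (at t)"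
proof -
  consider "t < 0" | "t > 0" | "t = 0" by linarith
  then show ?thesis
  proof cases
    case 1
    have "((\<lambda>_. 0) has_real_derivative 0) (at t)" by simp
    then have "(flat_exp n has_real_derivative 0) (at t)"
      by (rule has_field_derivative_transform_within_open[of _ _ _ "{..<0}"])
        (use 1 in \<open>auto simp: flat_exp_def\<close>)
    then show ?thesis using 1 by (simp add: flat_exp_def)
  next
    case 2
    have "((\<lambda>t. inverse t ^ n * exp (- inverse t)) has_real_derivative
        (inverse t ^ (n + 2) * exp (- inverse t) - n * (inverse t ^ (n + 1) * exp (- inverse t)))) (at t)"
    proof -
      have i: "(inverse has_real_derivative - (inverse t ^ Suc (Suc 0))) (at t)"
        using 2 by (intro DERIV_inverse) simp
      have "((\<lambda>t. inverse t ^ n) has_real_derivative - (n * inverse t ^ (n + 1))) (at t)"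
        using DERIV_power[OF i, of n] by (cases n) (simp_all add: mult_ac)
      moreover have "((\<lambda>t. exp (- inverse t)) has_real_derivative exp (- inverse t) * - (- (inverse t ^ Suc (Suc 0)))) (at t)"
        by (rule DERIV_fun_exp[OF DERIV_minus[OF i]])
      ultimately show ?thesis by (rule DERIV_cong[OF DERIV_mult]) (simp add: algebra_simps)
    qed
    then have "(flat_exp n has_real_derivative
        (inverse t ^ (n + 2) * exp (- inverse t) - n * (inverse t ^ (n + 1) * exp (- inverse t)))) (at t)"
      by (rule has_field_derivative_transform_within_open[of _ _ _ "{0<..}"])
        (use 2 in \<open>auto simp: flat_exp_def\<close>)
    then show ?thesis using 2 by (simp add: flat_exp_def)
  next
    case 3
    \<comment> \<open>Substituting \<open>x = inverse t\<close> in this limit controls the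
      difference quotient at 0 from the right; from the left it is 0.\<close>
    have lim: "((\<lambda>x::real. x ^ (n + 1) / exp x) \<longlongrightarrow> 0) at_top" by (rule tendsto_power_div_exp_0)
    have "((\<lambda>t. inverse t ^ (n + 1) / exp (inverse t)) \<longlongrightarrow> (0::real)) (at_right 0)"
      by (rule filterlim_compose[OF lim filterlim_inverse_at_top_right])
    moreover have "\<forall>\<^sub>F t in at_right 0. inverse t ^ (n + 1) / exp (inverse t) = flat_exp n t / t"
      using eventually_at_right_less[of "0::real"]
      by eventually_elim (auto simp: flat_exp_def exp_minus field_simps)
    ultimately have "((\<lambda>t. flat_exp n t / t) \<longlongrightarrow> 0) (at_right 0)" by (rule Lim_transform_eventually)
    moreover have "((\<lambda>t. flat_exp n t / t) \<longlongrightarrow> 0) (at_left 0)"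
    proof (rule Lim_transform_eventually[OF tendsto_const])
      show "\<forall>\<^sub>F t in at_left 0. 0 = flat_exp n t / t"
        using eventually_at_left_real[of "-1" 0] by (auto elim!: eventually_mono simp: flat_exp_def)
    qed
    ultimately have "((\<lambda>t. flat_exp n t / t) \<longlongrightarrow> 0) (at 0)" by (simp add: filterlim_split_at)
    then show ?thesis using 3 by (simp add: has_field_derivative_iff flat_exp_def)
  qed
qed

lemma smooth_on_flat_exp: "smooth_on (flat_exp n) UNIV"
proof -
  have "Ck_on k (flat_exp n) UNIV" for k
  proof (induction k arbitrary: n)
    case 0
    show ?case
      by (auto intro!: continuous_at_imp_continuous_on DERIV_isCont[OF flat_exp_derivative])
  next
    case (Suc k)
    show ?case
      by (rule Ck_on_SucI[OF open_UNIV flat_exp_derivative[unfolded has_field_derivative_def]])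
        (intro Ck_on_mult Ck_on_diff Ck_on_const Suc open_UNIV)
  qed
  then show ?thesis by (simp add: smooth_on_def)
qed

text \<open>The two summands of the denominator vanish for \<open>norm x \<ge> 2\<close> and for
  \<open>norm x \<le> 1\<close> respectively, so never together.\<close>

definition bump :: "'a::euclidean_space \<Rightarrow> real" where
  "bump x = flat_exp 0 (4 - x \<bullet> x) / (flat_exp 0 (4 - x \<bullet> x) + flat_exp 0 (x \<bullet> x - 1))"

lemma flat_exp_nonneg: "flat_exp n t \<ge> 0"
  and flat_exp_pos: "t > 0 \<Longrightarrow> flat_exp n t > 0"
  by (auto simp: flat_exp_def)

lemma bump_eq_1: "norm x \<le> 1 \<Longrightarrow> bump x = 1"
proof -
  assume "norm x \<le> 1"
  then have "x \<bullet> x \<le> 1" by (simp add: norm_le_square)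
  then show ?thesis using flat_exp_pos[of "4 - x \<bullet> x" 0]
    unfolding bump_def by (simp add: flat_exp_def)
qed

lemma bump_eq_0: "norm x \<ge> 2 \<Longrightarrow> bump x = 0"
proof -
  assume "norm x \<ge> 2"
  then have "x \<bullet> x \<ge> 4" by (simp add: norm_ge_square)
  then show ?thesis unfolding bump_def by (simp add: flat_exp_def)
qed

lemma smooth_on_bump: "smooth_on (bump :: 'a::euclidean_space \<Rightarrow> real) UNIV"
proof -
  have i: "smooth_on (\<lambda>x::'a. x \<bullet> x) UNIV"
    unfolding smooth_on_def by (intro allI Ck_on_inner Ck_on_id open_UNIV)
  have f: "smooth_on (\<lambda>x::'a. flat_exp 0 (4 - x \<bullet> x)) UNIV" "smooth_on (\<lambda>x::'a. flat_exp 0 (x \<bullet> x - 1)) UNIV"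
    by (rule smooth_on_compose[OF open_UNIV open_UNIV _ smooth_on_flat_exp]; intro UNIV_I smooth_intros i open_UNIV)+
  have pos: "flat_exp 0 (4 - x \<bullet> x) + flat_exp 0 (x \<bullet> x - 1) \<noteq> 0" for x :: 'a
  proof (cases "x \<bullet> x < 4")
    case True
    then show ?thesis using flat_exp_pos[of "4 - x \<bullet> x" 0] flat_exp_nonneg[of 0 "x \<bullet> x - 1"] by linarith
  next
    case False
    then show ?thesis using flat_exp_pos[of "x \<bullet> x - 1" 0] flat_exp_nonneg[of 0 "4 - x \<bullet> x"] by linarith
  qed
  show ?thesis unfolding bump_def[abs_def] by (intro smooth_intros f open_UNIV pos)
qed

definition compact_smooth :: "('a::euclidean_space \<Rightarrow> 'b::real_normed_vector) \<Rightarrow> bool" where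
  "compact_smooth G \<longleftrightarrow> smooth_on G UNIV \<and> (\<exists>R. \<forall>x. norm x > R \<longrightarrow> G x = 0)"

text \<open>Both the fixed point argument for flows and the passage to the torus need functions
  defined and bounded everywhere. The scaling \<open>4 / r\<close> sends the radii
  \<open>r / 4\<close> and \<open>r / 2\<close> to the radii 1 and 2 of \<open>bump\<close>.\<close>

lemma cutoff_extension:
  fixes f :: "'a::euclidean_space \<Rightarrow> 'b::real_normed_vector"
  assumes f: "smooth_on f (ball 0 r)" and r: "r > 0"
  obtains G where "compact_smooth G" "\<And>x. norm x \<le> r / 4 \<Longrightarrow> G x = f x" "\<And>x. norm x \<ge> r / 2 \<Longrightarrow> G x = 0"
proof -
  define G where "G x = bump ((4 / r) *\<^sub>R x) *\<^sub>R f x" for x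
  have 0: "G x = 0" if "norm x \<ge> r / 2" for x
  proof -
    have "norm ((4 / r) *\<^sub>R x) \<ge> 2" using that r by (simp add: field_simps)
    then show ?thesis by (simp add: G_def bump_eq_0)
  qed
  have 1: "G x = f x" if "norm x \<le> r / 4" for x
  proof -
    have "norm ((4 / r) *\<^sub>R x) \<le> 1" using that r by (simp add: field_simps)
    then show ?thesis by (simp add: G_def bump_eq_1)
  qed
  have "smooth_on (\<lambda>x::'a. bump ((4 / r) *\<^sub>R x)) (ball 0 r)"
    by (rule smooth_on_compose[OF open_ball open_UNIV _ smooth_on_bump]) (intro UNIV_I smooth_intros open_ball)+
  then have s1: "smooth_on G (ball 0 r)" unfolding G_def[abs_def] by (intro smooth_intros f open_ball)
  have o: "open (- cball 0 (r / 2) :: 'a set)" by (simp add: open_Compl)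
  have s2: "smooth_on G (- cball 0 (r / 2))"
    by (rule smooth_on_cong[OF o _ smooth_on_const[OF o, of 0]]) (simp add: 0)
  have "ball 0 r \<union> - cball 0 (r / 2) = (UNIV :: 'a set)" using r by auto
  then have "smooth_on G UNIV" using smooth_on_Un[OF open_ball o s1 s2] by simp
  then have "compact_smooth G" unfolding compact_smooth_def using 0 by (metis less_imp_le)
  then show thesis using 0 1 that by blast
qed

lemma compact_smooth_frechet:
  assumes "compact_smooth G"
  shows "compact_smooth (\<lambda>x. frechet_derivative G (at x) v)"
proof -
  obtain R where R: "\<And>x. norm x > R \<Longrightarrow> G x = 0" and G: "smooth_on G UNIV"
    using assms by (auto simp: compact_smooth_def)
  have "frechet_derivative G (at x) v = 0" if "norm x > R" for x
  proof -
    have "open (- cball 0 R :: 'a set)" by (simp add: open_Compl)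
    then have "frechet_derivative G (at x) = frechet_derivative (\<lambda>_. 0) (at x)"
      by (rule frechet_derivative_cong) (use that R in auto)
    then show ?thesis by simp
  qed
  then show ?thesis using G unfolding compact_smooth_def by (auto intro: smooth_on_frechet)
qed

lemma compact_smooth_bounded:
  assumes "compact_smooth G"
  obtains B where "B \<ge> 0" "\<And>x. norm (G x) \<le> B"
proof -
  obtain R where R: "\<And>x. norm x > R \<Longrightarrow> G x = 0" and G: "smooth_on G UNIV"
    using assms by (auto simp: compact_smooth_def)
  have "continuous_on (cball 0 R) G" using smooth_on_continuous[OF G] continuous_on_subset by blast
  then have "bounded (G ` cball 0 R)" using compact_imp_bounded compact_continuous_image compact_cball by blast
  then obtain B where B: "B > 0" "\<And>x. x \<in> cball 0 R \<Longrightarrow> norm (G x) \<le> B" by (auto simp: bounded_pos)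
  have "norm (G x) \<le> B" for x using B R[of x] by (cases "norm x \<le> R") auto
  then show thesis using that[of B] B by auto
qed

lemma compact_smooth_derivative_bound:
  assumes G: "compact_smooth G"
  obtains B where "B \<ge> 0" "\<And>x v. norm (frechet_derivative G (at x) v) \<le> B * norm v"
proof -
  have "\<exists>B. \<forall>x. norm (frechet_derivative G (at x) b) \<le> B \<and> B \<ge> 0" for b
    using compact_smooth_bounded[OF compact_smooth_frechet[OF G]] by metis
  then obtain B where B: "\<And>x b. norm (frechet_derivative G (at x) b) \<le> B b" "\<And>b. B b \<ge> 0" by metis
  show thesis
  proof (rule that[of "\<Sum>b\<in>Basis. B b"])
    fix x v
    have "norm (frechet_derivative G (at x) v) \<le> (\<Sum>b\<in>Basis. \<bar>v \<bullet> b\<bar> * norm (frechet_derivative G (at x) b))"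
      using G by (subst frechet_derivative_basis_sum)
        (auto simp: compact_smooth_def intro: smooth_on_differentiable order_trans[OF norm_sum])
    also have "\<dots> \<le> (\<Sum>b\<in>Basis. norm v * B b)"
      by (intro sum_mono mult_mono B norm_ge_zero) (auto simp: Basis_le_norm)
    finally show "norm (frechet_derivative G (at x) v) \<le> (\<Sum>b\<in>Basis. B b) * norm v"
      by (simp add: sum_distrib_left mult.commute)
  qed (use B in \<open>auto intro: sum_nonneg\<close>)
qed

lemma compact_smooth_has_derivative:
  "compact_smooth G \<Longrightarrow> (G has_derivative frechet_derivative G (at x)) (at x)"
  unfolding compact_smooth_def using smooth_on_has_derivative by blast

lemma compact_smooth_Lipschitz:
  assumes G: "compact_smooth G" and B: "\<And>x v. norm (frechet_derivative G (at x) v) \<le> B * norm v"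
  shows "norm (G x - G y) \<le> B * norm (x - y)"
  by (rule differentiable_bound[of UNIV G "\<lambda>x. frechet_derivative G (at x)"])
    (auto intro!: compact_smooth_has_derivative G onorm_le B)

text \<open>Taylor's formula with a remainder uniform in \<open>x\<close>. Uniformity is what
  carries the estimate over to the supremum norm of curves in
  \<open>bc_comp_quadratic\<close>.\<close>

lemma compact_smooth_quadratic:
  assumes G: "compact_smooth G"
  obtains C where "C \<ge> 0"
    "\<And>x h. norm (G (x + h) - G x - frechet_derivative G (at x) h) \<le> C * (norm h)\<^sup>2"
proof -
  have "\<exists>B. \<forall>x v. norm (frechet_derivative (\<lambda>x. frechet_derivative G (at x) b) (at x) v) \<le> B * norm v \<and> B \<ge> 0" for b
    using compact_smooth_derivative_bound[OF compact_smooth_frechet[OF G]] by metis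
  then obtain B where B: "\<And>x b v. norm (frechet_derivative (\<lambda>x. frechet_derivative G (at x) b) (at x) v) \<le> B b * norm v"
    "\<And>b. B b \<ge> 0" by metis
  have diff: "norm (frechet_derivative G (at x) v - frechet_derivative G (at y) v) \<le> sum B Basis * norm (x - y) * norm v" for x y v
  proof -
    have d: "G differentiable at x" for x
      using compact_smooth_has_derivative[OF G] differentiableI by blast
    have "norm (frechet_derivative G (at x) v - frechet_derivative G (at y) v) =
        norm (\<Sum>b\<in>Basis. (v \<bullet> b) *\<^sub>R (frechet_derivative G (at x) b - frechet_derivative G (at y) b))"
      by (subst (1 2) frechet_derivative_basis_sum[OF d]) (simp add: sum_subtractf scaleR_diff_right)
    also have "\<dots> \<le> (\<Sum>b\<in>Basis. \<bar>v \<bullet> b\<bar> * norm (frechet_derivative G (at x) b - frechet_derivative G (at y) b))"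
      by (rule order_trans[OF norm_sum]) simp
    also have "\<dots> \<le> (\<Sum>b\<in>Basis. norm v * (B b * norm (x - y)))"
      by (intro sum_mono mult_mono compact_smooth_Lipschitz compact_smooth_frechet G B norm_ge_zero)
        (auto simp: Basis_le_norm)
    finally show ?thesis by (simp add: sum_distrib_left sum_distrib_right mult_ac)
  qed
  show thesis
  proof (rule that[of "sum B Basis"])
    fix x h
    have "norm (G (x + h) - G x - frechet_derivative G (at x) (x + h - x)) \<le> norm (x + h - x) * (sum B Basis * norm h)"
    proof (rule differentiable_bound_linearization[where S = "cball x (norm h)" and f' = "\<lambda>x. frechet_derivative G (at x)"])
      fix y assume y: "y \<in> cball x (norm h)"
      show "(G has_derivative frechet_derivative G (at y)) (at y within cball x (norm h))"
        by (rule has_derivative_at_withinI[OF compact_smooth_has_derivative[OF G]])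
      show "onorm (frechet_derivative G (at y) - frechet_derivative G (at x)) \<le> sum B Basis * norm h"
      proof (rule onorm_le)
        fix v
        have "norm (frechet_derivative G (at y) v - frechet_derivative G (at x) v) \<le> sum B Basis * norm (y - x) * norm v"
          by (rule diff)
        also have "\<dots> \<le> sum B Basis * norm h * norm v"
          using y B by (intro mult_right_mono mult_left_mono sum_nonneg) (auto simp: dist_norm norm_minus_commute)
        finally show "norm ((frechet_derivative G (at y) - frechet_derivative G (at x)) v) \<le> sum B Basis * norm h * norm v"
          by simp
      qed
    qed (auto simp: dist_norm mult_left_le_one_le)
    then show "norm (G (x + h) - G x - frechet_derivative G (at x) h) \<le> sum B Basis * (norm h)\<^sup>2"
      by (simp add: power2_eq_square mult_ac)
  qed (use B in \<open>auto intro: sum_nonneg\<close>)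
qed

lemma has_derivative_quadratic:
  assumes "bounded_linear D" "\<And>y. norm (y - x) < d \<Longrightarrow> norm (f y - f x - D (y - x)) \<le> C * (norm (y - x))\<^sup>2" "d > 0"
  shows "(f has_derivative D) (at x)"
  unfolding has_derivative_within_alt
proof (intro conjI allI impI assms(1))
  fix e :: real assume e: "e > 0"
  have C: "e / (\<bar>C\<bar> + 1) > 0" using e by (simp add: add_nonneg_pos)
  show "\<exists>d>0. \<forall>y\<in>UNIV. norm (y - x) < d \<longrightarrow> norm (f y - f x - D (y - x)) \<le> e * norm (y - x)"
  proof (intro exI[of _ "min d (e / (\<bar>C\<bar> + 1))"] conjI ballI impI)
    fix y assume y: "norm (y - x) < min d (e / (\<bar>C\<bar> + 1))"
    then have "norm (y - x) * (\<bar>C\<bar> + 1) \<le> e" by (simp add: field_simps add_nonneg_pos)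
    then have "C * norm (y - x) \<le> e"
      using norm_ge_zero[of "y - x"] by (smt (verit) mult.commute mult_left_mono mult_nonneg_nonneg)
    then have "C * (norm (y - x))\<^sup>2 \<le> e * norm (y - x)"
      by (simp add: power2_eq_square mult_right_mono flip: mult.assoc)
    then show "norm (f y - f x - D (y - x)) \<le> e * norm (y - x)" using assms(2)[of y] y by simp
  qed (use C assms in auto)
qed

section \<open>Flows and the theorem of Frobenius\<close>

type_synonym 'e curve = "real \<Rightarrow>\<^sub>C 'e"

lemma Bcontfun_apply:
  assumes "continuous_on UNIV f" "\<And>x. norm (f x) \<le> B"
  shows "apply_bcontfun (Bcontfun f) = f"
  by (rule Bcontfun_inverse[OF bcontfun_normI[OF assms]])

definition bc_scale :: "real curve \<Rightarrow> 'e::euclidean_space curve \<Rightarrow> 'e curve" where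
  "bc_scale r y = Bcontfun (\<lambda>t. apply_bcontfun r t *\<^sub>R apply_bcontfun y t)"

lemma bc_scale_apply [simp]: "apply_bcontfun (bc_scale r y) = (\<lambda>t. apply_bcontfun r t *\<^sub>R apply_bcontfun y t)"
  unfolding bc_scale_def
  by (rule Bcontfun_apply[where B = "norm r * norm y"])
    (auto intro!: continuous_intros mult_mono norm_bounded simp flip: real_norm_def)

lemma bounded_bilinear_bc_scale:
  "bounded_bilinear (bc_scale :: real curve \<Rightarrow> 'e::euclidean_space curve \<Rightarrow> 'e curve)"
proof
  have "norm (bc_scale a b) \<le> norm a * norm b * 1" for a and b :: "'e curve"
  proof (rule norm_bound)
    fix t show "norm (apply_bcontfun (bc_scale a b) t) \<le> norm a * norm b * 1"
      using norm_bounded[of a t] norm_bounded[of b t] by (auto intro!: mult_mono)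
  qed
  then show "\<exists>K. \<forall>a (b :: 'e curve). norm (bc_scale a b) \<le> norm a * norm b * K" by blast
qed (auto intro!: bcontfun_eqI simp: algebra_simps)

definition bc_inner :: "'e::euclidean_space \<Rightarrow> 'e curve \<Rightarrow> real curve" where
  "bc_inner b y = Bcontfun (\<lambda>t. apply_bcontfun y t \<bullet> b)"

lemma bc_inner_apply [simp]: "apply_bcontfun (bc_inner b y) = (\<lambda>t. apply_bcontfun y t \<bullet> b)"
  unfolding bc_inner_def
proof (rule Bcontfun_apply[where B = "norm y * norm b"])
  show "norm (apply_bcontfun y t \<bullet> b) \<le> norm y * norm b" for t
    using Cauchy_Schwarz_ineq2[of "apply_bcontfun y t" b] norm_bounded[of y t]
    by (smt (verit) mult_right_mono norm_ge_zero real_norm_def)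
qed (auto intro!: continuous_intros)

lemma bounded_linear_bc_inner: "bounded_linear (bc_inner b)"
proof (rule bounded_linear_intro[where K = "norm b"])
  fix y show "norm (bc_inner b y) \<le> norm y * norm b"
  proof (rule norm_bound)
    fix t show "norm (apply_bcontfun (bc_inner b y) t) \<le> norm y * norm b"
      using Cauchy_Schwarz_ineq2[of "apply_bcontfun y t" b] norm_bounded[of y t]
      by simp (smt (verit) mult_right_mono norm_ge_zero)
  qed
qed (auto intro!: bcontfun_eqI simp: algebra_simps)

lemma bounded_linear_const_bcontfun:
  "bounded_linear (const_bcontfun :: 'e::real_normed_vector \<Rightarrow> real \<Rightarrow>\<^sub>C 'e)"
  by (rule bounded_linear_intro[where K = 1]) (auto intro!: bcontfun_eqI norm_bound)

lemma bounded_linear_apply_bcontfun: "bounded_linear (\<lambda>y :: real \<Rightarrow>\<^sub>C 'e::real_normed_vector. apply_bcontfun y t)"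
  by (rule bounded_linear_intro[where K = 1]) (auto simp: norm_bounded)

text \<open>Curves are bounded continuous functions on the whole line, because these form a Banach
  space. Clamping the upper limit of integration in \<open>bc_int\<close> confines the evolution to
  the time interval from 0 to 1 and makes integration an operator of norm at most 1.\<close>

definition unit_clamp :: "real \<Rightarrow> real" where "unit_clamp t = min 1 (max 0 t)"

lemma unit_clamp_bounds: "0 \<le> unit_clamp t" "unit_clamp t \<le> 1"
  and unit_clamp_id: "0 \<le> t \<Longrightarrow> t \<le> 1 \<Longrightarrow> unit_clamp t = t"
  by (auto simp: unit_clamp_def)

definition bc_int :: "'e::euclidean_space curve \<Rightarrow> 'e curve" where
  "bc_int y = Bcontfun (\<lambda>t. integral {0..unit_clamp t} (apply_bcontfun y))"

lemma bc_integrable: "apply_bcontfun y integrable_on {a..b}"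
  for y :: "'e::euclidean_space curve"
  by (rule integrable_continuous_real) simp

lemma bc_int_norm: "norm (integral {0..unit_clamp t} (apply_bcontfun y)) \<le> norm y"
  for y :: "'e::euclidean_space curve"
proof -
  have "norm (integral {0..unit_clamp t} (apply_bcontfun y)) \<le> norm y * (unit_clamp t - 0)"
    by (rule integral_bound) (auto simp: unit_clamp_bounds norm_bounded)
  also have "\<dots> \<le> norm y * 1" by (intro mult_left_mono) (auto simp: unit_clamp_bounds)
  finally show ?thesis by simp
qed

lemma bc_int_apply [simp]:
  "apply_bcontfun (bc_int y) = (\<lambda>t. integral {0..unit_clamp t} (apply_bcontfun y))"
  unfolding bc_int_def
proof (rule Bcontfun_apply[OF _ bc_int_norm])
  have "continuous_on {0..1} (\<lambda>t. integral {0..t} (apply_bcontfun y))"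
    by (rule indefinite_integral_continuous_1[OF bc_integrable])
  moreover have "continuous_on UNIV unit_clamp"
    unfolding unit_clamp_def[abs_def] by (intro continuous_intros)
  ultimately show "continuous_on UNIV (\<lambda>t. integral {0..unit_clamp t} (apply_bcontfun y))"
    by (rule continuous_on_compose2[of "{0..1}"]) (auto simp: unit_clamp_bounds)
qed

lemma bounded_linear_bc_int: "bounded_linear bc_int"
  by (rule bounded_linear_intro[where K = 1])
    (auto intro!: bcontfun_eqI norm_bound bc_int_norm integral_add bc_integrable)

definition bc_comp :: "('e::euclidean_space \<Rightarrow> 'f::euclidean_space) \<Rightarrow> 'e curve \<Rightarrow> 'f curve" where
  "bc_comp G y = Bcontfun (\<lambda>t. G (apply_bcontfun y t))"

lemma bc_comp_apply [simp]:
  assumes G: "compact_smooth G"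
  shows "apply_bcontfun (bc_comp G y) = (\<lambda>t. G (apply_bcontfun y t))"
proof -
  obtain B where B: "\<And>x. norm (G x) \<le> B" using compact_smooth_bounded[OF G] by metis
  have "continuous_on UNIV G" using G smooth_on_continuous by (auto simp: compact_smooth_def)
  then have "continuous_on UNIV (\<lambda>t. G (apply_bcontfun y t))"
    by (rule continuous_on_compose2) auto
  then show ?thesis unfolding bc_comp_def by (rule Bcontfun_apply) (rule B)
qed

text \<open>The derivative of the superposition operator \<open>bc_comp G\<close> at
  \<open>y\<close>: it applies the derivative of \<open>G\<close> at the point \<open>y t\<close> to
  \<open>z t\<close>. As a basis sum it is assembled from \<open>bc_comp\<close> of directional
  derivatives and so inherits smooth dependence on \<open>y\<close>.\<close>

definition bc_deriv :: "('e::euclidean_space \<Rightarrow> 'f::euclidean_space) \<Rightarrow> 'e curve \<Rightarrow> 'e curve \<Rightarrow>\<^sub>L 'f curve" where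
  "bc_deriv G y = (\<Sum>b\<in>Basis. Blinfun (\<lambda>r. bc_scale r (bc_comp (\<lambda>x. frechet_derivative G (at x) b) y))
     o\<^sub>L Blinfun (bc_inner b))"

lemma bc_deriv_apply:
  assumes G: "compact_smooth G"
  shows "apply_bcontfun (blinfun_apply (bc_deriv G y) z) t =
    frechet_derivative G (at (apply_bcontfun y t)) (apply_bcontfun z t)"
proof -
  have d: "G differentiable at x" for x
    using compact_smooth_has_derivative[OF G] differentiableI by blast
  have s: "apply_bcontfun (sum f A) t = (\<Sum>a\<in>A. apply_bcontfun (f a) t)" for f :: "'c \<Rightarrow> 'b curve" and A
    by (induction A rule: infinite_finite_induct) auto
  have "apply_bcontfun (blinfun_apply (bc_deriv G y) z) t =
    (\<Sum>b\<in>Basis. (apply_bcontfun z t \<bullet> b) *\<^sub>R frechet_derivative G (at (apply_bcontfun y t)) b)"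
    unfolding bc_deriv_def
    by (simp add: blinfun.sum_left s bounded_linear_Blinfun_apply bounded_linear_bc_inner
        bounded_bilinear.bounded_linear_left[OF bounded_bilinear_bc_scale] compact_smooth_frechet G)
  also have "\<dots> = frechet_derivative G (at (apply_bcontfun y t)) (apply_bcontfun z t)"
    by (rule frechet_derivative_basis_sum[OF d, symmetric])
  finally show ?thesis .
qed

lemma bc_comp_quadratic:
  fixes G :: "'a::euclidean_space \<Rightarrow> 'b::euclidean_space"
  assumes G: "compact_smooth G"
  obtains C where "C \<ge> 0" "\<And>y y' :: 'a curve. norm (bc_comp G y' - bc_comp G y - blinfun_apply (bc_deriv G y) (y' - y))
    \<le> C * (norm (y' - y))\<^sup>2"
proof -
  obtain C where C: "C \<ge> 0" "\<And>x h. norm (G (x + h) - G x - frechet_derivative G (at x) h) \<le> C * (norm h)\<^sup>2"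
    using compact_smooth_quadratic[OF G] by blast
  show thesis
  proof (rule that[OF C(1) norm_bound])
    fix y y' :: "'a curve" and t
    let ?h = "apply_bcontfun y' t - apply_bcontfun y t"
    have "norm (apply_bcontfun (bc_comp G y' - bc_comp G y - blinfun_apply (bc_deriv G y) (y' - y)) t)
       \<le> C * (norm ?h)\<^sup>2"
      using C(2)[of "apply_bcontfun y t" ?h] by (simp add: G bc_deriv_apply)
    also have "\<dots> \<le> C * (norm (y' - y))\<^sup>2"
      using norm_bounded[of "y' - y" t] C(1) by (intro mult_left_mono power_mono) auto
    finally show "norm (apply_bcontfun (bc_comp G y' - bc_comp G y - blinfun_apply (bc_deriv G y) (y' - y)) t)
       \<le> C * (norm (y' - y))\<^sup>2" .
  qed
qed

lemma bc_comp_has_derivative: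
  fixes G :: "'a::euclidean_space \<Rightarrow> 'b::euclidean_space"
  assumes G: "compact_smooth G"
  shows "(bc_comp G has_derivative blinfun_apply (bc_deriv G y)) (at y)"
proof -
  obtain C where "\<forall>y y' :: 'a curve. norm (bc_comp G y' - bc_comp G y - blinfun_apply (bc_deriv G y) (y' - y)) \<le> C * (norm (y' - y))\<^sup>2"
    by (rule bc_comp_quadratic[OF G]) (metis (no_types))
  then show ?thesis by (intro has_derivative_quadratic[where d = 1]) (auto intro: blinfun.bounded_linear_right)
qed

lemma blinfun_eq_iff: "f = g \<longleftrightarrow> (\<forall>x. blinfun_apply f x = blinfun_apply g x)"
  by (auto intro: blinfun_eqI)

text \<open>Directional derivatives of \<open>G\<close> are again smooth with compact support, so
  the derivative of \<open>bc_comp G\<close> is made of operators of the same kind and the induction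
  runs over all \<open>G\<close> simultaneously.\<close>

lemma Ck_on_bc_comp:
  assumes "open P" "compact_smooth G" "Ck_on k y P"
  shows "Ck_on k (\<lambda>p. bc_comp G (y p)) P"
  using assms(2,3)
proof (induction k arbitrary: G)
  case 0
  have "isCont (bc_comp G) z" for z
    using bc_comp_has_derivative[OF 0(1)] has_derivative_continuous by blast
  then have "continuous_on UNIV (bc_comp G)" by (intro continuous_at_imp_continuous_on) simp
  from continuous_on_compose2[OF this, of P y] show ?case using 0 by simp
next
  case (Suc k)
  show ?case
  proof (rule Ck_on_SucI[OF assms(1)])
    fix p assume "p \<in> P"
    then show "((\<lambda>p. bc_comp G (y p)) has_derivative
        (\<lambda>v. blinfun_apply (bc_deriv G (y p)) (frechet_derivative y (at p) v))) (at p)"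
      using has_derivative_compose[OF Ck_on_has_derivative[OF Suc.prems(2)] bc_comp_has_derivative[OF Suc.prems(1)]] by blast
  next
    fix v
    have "(\<lambda>p. blinfun_apply (bc_deriv G (y p)) (frechet_derivative y (at p) v)) =
      (\<lambda>p. \<Sum>b\<in>Basis. bc_scale (bc_inner b (frechet_derivative y (at p) v)) (bc_comp (\<lambda>x. frechet_derivative G (at x) b) (y p)))"
      by (simp add: bc_deriv_def blinfun.sum_left bounded_linear_Blinfun_apply bounded_linear_bc_inner
        bounded_bilinear.bounded_linear_left[OF bounded_bilinear_bc_scale])
    then show "Ck_on k (\<lambda>p. blinfun_apply (bc_deriv G (y p)) (frechet_derivative y (at p) v)) P"
      using Suc.prems Ck_on_SucD[OF Suc.prems(2)]
      by (auto intro!: Ck_on_sum bounded_bilinear.Ck_on_bilinear[OF bounded_bilinear_bc_scale] Suc.IH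
          Ck_on_linear_compose[OF bounded_linear_bc_inner] Ck_on_frechet compact_smooth_frechet assms(1)
          simp del: times_differentiable_on.simps)
  qed
qed

lemma Ck_on_bc_deriv:
  assumes P: "open P" and G: "compact_smooth G" and y: "Ck_on k y P"
  shows "Ck_on k (\<lambda>p. bc_deriv G (y p)) P"
proof -
  \<comment> \<open>Smoothness is wanted in the operator norm, so the operator of multiplying
    \<open>w\<close> by a scalar curve must itself depend boundedly and linearly on
    \<open>w\<close>.\<close>
  have l: "bounded_linear (\<lambda>w::'c curve. Blinfun (\<lambda>r. bc_scale r w))"
  proof (rule bounded_linear_intro[where K = 1])
    note A = bounded_linear_Blinfun_apply[OF bounded_bilinear.bounded_linear_left[OF bounded_bilinear_bc_scale]]
    fix w w' :: "'c curve" and s :: real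
    show "Blinfun (\<lambda>r. bc_scale r (w + w')) = Blinfun (\<lambda>r. bc_scale r w) + Blinfun (\<lambda>r. bc_scale r w')"
      unfolding blinfun_eq_iff A blinfun.add_left by (simp add: bounded_bilinear.add_right[OF bounded_bilinear_bc_scale])
    show "Blinfun (\<lambda>r. bc_scale r (s *\<^sub>R w)) = s *\<^sub>R Blinfun (\<lambda>r. bc_scale r w)"
      unfolding blinfun_eq_iff A blinfun.scaleR_left by (simp add: bounded_bilinear.scaleR_right[OF bounded_bilinear_bc_scale])
    show "norm (Blinfun (\<lambda>r. bc_scale r w)) \<le> norm w * 1"
    proof (rule norm_blinfun_bound)
      fix r show "norm (blinfun_apply (Blinfun (\<lambda>r. bc_scale r w)) r) \<le> norm w * 1 * norm r"
      proof (rule norm_bound)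
        fix t show "norm (apply_bcontfun (blinfun_apply (Blinfun (\<lambda>r. bc_scale r w)) r) t) \<le> norm w * 1 * norm r"
          using norm_bounded[of r t] norm_bounded[of w t]
          using mult_mono[of "norm (apply_bcontfun w t)" "norm w" "\<bar>apply_bcontfun r t\<bar>" "norm r"]
          by (simp add: A mult.commute)
      qed
    qed simp
  qed
  show ?thesis
    unfolding bc_deriv_def
    by (intro Ck_on_sum P Ck_on_linear_compose[OF bounded_linear_compose[OF
          bounded_bilinear.bounded_linear_left[OF bounded_bilinear_blinfun_compose] l]]
        Ck_on_bc_comp compact_smooth_frechet G y)
qed

instance bcontfun :: (metric_space, banach) banach ..

lemma bc_int_norm_le: "norm (bc_int z) \<le> norm z"
  by (rule norm_bound) (simp add: bc_int_norm)

lemma apply_bcontfun_sum: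
  "apply_bcontfun (\<Sum>a\<in>A. f a) t = (\<Sum>a\<in>A. apply_bcontfun (f a) t)"
  for f :: "'c \<Rightarrow> ('d::topological_space \<Rightarrow>\<^sub>C 'b::real_normed_vector)"
  by (induction A rule: infinite_finite_induct) auto

lemma norm_sum_component_le:
  fixes p :: "real^'n" and w :: "'n \<Rightarrow> 'a::real_normed_vector"
  assumes "\<And>j. norm (w j) \<le> B j"
  shows "norm (\<Sum>j\<in>UNIV. p $ j *\<^sub>R w j) \<le> norm p * (\<Sum>j\<in>UNIV. B j)"
proof -
  have "norm (\<Sum>j\<in>UNIV. p $ j *\<^sub>R w j) \<le> (\<Sum>j\<in>UNIV. \<bar>p $ j\<bar> * norm (w j))"
    by (rule order_trans[OF norm_sum]) simp
  also have "\<dots> \<le> (\<Sum>j\<in>UNIV. norm p * B j)"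
    by (intro sum_mono mult_mono assms component_le_norm_cart) auto
  finally show ?thesis by (simp add: sum_distrib_left)
qed

text \<open>A Picard iteration in the space of curves, contracting with constant 1/2 for small
  \<open>p\<close>. Lipschitz dependence on \<open>p\<close> gives the first derivative of the fixed
  point, and \<open>linear_fixed_point_Ck\<close> all further ones. The last clause is the same
  constant 1/2 in pointwise form, kept for uniqueness in the linearised equation.\<close>

lemma parametric_flow:
  fixes Y :: "'n::finite \<Rightarrow> real^'n \<Rightarrow> real^'n"
  assumes Y: "\<And>j. compact_smooth (Y j)"
  obtains \<delta> C y where "\<delta> > 0" "C > 0"
    "\<And>p t. norm p < \<delta> \<Longrightarrow> 0 \<le> t \<Longrightarrow> t \<le> 1 \<Longrightarrow> apply_bcontfun (y p) t =
      p - integral {0..t} (\<lambda>s. \<Sum>j\<in>UNIV. p $ j *\<^sub>R Y j (apply_bcontfun (y p) s))"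
    "\<And>p t. norm p < \<delta> \<Longrightarrow> norm (apply_bcontfun (y p) t) \<le> C * norm p"
    "smooth_on (y :: _ \<Rightarrow> (real^'n) curve) (ball 0 \<delta>)"
    "\<And>p v t. norm p < \<delta> \<Longrightarrow> 0 \<le> t \<Longrightarrow> t \<le> 1 \<Longrightarrow> apply_bcontfun (frechet_derivative y (at p) v) t =
      v - integral {0..t} (\<lambda>s. (\<Sum>j\<in>UNIV. v $ j *\<^sub>R Y j (apply_bcontfun (y p) s)) +
       (\<Sum>j\<in>UNIV. p $ j *\<^sub>R frechet_derivative (Y j) (at (apply_bcontfun (y p) s))
          (apply_bcontfun (frechet_derivative y (at p) v) s)))"
    "\<And>p a w. norm p < \<delta> \<Longrightarrow>
      norm (\<Sum>j\<in>UNIV. p $ j *\<^sub>R frechet_derivative (Y j) (at a) w) \<le> 1/2 * norm w"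
proof -
  have "\<exists>B. \<forall>x. norm (Y j x) \<le> B \<and> B \<ge> 0" for j using compact_smooth_bounded[OF Y] by metis
  then obtain B where B: "\<And>j x. norm (Y j x) \<le> B j" "\<And>j. B j \<ge> 0" by metis
  have "\<exists>B. \<forall>x v. norm (frechet_derivative (Y j) (at x) v) \<le> B * norm v \<and> B \<ge> 0" for j
    using compact_smooth_derivative_bound[OF Y] by metis
  then obtain DB where DB: "\<And>j x v. norm (frechet_derivative (Y j) (at x) v) \<le> DB j * norm v" "\<And>j. DB j \<ge> 0"
    by metis
  have "\<exists>C. \<forall>y y'. norm (bc_comp (Y j) y' - bc_comp (Y j) y - blinfun_apply (bc_deriv (Y j) y) (y' - y))
      \<le> C * (norm (y' - y))\<^sup>2 \<and> C \<ge> 0" for j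
    using bc_comp_quadratic[OF Y] by metis
  then obtain Q where Q: "\<And>j y y'. norm (bc_comp (Y j) y' - bc_comp (Y j) y - blinfun_apply (bc_deriv (Y j) y) (y' - y))
      \<le> Q j * (norm (y' - y))\<^sup>2" "\<And>j. Q j \<ge> 0" by metis
  define N where "N j = bc_comp (Y j)" for j
  have N: "apply_bcontfun (N j y) t = Y j (apply_bcontfun y t)" for j y t by (simp add: N_def Y)
  have NB: "norm (N j y) \<le> B j" for j y by (rule norm_bound) (simp add: N B)
  have NL: "norm (N j y - N j y') \<le> DB j * norm (y - y')" for j y y'
  proof (rule norm_bound)
    fix t
    have "norm (apply_bcontfun (N j y - N j y') t) \<le> DB j * norm (apply_bcontfun (y - y') t)"
      using compact_smooth_Lipschitz[OF Y DB(1)] by (simp add: N)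
    also have "\<dots> \<le> DB j * norm (y - y')" by (intro mult_left_mono norm_bounded DB)
    finally show "norm (apply_bcontfun (N j y - N j y') t) \<le> DB j * norm (y - y')" .
  qed
  \<comment> \<open>Within this radius \<open>norm p * sum DB UNIV\<close>, the Lipschitz constant
    of the Picard operator, is at most 1/2. The added 1 avoids division by zero.\<close>
  define \<delta> where "\<delta> = 1 / (2 * (sum DB UNIV + 1))"
  have sDB: "sum DB UNIV \<ge> 0" and sB: "sum B UNIV \<ge> 0" using DB B by (auto intro: sum_nonneg)
  then have \<delta>: "\<delta> > 0" by (simp add: \<delta>_def add_nonneg_pos)
  have small: "norm p * sum DB UNIV \<le> 1/2" if "norm p < \<delta>" for p :: "real^'n"
  proof -
    have "norm p * (sum DB UNIV + 1) \<le> \<delta> * (sum DB UNIV + 1)"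
      using that sDB by (intro mult_right_mono) auto
    also have "\<dots> = 1/2" using sDB by (simp add: \<delta>_def field_simps)
    finally show ?thesis by (simp add: algebra_simps) (smt (verit) norm_ge_zero)
  qed
  \<comment> \<open>The parameter is both the starting point and the vector of coefficients of the
    velocity. This double role is what makes \<open>T p\<close> a contraction for small
    \<open>p\<close> on a time interval of fixed length.\<close>
  define T where "T p y = const_bcontfun p - bc_int (\<Sum>j\<in>UNIV. p $ j *\<^sub>R N j y)" for p and y :: "(real^'n) curve"
  interpret J: bounded_linear bc_int by (rule bounded_linear_bc_int)
  have TL: "norm (T p y - T p y') \<le> 1/2 * norm (y - y')" if p: "norm p < \<delta>" for p y y'
  proof -
    have "T p y - T p y' = - bc_int (\<Sum>j\<in>UNIV. p $ j *\<^sub>R (N j y - N j y'))"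
      unfolding T_def by (simp add: J.diff sum_subtractf scaleR_diff_right)
    then have "norm (T p y - T p y') \<le> norm (\<Sum>j\<in>UNIV. p $ j *\<^sub>R (N j y - N j y'))"
      using bc_int_norm_le by simp
    also have "\<dots> \<le> norm p * (\<Sum>j\<in>UNIV. DB j * norm (y - y'))"
      by (rule norm_sum_component_le[OF NL])
    also have "\<dots> = (norm p * sum DB UNIV) * norm (y - y')" by (simp add: sum_distrib_right)
    also have "\<dots> \<le> 1/2 * norm (y - y')" using small[OF p] by (intro mult_right_mono) auto
    finally show ?thesis .
  qed
  have "\<exists>y. T p y = y" if p: "norm p < \<delta>" for p
    using banach_fix_type[of "1/2" "T p"] TL[OF p] by (auto simp: dist_norm)
  then obtain y where y: "\<And>p. norm p < \<delta> \<Longrightarrow> T p (y p) = y p" by metis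
  have Tdiff: "T q z - T p z = const_bcontfun (q - p) - bc_int (\<Sum>j\<in>UNIV. (q - p) $ j *\<^sub>R N j z)" for p q z
  proof -
    have "const_bcontfun (q - p) = const_bcontfun q - (const_bcontfun p :: (real^'n) curve)"
      by (rule bcontfun_eqI) simp
    then show ?thesis unfolding T_def by (simp add: J.diff sum_subtractf scaleR_diff_left)
  qed
  have const: "norm (const_bcontfun v :: (real^'n) curve) \<le> norm v" for v by (rule norm_bound) simp
  define C where "C = 2 * (1 + sum B UNIV)"
  have C: "C > 0" using sB by (simp add: C_def)
  have bnd: "norm (const_bcontfun v - bc_int (\<Sum>j\<in>UNIV. v $ j *\<^sub>R N j z)) \<le> (1 + sum B UNIV) * norm v" for v z
  proof -
    have "norm (const_bcontfun v - bc_int (\<Sum>j\<in>UNIV. v $ j *\<^sub>R N j z)) \<le>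
        norm (const_bcontfun v :: (real^'n) curve) + norm (bc_int (\<Sum>j\<in>UNIV. v $ j *\<^sub>R N j z))"
      by (rule norm_triangle_ineq4)
    also have "\<dots> \<le> norm v + norm v * sum B UNIV"
      by (intro add_mono const order_trans[OF bc_int_norm_le] norm_sum_component_le NB)
    finally show ?thesis by (simp add: algebra_simps)
  qed
  have yL: "norm (y q - y p) \<le> C * norm (q - p)" if p: "norm p < \<delta>" and q: "norm q < \<delta>" for p q
  proof -
    have "y q - y p = (T q (y q) - T p (y q)) + (T p (y q) - T p (y p))" using y[OF p] y[OF q] by simp
    then have "norm (y q - y p) \<le> norm (T q (y q) - T p (y q)) + norm (T p (y q) - T p (y p))"
      by (metis norm_triangle_ineq)
    also have "\<dots> \<le> (1 + sum B UNIV) * norm (q - p) + 1/2 * norm (y q - y p)"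
      unfolding Tdiff by (intro add_mono bnd TL p)
    finally show ?thesis by (simp add: C_def algebra_simps)
  qed
  \<comment> \<open>The derivative of \<open>T p\<close> at the curve \<open>y p\<close>. Together
    with \<open>w\<close>, the derivative of \<open>T\<close> in the parameter, it forms the
    differentiated fixed point equation.\<close>
  define L where "L p = - (\<Sum>j\<in>UNIV. p $ j *\<^sub>R (Blinfun bc_int o\<^sub>L bc_deriv (Y j) (y p)))" for p :: "real^'n"
  have Lapp: "blinfun_apply (L p) z = - bc_int (\<Sum>j\<in>UNIV. p $ j *\<^sub>R blinfun_apply (bc_deriv (Y j) (y p)) z)" for p z
    by (simp add: L_def blinfun.sum_left blinfun.minus_left blinfun.scaleR_left J.sum J.scaleR
        bounded_linear_Blinfun_apply bounded_linear_bc_int)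
  have dbnd: "norm (blinfun_apply (bc_deriv (Y j) z) w) \<le> DB j * norm w" for j z w
  proof (rule norm_bound)
    fix t
    have "norm (apply_bcontfun (blinfun_apply (bc_deriv (Y j) z) w) t) \<le> DB j * norm (apply_bcontfun w t)"
      by (simp add: bc_deriv_apply Y DB)
    also have "\<dots> \<le> DB j * norm w" by (intro mult_left_mono norm_bounded DB)
    finally show "norm (apply_bcontfun (blinfun_apply (bc_deriv (Y j) z) w) t) \<le> DB j * norm w" .
  qed
  have Lnorm: "norm (L p) \<le> 1/2" if p: "norm p < \<delta>" for p
  proof (rule norm_blinfun_bound)
    fix z
    have "norm (blinfun_apply (L p) z) \<le> norm (\<Sum>j\<in>UNIV. p $ j *\<^sub>R blinfun_apply (bc_deriv (Y j) (y p)) z)"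
      unfolding Lapp using bc_int_norm_le by simp
    also have "\<dots> \<le> norm p * (\<Sum>j\<in>UNIV. DB j * norm z)" by (rule norm_sum_component_le[OF dbnd])
    also have "\<dots> = (norm p * sum DB UNIV) * norm z" by (simp add: sum_distrib_right)
    also have "\<dots> \<le> 1/2 * norm z" using small[OF p] by (intro mult_right_mono) auto
    finally show "norm (blinfun_apply (L p) z) \<le> 1/2 * norm z" .
  qed simp
  define w where "w v p = const_bcontfun v - bc_int (\<Sum>j\<in>UNIV. v $ j *\<^sub>R N j (y p))" for v p :: "real^'n"
  have dy: "\<exists>y'. (y has_derivative y') (at p) \<and> (\<forall>v. y' v = w v p + blinfun_apply (L p) (y' v))"
    if p: "norm p < \<delta>" for p
  proof -
    obtain M where M: "\<And>a z. z = a + blinfun_apply (L p) z \<longleftrightarrow> z = blinfun_apply M a"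
      using neumann_inverse[OF Lnorm[OF p]] by blast
    \<comment> \<open>The second-order remainder of the superposition operators. As \<open>y\<close>
      is Lipschitz in the parameter, it is quadratic in \<open>q - p\<close> and contributes nothing
      to the derivative.\<close>
    define R where "R q = (\<Sum>j\<in>UNIV. p $ j *\<^sub>R (N j (y q) - N j (y p) - blinfun_apply (bc_deriv (Y j) (y p)) (y q - y p)))" for q
    define e where "e q = (const_bcontfun (q - p) - bc_int (\<Sum>j\<in>UNIV. (q - p) $ j *\<^sub>R N j (y q))) - bc_int (R q)" for q
    have eq: "y q = y p + blinfun_apply M (e q)" if q: "norm q < \<delta>" for q
    proof -
      have "y q - y p = (T q (y q) - T p (y q)) + (T p (y q) - T p (y p))" using y[OF p] y[OF q] by simp
      also have "\<dots> = e q + blinfun_apply (L p) (y q - y p)"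
        unfolding Tdiff e_def R_def Lapp unfolding T_def
        by (simp add: J.diff scaleR_diff_right sum_subtractf)
      finally have "y q - y p = blinfun_apply M (e q)" using M by blast
      then show ?thesis by (simp add: algebra_simps)
    qed
    have "(e has_derivative (\<lambda>v. w v p - 0)) (at p)"
      unfolding e_def w_def
    proof (rule has_derivative_diff[OF has_derivative_diff])
      have c: "const_bcontfun (q - p) = const_bcontfun q - (const_bcontfun p :: (real^'n) curve)" for q
        by (rule bcontfun_eqI) simp
      show "((\<lambda>q. const_bcontfun (q - p) :: (real^'n) curve) has_derivative const_bcontfun) (at p)"
        unfolding c using has_derivative_diff[OF bounded_linear_imp_has_derivative[OF bounded_linear_const_bcontfun] has_derivative_const]
        by simp
      have "\<forall>\<^sub>F q in at p. norm (y q - y p) \<le> norm (q - p) * C"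
        by (rule eventually_mono[OF eventually_at_in_open'[OF open_ball, of p 0 \<delta>]])
          (use p yL[OF p] in \<open>auto simp: mult.commute\<close>)
      moreover have "((\<lambda>q. q - p) \<longlongrightarrow> 0) (at p)" by (simp add: LIM_zero_iff)
      ultimately have "((\<lambda>q. y q - y p) \<longlongrightarrow> 0) (at p)" by (rule tendsto_0_le[rotated])
      then have cy: "isCont y p" by (simp add: isCont_def LIM_zero_iff)
      have cN: "isCont (\<lambda>q. N j (y q)) p" for j
        unfolding N_def using has_derivative_continuous[OF bc_comp_has_derivative[OF Y]]
        by (intro isCont_o2[OF cy])
      have "((\<lambda>q. \<Sum>j\<in>UNIV. (q - p) $ j *\<^sub>R N j (y q)) has_derivative
          (\<lambda>v. \<Sum>j\<in>UNIV. v $ j *\<^sub>R N j (y p))) (at p)"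
      proof (intro has_derivative_sum bounded_bilinear.has_derivative_zero_left[OF bounded_bilinear_scaleR] cN)
        show "((\<lambda>q. (q - p) $ j) has_derivative (\<lambda>v. v $ j)) (at p)" for j
        proof -
          have "((\<lambda>q. q $ j - p $ j) has_derivative (\<lambda>v. v $ j - 0)) (at p)"
            by (intro has_derivative_diff has_derivative_const bounded_linear_imp_has_derivative bounded_linear_vec_nth)
          then show ?thesis by simp
        qed
      qed simp
      then show "((\<lambda>q. bc_int (\<Sum>j\<in>UNIV. (q - p) $ j *\<^sub>R N j (y q))) has_derivative
          (\<lambda>v. bc_int (\<Sum>j\<in>UNIV. v $ j *\<^sub>R N j (y p)))) (at p)"
        by (rule J.has_derivative)
      show "((\<lambda>q. bc_int (R q)) has_derivative (\<lambda>v. 0)) (at p)"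
      proof (rule has_derivative_quadratic)
        fix q assume q: "norm (q - p) < \<delta> - norm p"
        then have q': "norm q < \<delta>" using norm_triangle_ineq[of "q - p" p] by simp
        have R0: "R p = 0" by (simp add: R_def)
        have "norm (R q) \<le> norm p * (\<Sum>j\<in>UNIV. Q j * (norm (y q - y p))\<^sup>2)"
          unfolding R_def N_def by (rule norm_sum_component_le[OF Q(1)])
        also have "\<dots> = norm p * sum Q UNIV * (norm (y q - y p))\<^sup>2" by (simp add: sum_distrib_right mult_ac)
        also have "\<dots> \<le> norm p * sum Q UNIV * (C * norm (q - p))\<^sup>2"
          using yL[OF p q'] Q by (intro mult_left_mono power_mono mult_nonneg_nonneg sum_nonneg) auto
        finally have "norm (R q) \<le> norm p * sum Q UNIV * C\<^sup>2 * (norm (q - p))\<^sup>2"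
          by (simp add: power_mult_distrib mult_ac)
        then show "norm (bc_int (R q) - bc_int (R p) - 0) \<le> norm p * sum Q UNIV * C\<^sup>2 * (norm (q - p))\<^sup>2"
          using bc_int_norm_le[of "R q"] by (simp add: R0 J.zero)
      qed (use p in auto)
    qed
    then have "((\<lambda>q. y p + blinfun_apply M (e q)) has_derivative (\<lambda>v. 0 + blinfun_apply M (w v p - 0))) (at p)"
      by (intro has_derivative_add has_derivative_const bounded_linear.has_derivative[OF blinfun.bounded_linear_right])
    then have "(y has_derivative (\<lambda>v. 0 + blinfun_apply M (w v p - 0))) (at p)"
      by (rule has_derivative_transform_within_open[of _ _ p UNIV "ball 0 \<delta>" y]) (use p eq[symmetric] in auto)
    then show ?thesis using M by auto
  qed
  then obtain y' where y': "\<And>p. norm p < \<delta> \<Longrightarrow> (y has_derivative y' p) (at p)"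
    "\<And>p v. norm p < \<delta> \<Longrightarrow> y' p v = w v p + blinfun_apply (L p) (y' p v)" by metis
  have Ck: "Ck_on k y (ball 0 \<delta>)" for k
  proof (induction k)
    case 0
    have "isCont y p" if "p \<in> ball 0 \<delta>" for p :: "real^'n" using has_derivative_continuous[OF y'(1)] that by simp
    then show ?case by (simp add: continuous_at_imp_continuous_on)
  next
    case (Suc k)
    note o = open_ball[of "0 :: real^'n" \<delta>]
    have comp: "Ck_on k (\<lambda>p :: real^'n. p $ j) (ball 0 \<delta>)" for j by (rule Ck_on_linear[OF bounded_linear_vec_nth o])
    show ?case
    proof (rule Ck_on_SucI[OF o])
      fix v
      show "Ck_on k (\<lambda>p. y' p v) (ball 0 \<delta>)"
      proof (rule linear_fixed_point_Ck[OF o])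
        show "Ck_on k L (ball 0 \<delta>)" unfolding L_def
          by (intro Ck_on_minus Ck_on_sum Ck_on_scaleR comp o
              Ck_on_linear_compose[OF bounded_bilinear.bounded_linear_right[OF bounded_bilinear_blinfun_compose]]
              Ck_on_bc_deriv Y Suc)
        show "Ck_on k (w v) (ball 0 \<delta>)" unfolding w_def N_def
          by (intro Ck_on_diff Ck_on_const Ck_on_sum Ck_on_scaleR o Ck_on_linear_compose[OF bounded_linear_bc_int]
              Ck_on_bc_comp Y Suc)
        show "y' p v = w v p + blinfun_apply (L p) (y' p v)" if "p \<in> ball 0 \<delta>" for p :: "real^'n"
          by (rule y'(2)) (use that in simp)
      qed (use Lnorm in simp)
    qed (use y'(1) in simp)
  qed
  have fy: "frechet_derivative y (at p) = y' p" if "norm p < \<delta>" for p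
    using frechet_derivative_at[OF y'(1)[OF that]] by simp
  show thesis
  proof (rule that[of \<delta> C y])
    fix p :: "real^'n" and t assume p: "norm p < \<delta>" and t: "(0::real) \<le> t" "t \<le> 1"
    have *: "apply_bcontfun (y p) t = apply_bcontfun (T p (y p)) t" using y[OF p] by simp
    show "apply_bcontfun (y p) t =
      p - integral {0..t} (\<lambda>s. \<Sum>j\<in>UNIV. p $ j *\<^sub>R Y j (apply_bcontfun (y p) s))"
    proof -
      have "apply_bcontfun (\<Sum>j\<in>UNIV. p $ j *\<^sub>R N j (y p)) = (\<lambda>s. \<Sum>j\<in>UNIV. p $ j *\<^sub>R Y j (apply_bcontfun (y p) s))"
        by (rule ext) (simp add: apply_bcontfun_sum N)
      then show ?thesis using * by (simp add: T_def unit_clamp_id t)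
    qed
  next
    fix p :: "real^'n" and t assume p: "norm p < \<delta>"
    have "norm (y p) \<le> (1 + sum B UNIV) * norm p" using bnd[of p "y p"] y[OF p] by (simp add: T_def)
    also have "\<dots> \<le> C * norm p" using sB by (intro mult_right_mono) (auto simp: C_def)
    finally show "norm (apply_bcontfun (y p) t) \<le> C * norm p" using norm_bounded order_trans by blast
  next
    fix p v :: "real^'n" and t assume p: "norm p < \<delta>" and t: "(0::real) \<le> t" "t \<le> 1"
    have "apply_bcontfun (y' p v) t = apply_bcontfun (w v p + blinfun_apply (L p) (y' p v)) t"
      using y'(2)[OF p] by simp
    also have "\<dots> = v - integral {0..t} (\<lambda>s. apply_bcontfun ((\<Sum>j\<in>UNIV. v $ j *\<^sub>R N j (y p)) +
       (\<Sum>j\<in>UNIV. p $ j *\<^sub>R blinfun_apply (bc_deriv (Y j) (y p)) (y' p v))) s)"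
      by (simp add: w_def Lapp unit_clamp_id t integral_add bc_integrable)
    finally show "apply_bcontfun (frechet_derivative y (at p) v) t =
      v - integral {0..t} (\<lambda>s. (\<Sum>j\<in>UNIV. v $ j *\<^sub>R Y j (apply_bcontfun (y p) s)) +
       (\<Sum>j\<in>UNIV. p $ j *\<^sub>R frechet_derivative (Y j) (at (apply_bcontfun (y p) s))
          (apply_bcontfun (frechet_derivative y (at p) v) s)))"
      by (simp add: fy[OF p] apply_bcontfun_sum N bc_deriv_apply Y)
  next
    fix p a u :: "real^'n" assume p: "norm p < \<delta>"
    have "norm (\<Sum>j\<in>UNIV. p $ j *\<^sub>R frechet_derivative (Y j) (at a) u) \<le> norm p * (\<Sum>j\<in>UNIV. DB j * norm u)"
      by (rule norm_sum_component_le[OF DB(1)])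
    also have "\<dots> = (norm p * sum DB UNIV) * norm u" by (simp add: sum_distrib_right)
    also have "\<dots> \<le> 1/2 * norm u" using small[OF p] by (intro mult_right_mono) auto
    finally show "norm (\<Sum>j\<in>UNIV. p $ j *\<^sub>R frechet_derivative (Y j) (at a) u) \<le> 1/2 * norm u" .
  qed (use \<delta> C Ck in \<open>auto simp: smooth_on_def\<close>)
qed

text \<open>At a maximum of \<open>norm (d t)\<close> the integral equation bounds the maximum by
  half of itself. This gives uniqueness for the linearised equation without an exponential
  estimate.\<close>

lemma volterra_zero:
  fixes d :: "real \<Rightarrow> 'a::euclidean_space"
  assumes d: "continuous_on {0..1} d" and f: "continuous_on {0..1} f"
    and eq: "\<And>t. t \<in> {0..1} \<Longrightarrow> d t = - integral {0..t} f"
    and le: "\<And>t. t \<in> {0..1} \<Longrightarrow> norm (f t) \<le> 1/2 * norm (d t)"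
    and t: "t \<in> {0..1}"
  shows "d t = 0"
proof -
  have "\<exists>s\<in>{0..1}. \<forall>t\<in>{0..1}. norm (d t) \<le> norm (d s)"
    by (rule continuous_attains_sup) (use d in \<open>auto intro: continuous_intros\<close>)
  then obtain s where s: "s \<in> {0..1}" "\<And>t. t \<in> {0..1} \<Longrightarrow> norm (d t) \<le> norm (d s)" by blast
  have "norm (d s) = norm (integral {0..s} f)" using eq[OF s(1)] by simp
  also have "\<dots> \<le> (1/2 * norm (d s)) * (s - 0)"
  proof (rule integral_bound)
    fix t assume "t \<in> {0..s}"
    then have t: "t \<in> {0..1}" using s(1) by auto
    show "norm (f t) \<le> 1/2 * norm (d s)" using le[OF t] s(2)[OF t] by simp
  qed (use s(1) f in \<open>auto intro: continuous_on_subset\<close>)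
  also have "\<dots> \<le> (1/2 * norm (d s)) * 1" using s(1) by (intro mult_left_mono) auto
  finally have "norm (d s) = 0" by simp
  then show ?thesis using s(2)[OF t] by simp
qed

text \<open>The leaf through \<open>x\<close> is followed along the curve whose velocity is \<open>- (\<Sum>j. x\<^sub>j Y\<^sub>j)\<close>: it reaches the
  transversal \<open>{x. \<forall>k. k \<notin> S \<longrightarrow> x\<^sub>k = 0}\<close> at time 1, at the point \<open>\<Phi> x\<close>.\<close>

theorem frobenius:
  fixes Y :: "'n::finite \<Rightarrow> real^'n \<Rightarrow> real^'n"
  assumes r: "r > 0"
    and smooth: "\<And>j. smooth_on (Y j) (ball 0 r)"
    and comp: "\<And>j k x. x \<in> ball 0 r \<Longrightarrow> j \<notin> S \<Longrightarrow> k \<notin> S \<Longrightarrow> Y j x $ k = (if j = k then 1 else 0)"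
    and zero: "\<And>j x. x \<in> ball 0 r \<Longrightarrow> j \<in> S \<Longrightarrow> Y j x = 0"
    and invol: "\<And>j k x. x \<in> ball 0 r \<Longrightarrow>
      frechet_derivative (Y k) (at x) (Y j x) = frechet_derivative (Y j) (at x) (Y k x)"
  obtains \<delta> C \<Phi> where "\<delta> > 0" "\<delta> \<le> r" "C > 0" "smooth_on \<Phi> (ball 0 \<delta>)"
    "\<And>x. x \<in> ball 0 \<delta> \<Longrightarrow> norm (\<Phi> x) \<le> C * norm x"
    "\<And>x k. x \<in> ball 0 \<delta> \<Longrightarrow> k \<notin> S \<Longrightarrow> \<Phi> x $ k = 0"
    "\<And>x. x \<in> ball 0 \<delta> \<Longrightarrow> (\<And>k. k \<notin> S \<Longrightarrow> x $ k = 0) \<Longrightarrow> \<Phi> x = x"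
    "\<And>x j. x \<in> ball 0 \<delta> \<Longrightarrow> frechet_derivative \<Phi> (at x) (Y j x) = 0"
    "\<And>(q :: real^'n \<Rightarrow> complex) e x. x \<in> ball 0 \<delta> \<Longrightarrow> C * norm x < e \<Longrightarrow>
      (\<And>x. x \<in> ball 0 e \<Longrightarrow> q differentiable (at x)) \<Longrightarrow>
      (\<And>x j. x \<in> ball 0 e \<Longrightarrow> j \<notin> S \<Longrightarrow> frechet_derivative q (at x) (Y j x) = 0) \<Longrightarrow> q (\<Phi> x) = q x"
proof -
  have "\<exists>G. compact_smooth G \<and> (\<forall>x. norm x \<le> r / 4 \<longrightarrow> G x = Y j x)" for j
    using cutoff_extension[OF smooth r] by metis
  then obtain G where G: "\<And>j. compact_smooth (G j)" "\<And>j x. norm x \<le> r / 4 \<Longrightarrow> G j x = Y j x" by metis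
  obtain \<delta>0 C0 y where \<delta>0: "\<delta>0 > 0" and C0: "C0 > 0"
    and y: "\<And>p t. norm p < \<delta>0 \<Longrightarrow> 0 \<le> t \<Longrightarrow> t \<le> 1 \<Longrightarrow> apply_bcontfun (y p) t =
      p - integral {0..t} (\<lambda>s. \<Sum>j\<in>UNIV. p $ j *\<^sub>R G j (apply_bcontfun (y p) s))"
    and ybnd: "\<And>p t. norm p < \<delta>0 \<Longrightarrow> norm (apply_bcontfun (y p) t) \<le> C0 * norm p"
    and ysm: "smooth_on (y :: _ \<Rightarrow> (real^'n) curve) (ball 0 \<delta>0)"
    and dy: "\<And>p v t. norm p < \<delta>0 \<Longrightarrow> 0 \<le> t \<Longrightarrow> t \<le> 1 \<Longrightarrow> apply_bcontfun (frechet_derivative y (at p) v) t =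
      v - integral {0..t} (\<lambda>s. (\<Sum>j\<in>UNIV. v $ j *\<^sub>R G j (apply_bcontfun (y p) s)) +
       (\<Sum>j\<in>UNIV. p $ j *\<^sub>R frechet_derivative (G j) (at (apply_bcontfun (y p) s))
          (apply_bcontfun (frechet_derivative y (at p) v) s)))"
    and half: "\<And>p a w. norm p < \<delta>0 \<Longrightarrow>
      norm (\<Sum>j\<in>UNIV. p $ j *\<^sub>R frechet_derivative (G j) (at a) w) \<le> 1/2 * norm w"
    using parametric_flow[of G, OF G(1)] by blast
  \<comment> \<open>\<open>C0 * (r / (5 * C0)) = r / 5 < r / 4\<close>, so the curves stay where the
    cut-off fields \<open>G\<close> agree with \<open>Y\<close>.\<close>
  define \<delta> where "\<delta> = Min {\<delta>0, r / (5 * C0), r}"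
  have \<delta>: "\<delta> > 0" "\<delta> \<le> \<delta>0" "\<delta> \<le> r / (5 * C0)" "\<delta> \<le> r" using \<delta>0 C0 r by (auto simp: \<delta>_def)
  let ?y = "\<lambda>p t. apply_bcontfun (y p) t"
  define \<Phi> where "\<Phi> p = ?y p 1" for p
  have near: "norm (?y p t) < r / 4" if "norm p < \<delta>" for p t
  proof -
    have "norm (?y p t) \<le> C0 * norm p" using ybnd that \<delta> by auto
    also have "\<dots> \<le> C0 * (r / (5 * C0))" using that \<delta> C0 by (intro mult_left_mono) auto
    also have "\<dots> < r / 4" using C0 r by simp
    finally show ?thesis .
  qed
  have GY: "G j (?y p t) = Y j (?y p t)"
      "frechet_derivative (G j) (at (?y p t)) = frechet_derivative (Y j) (at (?y p t))"
    if "norm p < \<delta>" for p t j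
  proof -
    show "G j (?y p t) = Y j (?y p t)" using near[OF that] G by (simp add: less_imp_le)
    show "frechet_derivative (G j) (at (?y p t)) = frechet_derivative (Y j) (at (?y p t))"
      by (rule frechet_derivative_cong[of "ball 0 (r / 4)"]) (use near[OF that] G in auto)
  qed
  have in_r: "?y p t \<in> ball 0 r" if "norm p < \<delta>" for p t using near[OF that, of t] r by simp
  have contF: "continuous_on T (\<lambda>s. \<Sum>j\<in>UNIV. p $ j *\<^sub>R G j (?y p s))" for p T
    by (intro continuous_intros continuous_on_compose2[OF smooth_on_continuous[of "G _" UNIV]])
      (use G in \<open>auto simp: compact_smooth_def\<close>)
  have y0: "?y p 0 = p" if "norm p < \<delta>" for p using y[of p 0] that \<delta> by simp
  have dyt: "((\<lambda>t. ?y p t) has_vector_derivative - (\<Sum>j\<in>UNIV. p $ j *\<^sub>R Y j (?y p t))) (at t within {0..1})"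
    if p: "norm p < \<delta>" and t: "t \<in> {0..1}" for p t
  proof -
    have "((\<lambda>t. p - integral {0..t} (\<lambda>s. \<Sum>j\<in>UNIV. p $ j *\<^sub>R G j (?y p s))) has_vector_derivative
        0 - (\<Sum>j\<in>UNIV. p $ j *\<^sub>R G j (?y p t))) (at t within {0..1})"
      by (intro has_vector_derivative_diff has_vector_derivative_const integral_has_vector_derivative contF t)
    then have "((\<lambda>t. ?y p t) has_vector_derivative 0 - (\<Sum>j\<in>UNIV. p $ j *\<^sub>R G j (?y p t))) (at t within {0..1})"
      by (rule has_vector_derivative_transform[OF t, rotated]) (use y[of p] p \<delta> in auto)
    then show ?thesis by (simp add: GY[OF p])
  qed
  have dYy: "((\<lambda>t. Q (?y p t)) has_vector_derivative
      frechet_derivative Q (at (?y p t)) (- (\<Sum>j\<in>UNIV. p $ j *\<^sub>R Y j (?y p t)))) (at t within {0..1})"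
    if p: "norm p < \<delta>" and t: "t \<in> {0..1}" and Q: "Q differentiable at (?y p t)"
    for p t and Q :: "real^'n \<Rightarrow> 'b::real_normed_vector"
  proof -
    have "(Q has_derivative frechet_derivative Q (at (?y p t))) (at (?y p t) within (?y p) ` {0..1})"
      using Q frechet_derivative_works has_derivative_at_withinI by blast
    from vector_derivative_diff_chain_within[OF dyt[OF p t] this] show ?thesis by (simp add: o_def)
  qed
  have Phi_zero: "frechet_derivative \<Phi> (at p) (Y j p) = 0" if p: "norm p < \<delta>" for p j
  proof (cases "j \<in> S")
    case True
    have "\<Phi> differentiable at p" unfolding \<Phi>_def
      using bounded_linear.has_derivative[OF bounded_linear_apply_bcontfun[of 1] smooth_on_has_derivative[OF ysm, of p]] p \<delta>
      by (auto simp: differentiable_def)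
    then show ?thesis using zero[of p j] True p \<delta> linear_0[OF linear_frechet_derivative] by auto
  next
    case False
    define v where "v = Y j p"
    define z where "z = frechet_derivative y (at p) v"
    \<comment> \<open>A guess for the variation of the curve when its parameter moves in the
      direction \<open>Y j p\<close>. It starts at \<open>Y j p\<close> and vanishes at time 1, as
      it must if \<open>\<Phi>\<close> is constant on leaves; commutation of the fields makes it
      solve the variational equation.\<close>
    define zh where "zh t = (1 - t) *\<^sub>R Y j (?y p t)" for t
    define A where "A t = (\<Sum>k\<in>UNIV. p $ k *\<^sub>R frechet_derivative (Y k) (at (?y p t)) (zh t))" for t
    \<comment> \<open>Outside \<open>S\<close> the vector \<open>v = Y j p\<close> has component 1
      at \<open>j\<close> and 0 elsewhere, and the fields with index in \<open>S\<close> vanish. So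
      the inhomogeneous term of the variational equation is \<open>Y j\<close> along the
      curve.\<close>
    have sv: "(\<Sum>k\<in>UNIV. v $ k *\<^sub>R Y k (?y p s)) = Y j (?y p s)" for s
    proof -
      have "v $ k *\<^sub>R Y k (?y p s) = (if k = j then Y j (?y p s) else 0)" for k
        using comp[of p j k] False zero[OF in_r[OF p], of k s] p \<delta> by (cases "k \<in> S") (auto simp: v_def)
      then show ?thesis by simp
    qed
    have zeq: "apply_bcontfun z t = v - integral {0..t} (\<lambda>s. Y j (?y p s) +
       (\<Sum>k\<in>UNIV. p $ k *\<^sub>R frechet_derivative (Y k) (at (?y p s)) (apply_bcontfun z s)))"
      if "t \<in> {0..1}" for t
      using dy[of p t v] that p \<delta> by (simp add: z_def GY[OF p] sv)
    have dzh: "(zh has_vector_derivative - (Y j (?y p t) + A t)) (at t within {0..1})" if t: "t \<in> {0..1}" for t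
    proof -
      let ?D = "\<lambda>k. frechet_derivative (Y k) (at (?y p t))"
      have d: "Y k differentiable at (?y p t)" for k using smooth_on_differentiable[OF smooth in_r[OF p]] .
      have l: "linear (?D k)" for k by (rule linear_frechet_derivative[OF d])
      have "((\<lambda>t. 1 - t) has_real_derivative -1) (at t within {0..1})"
        by (auto intro!: derivative_eq_intros)
      from has_vector_derivative_scaleR[OF this dYy[OF p t d[of j]]]
      have "(zh has_vector_derivative (1 - t) *\<^sub>R ?D j (- (\<Sum>k\<in>UNIV. p $ k *\<^sub>R Y k (?y p t)))
          + (-1) *\<^sub>R Y j (?y p t)) (at t within {0..1})"
        unfolding zh_def .
      \<comment> \<open>The derivative of \<open>Y j\<close> along the velocity is traded by
        \<open>invol\<close> for the derivatives of the \<open>Y k\<close> in the direction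
        \<open>Y j\<close>, which is the form occurring in the variational equation.\<close>
      moreover have "?D j (\<Sum>k\<in>UNIV. p $ k *\<^sub>R Y k (?y p t)) = (\<Sum>k\<in>UNIV. p $ k *\<^sub>R ?D k (Y j (?y p t)))"
        by (simp add: linear_sum[OF l] linear_cmul[OF l] invol[OF in_r[OF p]])
      moreover have "A t = (1 - t) *\<^sub>R (\<Sum>k\<in>UNIV. p $ k *\<^sub>R ?D k (Y j (?y p t)))"
        by (simp add: A_def zh_def linear_cmul[OF l] scaleR_sum_right mult_ac)
      ultimately show ?thesis by (simp add: linear_neg[OF l] minus_diff_commute)
    qed
    have czh: "continuous_on {0..1} zh"
      by (rule continuous_on_vector_derivative[OF dzh])
    have contD: "continuous_on {0..1} (\<lambda>s. frechet_derivative (Y k) (at (?y p s)) (u s))"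
      if "continuous_on {0..1} u" for u k
    proof -
      have "frechet_derivative (Y k) (at (?y p s)) (u s) =
          (\<Sum>b\<in>Basis. (u s \<bullet> b) *\<^sub>R frechet_derivative (Y k) (at (?y p s)) b)" for s
        by (rule frechet_derivative_basis_sum[OF smooth_on_differentiable[OF smooth in_r[OF p]]])
      moreover have "continuous_on {0..1} (\<lambda>s. \<Sum>b\<in>Basis. (u s \<bullet> b) *\<^sub>R frechet_derivative (Y k) (at (?y p s)) b)"
        by (intro continuous_intros that continuous_on_compose2[OF smooth_on_continuous[OF smooth_on_frechet[OF smooth]]])
          (use in_r[OF p] in auto)
      ultimately show ?thesis by simp
    qed
    have cY: "continuous_on {0..1} (\<lambda>s. Y j (?y p s))"
      by (intro continuous_on_compose2[OF smooth_on_continuous[OF smooth]]) (use in_r[OF p] in auto)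
    have cA: "continuous_on {0..1} A" unfolding A_def by (intro continuous_intros contD czh)
    have zheq: "zh t = v - integral {0..t} (\<lambda>s. Y j (?y p s) + A s)" if t: "t \<in> {0..1}" for t
    proof -
      have "((\<lambda>s. - (Y j (?y p s) + A s)) has_integral (zh t - zh 0)) {0..t}"
      proof (rule fundamental_theorem_of_calculus)
        fix s assume s: "s \<in> {0..t}"
        then show "(zh has_vector_derivative - (Y j (?y p s) + A s)) (at s within {0..t})"
          using dzh[of s] t by (auto intro: has_vector_derivative_within_subset)
      qed (use t in auto)
      from has_integral_neg[OF this] have "((\<lambda>s. Y j (?y p s) + A s) has_integral (zh 0 - zh t)) {0..t}"
        by (simp only: minus_minus minus_diff_eq)
      from integral_unique[OF this] have "integral {0..t} (\<lambda>s. Y j (?y p s) + A s) = zh 0 - zh t" .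
      then show ?thesis by (simp add: zh_def v_def y0[OF p])
    qed
    define d where "d t = apply_bcontfun z t - zh t" for t
    define f where "f t = (\<Sum>k\<in>UNIV. p $ k *\<^sub>R frechet_derivative (Y k) (at (?y p t)) (d t))" for t
    \<comment> \<open>The true variation and the guess satisfy the same linear integral equation, so
      their difference is zero.\<close>
    have "d 1 = 0"
    proof (rule volterra_zero[of d f])
      show cd: "continuous_on {0..1} d" unfolding d_def by (intro continuous_intros czh) simp
      show "continuous_on {0..1} f" unfolding f_def by (intro continuous_intros contD cd)
      show "norm (f t) \<le> 1/2 * norm (d t)" if "t \<in> {0..1}" for t
        using half[of p "?y p t" "d t"] p \<delta> by (simp add: f_def GY[OF p])
      show "d t = - integral {0..t} f" if t: "t \<in> {0..1}" for t
      proof -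
        let ?g = "\<lambda>s. \<Sum>k\<in>UNIV. p $ k *\<^sub>R frechet_derivative (Y k) (at (?y p s)) (apply_bcontfun z s)"
        have cz: "continuous_on {0..1} ?g" by (intro continuous_intros contD) simp
        have fg: "f s = (Y j (?y p s) + ?g s) - (Y j (?y p s) + A s)" for s
        proof -
          have l: "linear (frechet_derivative (Y k) (at (?y p s)))" for k
            by (rule linear_frechet_derivative[OF smooth_on_differentiable[OF smooth in_r[OF p]]])
          show ?thesis by (simp add: f_def d_def A_def linear_diff[OF l] scaleR_diff_right sum_subtractf)
        qed
        have sub: "{0..t} \<subseteq> {0..1}" using t by auto
        have "integral {0..t} f = integral {0..t} (\<lambda>s. Y j (?y p s) + ?g s) - integral {0..t} (\<lambda>s. Y j (?y p s) + A s)"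
          unfolding fg
          by (intro integral_diff integrable_continuous_real continuous_on_subset[OF _ sub] continuous_on_add cY cz cA)
        then show ?thesis using zeq[OF t] zheq[OF t] by (simp add: d_def)
      qed
    qed simp
    then have "apply_bcontfun z 1 = 0" by (simp add: d_def zh_def)
    moreover have H: "(\<Phi> has_derivative (\<lambda>v. apply_bcontfun (frechet_derivative y (at p) v) 1)) (at p)"
      unfolding \<Phi>_def using p \<delta>
      by (intro bounded_linear.has_derivative[OF bounded_linear_apply_bcontfun] smooth_on_has_derivative[OF ysm]) auto
    ultimately show ?thesis by (simp add: z_def v_def flip: frechet_derivative_at[OF H])
  qed
  show thesis
  proof (rule that[of \<delta> C0 \<Phi>])
    show "smooth_on \<Phi> (ball 0 \<delta>)" unfolding \<Phi>_def
      by (rule smooth_on_linear_compose[OF bounded_linear_apply_bcontfun open_ball smooth_on_subset[OF ysm]])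
        (use \<delta> in auto)
    show "norm (\<Phi> x) \<le> C0 * norm x" if "x \<in> ball 0 \<delta>" for x :: "real^'n" using ybnd[of x 1] that \<delta> by (simp add: \<Phi>_def)
    show "frechet_derivative \<Phi> (at x) (Y j x) = 0" if "x \<in> ball 0 \<delta>" for x :: "real^'n" and j using Phi_zero that by simp
  next
    fix x :: "real^'n" and k assume x: "x \<in> ball 0 \<delta>" and k: "k \<notin> S"
    have p: "norm x < \<delta>" using x by simp
    \<comment> \<open>Outside \<open>S\<close> the velocity has the constant component
      \<open>- x $ k\<close>; hence this coordinate decreases linearly from \<open>x $ k\<close> to
      0 at time 1.\<close>
    have H: "((\<lambda>t. ?y x t $ k) has_vector_derivative - x $ k) (at t within {0..1})" if t: "t \<in> {0..1}" for t
    proof -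
      have "(\<Sum>j\<in>UNIV. x $ j *\<^sub>R Y j (?y x t)) $ k = x $ k"
      proof -
        have "x $ j * Y j (?y x t) $ k = (if j = k then x $ k else 0)" for j
          using comp[OF in_r[OF p], of j k t] zero[OF in_r[OF p], of j t] k by (cases "j \<in> S") auto
        then show ?thesis by simp
      qed
      then show ?thesis
        using bounded_linear.has_vector_derivative[OF bounded_linear_vec_nth dyt[OF p t], of k] by simp
    qed
    have "((\<lambda>t::real. - x $ k) has_integral (?y x 1 $ k - ?y x 0 $ k)) {0..1}"
      by (rule fundamental_theorem_of_calculus[OF zero_le_one H])
    then have "?y x 1 $ k - ?y x 0 $ k = - x $ k"
      by (rule has_integral_unique) (use has_integral_const_real[of "- x $ k" 0 1] in simp)
    then show "\<Phi> x $ k = 0" using y0[OF p] by (simp add: \<Phi>_def)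
  next
    fix x :: "real^'n" assume x: "x \<in> ball 0 \<delta>" and k: "\<And>k. k \<notin> S \<Longrightarrow> x $ k = 0"
    have p: "norm x < \<delta>" using x by simp
    have "x $ j *\<^sub>R Y j (?y x s) = 0" for j s
      using zero[OF in_r[OF p], of j s] k[of j] by (cases "j \<in> S") auto
    then have "(\<Sum>j\<in>UNIV. x $ j *\<^sub>R Y j (?y x s)) = 0" for s by (intro sum.neutral) blast
    then show "\<Phi> x = x" using y[of x 1] p \<delta> by (simp add: \<Phi>_def GY[OF p])
  next
    fix q :: "real^'n \<Rightarrow> complex" and e and x :: "real^'n" assume x: "x \<in> ball 0 \<delta>" and e: "C0 * norm x < e"
      and q: "\<And>x. x \<in> ball 0 e \<Longrightarrow> q differentiable (at x)"
        "\<And>x j. x \<in> ball 0 e \<Longrightarrow> j \<notin> S \<Longrightarrow> frechet_derivative q (at x) (Y j x) = 0"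
    have p: "norm x < \<delta>" using x by simp
    have ye: "?y x t \<in> ball 0 e" for t using ybnd[of x t] p \<delta> e by simp
    have H: "((\<lambda>t. q (?y x t)) has_vector_derivative 0) (at t within {0..1})" if t: "t \<in> {0..1}" for t
    proof -
      let ?D = "frechet_derivative q (at (?y x t))"
      have l: "linear ?D" by (rule linear_frechet_derivative[OF q(1)[OF ye]])
      have "?D (Y j (?y x t)) = 0" for j
        using q(2)[OF ye, of j t] zero[OF in_r[OF p], of j t] linear_0[OF l] by (cases "j \<in> S") auto
      then have "?D (- (\<Sum>j\<in>UNIV. x $ j *\<^sub>R Y j (?y x t))) = 0"
        by (simp add: linear_neg[OF l] linear_sum[OF l] linear_cmul[OF l])
      then show ?thesis using dYy[OF p t q(1)[OF ye]] by simp
    qed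
    have "((\<lambda>t::real. 0) has_integral (q (?y x 1) - q (?y x 0))) {0..1}"
      by (rule fundamental_theorem_of_calculus[OF zero_le_one H])
    then have "q (?y x 1) - q (?y x 0) = 0" by simp
    then show "q (\<Phi> x) = q x" using y0[OF p] by (simp add: \<Phi>_def)
  qed (use \<delta> C0 in auto)
qed

section \<open>The Beltrami equation\<close>

no_notation Infinite_Set_Sum.abs_summable_on (infix "abs'_summable'_on" 50)

section \<open>Weighted convolution algebras\<close>

type_synonym freq = "int \<times> int"

text \<open>The shear sending \<open>(p, \<rho>)\<close> to \<open>(p - \<rho>, \<rho>)\<close> is a
  bijection of the index set, so the convolution terms are a rearrangement of the product family,
  whose absolute summability is checked by iterated sums.\<close>

lemma has_sum_convolution:
  fixes f g :: "freq \<Rightarrow> 'b::{real_normed_field, banach}"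
  assumes f: "f abs_summable_on UNIV" and g: "g abs_summable_on UNIV"
  shows "(\<lambda>(p, \<rho>). f (p - \<rho>) * g \<rho>) abs_summable_on UNIV"
    and "((\<lambda>(p, \<rho>). f (p - \<rho>) * g \<rho>) has_sum (infsum f UNIV * infsum g UNIV)) UNIV"
proof -
  have bij: "bij_betw (\<lambda>(p, \<rho>). (p - \<rho>, \<rho>)) (UNIV :: (freq \<times> freq) set) (UNIV \<times> UNIV)"
    by (rule bij_betw_byWitness[where f' = "\<lambda>(\<sigma>, \<rho>). (\<sigma> + \<rho>, \<rho>)"]) auto
  have s: "(\<lambda>(\<sigma>, \<rho>). f \<sigma> * g \<rho>) abs_summable_on UNIV \<times> UNIV"
  proof (rule iffD2[OF Infinite_Sum.abs_summable_on_Sigma_iff], intro conjI ballI)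
    show "(\<lambda>\<rho>. case (\<sigma>, \<rho>) of (\<sigma>, \<rho>) \<Rightarrow> f \<sigma> * g \<rho>) abs_summable_on UNIV" for \<sigma>
      using g by (simp add: norm_mult summable_on_cmult_right)
    have "(\<Sum>\<^sub>\<infinity>\<rho>. norm (case (\<sigma>, \<rho>) of (\<sigma>, \<rho>) \<Rightarrow> f \<sigma> * g \<rho>)) = norm (f \<sigma>) * (\<Sum>\<^sub>\<infinity>\<rho>. norm (g \<rho>))" for \<sigma>
      using g by (simp add: norm_mult infsum_cmult_right)
    then show "(\<lambda>\<sigma>. \<Sum>\<^sub>\<infinity>\<rho>. norm (case (\<sigma>, \<rho>) of (\<sigma>, \<rho>) \<Rightarrow> f \<sigma> * g \<rho>)) abs_summable_on UNIV"
      using f by (simp add: abs_mult infsum_nonneg summable_on_cmult_left)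
  qed
  have "((\<lambda>(\<sigma>, \<rho>). f \<sigma> * g \<rho>) has_sum (infsum f UNIV * infsum g UNIV)) (UNIV \<times> UNIV)"
  proof (rule has_sum_SigmaI)
    show "((\<lambda>\<rho>. case (\<sigma>, \<rho>) of (\<sigma>, \<rho>) \<Rightarrow> f \<sigma> * g \<rho>) has_sum (f \<sigma> * infsum g UNIV)) UNIV" for \<sigma>
      using has_sum_cmult_right[OF has_sum_infsum[OF Infinite_Sum.abs_summable_summable[OF g]]] by simp
    show "((\<lambda>\<sigma>. f \<sigma> * infsum g UNIV) has_sum (infsum f UNIV * infsum g UNIV)) UNIV"
      using has_sum_cmult_left[OF has_sum_infsum[OF Infinite_Sum.abs_summable_summable[OF f]]] .
  qed (rule Infinite_Sum.abs_summable_summable[OF s])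
  then show "((\<lambda>(p, \<rho>). f (p - \<rho>) * g \<rho>) has_sum (infsum f UNIV * infsum g UNIV)) UNIV"
    using has_sum_reindex_bij_betw[OF bij, of "\<lambda>(\<sigma>, \<rho>). f \<sigma> * g \<rho>"] by (simp add: case_prod_unfold)
  show "(\<lambda>(p, \<rho>). f (p - \<rho>) * g \<rho>) abs_summable_on UNIV"
    using s summable_on_reindex_bij_betw[OF bij, of "\<lambda>x. norm (case x of (\<sigma>, \<rho>) \<Rightarrow> f \<sigma> * g \<rho>)"]
    by (simp add: case_prod_unfold)
qed

lemma convolution_inner_abs:
  fixes f g :: "freq \<Rightarrow> 'b::{real_normed_field, banach}"
  assumes f: "f abs_summable_on UNIV" and g: "g abs_summable_on UNIV"
  shows "(\<lambda>\<rho>. f (p - \<rho>) * g \<rho>) abs_summable_on UNIV"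
proof -
  have "(\<lambda>(p, \<rho>). f (p - \<rho>) * g \<rho>) abs_summable_on UNIV \<times> UNIV"
    using has_sum_convolution(1)[OF f g] by simp
  from Infinite_Sum.abs_summable_on_Sigma_iff[THEN iffD1, OF this]
  have "(\<lambda>\<rho>. (\<lambda>(p, \<rho>). f (p - \<rho>) * g \<rho>) (p, \<rho>)) abs_summable_on UNIV" by blast
  then show ?thesis by simp
qed

definition convolution :: "(freq \<Rightarrow> complex) \<Rightarrow> (freq \<Rightarrow> complex) \<Rightarrow> freq \<Rightarrow> complex" where
  "convolution c d p = (\<Sum>\<^sub>\<infinity>\<rho>. c (p - \<rho>) * d \<rho>)"

definition wsummable :: "(freq \<Rightarrow> real) \<Rightarrow> (freq \<Rightarrow> complex) \<Rightarrow> bool" where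
  "wsummable w c \<longleftrightarrow> (\<lambda>p. w p * norm (c p)) summable_on UNIV"

definition wnorm :: "(freq \<Rightarrow> real) \<Rightarrow> (freq \<Rightarrow> complex) \<Rightarrow> real" where
  "wnorm w c = (\<Sum>\<^sub>\<infinity>p. w p * norm (c p))"

text \<open>Beurling weights: the product inequality makes the weighted summable families an algebra
  under convolution, and the lower bound 1 embeds it in the unweighted one.\<close>

definition submultiplicative :: "(freq \<Rightarrow> real) \<Rightarrow> bool" where
  "submultiplicative w \<longleftrightarrow> (\<forall>p. w p \<ge> 1) \<and> (\<forall>p \<rho>. w (p + \<rho>) \<le> w p * w \<rho>)"

lemma submultiplicative_pos: "submultiplicative w \<Longrightarrow> w p > 0" "submultiplicative w \<Longrightarrow> w p \<ge> 0"
  unfolding submultiplicative_def by (meson less_le_trans zero_less_one, meson order_trans zero_le_one)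

lemma submultiplicative_one: "submultiplicative (\<lambda>_. 1)"
  by (simp add: submultiplicative_def)

lemma wsummable_mono:
  assumes "wsummable w c" "\<And>p. 0 \<le> w' p * norm (c' p)" "\<And>p. w' p * norm (c' p) \<le> C * (w p * norm (c p))"
  shows "wsummable w' c'"
  unfolding wsummable_def
  by (rule summable_on_comparison_test[OF summable_on_cmult_right[OF assms(1)[unfolded wsummable_def]] assms(3,2)])

lemma wsummable_abs:
  assumes "submultiplicative w" "wsummable w c"
  shows "c abs_summable_on UNIV"
proof -
  have "wsummable (\<lambda>_. 1) c"
  proof (rule wsummable_mono[OF assms(2), where C = 1])
    fix p show "1 * norm (c p) \<le> 1 * (w p * norm (c p))"
    proof -
      have "1 \<le> w p" using assms(1) unfolding submultiplicative_def by blast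
      then show ?thesis using mult_right_mono[of 1 "w p" "norm (c p)"] by simp
    qed
  qed simp
  then show ?thesis by (simp add: wsummable_def)
qed

lemma wnorm_nonneg: "submultiplicative w \<Longrightarrow> wnorm w c \<ge> 0"
  unfolding wnorm_def by (intro infsum_nonneg mult_nonneg_nonneg) (auto simp: submultiplicative_pos)

text \<open>Since \<open>w p \<le> w (p - \<rho>) * w \<rho>\<close>, each factor of the convolution
  can carry its own weight, and the estimate reduces to the product of two absolutely convergent
  sums.\<close>

lemma convolution_wnorm:
  assumes w: "submultiplicative w" and c: "wsummable w c" and d: "wsummable w d"
  shows "wsummable w (convolution c d)" "wnorm w (convolution c d) \<le> wnorm w c * wnorm w d"
proof -
  let ?c = "\<lambda>p. w p * norm (c p)" and ?d = "\<lambda>p. w p * norm (d p)"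
  have cd: "?c abs_summable_on UNIV" "?d abs_summable_on UNIV"
    using c d submultiplicative_pos[OF w] by (simp_all add: wsummable_def abs_mult abs_of_pos)
  note S = has_sum_convolution[OF cd]
  have "((\<lambda>(p, \<rho>). ?c (p - \<rho>) * ?d \<rho>) has_sum (wnorm w c * wnorm w d)) (UNIV \<times> UNIV)"
    using S(2) by (simp add: wnorm_def)
  note S' = has_sum_imp_summable[OF this] infsumI[OF this]
  have s2: "(\<lambda>p. \<Sum>\<^sub>\<infinity>\<rho>. ?c (p - \<rho>) * ?d \<rho>) summable_on UNIV"
    by (rule summable_on_Sigma_banach[OF S'(1)])
  have i2: "(\<Sum>\<^sub>\<infinity>p. \<Sum>\<^sub>\<infinity>\<rho>. ?c (p - \<rho>) * ?d \<rho>) = wnorm w c * wnorm w d"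
    using infsum_Sigma'_banach[OF S'(1)] S'(2) by simp
  have ab: "(\<lambda>\<rho>. c (p - \<rho>) * d \<rho>) abs_summable_on UNIV" for p
    by (rule convolution_inner_abs[OF wsummable_abs[OF w c] wsummable_abs[OF w d]])
  have inner: "(\<lambda>\<rho>. ?c (p - \<rho>) * ?d \<rho>) summable_on UNIV" for p
    using summable_on_SigmaD1[OF S'(1), of p] by simp
  have le: "w p * norm (convolution c d p) \<le> (\<Sum>\<^sub>\<infinity>\<rho>. ?c (p - \<rho>) * ?d \<rho>)" for p
  proof -
    have "w p * norm (convolution c d p) \<le> w p * (\<Sum>\<^sub>\<infinity>\<rho>. norm (c (p - \<rho>) * d \<rho>))"
      unfolding convolution_def by (intro mult_left_mono norm_infsum_bound ab submultiplicative_pos[OF w])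
    also have "\<dots> = (\<Sum>\<^sub>\<infinity>\<rho>. w p * norm (c (p - \<rho>) * d \<rho>))"
      using ab by (intro infsum_cmult_right[symmetric])
    also have "\<dots> \<le> (\<Sum>\<^sub>\<infinity>\<rho>. ?c (p - \<rho>) * ?d \<rho>)"
    proof (rule infsum_mono)
      fix \<rho>
      have "w p \<le> w (p - \<rho>) * w \<rho>" using w unfolding submultiplicative_def by (metis diff_add_cancel)
      then have "w p * (norm (c (p - \<rho>)) * norm (d \<rho>)) \<le> (w (p - \<rho>) * w \<rho>) * (norm (c (p - \<rho>)) * norm (d \<rho>))"
        by (intro mult_right_mono) auto
      then show "w p * norm (c (p - \<rho>) * d \<rho>) \<le> ?c (p - \<rho>) * ?d \<rho>" by (simp add: norm_mult mult_ac)
    qed (rule summable_on_cmult_right[OF ab], rule inner)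
    finally show ?thesis .
  qed
  show s: "wsummable w (convolution c d)" unfolding wsummable_def
    by (rule summable_on_comparison_test[OF s2 le]) (use submultiplicative_pos[OF w] in auto)
  show "wnorm w (convolution c d) \<le> wnorm w c * wnorm w d"
    unfolding i2[symmetric] unfolding wnorm_def
    by (rule infsum_mono[OF s[unfolded wsummable_def] s2 le])
qed

section \<open>Trigonometric series with rapidly decreasing coefficients\<close>

definition char :: "freq \<Rightarrow> complex \<Rightarrow> complex" where
  "char p y = cis (of_int (fst p) * Re y + of_int (snd p) * Im y)"

lemma norm_char [simp]: "norm (char p y) = 1"
  by (simp add: char_def)

lemma char_add: "char (p + \<rho>) y = char p y * char \<rho> y"
  by (simp add: char_def cis_mult algebra_simps)

definition trig :: "(freq \<Rightarrow> complex) \<Rightarrow> complex \<Rightarrow> complex" where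
  "trig c y = (\<Sum>\<^sub>\<infinity>p. c p * char p y)"

lemma trig_abs: "c abs_summable_on UNIV \<Longrightarrow> (\<lambda>p. c p * char p y) abs_summable_on UNIV"
  by (simp add: norm_mult)

lemma trig_summable: "c abs_summable_on UNIV \<Longrightarrow> (\<lambda>p. c p * char p y) summable_on UNIV"
  by (rule Infinite_Sum.abs_summable_summable[OF trig_abs])

lemma norm_trig_le: "c abs_summable_on UNIV \<Longrightarrow> norm (trig c y) \<le> wnorm (\<lambda>_. 1) c"
  unfolding trig_def wnorm_def using norm_infsum_bound[OF trig_abs[of c y]] by (simp add: norm_mult)

lemma trig_convolution:
  assumes c: "c abs_summable_on UNIV" and d: "d abs_summable_on UNIV"
  shows "trig (convolution c d) y = trig c y * trig d y"
proof -
  let ?f = "\<lambda>(p, \<rho>). (c (p - \<rho>) * char (p - \<rho>) y) * (d \<rho> * char \<rho> y)"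
  note S = has_sum_convolution[OF trig_abs[OF c, of y] trig_abs[OF d, of y]]
  have ab: "(\<lambda>\<rho>. c (p - \<rho>) * d \<rho>) summable_on UNIV" for p
    by (rule Infinite_Sum.abs_summable_summable[OF convolution_inner_abs[OF c d]])
  have "(\<Sum>\<^sub>\<infinity>\<rho>. ?f (p, \<rho>)) = convolution c d p * char p y" for p
  proof -
    have "c (p - \<rho>) * char (p - \<rho>) y * (d \<rho> * char \<rho> y) = (c (p - \<rho>) * d \<rho>) * char p y" for \<rho>
    proof -
      have "char p y = char (p - \<rho>) y * char \<rho> y" using char_add[of "p - \<rho>" \<rho> y] by simp
      then show ?thesis by simp
    qed
    then show ?thesis unfolding convolution_def
      using infsum_cmult_left[of "char p y" "\<lambda>\<rho>. c (p - \<rho>) * d \<rho>" UNIV] ab[of p] by (simp only: prod.case)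
  qed
  moreover have "(\<Sum>\<^sub>\<infinity>p. \<Sum>\<^sub>\<infinity>\<rho>. ?f (p, \<rho>)) = infsum ?f (UNIV \<times> UNIV)"
    by (rule infsum_Sigma_banach) (use Infinite_Sum.abs_summable_summable[OF S(1)] in simp)
  ultimately show ?thesis using infsumI[OF S(2)] by (simp add: trig_def)
qed

lemma norm_cis_minus_1: "norm (cis \<theta> - 1) \<le> \<bar>\<theta>\<bar>"
proof -
  have "norm (cis \<theta> - cis 0) \<le> 1 * norm (\<theta> - 0)"
    by (rule differentiable_bound[of UNIV cis "\<lambda>\<theta> t. t *\<^sub>R (\<i> * cis \<theta>)"])
      (auto intro!: derivative_eq_intros onorm_le simp: norm_mult)
  then show ?thesis by simp
qed

lemma norm_cis_minus_linear: "norm (cis \<theta> - 1 - \<i> * \<theta>) \<le> \<theta>\<^sup>2"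
proof -
  let ?f = "\<lambda>t. cis t - 1 - \<i> * complex_of_real t"
  have "norm (?f \<theta> - ?f 0) \<le> \<bar>\<theta>\<bar> * norm (\<theta> - 0)"
  proof (rule differentiable_bound[of "cball 0 \<bar>\<theta>\<bar>" ?f "\<lambda>t s. s *\<^sub>R (\<i> * (cis t - 1))"])
    fix t :: real assume t: "t \<in> cball 0 \<bar>\<theta>\<bar>"
    show "(?f has_derivative (\<lambda>s. s *\<^sub>R (\<i> * (cis t - 1)))) (at t within cball 0 \<bar>\<theta>\<bar>)"
      by (auto intro!: derivative_eq_intros simp: scaleR_conv_of_real algebra_simps)
    have "norm (cis t - 1) \<le> \<bar>\<theta>\<bar>" using norm_cis_minus_1[of t] t by simp
    then show "onorm (\<lambda>s. s *\<^sub>R (\<i> * (cis t - 1))) \<le> \<bar>\<theta>\<bar>"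
      by (intro onorm_le) (simp add: norm_mult mult.commute[of "\<bar>\<theta>\<bar>"] mult_left_mono)
  qed auto
  then show ?thesis by (simp add: power2_eq_square)
qed

definition freq_weight :: "freq \<Rightarrow> real" where
  "freq_weight p = 1 + \<bar>of_int (fst p)\<bar> + \<bar>of_int (snd p)\<bar>"

text \<open>One differentiation multiplies the coefficients by at most a constant times
  \<open>freq_weight\<close>; requiring all powers makes the class stable under termwise
  differentiation.\<close>

definition rapid :: "(freq \<Rightarrow> complex) \<Rightarrow> bool" where
  "rapid c \<longleftrightarrow> (\<forall>s. wsummable (\<lambda>p. freq_weight p ^ s) c)"

lemma freq_weight_ge_1: "freq_weight p \<ge> 1"
  by (simp add: freq_weight_def)

lemma rapid_multiplier:
  assumes "rapid c" "\<And>p. norm (m p) \<le> C * freq_weight p"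
  shows "rapid (\<lambda>p. m p * c p)"
  unfolding rapid_def
proof
  fix s
  have "wsummable (\<lambda>p. freq_weight p ^ Suc s) c" using assms(1) unfolding rapid_def by blast
  then show "wsummable (\<lambda>p. freq_weight p ^ s) (\<lambda>p. m p * c p)"
  proof (rule wsummable_mono[where C = C])
    fix p
    have "freq_weight p \<ge> 0" using freq_weight_ge_1[of p] by linarith
    then show "0 \<le> freq_weight p ^ s * norm (m p * c p)" by simp
    have "norm (m p) * (freq_weight p ^ s * norm (c p)) \<le> (C * freq_weight p) * (freq_weight p ^ s * norm (c p))"
      using \<open>freq_weight p \<ge> 0\<close> by (intro mult_right_mono assms(2)) auto
    then show "freq_weight p ^ s * norm (m p * c p) \<le> C * (freq_weight p ^ Suc s * norm (c p))"
      by (simp add: norm_mult mult_ac)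
  qed
qed

lemma rapid_abs: "rapid c \<Longrightarrow> c abs_summable_on UNIV"
  unfolding rapid_def wsummable_def by (drule spec[of _ 0]) simp

lemma freq_weight_dot: "\<bar>of_int (fst p) * Re v + of_int (snd p) * Im v\<bar> \<le> freq_weight p * norm v"
proof -
  have "\<bar>of_int (fst p) * Re v + of_int (snd p) * Im v\<bar> \<le>
      \<bar>of_int (fst p)\<bar> * norm v + \<bar>of_int (snd p)\<bar> * norm v"
    by (rule order_trans[OF abs_triangle_ineq])
      (auto simp: abs_mult intro!: add_mono mult_left_mono abs_Re_le_cmod abs_Im_le_cmod)
  also have "\<dots> \<le> freq_weight p * norm v" by (simp add: freq_weight_def algebra_simps)
  finally show ?thesis .
qed

lemma has_sum_diff:
  fixes f g :: "'a \<Rightarrow> 'b::real_normed_vector"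
  shows "(f has_sum a) A \<Longrightarrow> (g has_sum b) A \<Longrightarrow> ((\<lambda>x. f x - g x) has_sum (a - b)) A"
  unfolding has_sum_def sum_subtractf by (rule tendsto_diff)

text \<open>The Taylor remainder of each character is at most \<open>freq_weight p ^ 2\<close> times
  the square of the increment, and this factor is summable against rapid coefficients. The increment
  can therefore be taken out of the sum.\<close>

lemma trig_has_derivative:
  assumes c: "rapid c"
  shows "(trig c has_derivative
    (\<lambda>v. trig (\<lambda>p. \<i> * of_real (of_int (fst p) * Re v + of_int (snd p) * Im v) * c p) y)) (at y)"
proof -
  let ?d = "\<lambda>p v. of_int (fst p) * Re v + of_int (snd p) * Im v :: real"
  let ?D = "\<lambda>v. trig (\<lambda>p. \<i> * of_real (?d p v) * c p) y"
  have rd: "rapid (\<lambda>p. \<i> * of_real (?d p v) * c p)" for v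
    by (rule rapid_multiplier[OF c, where C = "norm v"])
      (unfold norm_mult norm_of_real norm_ii, use freq_weight_dot in \<open>simp add: mult.commute\<close>)
  note sm = trig_summable
  have wc: "wsummable (\<lambda>p. freq_weight p ^ 2) c" using c unfolding rapid_def by blast
  have bl: "bounded_linear ?D"
  proof (rule bounded_linear_intro)
    show "?D (v + w) = ?D v + ?D w" for v w
      unfolding trig_def by (subst infsum_add[OF sm[OF rapid_abs[OF rd]] sm[OF rapid_abs[OF rd]], symmetric]) (simp add: algebra_simps)
    show "?D (r *\<^sub>R v) = r *\<^sub>R ?D v" for r v
    proof -
      have "?D (r *\<^sub>R v) = (\<Sum>\<^sub>\<infinity>p. of_real r * (\<i> * of_real (?d p v) * c p * char p y))"
        unfolding trig_def by (simp add: algebra_simps)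
      also have "\<dots> = of_real r * ?D v"
        unfolding trig_def by (rule infsum_cmult_right) (use sm[OF rapid_abs[OF rd]] in blast)
      finally show ?thesis by (simp add: scaleR_conv_of_real)
    qed
    show "norm (?D v) \<le> norm v * (\<Sum>\<^sub>\<infinity>p. freq_weight p * norm (c p))" for v
    proof -
      have w1: "(\<lambda>p. freq_weight p * norm (c p)) summable_on UNIV"
        using c unfolding rapid_def wsummable_def by (drule_tac spec[of _ 1]) simp
      have "norm (?D v) \<le> (\<Sum>\<^sub>\<infinity>p. norm (\<i> * of_real (?d p v) * c p * char p y))"
        unfolding trig_def by (rule norm_infsum_bound[OF trig_abs[OF rapid_abs[OF rd]]])
      also have "\<dots> \<le> (\<Sum>\<^sub>\<infinity>p. norm v * (freq_weight p * norm (c p)))"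
      proof (rule infsum_mono)
        fix p
        show "norm (\<i> * of_real (?d p v) * c p * char p y) \<le> norm v * (freq_weight p * norm (c p))"
          using mult_right_mono[OF freq_weight_dot, of "norm (c p)" p v]
          unfolding norm_mult norm_of_real by (simp add: mult_ac)
      qed (use trig_abs[OF rapid_abs[OF rd]] w1 in \<open>auto intro: summable_on_cmult_right\<close>)
      also have "\<dots> = norm v * (\<Sum>\<^sub>\<infinity>p. freq_weight p * norm (c p))"
        by (rule infsum_cmult_right) (use w1 in blast)
      finally show ?thesis .
    qed
  qed
  show ?thesis
  proof (rule has_derivative_quadratic[OF bl, where d = 1])
    fix y'
    let ?h = "y' - y"
    let ?t = "\<lambda>p. c p * char p y' - c p * char p y - \<i> * of_real (?d p ?h) * c p * char p y"
    have le: "norm (?t p) \<le> (norm ?h)\<^sup>2 * (freq_weight p ^ 2 * norm (c p))" for p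
    proof -
      have "char p y' = char p y * cis (?d p ?h)" by (simp add: char_def cis_mult algebra_simps)
      then have "?t p = c p * char p y * (cis (?d p ?h) - 1 - \<i> * of_real (?d p ?h))" by (simp add: algebra_simps)
      then have "norm (?t p) \<le> norm (c p) * (?d p ?h)\<^sup>2"
        using norm_cis_minus_linear[of "?d p ?h"] by (simp add: norm_mult mult_left_mono)
      also have "\<dots> \<le> norm (c p) * (freq_weight p * norm ?h)\<^sup>2"
        using power_mono[OF freq_weight_dot abs_ge_zero, of p ?h 2] by (intro mult_left_mono) auto
      finally show ?thesis by (simp add: power_mult_distrib mult_ac)
    qed
    have s2: "(\<lambda>p. (norm ?h)\<^sup>2 * (freq_weight p ^ 2 * norm (c p))) summable_on UNIV"
      using wc unfolding wsummable_def by (rule summable_on_cmult_right)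
    have ab: "?t abs_summable_on UNIV"
      by (rule summable_on_comparison_test[OF s2 le]) auto
    have "trig c y' - trig c y - ?D ?h = (\<Sum>\<^sub>\<infinity>p. ?t p)"
    proof -
      have "(?t has_sum (trig c y' - trig c y - ?D ?h)) UNIV"
        unfolding trig_def
        by (intro has_sum_diff has_sum_infsum sm[OF rapid_abs[OF c]] sm[OF rapid_abs[OF rd]])
      then show ?thesis by (simp add: infsumI)
    qed
    then have "norm (trig c y' - trig c y - ?D ?h) \<le> (\<Sum>\<^sub>\<infinity>p. norm (?t p))" using norm_infsum_bound[OF ab] by simp
    also have "\<dots> \<le> (\<Sum>\<^sub>\<infinity>p. (norm ?h)\<^sup>2 * (freq_weight p ^ 2 * norm (c p)))"
      by (rule infsum_mono[OF ab s2 le])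
    also have "\<dots> = (norm ?h)\<^sup>2 * wnorm (\<lambda>p. freq_weight p ^ 2) c"
      unfolding wnorm_def by (rule infsum_cmult_right) (use wc in \<open>simp add: wsummable_def\<close>)
    finally show "norm (trig c y' - trig c y - ?D ?h) \<le> wnorm (\<lambda>p. freq_weight p ^ 2) c * (norm ?h)\<^sup>2"
      by (simp add: mult.commute)
  qed simp
qed

lemma smooth_on_trig: "rapid c \<Longrightarrow> smooth_on (trig c) UNIV"
proof -
  have "rapid c \<Longrightarrow> Ck_on k (trig c) UNIV" for k
  proof (induction k arbitrary: c)
    case 0
    then show ?case
      using has_derivative_continuous[OF trig_has_derivative] by (auto intro!: continuous_at_imp_continuous_on)
  next
    case (Suc k)
    have "rapid (\<lambda>p. \<i> * of_real (of_int (fst p) * Re v + of_int (snd p) * Im v) * c p)" for v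
      by (rule rapid_multiplier[OF Suc.prems, where C = "norm v"])
        (unfold norm_mult norm_of_real norm_ii, use freq_weight_dot in \<open>simp add: mult.commute\<close>)
    then show ?case by (intro Ck_on_SucI[OF open_UNIV trig_has_derivative[OF Suc.prems]] Suc.IH)
  qed
  then show "rapid c \<Longrightarrow> ?thesis" by (simp add: smooth_on_def)
qed

section \<open>Neumann series of a small perturbation\<close>

lemma wnorm_multiplier:
  assumes c: "wsummable w c" and w: "submultiplicative w" and s: "\<And>p. norm (s p) \<le> C"
  shows "wsummable w (\<lambda>p. s p * c p)" "wnorm w (\<lambda>p. s p * c p) \<le> C * wnorm w c"
proof -
  have le: "w p * norm (s p * c p) \<le> C * (w p * norm (c p))" for p
    using mult_right_mono[OF s, of "w p * norm (c p)" p] submultiplicative_pos(2)[OF w, of p]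
    by (simp add: norm_mult mult_ac)
  show 1: "wsummable w (\<lambda>p. s p * c p)"
    by (rule wsummable_mono[OF c _ le]) (simp add: submultiplicative_pos(2)[OF w])
  have "wnorm w (\<lambda>p. s p * c p) \<le> (\<Sum>\<^sub>\<infinity>p. C * (w p * norm (c p)))"
    unfolding wnorm_def
    by (rule infsum_mono[OF 1[unfolded wsummable_def] summable_on_cmult_right[OF c[unfolded wsummable_def]] le])
  also have "\<dots> = C * wnorm w c"
    unfolding wnorm_def by (rule infsum_cmult_right) (use c in \<open>simp add: wsummable_def\<close>)
  finally show "wnorm w (\<lambda>p. s p * c p) \<le> C * wnorm w c" .
qed

text \<open>Coefficients of the iterates of \<nu> under the map "apply the Fourier multiplier
  \<open>s\<close>, then multiply by \<nu>"; on the coefficient side multiplication is convolution.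
  Their sum is the Neumann series.\<close>

primrec neumann :: "(freq \<Rightarrow> complex) \<Rightarrow> (freq \<Rightarrow> complex) \<Rightarrow> nat \<Rightarrow> freq \<Rightarrow> complex" where
  "neumann \<nu> s 0 = \<nu>"
| "neumann \<nu> s (Suc n) = convolution \<nu> (\<lambda>p. s p * neumann \<nu> s n p)"

definition neumann_sum :: "(freq \<Rightarrow> complex) \<Rightarrow> (freq \<Rightarrow> complex) \<Rightarrow> freq \<Rightarrow> complex" where
  "neumann_sum \<nu> s p = (\<Sum>\<^sub>\<infinity>n. neumann \<nu> s n p)"

lemma neumann_wnorm:
  assumes \<nu>: "wsummable w \<nu>" and w: "submultiplicative w" and s: "\<And>p. norm (s p) \<le> C"
  shows "wsummable w (neumann \<nu> s n) \<and> wnorm w (neumann \<nu> s n) \<le> wnorm w \<nu> * (C * wnorm w \<nu>) ^ n"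
proof (induction n)
  case 0
  show ?case using \<nu> by simp
next
  case (Suc n)
  note m = wnorm_multiplier[OF conjunct1[OF Suc] w s]
  have C: "C \<ge> 0" using s[of 0] norm_ge_zero order_trans by blast
  have "wnorm w (neumann \<nu> s (Suc n)) \<le> wnorm w \<nu> * wnorm w (\<lambda>p. s p * neumann \<nu> s n p)"
    using convolution_wnorm(2)[OF w \<nu> m(1)] by simp
  also have "\<dots> \<le> wnorm w \<nu> * (C * (wnorm w \<nu> * (C * wnorm w \<nu>) ^ n))"
    using Suc C by (intro mult_left_mono order_trans[OF m(2)] wnorm_nonneg w) auto
  finally show ?case using convolution_wnorm(1)[OF w \<nu> m(1)] by (simp add: mult_ac)
qed

lemma geometric_summable_on:
  assumes "0 \<le> q" "q < (1::real)"
  shows "(\<lambda>n::nat. B * q ^ n) summable_on UNIV" "(\<Sum>\<^sub>\<infinity>n::nat. B * q ^ n) = B / (1 - q)"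
proof -
  have "(\<lambda>n. q ^ n) sums (1 / (1 - q))" using geometric_sums[of q] assms by simp
  moreover have "summable (\<lambda>n. norm (q ^ n))" using assms by (simp add: summable_geometric)
  ultimately have "((\<lambda>n. q ^ n) has_sum (1 / (1 - q))) UNIV" by (intro norm_summable_imp_has_sum)
  then have "((\<lambda>n. B * q ^ n) has_sum (B * (1 / (1 - q)))) UNIV" by (rule has_sum_cmult_right)
  then show "(\<lambda>n::nat. B * q ^ n) summable_on UNIV" "(\<Sum>\<^sub>\<infinity>n::nat. B * q ^ n) = B / (1 - q)"
    using infsumI has_sum_imp_summable by fastforce+
qed

context
  fixes \<nu> s :: "freq \<Rightarrow> complex" and C :: real and w :: "freq \<Rightarrow> real"
  assumes \<nu>: "wsummable w \<nu>" and w: "submultiplicative w" and s: "\<And>p. norm (s p) \<le> C"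
    and q: "C * wnorm w \<nu> < 1"
begin

lemma C_nonneg: "C \<ge> 0" using s[of 0] norm_ge_zero order_trans by blast

lemma q_nonneg: "C * wnorm w \<nu> \<ge> 0" using C_nonneg wnorm_nonneg[OF w] by simp

lemma neumann_double_summable:
  "(\<lambda>(n, p). w p * norm (neumann \<nu> s n p)) summable_on (UNIV \<times> UNIV)"
proof (rule summable_on_SigmaI)
  note N = neumann_wnorm[OF \<nu> w s]
  show "((\<lambda>p. case (n, p) of (n, p) \<Rightarrow> w p * norm (neumann \<nu> s n p)) has_sum wnorm w (neumann \<nu> s n)) UNIV" for n
    using N[where n = n] by (simp add: wnorm_def wsummable_def)
  show "(\<lambda>n. wnorm w (neumann \<nu> s n)) summable_on UNIV"
    by (rule summable_on_comparison_test[OF geometric_summable_on(1)[OF q_nonneg q, of "wnorm w \<nu>"]])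
      (use N wnorm_nonneg[OF w] in auto)
qed (use submultiplicative_pos(2)[OF w] in auto)

lemma neumann_pointwise_abs: "(\<lambda>n. neumann \<nu> s n p) abs_summable_on UNIV"
proof -
  have "(\<lambda>(p, n). w p * norm (neumann \<nu> s n p)) summable_on (UNIV \<times> UNIV)"
    using neumann_double_summable summable_on_swap[of "\<lambda>(n, p). w p * norm (neumann \<nu> s n p)" UNIV UNIV]
    by (simp add: case_prod_unfold)
  from summable_on_SigmaD1[OF this, of p]
  have "(\<lambda>n. w p * norm (neumann \<nu> s n p)) summable_on UNIV" by simp
  then have "(\<lambda>n. inverse (w p) * (w p * norm (neumann \<nu> s n p))) summable_on UNIV"
    by (rule summable_on_cmult_right)
  then show ?thesis using submultiplicative_pos(1)[OF w, of p] by (simp flip: mult.assoc)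
qed

lemma neumann_sum_wsummable: "wsummable w (neumann_sum \<nu> s)"
  unfolding wsummable_def
proof (rule summable_on_comparison_test)
  have sw: "(\<lambda>(p, n). w p * norm (neumann \<nu> s n p)) summable_on (UNIV \<times> UNIV)"
    using neumann_double_summable summable_on_swap[of "\<lambda>(n, p). w p * norm (neumann \<nu> s n p)" UNIV UNIV]
    by (simp add: case_prod_unfold)
  from summable_on_Sigma_banach[OF sw]
  show "(\<lambda>p. \<Sum>\<^sub>\<infinity>n. w p * norm (neumann \<nu> s n p)) summable_on UNIV" .
  fix p
  have "w p * norm (neumann_sum \<nu> s p) \<le> w p * (\<Sum>\<^sub>\<infinity>n. norm (neumann \<nu> s n p))"
    unfolding neumann_sum_def
    by (intro mult_left_mono norm_infsum_bound neumann_pointwise_abs submultiplicative_pos(2)[OF w])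
  also have "\<dots> = (\<Sum>\<^sub>\<infinity>n. w p * norm (neumann \<nu> s n p))"
    using neumann_pointwise_abs by (intro infsum_cmult_right[symmetric])
  finally show "w p * norm (neumann_sum \<nu> s p) \<le> (\<Sum>\<^sub>\<infinity>n. w p * norm (neumann \<nu> s n p))" .
qed (use submultiplicative_pos(2)[OF w] in auto)

text \<open>The sums over iterations and over frequencies are exchanged for an arbitrary bounded
  family \<open>b\<close>. The applications take for \<open>b\<close> a character and
  \<open>s\<close> times a character.\<close>

lemma neumann_exchange:
  assumes b: "\<And>p. norm (b p) \<le> K"
  shows "(\<Sum>\<^sub>\<infinity>p. neumann_sum \<nu> s p * b p) = (\<Sum>\<^sub>\<infinity>n. \<Sum>\<^sub>\<infinity>p. neumann \<nu> s n p * b p)"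
    and "(\<lambda>n. \<Sum>\<^sub>\<infinity>p. neumann \<nu> s n p * b p) summable_on UNIV"
proof -
  have K: "K \<ge> 0" using b[of 0] norm_ge_zero order_trans by blast
  have "(\<lambda>(n, p). neumann \<nu> s n p * b p) abs_summable_on UNIV \<times> UNIV"
  proof (rule summable_on_comparison_test[OF summable_on_cmult_right[OF neumann_double_summable, of K]])
    fix x :: "nat \<times> freq"
    obtain n p where x: "x = (n, p)" by (cases x)
    have "1 \<le> w p" using w unfolding submultiplicative_def by blast
    then have "norm (neumann \<nu> s n p) * norm (b p) \<le> (w p * norm (neumann \<nu> s n p)) * K"
      using mult_right_mono[of 1 "w p" "norm (neumann \<nu> s n p)"] by (intro mult_mono b) auto
    then show "norm (case x of (n, p) \<Rightarrow> neumann \<nu> s n p * b p) \<le> K * (case x of (n, p) \<Rightarrow> w p * norm (neumann \<nu> s n p))"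
      by (simp add: x norm_mult mult_ac)
  qed auto
  then have S: "(\<lambda>(n, p). neumann \<nu> s n p * b p) summable_on UNIV \<times> UNIV"
    by (rule Infinite_Sum.abs_summable_summable)
  have "(\<Sum>\<^sub>\<infinity>p. neumann_sum \<nu> s p * b p) = (\<Sum>\<^sub>\<infinity>p. \<Sum>\<^sub>\<infinity>n. neumann \<nu> s n p * b p)"
    unfolding neumann_sum_def
    using Infinite_Sum.abs_summable_summable[OF neumann_pointwise_abs] by (intro infsum_cong infsum_cmult_left[symmetric])
  then show "(\<Sum>\<^sub>\<infinity>p. neumann_sum \<nu> s p * b p) = (\<Sum>\<^sub>\<infinity>n. \<Sum>\<^sub>\<infinity>p. neumann \<nu> s n p * b p)"
    using infsum_swap_banach[OF S] by simp
  show "(\<lambda>n. \<Sum>\<^sub>\<infinity>p. neumann \<nu> s n p * b p) summable_on UNIV"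
    by (rule summable_on_Sigma_banach[OF S])
qed

text \<open>Applying the multiplier and multiplying by \<nu> shifts the index of the series by one,
  so the series reproduces itself up to its first term \<nu>.\<close>

lemma neumann_sum_equation:
  "trig (neumann_sum \<nu> s) y = trig \<nu> y * (1 + trig (\<lambda>p. s p * neumann_sum \<nu> s p) y)"
proof -
  note N = neumann_wnorm[OF \<nu> w s]
  let ?b = "\<lambda>p. s p * char p y"
  have b: "norm (?b p) \<le> C" for p using s by (simp add: norm_mult)
  have eq1: "trig (neumann_sum \<nu> s) y = (\<Sum>\<^sub>\<infinity>n. trig (neumann \<nu> s n) y)"
    and s1: "(\<lambda>n. trig (neumann \<nu> s n) y) summable_on UNIV"
    using neumann_exchange[of "\<lambda>p. char p y" 1] by (simp_all add: trig_def)
  have eq2: "trig (\<lambda>p. s p * neumann_sum \<nu> s p) y = (\<Sum>\<^sub>\<infinity>n. trig (\<lambda>p. s p * neumann \<nu> s n p) y)"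
    and s2: "(\<lambda>n. trig (\<lambda>p. s p * neumann \<nu> s n p) y) summable_on UNIV"
    using neumann_exchange[of ?b C, OF b] by (simp_all add: trig_def mult_ac)
  have step: "trig (neumann \<nu> s (Suc n)) y = trig \<nu> y * trig (\<lambda>p. s p * neumann \<nu> s n p) y" for n
    using trig_convolution[OF wsummable_abs[OF w \<nu>] wsummable_abs[OF w wnorm_multiplier(1)[OF conjunct1[OF N] w s]]]
    by simp
  have A: "(\<lambda>n. trig (neumann \<nu> s n) y) sums trig (neumann_sum \<nu> s) y"
    using has_sum_imp_sums[OF has_sum_infsum[OF s1]] eq1 by simp
  have "(\<lambda>n. trig \<nu> y * trig (\<lambda>p. s p * neumann \<nu> s n p) y) sums (trig \<nu> y * trig (\<lambda>p. s p * neumann_sum \<nu> s p) y)"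
    using sums_mult[OF has_sum_imp_sums[OF has_sum_infsum[OF s2]]] eq2 by simp
  then have "(\<lambda>n. trig (neumann \<nu> s (Suc n)) y) sums (trig \<nu> y * trig (\<lambda>p. s p * neumann_sum \<nu> s p) y)"
    by (simp only: step)
  then have "(\<lambda>n. trig (neumann \<nu> s n) y) sums (trig \<nu> y * trig (\<lambda>p. s p * neumann_sum \<nu> s p) y + trig (neumann \<nu> s 0) y)"
    by (subst (asm) sums_Suc_iff) simp
  then have "trig (neumann_sum \<nu> s) y = trig \<nu> y * trig (\<lambda>p. s p * neumann_sum \<nu> s p) y + trig \<nu> y"
    using A sums_unique2 by fastforce
  then show ?thesis by (simp add: algebra_simps)
qed

text \<open>The bound is the geometric series without its leading 1. It is stated for the value
  after the multiplier, since that is the quantity to be kept away from -1.\<close>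

lemma neumann_sum_small:
  "norm (trig (\<lambda>p. s p * neumann_sum \<nu> s p) y) \<le> C * wnorm w \<nu> / (1 - C * wnorm w \<nu>)"
proof -
  note N = neumann_wnorm[OF \<nu> w s]
  let ?b = "\<lambda>p. s p * char p y"
  have b: "norm (?b p) \<le> C" for p using s by (simp add: norm_mult)
  have eq2: "trig (\<lambda>p. s p * neumann_sum \<nu> s p) y = (\<Sum>\<^sub>\<infinity>n. trig (\<lambda>p. s p * neumann \<nu> s n p) y)"
    using neumann_exchange[of ?b C, OF b] by (simp_all add: trig_def mult_ac)
  have le: "norm (trig (\<lambda>p. s p * neumann \<nu> s n p) y) \<le> (C * wnorm w \<nu>) * (C * wnorm w \<nu>) ^ n" for n
  proof -
    note m = wnorm_multiplier[OF conjunct1[OF N[where n = n]] w s]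
    have "norm (trig (\<lambda>p. s p * neumann \<nu> s n p) y) \<le> wnorm (\<lambda>_. 1) (\<lambda>p. s p * neumann \<nu> s n p)"
      by (rule norm_trig_le[OF wsummable_abs[OF w m(1)]])
    also have "\<dots> \<le> wnorm w (\<lambda>p. s p * neumann \<nu> s n p)"
      unfolding wnorm_def
    proof (rule infsum_mono)
      fix p
      have "1 \<le> w p" using w unfolding submultiplicative_def by blast
      then show "1 * norm (s p * neumann \<nu> s n p) \<le> w p * norm (s p * neumann \<nu> s n p)"
        by (rule mult_right_mono) simp
    qed (use m(1) wsummable_abs[OF w m(1)] in \<open>simp_all add: wsummable_def\<close>)
    also have "\<dots> \<le> C * wnorm w (neumann \<nu> s n)" by (rule m(2))
    also have "\<dots> \<le> C * (wnorm w \<nu> * (C * wnorm w \<nu>) ^ n)" using N C_nonneg by (intro mult_left_mono) auto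
    finally show ?thesis by (simp add: mult_ac)
  qed
  note g = geometric_summable_on[OF q_nonneg q, of "C * wnorm w \<nu>"]
  have ab: "(\<lambda>n. trig (\<lambda>p. s p * neumann \<nu> s n p) y) abs_summable_on UNIV"
    by (rule summable_on_comparison_test[OF g(1) le]) auto
  have "norm (trig (\<lambda>p. s p * neumann_sum \<nu> s p) y) \<le> (\<Sum>\<^sub>\<infinity>n. norm (trig (\<lambda>p. s p * neumann \<nu> s n p) y))"
    unfolding eq2 by (rule norm_infsum_bound[OF ab])
  also have "\<dots> \<le> (\<Sum>\<^sub>\<infinity>n. (C * wnorm w \<nu>) * (C * wnorm w \<nu>) ^ n)" by (rule infsum_mono[OF ab g(1) le])
  finally show ?thesis using g(2) by simp
qed

end

text \<open>Rescaling the weights lets the smallness of \<open>\<nu>\<close> in the unweighted norm suffice for every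
  polynomial weight.\<close>

definition slow_weight :: "real \<Rightarrow> nat \<Rightarrow> freq \<Rightarrow> real" where
  "slow_weight e s p = (1 + e * (freq_weight p - 1)) ^ s"

lemma submultiplicative_slow_weight:
  assumes "e \<ge> 0"
  shows "submultiplicative (slow_weight e s)"
  unfolding submultiplicative_def
proof (intro conjI allI)
  have x: "freq_weight p - 1 \<ge> 0" for p using freq_weight_ge_1[of p] by simp
  show "1 \<le> slow_weight e s p" for p
    unfolding slow_weight_def using x[of p] assms by (intro one_le_power) simp
  fix p \<rho> :: freq
  have "freq_weight (p + \<rho>) - 1 \<le> (freq_weight p - 1) + (freq_weight \<rho> - 1)"
    by (simp add: freq_weight_def)
  then have "e * (freq_weight (p + \<rho>) - 1) \<le> e * ((freq_weight p - 1) + (freq_weight \<rho> - 1))"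
    using assms by (rule mult_left_mono)
  moreover have "0 \<le> (e * (freq_weight p - 1)) * (e * (freq_weight \<rho> - 1))"
    using x assms by (intro mult_nonneg_nonneg) auto
  ultimately have "1 + e * (freq_weight (p + \<rho>) - 1) \<le> (1 + e * (freq_weight p - 1)) * (1 + e * (freq_weight \<rho> - 1))"
    by (simp add: algebra_simps)
  then show "slow_weight e s (p + \<rho>) \<le> slow_weight e s p * slow_weight e s \<rho>"
    unfolding slow_weight_def power_mult_distrib[symmetric]
    using x assms by (intro power_mono) (auto intro!: add_nonneg_nonneg)
qed

text \<open>Convexity in \<open>e\<close>: a power of an affine function lies below its chord
  between \<open>e = 0\<close> and \<open>e = 1\<close>. The chord inequality is proved by induction
  on the exponent.\<close>

lemma slow_weight_le:
  assumes "0 \<le> e" "e \<le> 1"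
  shows "slow_weight e s p \<le> 1 + e * freq_weight p ^ s"
proof -
  have x: "x \<ge> 0 \<Longrightarrow> (1 + e * x) ^ s \<le> 1 + e * ((1 + x) ^ s - 1)" for x :: real
  proof (induction s)
    case (Suc s)
    have P: "(1 + x) ^ s \<ge> 1" using Suc.prems by (intro one_le_power) simp
    have "(1 + e * x) ^ Suc s \<le> (1 + e * x) * (1 + e * ((1 + x) ^ s - 1))"
      using Suc assms by (simp add: mult_left_mono)
    also have "\<dots> = 1 + e * x + e * ((1 + x) ^ s - 1) + e * e * (x * ((1 + x) ^ s - 1))"
      by (simp add: algebra_simps)
    also have "\<dots> \<le> 1 + e * x + e * ((1 + x) ^ s - 1) + e * 1 * (x * ((1 + x) ^ s - 1))"
      using assms P Suc.prems by (intro add_left_mono mult_right_mono mult_left_mono) auto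
    also have "\<dots> = 1 + e * ((1 + x) ^ Suc s - 1)" by (simp add: algebra_simps)
    finally show ?case .
  qed simp
  show ?thesis using x[of "freq_weight p - 1"] freq_weight_ge_1[of p] assms
    by (simp add: slow_weight_def algebra_simps)
qed

lemma neumann_sum_rapid:
  assumes \<nu>: "rapid \<nu>" and s: "\<And>p. norm (s p) \<le> C" and q: "C * wnorm (\<lambda>_. 1) \<nu> < 1"
  shows "rapid (neumann_sum \<nu> s)"
  unfolding rapid_def
proof
  fix m
  have C: "C \<ge> 0" using s[of 0] norm_ge_zero order_trans by blast
  let ?M = "wnorm (\<lambda>p. freq_weight p ^ m) \<nu>"
  have M: "?M \<ge> 0" unfolding wnorm_def using freq_weight_ge_1
    by (intro infsum_nonneg mult_nonneg_nonneg zero_le_power) (auto intro: order_trans[OF zero_le_one])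
  \<comment> \<open>At most half of the gap \<open>1 - C * wnorm (\<lambda>_. 1) \<nu>\<close> is
    spent on the additional term \<open>e * (C * ?M)\<close> of the weighted norm.\<close>
  define e where "e = min 1 ((1 - C * wnorm (\<lambda>_. 1) \<nu>) / (2 * (C * ?M + 1)))"
  have pos: "C * ?M + 1 > 0" using C M by (simp add: add_nonneg_pos)
  have e: "e > 0" "e \<le> 1" using q pos by (auto simp: e_def)
  have "e * (C * ?M) \<le> (1 - C * wnorm (\<lambda>_. 1) \<nu>) / (2 * (C * ?M + 1)) * (C * ?M + 1)"
    using C M e(1) by (intro mult_mono) (auto simp: e_def)
  also have "\<dots> = (1 - C * wnorm (\<lambda>_. 1) \<nu>) / 2" using pos by (simp add: field_simps)
  finally have eM: "e * (C * ?M) < 1 - C * wnorm (\<lambda>_. 1) \<nu>" using q by simp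
  have \<nu>m: "(\<lambda>p. freq_weight p ^ m * norm (\<nu> p)) summable_on UNIV" "(\<lambda>p. 1 * norm (\<nu> p)) summable_on UNIV"
    using \<nu> rapid_abs[OF \<nu>] by (auto simp: rapid_def wsummable_def)
  have le: "slow_weight e m p * norm (\<nu> p) \<le> 1 * norm (\<nu> p) + e * (freq_weight p ^ m * norm (\<nu> p))" for p
    using mult_right_mono[OF slow_weight_le, of e "norm (\<nu> p)" m p] e by (simp add: algebra_simps)
  have w: "submultiplicative (slow_weight e m)" using e by (intro submultiplicative_slow_weight) simp
  note sm = summable_on_add[OF \<nu>m(2) summable_on_cmult_right[OF \<nu>m(1), of e]]
  have ws: "wsummable (slow_weight e m) \<nu>" unfolding wsummable_def
    by (rule summable_on_comparison_test[OF sm le]) (simp add: submultiplicative_pos(2)[OF w])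
  have "wnorm (slow_weight e m) \<nu> \<le> (\<Sum>\<^sub>\<infinity>p. 1 * norm (\<nu> p) + e * (freq_weight p ^ m * norm (\<nu> p)))"
    unfolding wnorm_def by (rule infsum_mono[OF ws[unfolded wsummable_def] sm le])
  also have "\<dots> = wnorm (\<lambda>_. 1) \<nu> + e * ?M"
    unfolding wnorm_def using \<nu>m by (subst infsum_add) (auto intro: summable_on_cmult_right simp: infsum_cmult_right)
  finally have "C * wnorm (slow_weight e m) \<nu> \<le> C * (wnorm (\<lambda>_. 1) \<nu> + e * ?M)" using C by (rule mult_left_mono)
  also have "\<dots> < 1" using eM by (simp add: algebra_simps)
  finally have "wsummable (slow_weight e m) (neumann_sum \<nu> s)" by (rule neumann_sum_wsummable[OF ws w s])
  then show "wsummable (\<lambda>p. freq_weight p ^ m) (neumann_sum \<nu> s)"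
  proof (rule wsummable_mono[where C = "inverse e ^ m"])
    fix p
    have f1: "freq_weight p \<ge> 1" by (rule freq_weight_ge_1)
    then show "0 \<le> freq_weight p ^ m * norm (neumann_sum \<nu> s p)" by simp
    have "freq_weight p \<le> inverse e * (1 + e * (freq_weight p - 1))"
      using e f1 by (simp add: field_simps)
    then have *: "freq_weight p ^ m \<le> inverse e ^ m * slow_weight e m p"
      unfolding slow_weight_def power_mult_distrib[symmetric] using f1 by (intro power_mono) auto
    show "freq_weight p ^ m * norm (neumann_sum \<nu> s p) \<le> inverse e ^ m * (slow_weight e m p * norm (neumann_sum \<nu> s p))"
      using mult_right_mono[OF *, of "norm (neumann_sum \<nu> s p)"] by (simp add: mult.assoc)
  qed
qed

section \<open>The Beltrami equation on the torus\<close>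

lemma trig_delta: "trig (\<lambda>p. if p = 0 then a else 0) y = a"
proof -
  have "trig (\<lambda>p. if p = 0 then a else 0) y = (\<Sum>\<^sub>\<infinity>p\<in>{0}. a * char p y)"
    unfolding trig_def by (rule infsum_cong_neutral) auto
  then show ?thesis by (simp add: char_def)
qed

lemma trig_add:
  assumes "c abs_summable_on UNIV" "d abs_summable_on UNIV"
  shows "trig (\<lambda>p. c p + d p) y = trig c y + trig d y"
  unfolding trig_def using infsum_add[OF trig_summable[OF assms(1)] trig_summable[OF assms(2)]]
  by (simp add: algebra_simps)

lemma trig_cmult:
  assumes "c abs_summable_on UNIV"
  shows "trig (\<lambda>p. a * c p) y = a * trig c y"
  unfolding trig_def using infsum_cmult_right[of a, OF trig_summable[OF assms]] by (simp add: mult.assoc)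

text \<open>The equation \<open>\<partial>\<^sub>2 z = (m + \<nu>) \<partial>\<^sub>1 z\<close> becomes \<open>h = \<nu> (1 + S h)\<close> for \<open>h = \<partial>\<^sub>2 z - m \<partial>\<^sub>1 z\<close>, where the
  Fourier multiplier \<open>S = \<partial>\<^sub>1 (\<partial>\<^sub>2 - m \<partial>\<^sub>1)\<inverse>\<close> is bounded by \<open>1 / \<bar>Im m\<bar>\<close>.\<close>

lemma periodic_beltrami:
  assumes \<nu>: "rapid \<nu>" and m: "Im m \<noteq> 0" and small: "wnorm (\<lambda>_. 1) \<nu> \<le> \<bar>Im m\<bar> / 3"
  obtains z where "smooth_on z UNIV"
    "\<And>y. frechet_derivative z (at y) \<i> = (m + trig \<nu> y) * frechet_derivative z (at y) 1"
    "\<And>y. frechet_derivative z (at y) 1 \<noteq> 0"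
proof -
  define C where "C = 1 / \<bar>Im m\<bar>"
  have C: "C > 0" using m by (simp add: C_def)
  \<comment> \<open>Up to the factor \<open>\<i>\<close> this is the symbol of the operator
    \<partial>_2 - m \<partial>_1. Its imaginary part is \<open>- Im m * fst p\<close>, so it
    vanishes only at the frequency 0 and its inverse stays bounded on the others.\<close>
  define D where "D p = of_int (snd p) - m * of_int (fst p)" for p :: freq
  define s where "s p = of_int (fst p) / D p" for p
  have Dk: "\<bar>Im m\<bar> * \<bar>of_int (fst p)\<bar> \<le> norm (D p)" for p
    using abs_Im_le_cmod[of "D p"] by (simp add: D_def abs_mult)
  have D0: "D p \<noteq> 0 \<and> norm (1 / D p) \<le> 1 + C" if "p \<noteq> 0" for p
  proof (cases "fst p = 0")
    case True
    then have "snd p \<noteq> 0" using that by (simp add: prod_eq_iff)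
    then have "norm (D p) \<ge> 1" using True by (simp add: D_def)
    then show ?thesis using C mult_mono[of 1 "1 + C" 1 "norm (D p)"] by (auto simp: norm_divide divide_le_eq)
  next
    case False
    then have "\<bar>of_int (fst p) :: real\<bar> \<ge> 1" by linarith
    then have "\<bar>Im m\<bar> \<le> norm (D p)" using Dk[of p] mult_left_mono[of 1 "\<bar>of_int (fst p) :: real\<bar>" "\<bar>Im m\<bar>"] by simp
    then have "D p \<noteq> 0" "norm (1 / D p) \<le> C" using m by (auto simp: norm_divide C_def frac_le)
    then show ?thesis by simp
  qed
  have s: "norm (s p) \<le> C" for p
  proof (cases "D p = 0")
    case False
    have "\<bar>of_int (fst p)\<bar> \<le> C * norm (D p)" using Dk[of p] m by (simp add: C_def field_simps)
    then show ?thesis using False by (simp add: s_def norm_divide divide_le_eq)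
  qed (use C in \<open>simp add: s_def\<close>)
  \<comment> \<open>The factor 3 in \<open>small\<close> is chosen for this: the Neumann bound
    becomes (1/3) / (1 - 1/3) = 1/2, and \<open>1 + S h\<close>, which will be \<partial>_1 z, has
    no zero.\<close>
  have q: "C * wnorm (\<lambda>_. 1) \<nu> \<le> 1/3" using mult_left_mono[OF small, of C] C m by (simp add: C_def)
  then have q1: "C * wnorm (\<lambda>_. 1) \<nu> < 1" by simp
  have w\<nu>: "wsummable (\<lambda>_. 1) \<nu>" using rapid_abs[OF \<nu>] by (simp add: wsummable_def)
  define h where "h = neumann_sum \<nu> s"
  have h: "rapid h" unfolding h_def by (rule neumann_sum_rapid[OF \<nu> s q1])
  have eq: "trig h y = trig \<nu> y * (1 + trig (\<lambda>p. s p * h p) y)" for y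
    unfolding h_def by (rule neumann_sum_equation[OF w\<nu> submultiplicative_one s q1])
  have sml: "norm (trig (\<lambda>p. s p * h p) y) \<le> 1/2" for y
  proof -
    let ?q = "C * wnorm (\<lambda>_. 1) \<nu>"
    have "norm (trig (\<lambda>p. s p * h p) y) \<le> ?q / (1 - ?q)"
      unfolding h_def by (rule neumann_sum_small[OF w\<nu> submultiplicative_one s q1])
    also have "\<dots> \<le> 1/2" using q by (simp add: divide_le_eq)
    finally show ?thesis .
  qed
  \<comment> \<open>The inverse symbol. The frequency 0 is left out, since a constant is not the
    image of a periodic function.\<close>
  define mu where "mu p = (if p = 0 then 0 else 1 / (\<i> * D p))" for p
  define v where "v p = mu p * h p" for p
  have v: "rapid v" unfolding v_def
  proof (rule rapid_multiplier[OF h])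
    fix p
    have "norm (mu p) \<le> 1 + C" using D0[of p] C by (simp add: mu_def norm_divide norm_mult)
    also have "\<dots> \<le> (1 + C) * freq_weight p" using C freq_weight_ge_1[of p] by simp
    finally show "norm (mu p) \<le> (1 + C) * freq_weight p" .
  qed
  \<comment> \<open>The linear part takes care of the frequency 0: the operator \<partial>_2 - m
    \<partial>_1 sends it to the constant \<open>h 0\<close>, while \<open>v\<close> produces all
    other frequencies of \<open>h\<close>. Its derivative in direction 1 is the summand 1 of
    \<open>1 + S h\<close>.\<close>
  define z where "z y = of_real (Re y) + (m + h 0) * of_real (Im y) + trig v y" for y
  define d where "d u y = of_real (Re u) + (m + h 0) * of_real (Im u) +
     trig (\<lambda>p. \<i> * of_real (of_int (fst p) * Re u + of_int (snd p) * Im u) * v p) y" for u y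
  have dz: "(z has_derivative (\<lambda>u. d u y)) (at y)" for y
    unfolding z_def d_def
    by (intro has_derivative_add trig_has_derivative[OF v] bounded_linear_imp_has_derivative
        bounded_linear_const_mult[OF bounded_linear_compose[OF bounded_linear_of_real bounded_linear_Im]]
        bounded_linear_compose[OF bounded_linear_of_real bounded_linear_Re])
  have fz: "frechet_derivative z (at y) u = d u y" for y u
    using frechet_derivative_at[OF dz[of y]] by metis
  have d1: "d 1 y = 1 + trig (\<lambda>p. s p * h p) y" for y
  proof -
    have "\<i> * of_int (fst p) * v p = s p * h p" for p
    proof (cases "p = 0")
      case False
      then show ?thesis using D0[OF False] by (simp add: v_def mu_def s_def)
    qed (simp add: v_def mu_def s_def)
    then show ?thesis by (simp add: d_def)
  qed
  have di: "d \<i> y - m * d 1 y = trig h y" for y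
  proof -
    have r: "rapid (\<lambda>p. (\<i> * of_int (snd p)) * v p)" "rapid (\<lambda>p. (\<i> * of_int (fst p)) * v p)"
      by (rule rapid_multiplier[OF v, where C = 1]; simp add: norm_mult freq_weight_def)+
    let ?h = "\<lambda>p. if p = 0 then 0 else h p"
    have "\<i> * of_int (snd p) * v p + (- m) * (\<i> * of_int (fst p) * v p) = ?h p" for p
    proof (cases "p = 0")
      case False
      have "\<i> * of_int (snd p) * v p + (- m) * (\<i> * of_int (fst p) * v p) = \<i> * D p * v p"
        by (simp add: D_def algebra_simps)
      then show ?thesis using D0[OF False] False by (simp add: v_def mu_def)
    qed (simp add: v_def mu_def)
    then have "trig ?h y = trig (\<lambda>p. \<i> * of_int (snd p) * v p) y + (- m) * trig (\<lambda>p. \<i> * of_int (fst p) * v p) y"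
      using trig_add[OF rapid_abs[OF r(1)] rapid_abs[OF rapid_multiplier[OF r(2), of "\<lambda>_. - m" "norm m"]], of y]
        trig_cmult[OF rapid_abs[OF r(2)], of "- m" y] freq_weight_ge_1 mult_left_mono[OF freq_weight_ge_1, of "norm m"]
      by simp
    moreover have "trig h y = h 0 + trig ?h y"
    proof -
      have h': "?h abs_summable_on UNIV"
        by (rule summable_on_comparison_test[OF rapid_abs[OF h]]) auto
      have d': "(\<lambda>p::freq. if p = 0 then h 0 else 0) abs_summable_on UNIV"
        by (rule summable_on_comparison_test[OF rapid_abs[OF h]]) auto
      have "h = (\<lambda>p. (if p = 0 then h 0 else 0) + ?h p)" by auto
      then show ?thesis using trig_add[OF d' h', of y] trig_delta[of "h 0" y] by simp
    qed
    ultimately show ?thesis by (simp add: d_def algebra_simps)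
  qed
  show thesis
  proof (rule that[of z])
    have "smooth_on (\<lambda>y. of_real (Re y) + (m + h 0) * of_real (Im y) + trig v y) UNIV"
      by (intro smooth_intros smooth_on_trig v open_UNIV smooth_on_linear bounded_linear_Re bounded_linear_Im)
    then show "smooth_on z UNIV" by (simp add: z_def[abs_def])
    show "frechet_derivative z (at y) \<i> = (m + trig \<nu> y) * frechet_derivative z (at y) 1" for y
      using di[of y] eq[of y] d1[of y] by (simp add: fz algebra_simps)
    show "frechet_derivative z (at y) 1 \<noteq> 0" for y
    proof
      assume "frechet_derivative z (at y) 1 = 0"
      then have "trig (\<lambda>p. s p * h p) y = -1" using d1[of y] by (simp add: fz add_eq_0_iff)
      then show False using sml[of y] by simp
    qed
  qed
qed

section \<open>Fourier series in one variable\<close>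

definition fourier_coeff :: "(real \<Rightarrow> complex) \<Rightarrow> int \<Rightarrow> complex" where
  "fourier_coeff f k = integral {-pi..pi} (\<lambda>t. f t * cis (- of_int k * t)) / (2 * pi)"

lemma cis_int_pi: "cis (of_int k * pi) = cis (- (of_int k * pi))"
  by (simp add: complex_eq_iff mult.commute)

lemma cis_continuous: "continuous_on S f \<Longrightarrow> continuous_on S (\<lambda>t. cis (f t))"
  by (intro continuous_intros)

lemma has_integral_cis:
  "((\<lambda>t. cis (of_int k * t)) has_integral (if k = 0 then 2 * pi else 0)) {-pi..pi}"
proof (cases "k = 0")
  case True
  then show ?thesis using has_integral_const_real[of "1::complex" "-pi" pi] by (simp add: scaleR_conv_of_real)
next
  case False
  have "((\<lambda>t. cis (of_int k * t) / (\<i> * of_int k)) has_vector_derivative cis (of_int k * t)) (at t within {-pi..pi})" for t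
    unfolding has_vector_derivative_def using False
    by (auto intro!: derivative_eq_intros simp: scaleR_conv_of_real field_simps)
  then have "((\<lambda>t. cis (of_int k * t)) has_integral
      (cis (of_int k * pi) / (\<i> * of_int k) - cis (of_int k * -pi) / (\<i> * of_int k))) {-pi..pi}"
    by (intro fundamental_theorem_of_calculus) auto
  then show ?thesis using False cis_int_pi[of k] by simp
qed

lemma fourier_coeff_has_integral:
  assumes "continuous_on {-pi..pi} f"
  shows "((\<lambda>t. f t * cis (- of_int k * t)) has_integral (2 * pi * fourier_coeff f k)) {-pi..pi}"
proof -
  have "(\<lambda>t. f t * cis (- of_int k * t)) integrable_on {-pi..pi}"
    by (intro integrable_continuous_real continuous_intros cis_continuous assms)
  then show ?thesis unfolding fourier_coeff_def by (simp add: has_integral_integral)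
qed

text \<open>The integral of \<open>(norm (g t - S t))\<^sup>2\<close> is nonnegative for the partial
  sum \<open>S\<close> over \<open>K\<close>; by orthogonality of the characters both the mixed
  terms and the square of \<open>S\<close> integrate to \<open>P\<close>.\<close>

lemma bessel_inequality:
  assumes g: "continuous_on {-pi..pi} g" and K: "finite K"
  shows "(\<Sum>k\<in>K. (norm (fourier_coeff g k))\<^sup>2) \<le> integral {-pi..pi} (\<lambda>t. (norm (g t))\<^sup>2) / (2 * pi)"
proof -
  define c where "c = fourier_coeff g"
  define S where "S t = (\<Sum>k\<in>K. c k * cis (of_int k * t))" for t
  define P where "P = (\<Sum>k\<in>K. 2 * pi * (norm (c k))\<^sup>2)"
  have A: "((\<lambda>t. g t * cnj (S t)) has_integral of_real P) {-pi..pi}"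
  proof -
    have "((\<lambda>t. \<Sum>k\<in>K. cnj (c k) * (g t * cis (- of_int k * t))) has_integral
        (\<Sum>k\<in>K. cnj (c k) * (2 * pi * c k))) {-pi..pi}"
      unfolding c_def by (intro has_integral_sum K has_integral_mult_right fourier_coeff_has_integral g)
    moreover have "(\<Sum>k\<in>K. cnj (c k) * (2 * pi * c k)) = of_real P"
      by (simp add: P_def complex_norm_square mult_ac del: of_real_power)
    ultimately show ?thesis by (simp add: S_def sum_distrib_left cis_cnj mult_ac)
  qed
  have B: "((\<lambda>t. S t * cnj (S t)) has_integral of_real P) {-pi..pi}"
  proof -
    have "((\<lambda>t. \<Sum>k\<in>K. \<Sum>j\<in>K. (c k * cnj (c j)) * cis (of_int (k - j) * t)) has_integral
        (\<Sum>k\<in>K. \<Sum>j\<in>K. (c k * cnj (c j)) * (if k - j = 0 then 2 * pi else 0))) {-pi..pi}"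
      by (intro has_integral_sum K has_integral_mult_right has_integral_cis)
    moreover have "(\<Sum>k\<in>K. \<Sum>j\<in>K. (c k * cnj (c j)) * (if k - j = 0 then 2 * pi else 0)) = of_real P"
    proof -
      have "(\<Sum>j\<in>K. (c k * cnj (c j)) * (if k - j = 0 then 2 * pi else 0)) = of_real (2 * pi * (norm (c k))\<^sup>2)" if "k \<in> K" for k
      proof -
        have "(\<Sum>j\<in>K. (c k * cnj (c j)) * (if k - j = 0 then 2 * pi else 0)) = (\<Sum>j\<in>K. if j = k then c k * cnj (c k) * (2 * pi) else 0)"
          by (intro sum.cong) auto
        then show ?thesis using K that by (simp add: complex_norm_square mult_ac del: of_real_power)
      qed
      then show ?thesis by (simp add: P_def)
    qed
    moreover have "(\<Sum>k\<in>K. \<Sum>j\<in>K. (c k * cnj (c j)) * cis (of_int (k - j) * t)) = S t * cnj (S t)" for t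
    proof -
      have "cis (of_int (k - j) * t) = cis (of_int k * t) * cis (- (of_int j * t))" for k j
        by (simp add: cis_mult algebra_simps)
      then show ?thesis by (simp add: S_def sum_product cis_cnj mult_ac)
    qed
    ultimately show ?thesis by simp
  qed
  let ?G = "\<lambda>t. complex_of_real ((norm (g t))\<^sup>2)"
  have G: "(?G has_integral of_real (integral {-pi..pi} (\<lambda>t. (norm (g t))\<^sup>2))) {-pi..pi}"
    by (rule has_integral_of_real) (intro integrable_integral integrable_continuous_real continuous_intros g)
  have cA: "((\<lambda>t. cnj (g t * cnj (S t))) has_integral of_real P) {-pi..pi}"
    using has_integral_linear[OF A bounded_linear_cnj] by (simp add: o_def)
  have "((\<lambda>t. ?G t - g t * cnj (S t) - cnj (g t * cnj (S t)) + S t * cnj (S t)) has_integral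
     (of_real (integral {-pi..pi} (\<lambda>t. (norm (g t))\<^sup>2)) - of_real P - of_real P + of_real P)) {-pi..pi}"
    by (intro has_integral_add has_integral_diff G A B cA)
  moreover have "?G t - g t * cnj (S t) - cnj (g t * cnj (S t)) + S t * cnj (S t) = of_real ((norm (g t - S t))\<^sup>2)" for t
    by (simp add: complex_norm_square algebra_simps del: of_real_power)
  ultimately have "((\<lambda>t. complex_of_real ((norm (g t - S t))\<^sup>2)) has_integral
      of_real (integral {-pi..pi} (\<lambda>t. (norm (g t))\<^sup>2) - P)) {-pi..pi}" by simp
  from has_integral_linear[OF this bounded_linear_Re]
  have "((\<lambda>t. (norm (g t - S t))\<^sup>2) has_integral (integral {-pi..pi} (\<lambda>t. (norm (g t))\<^sup>2) - P)) {-pi..pi}"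
    by (simp add: o_def del: of_real_diff of_real_power)
  then have "0 \<le> integral {-pi..pi} (\<lambda>t. (norm (g t))\<^sup>2) - P" by (rule has_integral_nonneg) simp
  then show ?thesis by (simp add: P_def c_def field_simps sum_distrib_left)
qed

text \<open>The Riemann-Lebesgue lemma, from summability of the squares in
  \<open>bessel_inequality\<close>. An injective sequence of frequencies counts each square once;
  the applications run to the two ends of the integers.\<close>

lemma fourier_coeff_tendsto_0:
  assumes g: "continuous_on {-pi..pi} g" and inj: "inj (p :: nat \<Rightarrow> int)"
  shows "(\<lambda>n. fourier_coeff g (p n)) \<longlonglongrightarrow> 0"
proof -
  have "summable (\<lambda>n. (norm (fourier_coeff g (p n)))\<^sup>2)"
  proof (rule summableI_nonneg_bounded)
    fix n
    have "(\<Sum>i<n. (norm (fourier_coeff g (p i)))\<^sup>2) = (\<Sum>k\<in>p ` {..<n}. (norm (fourier_coeff g k))\<^sup>2)"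
      using inj by (subst sum.reindex) (auto intro: inj_on_subset)
    also have "\<dots> \<le> integral {-pi..pi} (\<lambda>t. (norm (g t))\<^sup>2) / (2 * pi)" by (rule bessel_inequality[OF g]) simp
    finally show "(\<Sum>i<n. (norm (fourier_coeff g (p i)))\<^sup>2) \<le> integral {-pi..pi} (\<lambda>t. (norm (g t))\<^sup>2) / (2 * pi)" .
  qed simp
  then have "(\<lambda>n. (norm (fourier_coeff g (p n)))\<^sup>2) \<longlonglongrightarrow> 0" by (rule summable_LIMSEQ_zero)
  then have "(\<lambda>n. sqrt ((norm (fourier_coeff g (p n)))\<^sup>2)) \<longlonglongrightarrow> sqrt 0" by (rule tendsto_real_sqrt)
  then show ?thesis by (simp add: tendsto_norm_zero_iff)
qed

lemma cis_eq_1_small: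
  assumes "\<bar>t\<bar> < 2 * pi" "cis t = 1"
  shows "t = 0"
proof -
  have "cos t = 1" using arg_cong[OF assms(2), of Re] by simp
  then obtain n :: int where n: "t = of_int n * 2 * pi" using cos_one_2pi_int by blast
  then have "\<bar>of_int n :: real\<bar> * (2 * pi) < 1 * (2 * pi)" using assms(1) by (simp add: abs_mult)
  then have "\<bar>of_int n :: real\<bar> < 1" by (rule mult_right_less_imp_less) simp
  then show ?thesis using n by simp
qed

lemma has_vector_derivative_quotient:
  fixes f :: "real \<Rightarrow> complex"
  shows "(f has_vector_derivative f') (at x) \<longleftrightarrow> ((\<lambda>t. (f t - f x) / of_real (t - x)) \<longlongrightarrow> f') (at x)"
proof -
  have "((\<lambda>t. (f t - f x) / of_real (t - x)) \<longlongrightarrow> f') (at x) \<longleftrightarrow> ((\<lambda>t. norm ((f t - f x) / of_real (t - x) - f')) \<longlongrightarrow> 0) (at x)"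
    by (simp only: tendsto_norm_zero_iff LIM_zero_iff)
  also have "\<dots> \<longleftrightarrow> ((\<lambda>t. norm (f t - f x - (t - x) *\<^sub>R f') / norm (t - x)) \<longlongrightarrow> 0) (at x)"
  proof (rule tendsto_cong)
    show "\<forall>\<^sub>F t in at x. norm ((f t - f x) / of_real (t - x) - f') = norm (f t - f x - (t - x) *\<^sub>R f') / norm (t - x)"
      unfolding eventually_at
    proof (intro exI[of _ 1] conjI ballI impI)
      fix t assume "t \<noteq> x \<and> dist t x < 1"
      then have "(f t - f x) / of_real (t - x) - f' = (f t - f x - (t - x) *\<^sub>R f') / of_real (t - x)"
        by (simp add: scaleR_conv_of_real diff_divide_distrib)
      then show "norm ((f t - f x) / of_real (t - x) - f') = norm (f t - f x - (t - x) *\<^sub>R f') / norm (t - x)"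
        by (simp add: norm_divide flip: of_real_diff)
    qed simp
  qed
  also have "\<dots> \<longleftrightarrow> (f has_vector_derivative f') (at x)"
    unfolding has_vector_derivative_def has_derivative_iff_norm by (simp add: bounded_linear_scaleR_left)
  finally show ?thesis by simp
qed

text \<open>Dividing \<open>f - f x\<^sub>0\<close> by \<open>cis (t - x\<^sub>0) - 1\<close> turns the partial sums of the Fourier series into telescoping
  sums.\<close>

lemma fourier_inversion:
  assumes f: "continuous_on {-pi..pi} f" and x: "-pi < x" "x < pi"
    and d: "(f has_vector_derivative f') (at x)"
    and s: "fourier_coeff f abs_summable_on UNIV"
  shows "f x = (\<Sum>\<^sub>\<infinity>k. fourier_coeff f k * cis (of_int k * x))"
proof -
  \<comment> \<open>At \<open>x\<close> the quotient tends to \<open>f' / \<i>\<close>, because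
    \<open>cis (t - x)\<close> has the derivative \<open>\<i>\<close> there. With this value
    \<open>g\<close> is continuous, so its Fourier coefficients tend to 0.\<close>
  define g where "g t = (if t = x then f' / \<i> else (f t - f x) / (cis (t - x) - 1))" for t
  have g: "continuous_on {-pi..pi} g"
    unfolding continuous_on_eq_continuous_within
  proof
    fix t assume t: "t \<in> {-pi..pi}"
    show "continuous (at t within {-pi..pi}) g"
    proof (cases "t = x")
      case True
      have "((\<lambda>t. (cis (t - x) - cis (x - x)) / of_real (t - x)) \<longlongrightarrow> \<i>) (at x)"
      proof -
        have "((\<lambda>t. cis (t - x)) has_vector_derivative \<i>) (at x)"
          unfolding has_vector_derivative_def by (auto intro!: derivative_eq_intros)
        then show ?thesis by (simp add: has_vector_derivative_quotient)
      qed
      moreover have "((\<lambda>t. (f t - f x) / of_real (t - x)) \<longlongrightarrow> f') (at x)"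
        using d by (simp add: has_vector_derivative_quotient)
      ultimately have "((\<lambda>t. ((f t - f x) / of_real (t - x)) / ((cis (t - x) - cis (x - x)) / of_real (t - x))) \<longlongrightarrow> f' / \<i>) (at x)"
        by (intro tendsto_divide) auto
      moreover have "\<forall>\<^sub>F t in at x. ((f t - f x) / of_real (t - x)) / ((cis (t - x) - cis (x - x)) / of_real (t - x)) = g t"
        unfolding eventually_at by (intro exI[of _ 1]) (auto simp: g_def)
      ultimately have "(g \<longlongrightarrow> f' / \<i>) (at x)" by (rule Lim_transform_eventually)
      then have "isCont g x" by (simp add: isCont_def g_def)
      then show ?thesis using True continuous_at_imp_continuous_at_within by blast
    next
      case False
      have "\<bar>t - x\<bar> < 2 * pi" using t x unfolding abs_less_iff atLeastAtMost_iff by linarith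
      then have ne: "cis (t - x) - 1 \<noteq> 0" using cis_eq_1_small[of "t - x"] False by auto
      have "continuous (at t within {-pi..pi}) (\<lambda>t. (f t - f x) / (cis (t - x) - 1))"
      proof (intro continuous_intros)
        have "continuous_on {-pi..pi} (\<lambda>t. cis (t - x))" by (intro cis_continuous continuous_intros)
        then show "continuous (at t within {-pi..pi}) (\<lambda>t. cis (t - x))"
          using t by (simp add: continuous_on_eq_continuous_within)
      qed (use f t ne in \<open>auto simp: continuous_on_eq_continuous_within\<close>)
      moreover have "\<forall>\<^sub>F s in at t within {-pi..pi}. (f s - f x) / (cis (s - x) - 1) = g s"
        unfolding eventually_at by (rule exI[of _ "\<bar>t - x\<bar>"]) (use False in \<open>auto simp: g_def dist_real_def\<close>)
      ultimately show ?thesis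
        unfolding continuous_within using False Lim_transform_eventually by (fastforce simp: g_def)
    qed
  qed
  have fg: "f t = f x + (cis (t - x) - 1) * g t" if t: "t \<in> {-pi..pi}" for t
  proof -
    have "\<bar>t - x\<bar> < 2 * pi" using t x unfolding abs_less_iff atLeastAtMost_iff by linarith
    then show ?thesis using cis_eq_1_small[of "t - x"] by (auto simp: g_def)
  qed
  define a where "a k = cis (of_int k * x) * fourier_coeff g k" for k
  \<comment> \<open>Multiplication by \<open>cis (t - x) - 1\<close> shifts frequencies by one.
    Apart from the contribution of the constant \<open>f x\<close> at \<open>k = 0\<close>, each
    term is thus a difference of consecutive values of \<open>a\<close>.\<close>
  have tel: "fourier_coeff f k * cis (of_int k * x) = (if k = 0 then f x else 0) + (a (k - 1) - a k)" for k
  proof -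
    have I: "((\<lambda>t. f x * cis (of_int (- k) * t) + (cis (- x) * (g t * cis (- of_int (k - 1) * t)) - g t * cis (- of_int k * t)))
       has_integral (f x * (if - k = 0 then 2 * pi else 0) + (cis (- x) * (2 * pi * fourier_coeff g (k - 1)) - 2 * pi * fourier_coeff g k))) {-pi..pi}"
      by (intro has_integral_add has_integral_diff has_integral_mult_right has_integral_cis fourier_coeff_has_integral g)
    have E: "f x * cis (of_int (- k) * t) + (cis (- x) * (g t * cis (- of_int (k - 1) * t)) - g t * cis (- of_int k * t))
        = f t * cis (- of_int k * t)" if t: "t \<in> {-pi..pi}" for t
    proof -
      have "cis (- of_int (k - 1) * t) = cis t * cis (- of_int k * t)" "cis (t - x) = cis t * cis (- x)"
        by (simp_all add: cis_mult algebra_simps)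
      then show ?thesis by (subst fg[OF t]) (simp add: algebra_simps)
    qed
    have "((\<lambda>t. f t * cis (- of_int k * t)) has_integral (f x * (if - k = 0 then 2 * pi else 0) + (cis (- x) * (2 * pi * fourier_coeff g (k - 1)) - 2 * pi * fourier_coeff g k))) {-pi..pi}"
      by (rule has_integral_eq[OF E I])
    from has_integral_unique[OF fourier_coeff_has_integral[OF f] this]
    have "complex_of_real (2 * pi) * fourier_coeff f k =
        complex_of_real (2 * pi) * ((if k = 0 then f x else 0) + (cis (- x) * fourier_coeff g (k - 1) - fourier_coeff g k))"
      by (cases "k = 0") (simp_all add: algebra_simps)
    then have X: "fourier_coeff f k = (if k = 0 then f x else 0) + (cis (- x) * fourier_coeff g (k - 1) - fourier_coeff g k)"
      by (subst (asm) mult_cancel_left) simp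
    have E: "cis (of_int (k - 1) * x) = cis (- x) * cis (of_int k * x)" by (simp add: cis_mult algebra_simps)
    show ?thesis unfolding a_def E X by (cases "k = 0") (simp_all add: algebra_simps)
  qed
  have part: "(\<Sum>k=-int n..int n. fourier_coeff f k * cis (of_int k * x)) = f x + (a (- int (Suc n)) - a (int n))" for n
  proof (induction n)
    case 0
    show ?case using tel[of 0] by simp
  next
    case (Suc n)
    have "{-int (Suc n)..int (Suc n)} = insert (- int (Suc n)) (insert (int (Suc n)) {-int n..int n})" by auto
    then show ?case using Suc tel[of "- int (Suc n)"] tel[of "int (Suc n)"] by simp
  qed
  have lim0: "(\<lambda>n. a (p n)) \<longlonglongrightarrow> 0" if "inj p" for p :: "nat \<Rightarrow> int"
  proof -
    have "(\<lambda>n. norm (a (p n))) \<longlonglongrightarrow> 0"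
      using tendsto_norm_zero[OF fourier_coeff_tendsto_0[OF g that]] by (simp add: a_def norm_mult)
    then show ?thesis by (rule tendsto_norm_zero_cancel)
  qed
  have "(\<lambda>n. f x + (a (- int (Suc n)) - a (int n))) \<longlonglongrightarrow> f x + (0 - 0)"
    by (intro tendsto_intros lim0) (auto simp: inj_def)
  moreover have "(\<lambda>n. \<Sum>k=-int n..int n. fourier_coeff f k * cis (of_int k * x)) \<longlonglongrightarrow> (\<Sum>\<^sub>\<infinity>k. fourier_coeff f k * cis (of_int k * x))"
  proof -
    have "(\<lambda>k. fourier_coeff f k * cis (of_int k * x)) summable_on UNIV"
      by (rule Infinite_Sum.abs_summable_summable) (use s in \<open>simp add: norm_mult\<close>)
    then have L: "(sum (\<lambda>k. fourier_coeff f k * cis (of_int k * x)) \<longlongrightarrow> (\<Sum>\<^sub>\<infinity>k. fourier_coeff f k * cis (of_int k * x)))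
        (finite_subsets_at_top UNIV)"
      by (rule has_sum_infsum[unfolded has_sum_def])
    have "filterlim (\<lambda>n. {-int n..int n}) (finite_subsets_at_top UNIV) sequentially"
      unfolding filterlim_finite_subsets_at_top
    proof (intro allI impI)
      fix X :: "int set" assume "finite X \<and> X \<subseteq> UNIV"
      then have m: "\<bar>k\<bar> \<le> Max (abs ` X)" if "k \<in> X" for k using that by simp
      show "\<forall>\<^sub>F n in sequentially. finite {-int n..int n} \<and> X \<subseteq> {-int n..int n} \<and> {-int n..int n} \<subseteq> UNIV"
        using eventually_ge_at_top[of "nat (Max (abs ` X))"]
      proof eventually_elim
        case (elim n)
        have "k \<in> {-int n..int n}" if "k \<in> X" for k using m[OF that] elim by auto
        then show ?case by auto
      qed
    qed
    from filterlim_compose[OF L this] show ?thesis .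
  qed
  ultimately show ?thesis using LIMSEQ_unique part by (metis (no_types, lifting) add.right_neutral diff_zero ext)
qed

lemma fourier_coeff_cmult: "fourier_coeff (\<lambda>t. c * f t) k = c * fourier_coeff f k"
  unfolding fourier_coeff_def by (simp add: mult.assoc)

lemma fourier_coeff_diff:
  assumes "continuous_on {-pi..pi} f" "continuous_on {-pi..pi} g"
  shows "fourier_coeff (\<lambda>t. f t - g t) k = fourier_coeff f k - fourier_coeff g k"
proof -
  have "((\<lambda>t. (f t - g t) * cis (- of_int k * t)) has_integral (2 * pi * fourier_coeff f k - 2 * pi * fourier_coeff g k)) {-pi..pi}"
    using has_integral_diff[OF fourier_coeff_has_integral[OF assms(1)] fourier_coeff_has_integral[OF assms(2)], of k k]
    by (simp add: algebra_simps)
  then show ?thesis unfolding fourier_coeff_def[of "\<lambda>t. f t - g t"] by (simp add: integral_unique diff_divide_distrib)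
qed

lemma norm_fourier_coeff_le:
  assumes f: "continuous_on {-pi..pi} f" and B: "\<And>t. t \<in> {-pi..pi} \<Longrightarrow> norm (f t) \<le> B"
  shows "norm (fourier_coeff f k) \<le> B"
proof -
  have "norm (integral {-pi..pi} (\<lambda>t. f t * cis (- of_int k * t))) \<le> B * (pi - - pi)"
    by (rule integral_bound) (auto intro!: continuous_intros cis_continuous f simp: norm_mult B)
  then show ?thesis by (simp add: fourier_coeff_def norm_divide norm_mult divide_le_eq mult_ac)
qed

lemma fourier_coeff_derivative:
  assumes f: "\<And>t. (f has_vector_derivative f' t) (at t)" and f': "continuous_on {-pi..pi} f'"
    and per: "f pi = f (- pi)"
  shows "fourier_coeff f' k = \<i> * of_int k * fourier_coeff f k"
proof -
  let ?e = "\<lambda>t. cis (- of_int k * t)"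
  have cf: "continuous_on {-pi..pi} f"
    by (rule continuous_on_vector_derivative[OF has_vector_derivative_at_within[OF f]])
  have e: "(?e has_vector_derivative (- \<i> * of_int k * ?e t)) (at t)" for t
    unfolding has_vector_derivative_def
    by (auto intro!: derivative_eq_intros simp: scaleR_conv_of_real algebra_simps)
  have "((\<lambda>t. f t * ?e t) has_vector_derivative (f t * (- \<i> * of_int k * ?e t) + f' t * ?e t)) (at t within {-pi..pi})" for t
    by (rule has_vector_derivative_at_within[OF has_vector_derivative_mult[OF f e]])
  then have "((\<lambda>t. f t * (- \<i> * of_int k * ?e t) + f' t * ?e t) has_integral (f pi * ?e pi - f (-pi) * ?e (-pi))) {-pi..pi}"
    by (intro fundamental_theorem_of_calculus) auto
  moreover have "f pi * ?e pi - f (-pi) * ?e (-pi) = 0" using per cis_int_pi[of k] by simp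
  ultimately have "((\<lambda>t. f t * (- \<i> * of_int k * ?e t) + f' t * ?e t) has_integral 0) {-pi..pi}" by simp
  moreover have "((\<lambda>t. (- \<i> * of_int k) * (f t * ?e t) + f' t * ?e t) has_integral
      ((- \<i> * of_int k) * (2 * pi * fourier_coeff f k) + 2 * pi * fourier_coeff f' k)) {-pi..pi}"
    by (intro has_integral_add has_integral_mult_right fourier_coeff_has_integral cf f')
  ultimately have "(- \<i> * of_int k) * (2 * pi * fourier_coeff f k) + 2 * pi * fourier_coeff f' k = 0"
    by (intro has_integral_unique[of _ _ "{-pi..pi}"]) (simp_all add: mult_ac)
  then have "complex_of_real (2 * pi) * fourier_coeff f' k = complex_of_real (2 * pi) * (\<i> * of_int k * fourier_coeff f k)"
    by (simp add: algebra_simps)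
  then show ?thesis by (subst (asm) mult_cancel_left) simp
qed

section \<open>Fourier coefficients of compactly supported functions in the plane\<close>

definition torus_supported :: "(complex \<Rightarrow> complex) \<Rightarrow> bool" where
  "torus_supported F \<longleftrightarrow> smooth_on F UNIV \<and> (\<forall>y. norm y \<ge> 2 \<longrightarrow> F y = 0)"

definition dir_deriv :: "'a::real_normed_vector \<Rightarrow> ('a \<Rightarrow> 'b::real_normed_vector) \<Rightarrow> 'a \<Rightarrow> 'b" where
  "dir_deriv v F y = frechet_derivative F (at y) v"

definition coeff2 :: "(complex \<Rightarrow> complex) \<Rightarrow> freq \<Rightarrow> complex" where
  "coeff2 F \<kappa> = fourier_coeff (\<lambda>b. fourier_coeff (\<lambda>a. F (Complex a b)) (fst \<kappa>)) (snd \<kappa>)"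

lemma smooth_on_dir_deriv: "smooth_on F S \<Longrightarrow> smooth_on (dir_deriv v F) S"
  unfolding dir_deriv_def[abs_def] by (rule smooth_on_frechet)

lemma continuous_Complex: "continuous_on S (\<lambda>p. Complex (fst p) (snd p))" "continuous_on T (\<lambda>a. Complex a b)"
  "continuous_on T (\<lambda>b. Complex a b)"
  unfolding Complex_eq by (intro continuous_intros)+

lemma smooth_slice_continuous:
  assumes "smooth_on F UNIV"
  shows "continuous_on S (\<lambda>a. F (Complex a b))" "continuous_on S (\<lambda>b. F (Complex a b))"
  by (rule continuous_on_compose2[OF smooth_on_continuous[OF assms]], rule continuous_Complex, simp)+

lemma slice_derivative:
  assumes "smooth_on F UNIV"
  shows "((\<lambda>a. F (Complex a b)) has_vector_derivative dir_deriv 1 F (Complex a b)) (at a)"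
    and "((\<lambda>b. F (Complex a b)) has_vector_derivative dir_deriv \<i> F (Complex a b)) (at b)"
proof -
  let ?D = "frechet_derivative F (at (Complex a b))"
  have D: "(F has_derivative ?D) (at (Complex a b))" using smooth_on_has_derivative[OF assms] by simp
  have l: "linear ?D" using D has_derivative_linear by blast
  have "((\<lambda>a. Complex a b) has_derivative (\<lambda>h. of_real h)) (at a)" "((\<lambda>b. Complex a b) has_derivative (\<lambda>h. \<i> * of_real h)) (at b)"
    unfolding Complex_eq by (auto intro!: derivative_eq_intros)
  from this[THEN has_derivative_compose, of F ?D] D
  have "((\<lambda>a. F (Complex a b)) has_derivative (\<lambda>h. ?D (of_real h))) (at a)"
    "((\<lambda>b. F (Complex a b)) has_derivative (\<lambda>h. ?D (\<i> * of_real h))) (at b)" by auto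
  moreover have "?D (of_real h) = h *\<^sub>R ?D 1" "?D (\<i> * of_real h) = h *\<^sub>R ?D \<i>" for h
    using linear_cmul[OF l, of h 1] linear_cmul[OF l, of h \<i>] by (simp_all add: scaleR_conv_of_real mult.commute)
  ultimately show "((\<lambda>a. F (Complex a b)) has_vector_derivative dir_deriv 1 F (Complex a b)) (at a)"
    "((\<lambda>b. F (Complex a b)) has_vector_derivative dir_deriv \<i> F (Complex a b)) (at b)"
    by (simp_all add: has_vector_derivative_def dir_deriv_def)
qed

lemma fourier_coeff_slice_derivative:
  assumes F: "smooth_on F UNIV"
  shows "((\<lambda>b. fourier_coeff (\<lambda>a. F (Complex a b)) k) has_vector_derivative
    fourier_coeff (\<lambda>a. dir_deriv \<i> F (Complex a b)) k) (at b)"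
proof -
  let ?e = "\<lambda>a. cis (- of_int k * a)"
  have "((\<lambda>b. integral (cbox (-pi) pi) (\<lambda>a. F (Complex a b) * ?e a)) has_vector_derivative
      integral (cbox (-pi) pi) (\<lambda>a. dir_deriv \<i> F (Complex a b) * ?e a)) (at b within UNIV)"
  proof (rule leibniz_rule_vector_derivative)
    show "((\<lambda>b. F (Complex a b) * ?e a) has_vector_derivative dir_deriv \<i> F (Complex a b) * ?e a) (at b within UNIV)" for a b
      using has_vector_derivative_mult[OF slice_derivative(2)[OF F] has_vector_derivative_const] by simp
    show "(\<lambda>a. F (Complex a b) * ?e a) integrable_on cbox (-pi) pi" for b
      by (intro integrable_continuous continuous_intros cis_continuous smooth_slice_continuous F)
    have "continuous_on (UNIV \<times> cbox (-pi) pi) (\<lambda>p. dir_deriv \<i> F (Complex (snd p) (fst p)) * ?e (snd p))"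
    proof (intro continuous_intros cis_continuous)
      show "continuous_on (UNIV \<times> cbox (-pi) pi) (\<lambda>p. dir_deriv \<i> F (Complex (snd p) (fst p)))"
        by (rule continuous_on_compose2[OF smooth_on_continuous[OF smooth_on_dir_deriv[OF F]]])
          (auto simp: Complex_eq intro!: continuous_intros)
    qed
    then show "continuous_on (UNIV \<times> cbox (-pi) pi) (\<lambda>(b, a). dir_deriv \<i> F (Complex a b) * ?e a)"
      by (simp add: case_prod_unfold)
  qed auto
  then have "((\<lambda>b. integral {-pi..pi} (\<lambda>a. F (Complex a b) * ?e a) * (1 / (2 * pi))) has_vector_derivative
      integral {-pi..pi} (\<lambda>a. dir_deriv \<i> F (Complex a b) * ?e a) * (1 / (2 * pi))) (at b)"
    using has_vector_derivative_mult_left[of _ _ "at b" "1 / (2 * complex_of_real pi)"] by simp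
  then show ?thesis unfolding fourier_coeff_def by (simp add: mult.commute)
qed

lemma coeff_slice_continuous:
  "smooth_on F UNIV \<Longrightarrow> continuous_on S (\<lambda>b. fourier_coeff (\<lambda>a. F (Complex a b)) k)"
  by (rule continuous_on_vector_derivative[OF has_vector_derivative_at_within[OF fourier_coeff_slice_derivative]])

text \<open>The radius 2, beyond which \<open>bump\<close> vanishes, is smaller than pi. Hence the
  functions are zero on the edges of the period square, agree with their periodic extensions inside
  it, and integrations by parts leave no boundary terms.\<close>

lemma torus_supportedD:
  assumes "torus_supported F"
  shows "smooth_on F UNIV" "\<bar>a\<bar> \<ge> pi \<Longrightarrow> F (Complex a b) = 0" "\<bar>b\<bar> \<ge> pi \<Longrightarrow> F (Complex a b) = 0"
  using assms abs_Re_le_cmod[of "Complex a b"] abs_Im_le_cmod[of "Complex a b"] pi_ge_two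
  unfolding torus_supported_def by auto

lemma coeff2_deriv:
  assumes F: "torus_supported F"
  shows "coeff2 (dir_deriv 1 F) \<kappa> = \<i> * of_int (fst \<kappa>) * coeff2 F \<kappa>"
    and "coeff2 (dir_deriv \<i> F) \<kappa> = \<i> * of_int (snd \<kappa>) * coeff2 F \<kappa>"
proof -
  note s = torus_supportedD(1)[OF F]
  have "fourier_coeff (\<lambda>a. dir_deriv 1 F (Complex a b)) k = \<i> * of_int k * fourier_coeff (\<lambda>a. F (Complex a b)) k" for b k
    by (rule fourier_coeff_derivative[OF slice_derivative(1)[OF s]])
      (use torus_supportedD(2)[OF F] smooth_slice_continuous[OF smooth_on_dir_deriv[OF s]] in auto)
  then show "coeff2 (dir_deriv 1 F) \<kappa> = \<i> * of_int (fst \<kappa>) * coeff2 F \<kappa>"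
    unfolding coeff2_def by (simp add: fourier_coeff_cmult)
  show "coeff2 (dir_deriv \<i> F) \<kappa> = \<i> * of_int (snd \<kappa>) * coeff2 F \<kappa>"
    unfolding coeff2_def
    by (rule fourier_coeff_derivative[OF fourier_coeff_slice_derivative[OF s]])
      (use torus_supportedD(3)[OF F] coeff_slice_continuous[OF smooth_on_dir_deriv[OF s]] in auto)
qed

lemma coeff2_diff:
  assumes F: "smooth_on F UNIV" and G: "smooth_on G UNIV"
  shows "coeff2 (\<lambda>y. F y - G y) \<kappa> = coeff2 F \<kappa> - coeff2 G \<kappa>"
  unfolding coeff2_def
  by (subst fourier_coeff_diff[OF coeff_slice_continuous[OF F] coeff_slice_continuous[OF G], symmetric])
    (simp add: fourier_coeff_diff[OF smooth_slice_continuous(1)[OF F] smooth_slice_continuous(1)[OF G]])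

lemma norm_coeff2_le:
  assumes F: "smooth_on F UNIV" and B: "\<And>y. norm (F y) \<le> B"
  shows "norm (coeff2 F \<kappa>) \<le> B"
  unfolding coeff2_def by (intro norm_fourier_coeff_le coeff_slice_continuous smooth_slice_continuous F B)

text \<open>Outside the closed disc of radius 2 the function vanishes near every point; on the
  circle itself the derivative vanishes by continuity.\<close>

lemma torus_supported_dir_deriv:
  assumes "torus_supported F"
  shows "torus_supported (dir_deriv v F)"
proof -
  note s = torus_supportedD(1)[OF assms]
  have z: "dir_deriv v F y = 0" if y: "norm y > 2" for y
  proof -
    have "frechet_derivative F (at y) = frechet_derivative (\<lambda>_. 0) (at y)"
      by (rule frechet_derivative_cong[of "- cball 0 2"]) (use y assms in \<open>auto simp: torus_supported_def open_Compl\<close>)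
    then show ?thesis by (simp add: dir_deriv_def)
  qed
  have "dir_deriv v F y = 0" if y: "norm y \<ge> 2" for y
  proof -
    have "closed {y. dir_deriv v F y = 0}"
      using continuous_closed_preimage_constant[OF smooth_on_continuous[OF smooth_on_dir_deriv[OF s]] closed_UNIV, of v 0] by simp
    moreover have "y islimpt {y. norm y > 2}"
    proof -
      have "(\<lambda>n. (1 + 1 / real (Suc n)) *\<^sub>R y) \<longlonglongrightarrow> (1 + 0) *\<^sub>R y"
        by (intro tendsto_intros LIMSEQ_inverse_real_of_nat[unfolded inverse_eq_divide])
      moreover have "(1 + 1 / real (Suc n)) *\<^sub>R y \<in> {y. norm y > 2} - {y}" for n
      proof -
        have ny: "norm y > 0" using y by linarith
        then have N: "norm ((1 + 1 / real (Suc n)) *\<^sub>R y) > norm y" by (simp add: field_simps)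
        then have "(1 + 1 / real (Suc n)) *\<^sub>R y \<noteq> y" by (metis less_irrefl)
        then show ?thesis using y N by (simp del: of_nat_Suc norm_scaleR)
      qed
      ultimately show ?thesis unfolding islimpt_sequential by (intro exI[of _ "\<lambda>n. (1 + 1 / real (Suc n)) *\<^sub>R y"]) simp
    qed
    moreover have "{y. norm y > 2} \<subseteq> {y. dir_deriv v F y = 0}" using z by auto
    ultimately show ?thesis using closed_limpt islimpt_subset by blast
  qed
  then show ?thesis using s by (auto simp: torus_supported_def intro: smooth_on_dir_deriv)
qed

text \<open>The operator 1 - \<partial>_v \<partial>_v. For \<open>v = 1\<close> and
  \<open>v = \<i>\<close> its Fourier multiplier is 1 plus the square of a frequency, which has no
  zero and grows fast enough for summability in that variable.\<close>

definition helm :: "'a::real_normed_vector \<Rightarrow> ('a \<Rightarrow> complex) \<Rightarrow> 'a \<Rightarrow> complex" where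
  "helm v F y = F y - dir_deriv v (dir_deriv v F) y"

lemma smooth_on_helm: "open S \<Longrightarrow> smooth_on F S \<Longrightarrow> smooth_on (helm v F) S"
  unfolding helm_def[abs_def] by (intro smooth_intros smooth_on_dir_deriv)

lemma torus_supported_helm:
  assumes "torus_supported F"
  shows "torus_supported (helm v F)"
  using assms torus_supported_dir_deriv[OF torus_supported_dir_deriv[OF assms], of v v] smooth_on_helm[OF open_UNIV]
  by (auto simp: torus_supported_def helm_def)

lemma coeff2_helm:
  assumes F: "torus_supported F"
  shows "coeff2 (helm 1 F) \<kappa> = (1 + (of_int (fst \<kappa>))\<^sup>2) * coeff2 F \<kappa>"
    and "coeff2 (helm \<i> F) \<kappa> = (1 + (of_int (snd \<kappa>))\<^sup>2) * coeff2 F \<kappa>"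
proof -
  note s = torus_supportedD(1)[OF F]
  show "coeff2 (helm 1 F) \<kappa> = (1 + (of_int (fst \<kappa>))\<^sup>2) * coeff2 F \<kappa>" "coeff2 (helm \<i> F) \<kappa> = (1 + (of_int (snd \<kappa>))\<^sup>2) * coeff2 F \<kappa>"
    unfolding helm_def[abs_def]
    by (simp_all add: coeff2_diff[OF s smooth_on_dir_deriv[OF smooth_on_dir_deriv[OF s]]]
        coeff2_deriv[OF torus_supported_dir_deriv[OF F]] coeff2_deriv[OF F] power2_eq_square algebra_simps)
qed

text \<open>The Fourier multiplier of \<open>helm 1\<close> after \<open>helm \<i>\<close>. Being a
  product of one-variable factors, it has a reciprocal that is summable over the two-dimensional
  lattice.\<close>

definition big_weight :: "freq \<Rightarrow> real" where
  "big_weight \<kappa> = (1 + (of_int (fst \<kappa>))\<^sup>2) * (1 + (of_int (snd \<kappa>))\<^sup>2)"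

lemma big_weight_ge_1: "big_weight \<kappa> \<ge> 1"
  unfolding big_weight_def using mult_mono[of 1 "1 + (of_int (fst \<kappa>))\<^sup>2" 1 "1 + (of_int (snd \<kappa>))\<^sup>2 :: real"] by simp

lemma coeff2_big_weight:
  assumes "torus_supported F"
  shows "norm (coeff2 (helm 1 (helm \<i> F)) \<kappa>) = big_weight \<kappa> * norm (coeff2 F \<kappa>)"
proof -
  have "coeff2 (helm 1 (helm \<i> F)) \<kappa> = of_real (big_weight \<kappa>) * coeff2 F \<kappa>"
    by (simp add: coeff2_helm torus_supported_helm assms big_weight_def mult.assoc)
  then show ?thesis using big_weight_ge_1[of \<kappa>] by (simp add: norm_mult)
qed

lemma summable_inverse_big_weight: "(\<lambda>\<kappa>. 1 / big_weight \<kappa>) summable_on UNIV"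
proof -
  let ?h = "\<lambda>k::int. 1 / (1 + (of_int k)\<^sup>2) :: real"
  have "summable (\<lambda>n. 1 / (1 + (real n)\<^sup>2))"
  proof (rule summable_comparison_test_ev)
    have "summable (\<lambda>n. inverse (real (Suc n) ^ 2))" 
      using inverse_power_summable[of 2, where 'a = real] by (subst summable_Suc_iff) simp
    then show "summable (\<lambda>n. 2 * inverse (real (Suc n) ^ 2))" by (rule summable_mult)
    show "\<forall>\<^sub>F n in sequentially. norm (1 / (1 + (real n)\<^sup>2)) \<le> 2 * inverse (real (Suc n) ^ 2)"
    proof (intro always_eventually allI)
      fix n
      have "(real (Suc n))\<^sup>2 \<le> 2 * (1 + (real n)\<^sup>2)"
        using zero_le_power2[of "real n - 1"] by (simp add: power2_eq_square algebra_simps)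
      moreover have "1 + (real n)\<^sup>2 > 0" by (simp add: add_pos_nonneg)
      ultimately show "norm (1 / (1 + (real n)\<^sup>2)) \<le> 2 * inverse (real (Suc n) ^ 2)"
        by (simp add: field_simps del: of_nat_Suc)
    qed
  qed
  then have "(\<lambda>n. 1 / (1 + (real n)\<^sup>2)) summable_on UNIV"
    by (subst summable_on_UNIV_nonneg_real_iff) (auto simp: add_pos_nonneg)
  then have n: "(?h \<circ> int) summable_on UNIV" "(?h \<circ> (\<lambda>n. - int n)) summable_on UNIV"
    by (simp_all add: o_def)
  have "?h summable_on (range int)" "?h summable_on (range (\<lambda>n. - int n))"
    using n by (subst summable_on_reindex; simp add: inj_def)+
  then have "?h summable_on (range int \<union> range (\<lambda>n. - int n))" by (rule summable_on_union)
  moreover have "range int \<union> range (\<lambda>n. - int n) = UNIV"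
    by (auto simp: image_iff) (metis int_cases2)
  ultimately have h: "?h summable_on UNIV" by simp
  have "(\<lambda>(k, l). ?h k * ?h l) summable_on UNIV \<times> UNIV"
  proof (rule summable_on_SigmaI)
    show "((\<lambda>l. case (k, l) of (k, l) \<Rightarrow> ?h k * ?h l) has_sum (?h k * infsum ?h UNIV)) UNIV" for k
      using has_sum_cmult_right[OF has_sum_infsum[OF h], of "?h k"] by simp
    show "(\<lambda>k. ?h k * infsum ?h UNIV) summable_on UNIV" by (rule summable_on_cmult_left[OF h])
  qed (auto intro!: divide_nonneg_nonneg)
  then show ?thesis by (simp add: big_weight_def case_prod_unfold)
qed

definition big_weight_sum :: real where "big_weight_sum = (\<Sum>\<^sub>\<infinity>\<kappa>. 1 / big_weight \<kappa>)"

text \<open>A bound on \<open>helm 1 (helm \<i> F)\<close> bounds its coefficients, and those of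
  \<open>F\<close> after division by \<open>big_weight\<close>. A supremum bound on finitely many
  derivatives thus controls the norm in which \<open>periodic_beltrami\<close> requires
  smallness.\<close>

lemma coeff2_wnorm:
  assumes F: "torus_supported F" and B: "\<And>y. norm (helm 1 (helm \<i> F) y) \<le> B"
  shows "coeff2 F abs_summable_on UNIV" "wnorm (\<lambda>_. 1) (coeff2 F) \<le> B * big_weight_sum"
proof -
  have le: "norm (coeff2 F \<kappa>) \<le> B * (1 / big_weight \<kappa>)" for \<kappa>
  proof -
    have "big_weight \<kappa> * norm (coeff2 F \<kappa>) \<le> B"
      unfolding coeff2_big_weight[OF F, symmetric]
      by (rule norm_coeff2_le[OF torus_supportedD(1) B]) (intro torus_supported_helm F)
    then show ?thesis using big_weight_ge_1[of \<kappa>] by (simp add: field_simps)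
  qed
  note s = summable_on_cmult_right[OF summable_inverse_big_weight, of B]
  show ab: "coeff2 F abs_summable_on UNIV" by (rule summable_on_comparison_test[OF s le]) simp
  have "wnorm (\<lambda>_. 1) (coeff2 F) \<le> (\<Sum>\<^sub>\<infinity>\<kappa>. B * (1 / big_weight \<kappa>))"
    unfolding wnorm_def using infsum_mono[OF ab s le] by simp
  also have "\<dots> = B * big_weight_sum"
    unfolding big_weight_sum_def by (rule infsum_cmult_right) (rule summable_inverse_big_weight)
  finally show "wnorm (\<lambda>_. 1) (coeff2 F) \<le> B * big_weight_sum" .
qed

lemma torus_supported_bounded:
  assumes "torus_supported F"
  obtains B where "\<And>y. norm (F y) \<le> B"
proof -
  have "compact_smooth F" unfolding compact_smooth_def using assms by (auto simp: torus_supported_def intro!: exI[of _ 2])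
  then show thesis using compact_smooth_bounded that by metis
qed

text \<open>The operators can be applied any number of times without leaving the class of smooth
  functions with this support, and \<open>big_weight\<close> dominates
  \<open>freq_weight\<close>.\<close>

lemma coeff2_rapid:
  assumes F: "torus_supported F"
  shows "rapid (coeff2 F)"
  unfolding rapid_def
proof
  fix s
  have "\<exists>G. torus_supported G \<and> (\<forall>\<kappa>. norm (coeff2 G \<kappa>) = big_weight \<kappa> ^ s * norm (coeff2 F \<kappa>))"
  proof (induction s)
    case 0
    then show ?case using F by auto
  next
    case (Suc s)
    then obtain G where G: "torus_supported G" "\<And>\<kappa>. norm (coeff2 G \<kappa>) = big_weight \<kappa> ^ s * norm (coeff2 F \<kappa>)" by blast
    show ?case
      by (rule exI[of _ "helm 1 (helm \<i> G)"]) (simp add: torus_supported_helm G coeff2_big_weight mult.assoc)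
  qed
  then obtain G where G: "torus_supported G" "\<And>\<kappa>. norm (coeff2 G \<kappa>) = big_weight \<kappa> ^ s * norm (coeff2 F \<kappa>)" by blast
  obtain B where B: "\<And>y. norm (helm 1 (helm \<i> G) y) \<le> B"
    using torus_supported_bounded[OF torus_supported_helm[OF torus_supported_helm[OF G(1)]]] by metis
  have "wsummable (\<lambda>_. 1) (coeff2 G)" using coeff2_wnorm(1)[OF G(1) B] by (simp add: wsummable_def)
  then show "wsummable (\<lambda>\<kappa>. freq_weight \<kappa> ^ s) (coeff2 F)"
  proof (rule wsummable_mono[where C = 1])
    fix \<kappa>
    have i: "\<bar>of_int k\<bar> \<le> (of_int k :: real)\<^sup>2" for k :: int
    proof -
      have "k = 0 \<or> 1 \<le> \<bar>k\<bar>" by linarith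
      then have "\<bar>k\<bar> * 1 \<le> \<bar>k\<bar> * \<bar>k\<bar>" using mult_left_mono[of 1 "\<bar>k\<bar>" "\<bar>k\<bar>"] by auto
      then have "\<bar>k\<bar> \<le> k\<^sup>2" by (simp add: power2_eq_square)
      then show ?thesis by (metis of_int_abs of_int_le_iff of_int_power)
    qed
    have "freq_weight \<kappa> \<le> 1 + (of_int (fst \<kappa>))\<^sup>2 + (of_int (snd \<kappa>))\<^sup>2"
      unfolding freq_weight_def using i[of "fst \<kappa>"] i[of "snd \<kappa>"] by linarith
    also have "\<dots> \<le> big_weight \<kappa>" by (simp add: big_weight_def algebra_simps)
    finally have "freq_weight \<kappa> ^ s \<le> big_weight \<kappa> ^ s" using freq_weight_ge_1[of \<kappa>] by (intro power_mono) auto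
    then show "freq_weight \<kappa> ^ s * norm (coeff2 F \<kappa>) \<le> 1 * (1 * norm (coeff2 G \<kappa>))" by (simp add: G(2) mult_right_mono)
    show "0 \<le> freq_weight \<kappa> ^ s * norm (coeff2 F \<kappa>)" using freq_weight_ge_1[of \<kappa>] by simp
  qed
qed

text \<open>One-variable inversion is applied in the imaginary variable to each slice of
  coefficients and then in the real variable; absolute summability merges the iterated sums into the
  double series.\<close>

lemma trig_coeff2:
  assumes F: "torus_supported F" and y: "\<bar>Re y\<bar> < pi" "\<bar>Im y\<bar> < pi"
  shows "trig (coeff2 F) y = F y"
proof -
  note s = torus_supportedD(1)[OF F]
  let ?H = "\<lambda>k b. fourier_coeff (\<lambda>a. F (Complex a b)) k"
  have ab: "coeff2 F abs_summable_on UNIV \<times> UNIV" using rapid_abs[OF coeff2_rapid[OF F]] by simp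
  note sig = Infinite_Sum.abs_summable_on_Sigma_iff[THEN iffD1, OF ab]
  have inner: "fourier_coeff (?H k) abs_summable_on UNIV" for k
    using conjunct1[OF sig, rule_format, of k] by (simp add: coeff2_def[abs_def])
  have H: "?H k (Im y) = (\<Sum>\<^sub>\<infinity>l. coeff2 F (k, l) * cis (of_int l * Im y))" for k
    using fourier_inversion[OF coeff_slice_continuous[OF s] _ _ fourier_coeff_slice_derivative[OF s] inner, of "Im y"] y
    by (simp add: coeff2_def)
  have "(\<lambda>k. ?H k (Im y)) abs_summable_on UNIV"
  proof (rule summable_on_comparison_test)
    show "(\<lambda>k. \<Sum>\<^sub>\<infinity>l. norm (coeff2 F (k, l))) summable_on UNIV"
      using conjunct2[OF sig] by (simp add: infsum_nonneg)
    fix k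
    have "(\<lambda>l. coeff2 F (k, l) * cis (of_int l * Im y)) abs_summable_on UNIV"
      using conjunct1[OF sig, rule_format, of k] by (simp add: norm_mult)
    from norm_infsum_bound[OF this] show "norm (?H k (Im y)) \<le> (\<Sum>\<^sub>\<infinity>l. norm (coeff2 F (k, l)))"
      unfolding H by (simp add: norm_mult)
  qed simp
  from fourier_inversion[OF smooth_slice_continuous(1)[OF s] _ _ slice_derivative(1)[OF s] this, of "Re y"] y
  have "F y = (\<Sum>\<^sub>\<infinity>k. ?H k (Im y) * cis (of_int k * Re y))" by simp
  also have "\<dots> = (\<Sum>\<^sub>\<infinity>k. \<Sum>\<^sub>\<infinity>l. coeff2 F (k, l) * char (k, l) y)"
  proof (rule infsum_cong)
    fix k
    have "(\<lambda>l. coeff2 F (k, l) * cis (of_int l * Im y)) summable_on UNIV"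
      by (rule Infinite_Sum.abs_summable_summable) (use conjunct1[OF sig, rule_format, of k] in \<open>simp add: norm_mult\<close>)
    then have "?H k (Im y) * cis (of_int k * Re y) = (\<Sum>\<^sub>\<infinity>l. coeff2 F (k, l) * cis (of_int l * Im y) * cis (of_int k * Re y))"
      unfolding H by (intro infsum_cmult_left[symmetric])
    also have "\<dots> = (\<Sum>\<^sub>\<infinity>l. coeff2 F (k, l) * char (k, l) y)"
      by (rule infsum_cong) (simp add: char_def cis_mult mult.assoc add.commute)
    finally show "?H k (Im y) * cis (of_int k * Re y) = (\<Sum>\<^sub>\<infinity>l. coeff2 F (k, l) * char (k, l) y)" .
  qed
  also have "\<dots> = trig (coeff2 F) y"
    unfolding trig_def
    using infsum_Sigma_banach[of "\<lambda>\<kappa>. coeff2 F \<kappa> * char \<kappa> y" UNIV "\<lambda>_. UNIV"]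
      trig_summable[OF rapid_abs[OF coeff2_rapid[OF F]]] by simp
  finally show ?thesis by simp
qed

section \<open>Local solution of the Beltrami equation\<close>

lemma dir_deriv_slice:
  fixes G :: "real \<times> complex \<Rightarrow> complex"
  assumes "smooth_on G UNIV"
  shows "dir_deriv v (\<lambda>y. G (d, y)) y = dir_deriv (0, v) G (d, y)"
proof -
  have "((\<lambda>y. (d, y)) has_derivative (\<lambda>v. (0, v))) (at y)" by (auto intro!: derivative_eq_intros)
  from has_derivative_compose[OF this, of G] smooth_on_has_derivative[OF assms]
  have "((\<lambda>y. G (d, y)) has_derivative (\<lambda>v. frechet_derivative G (at (d, y)) (0, v))) (at y)" by auto
  from frechet_derivative_at[OF this] show ?thesis by (simp add: dir_deriv_def fun_eq_iff)
qed

lemma helm_slice: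
  fixes G :: "real \<times> complex \<Rightarrow> complex"
  assumes "smooth_on G UNIV"
  shows "helm v (\<lambda>y. G (d, y)) y = helm (0, v) G (d, y)"
  using dir_deriv_slice[OF assms] dir_deriv_slice[OF smooth_on_dir_deriv[OF assms]]
  by (simp add: helm_def ext[of "dir_deriv v (\<lambda>y. G (d, y))" "\<lambda>y. dir_deriv (0, v) G (d, y)"])

text \<open>The fourth-order expression bounded in \<open>coeff2_wnorm\<close> depends uniformly
  continuously on \<open>d\<close> over a compact set containing the support and is zero for
  \<open>d = 0\<close>; so it is uniformly small for small \<open>d\<close>.\<close>

lemma coeff2_small:
  fixes G :: "real \<times> complex \<Rightarrow> complex"
  assumes G: "smooth_on G UNIV" and supp: "\<And>d. torus_supported (\<lambda>y. G (d, y))"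
    and zero: "\<And>y. G (0, y) = 0" and e: "e > 0"
  obtains \<eta> where "\<eta> > 0" "\<And>d. \<bar>d\<bar> < \<eta> \<Longrightarrow> wnorm (\<lambda>_. 1) (coeff2 (\<lambda>y. G (d, y))) \<le> e"
proof -
  let ?L = "helm (0, 1) (helm (0, \<i>) G)"
  have sl: "helm 1 (helm \<i> (\<lambda>y. G (d, y))) y = ?L (d, y)" for d y
    using helm_slice[OF G, of \<i> d] helm_slice[OF smooth_on_helm[OF open_UNIV G], of 1]
    by (simp add: ext[of "helm \<i> (\<lambda>y. G (d, y))" "\<lambda>y. helm (0, \<i>) G (d, y)"])
  have L0: "?L (0, y) = 0" for y
  proof -
    have "(\<lambda>y. G (0, y)) = (\<lambda>_. 0)" using zero by auto
    moreover have "helm v (\<lambda>_. 0) = (\<lambda>_. 0)" for v :: complex by (rule ext) (simp add: helm_def dir_deriv_def[abs_def])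
    ultimately show ?thesis using sl[of 0 y, symmetric] by simp
  qed
  have "continuous_on (cball 0 1 \<times> cball 0 2) ?L"
    using smooth_on_continuous[OF smooth_on_helm[OF open_UNIV smooth_on_helm[OF open_UNIV G]]] continuous_on_subset by blast
  then have "uniformly_continuous_on (cball 0 1 \<times> cball 0 2) ?L"
    by (rule compact_uniformly_continuous) (intro compact_Times compact_cball)
  moreover define e' where "e' = e / (\<bar>big_weight_sum\<bar> + 1)"
  have e': "e' > 0" using e by (simp add: e'_def add_nonneg_pos)
  ultimately obtain \<eta> where \<eta>: "\<eta> > 0" "\<And>p q. p \<in> cball 0 1 \<times> cball 0 2 \<Longrightarrow> q \<in> cball 0 1 \<times> cball 0 2 \<Longrightarrow> dist q p < \<eta> \<Longrightarrow> dist (?L q) (?L p) < e'"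
    unfolding uniformly_continuous_on_def by metis
  show thesis
  proof (rule that[of "min \<eta> 1"])
    fix d :: real assume d: "\<bar>d\<bar> < min \<eta> 1"
    have "norm (helm 1 (helm \<i> (\<lambda>y. G (d, y))) y) \<le> e'" for y
    proof (cases "norm y \<le> 2")
      case True
      have "dist (?L (d, y)) (?L (0, y)) < e'"
        by (rule \<eta>(2)) (use True d in \<open>auto simp: dist_Pair_Pair\<close>)
      then show ?thesis by (simp add: sl L0)
    next
      case False
      then show ?thesis using torus_supported_helm[OF torus_supported_helm[OF supp[of d]], of 1 \<i>] e'
        by (simp add: torus_supported_def)
    qed
    then have "wnorm (\<lambda>_. 1) (coeff2 (\<lambda>y. G (d, y))) \<le> e' * big_weight_sum" by (rule coeff2_wnorm(2)[OF supp])
    also have "\<dots> \<le> e' * (\<bar>big_weight_sum\<bar> + 1)" using e' by (intro mult_left_mono) auto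
    also have "\<dots> = e" by (simp add: e'_def)
    finally show "wnorm (\<lambda>_. 1) (coeff2 (\<lambda>y. G (d, y))) \<le> e" .
  qed (use \<eta> in auto)
qed

text \<open>Under a strong dilation the coefficient is nearly the constant \<open>m 0\<close> on the
  disc that carries the cutoff, so the torus problem there has a small perturbation. Its solution,
  scaled back, solves the original equation near 0, where the cutoff equals 1.\<close>

theorem beltrami:
  fixes m :: "complex \<Rightarrow> complex"
  assumes m: "smooth_on m (ball 0 r)" and r: "r > 0" and Im: "Im (m 0) \<noteq> 0"
  obtains \<rho> z where "\<rho> > 0" "\<rho> \<le> r" "smooth_on z (ball 0 \<rho>)"
    "\<And>y. y \<in> ball 0 \<rho> \<Longrightarrow> frechet_derivative z (at y) \<i> = m y * frechet_derivative z (at y) 1"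
    "\<And>y. y \<in> ball 0 \<rho> \<Longrightarrow> frechet_derivative z (at y) 1 \<noteq> (0::complex)"
proof -
  have "smooth_on (\<lambda>y. m y - m 0) (ball 0 r)" by (intro smooth_intros m open_ball)
  from cutoff_extension[OF this r] obtain N where N: "compact_smooth N" "\<And>y. norm y \<le> r / 4 \<Longrightarrow> N y = m y - m 0" by metis
  \<comment> \<open>The deviation of \<open>m\<close> from \<open>m 0\<close> seen after dilation by
    \<open>fst p\<close>, cut off at radius 2. With the dilation factor as a variable,
    \<open>G\<close> is jointly smooth up to the factor 0, where it vanishes.\<close>
  define G where "G p = bump (snd p) *\<^sub>R N (fst p *\<^sub>R snd p)" for p :: "real \<times> complex"
  have lf: "smooth_on (fst :: real \<times> complex \<Rightarrow> real) UNIV" and ls: "smooth_on (snd :: real \<times> complex \<Rightarrow> complex) UNIV"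
    by (intro smooth_on_linear bounded_linear_fst bounded_linear_snd open_UNIV)+
  have G: "smooth_on G UNIV"
    unfolding G_def[abs_def]
  proof (rule smooth_on_scaleR[OF open_UNIV])
    show "smooth_on (\<lambda>p :: real \<times> complex. bump (snd p)) UNIV"
      by (rule smooth_on_compose[OF open_UNIV open_UNIV UNIV_I smooth_on_bump ls])
    show "smooth_on (\<lambda>p :: real \<times> complex. N (fst p *\<^sub>R snd p)) UNIV"
      by (rule smooth_on_compose[OF open_UNIV open_UNIV UNIV_I _ smooth_on_scaleR[OF open_UNIV lf ls]])
        (use N in \<open>simp add: compact_smooth_def\<close>)
  qed
  have supp: "torus_supported (\<lambda>y. G (d, y))" for d
  proof -
    have "smooth_on (\<lambda>y::complex. (d, y)) UNIV"
    proof -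
      have "smooth_on (\<lambda>y::complex. (d, 0) + (0::real, y)) UNIV"
        by (intro smooth_intros smooth_on_linear[OF bounded_linear_Pair[OF bounded_linear_zero bounded_linear_ident]] open_UNIV)
      then show ?thesis by simp
    qed
    then have "smooth_on (\<lambda>y. G (d, y)) UNIV" by (rule smooth_on_compose[OF open_UNIV open_UNIV UNIV_I G])
    then show ?thesis by (simp add: torus_supported_def G_def bump_eq_0)
  qed
  have "G (0, y) = 0" for y using N(2)[of 0] r by (simp add: G_def)
  then obtain \<eta> where \<eta>: "\<eta> > 0" "\<And>d. \<bar>d\<bar> < \<eta> \<Longrightarrow> wnorm (\<lambda>_. 1) (coeff2 (\<lambda>y. G (d, y))) \<le> \<bar>Im (m 0)\<bar> / 3"
    using coeff2_small[OF G supp, of "\<bar>Im (m 0)\<bar> / 3"] Im by auto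
  define d where "d = \<eta> / 2"
  have d: "d > 0" "\<bar>d\<bar> < \<eta>" using \<eta> by (auto simp: d_def)
  obtain z where z: "smooth_on z UNIV"
    "\<And>y. frechet_derivative z (at y) \<i> = (m 0 + trig (coeff2 (\<lambda>y. G (d, y))) y) * frechet_derivative z (at y) 1"
    "\<And>y. frechet_derivative z (at y) 1 \<noteq> 0"
    using periodic_beltrami[OF coeff2_rapid[OF supp] Im \<eta>(2)[OF d(2)]] by blast
  \<comment> \<open>Below \<open>d\<close> the rescaled point lies in the unit disc, where
    \<open>bump\<close> is 1 and the Fourier series represents the function; below
    \<open>r / 4\<close> the extension \<open>N\<close> equals \<open>m y - m 0\<close>.\<close>
  define \<rho> where "\<rho> = min d (r / 4)"
  define Z where "Z y = z ((1 / d) *\<^sub>R y)" for y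
  have dZ: "frechet_derivative Z (at y) v = (1 / d) *\<^sub>R frechet_derivative z (at ((1 / d) *\<^sub>R y)) v" for y v
  proof -
    let ?D = "frechet_derivative z (at ((1 / d) *\<^sub>R y))"
    have l: "linear ?D" using z(1) linear_frechet_derivative smooth_on_differentiable by blast
    have "((\<lambda>y. (1 / d) *\<^sub>R y) has_derivative (\<lambda>v. (1 / d) *\<^sub>R v)) (at y)" by (auto intro!: derivative_eq_intros)
    from has_derivative_compose[OF this, of z ?D] smooth_on_has_derivative[OF z(1)]
    have "(Z has_derivative (\<lambda>v. ?D ((1 / d) *\<^sub>R v))) (at y)" unfolding Z_def by auto
    from frechet_derivative_at[OF this] show ?thesis by (metis linear_cmul[OF l])
  qed
  have tr: "m 0 + trig (coeff2 (\<lambda>y. G (d, y))) ((1 / d) *\<^sub>R y) = m y" if y: "y \<in> ball 0 \<rho>" for y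
  proof -
    let ?y = "(1 / d) *\<^sub>R y"
    have n: "norm ?y \<le> 1" using y d by (simp add: \<rho>_def field_simps)
    have "\<bar>Re ?y\<bar> < pi" "\<bar>Im ?y\<bar> < pi"
      using abs_Re_le_cmod[of ?y] abs_Im_le_cmod[of ?y] n pi_ge_two by linarith+
    then have "trig (coeff2 (\<lambda>y. G (d, y))) ?y = G (d, ?y)" by (rule trig_coeff2[OF supp])
    also have "\<dots> = N y" using n d by (simp add: G_def bump_eq_1)
    also have "\<dots> = m y - m 0" by (rule N(2)) (use y in \<open>simp add: \<rho>_def\<close>)
    finally show ?thesis by simp
  qed
  show thesis
  proof (rule that[of \<rho> Z])
    show "\<rho> > 0" "\<rho> \<le> r" using d r by (auto simp: \<rho>_def)
    have "smooth_on Z UNIV" unfolding Z_def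
      by (rule smooth_on_compose[OF open_UNIV open_UNIV UNIV_I z(1)]) (intro smooth_intros open_UNIV)
    then show "smooth_on Z (ball 0 \<rho>)" using smooth_on_subset by blast
    show "frechet_derivative Z (at y) \<i> = m y * frechet_derivative Z (at y) 1" if "y \<in> ball 0 \<rho>" for y
      using z(2)[of "(1 / d) *\<^sub>R y"] unfolding tr[OF that] dZ by simp
    show "frechet_derivative Z (at y) 1 \<noteq> 0" if "y \<in> ball 0 \<rho>" for y
      using z(3) d by (simp add: dZ)
  qed
qed

section \<open>Integrating a covector field\<close>

lemma frechet_partial_sum:
  fixes q :: "real^'n::finite \<Rightarrow> 'b::real_normed_vector"
  assumes "q differentiable at x"
  shows "frechet_derivative q (at x) v = (\<Sum>k\<in>UNIV. v $ k *\<^sub>R partial k q x)"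
proof -
  have l: "linear (frechet_derivative q (at x))" by (rule linear_frechet_derivative[OF assms])
  have "v = (\<Sum>k\<in>UNIV. v $ k *\<^sub>R axis k 1)"
    by (simp add: vec_eq_iff axis_def if_distrib[of "\<lambda>c. _ * c"] cong: if_cong)
  then show ?thesis
    by (metis (no_types, lifting) linear_sum[OF l] linear_cmul[OF l] partial_def sum.cong)
qed

lemma frechet_partial_sum_complex:
  fixes q :: "real^'n::finite \<Rightarrow> complex"
  assumes "q differentiable at x"
  shows "frechet_derivative q (at x) v = (\<Sum>k\<in>UNIV. partial k q x * of_real (v $ k))"
  using frechet_partial_sum[OF assms] by (simp add: scaleR_conv_of_real mult.commute)

lemma ball_scale_less:
  fixes x :: "'a::real_normed_vector"
  assumes "C > 0" "x \<in> ball 0 (e / (C + 1))"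
  shows "C * norm x < e"
proof -
  have "norm x * (C + 1) < e" using assms by (simp add: field_simps)
  then have "C * norm x + norm x < e" by (simp add: algebra_simps)
  then show ?thesis using norm_ge_zero[of x] by linarith
qed

text \<open>The distribution is a graph over the coordinates outside \<open>S\<close>, so the fields
  have constant components there and their brackets have components in \<open>S\<close> only;
  \<open>invol\<close> thus says that they commute. For \<open>frobenius\<close> the fields with
  index in \<open>S\<close> are replaced by 0.\<close>

lemma frobenius_graph:
  fixes B :: "'n::finite \<Rightarrow> 'n \<Rightarrow> real^'n \<Rightarrow> real" and S :: "'n set"
  defines "Y \<equiv> \<lambda>j x. axis j 1 + (\<Sum>s\<in>S. B j s x *\<^sub>R axis s 1)"
  assumes r: "r > 0"
    and smooth: "\<And>j s. smooth_on (B j s) (ball 0 r)"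
    and invol: "\<And>j k s x. x \<in> ball 0 r \<Longrightarrow> j \<notin> S \<Longrightarrow> k \<notin> S \<Longrightarrow> s \<in> S \<Longrightarrow>
      frechet_derivative (B k s) (at x) (Y j x) = frechet_derivative (B j s) (at x) (Y k x)"
  obtains \<delta> C \<Phi> where "\<delta> > 0" "\<delta> \<le> r" "C > 0" "smooth_on \<Phi> (ball 0 \<delta>)"
    "\<And>x. x \<in> ball 0 \<delta> \<Longrightarrow> norm (\<Phi> x) \<le> C * norm x"
    "\<And>x k. x \<in> ball 0 \<delta> \<Longrightarrow> k \<notin> S \<Longrightarrow> \<Phi> x $ k = 0"
    "\<And>x s. x \<in> ball 0 \<delta> \<Longrightarrow> (\<And>k. k \<notin> S \<Longrightarrow> x $ k = 0) \<Longrightarrow> s \<in> S \<Longrightarrow>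
      frechet_derivative \<Phi> (at x) (axis s 1) = axis s 1"
    "\<And>x j. x \<in> ball 0 \<delta> \<Longrightarrow> j \<notin> S \<Longrightarrow> frechet_derivative \<Phi> (at x) (Y j x) = 0"
    "\<And>(q :: real^'n \<Rightarrow> complex) e x. x \<in> ball 0 \<delta> \<Longrightarrow> C * norm x < e \<Longrightarrow>
      (\<And>x. x \<in> ball 0 e \<Longrightarrow> q differentiable (at x)) \<Longrightarrow>
      (\<And>x j. x \<in> ball 0 e \<Longrightarrow> j \<notin> S \<Longrightarrow> frechet_derivative q (at x) (Y j x) = 0) \<Longrightarrow> q (\<Phi> x) = q x"
proof -
  define Y' where "Y' j x = (if j \<in> S then 0 else Y j x)" for j x
  have sY: "smooth_on (Y' j) (ball 0 r)" for j
    unfolding Y'_def Y_def by (cases "j \<in> S") (auto intro!: smooth_intros smooth)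
  have dY: "frechet_derivative (Y' k) (at x) v = (\<Sum>s\<in>S. frechet_derivative (B k s) (at x) v *\<^sub>R axis s 1)"
    if x: "x \<in> ball 0 r" and k: "k \<notin> S" for k x v
  proof -
    have H: "(Y' k has_derivative (\<lambda>v. 0 + (\<Sum>s\<in>S. frechet_derivative (B k s) (at x) v *\<^sub>R axis s 1))) (at x)"
    proof -
      have "Y' k = (\<lambda>x. axis k 1 + (\<Sum>s\<in>S. B k s x *\<^sub>R axis s 1))" using k by (auto simp: Y'_def Y_def)
      moreover have 1: "((\<lambda>x. B k s x *\<^sub>R (axis s 1 :: real^'n)) has_derivative
          (\<lambda>v. frechet_derivative (B k s) (at x) v *\<^sub>R axis s 1)) (at x)" for s
        by (rule has_derivative_scaleR_left[OF smooth_on_has_derivative[OF smooth x]])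
      have 2: "((\<lambda>x. \<Sum>s\<in>S. B k s x *\<^sub>R (axis s 1 :: real^'n)) has_derivative
          (\<lambda>v. \<Sum>s\<in>S. frechet_derivative (B k s) (at x) v *\<^sub>R axis s 1)) (at x)"
        by (rule has_derivative_sum) (rule 1)
      note has_derivative_add[OF has_derivative_const[of "axis k 1 :: real^'n"] 2]
      ultimately show ?thesis by simp
    qed
    show ?thesis using fun_cong[OF frechet_derivative_at[OF H], of v] by simp
  qed
  have comp: "Y' j x $ k = (if j = k then 1 else 0)" if "j \<notin> S" "k \<notin> S" for j k x
  proof -
    have "(\<Sum>s\<in>S. B j s x * axis s 1 $ k) = 0"
      using that by (intro sum.neutral) (auto simp: axis_def)
    then show ?thesis using that by (simp add: Y'_def Y_def axis_def)
  qed
  have inv: "frechet_derivative (Y' k) (at x) (Y' j x) = frechet_derivative (Y' j) (at x) (Y' k x)"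
    if x: "x \<in> ball 0 r" for j k x
  proof -
    have z: "frechet_derivative (Y' j) (at x) v = 0" if "j \<in> S" for j v
    proof -
      have "Y' j = (\<lambda>_. 0)" using that by (auto simp: Y'_def)
      then show ?thesis by simp
    qed
    have l: "frechet_derivative (Y' j) (at x) 0 = 0" for j
      using linear_0[OF linear_frechet_derivative[OF smooth_on_differentiable[OF sY x]]] .
    show ?thesis
    proof (cases "j \<in> S \<or> k \<in> S")
      case True
      then show ?thesis using z l by (auto simp: Y'_def)
    next
      case False
      then show ?thesis using dY[OF x] invol[OF x] by (simp add: Y'_def)
    qed
  qed
  obtain \<delta> C \<Phi> where \<delta>: "\<delta> > 0" "\<delta> \<le> r" "C > 0" and sm: "smooth_on \<Phi> (ball 0 \<delta>)"
    and bd: "\<And>x. x \<in> ball 0 \<delta> \<Longrightarrow> norm (\<Phi> x) \<le> C * norm x"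
    and z: "\<And>x k. x \<in> ball 0 \<delta> \<Longrightarrow> k \<notin> S \<Longrightarrow> \<Phi> x $ k = 0"
    and id: "\<And>x. x \<in> ball 0 \<delta> \<Longrightarrow> (\<And>k. k \<notin> S \<Longrightarrow> x $ k = 0) \<Longrightarrow> \<Phi> x = x"
    and d: "\<And>x j. x \<in> ball 0 \<delta> \<Longrightarrow> frechet_derivative \<Phi> (at x) (Y' j x) = 0"
    and q: "\<And>(q :: real^'n \<Rightarrow> complex) e x. x \<in> ball 0 \<delta> \<Longrightarrow> C * norm x < e \<Longrightarrow>
      (\<And>x. x \<in> ball 0 e \<Longrightarrow> q differentiable (at x)) \<Longrightarrow>
      (\<And>x j. x \<in> ball 0 e \<Longrightarrow> j \<notin> S \<Longrightarrow> frechet_derivative q (at x) (Y' j x) = 0) \<Longrightarrow> q (\<Phi> x) = q x"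
    by (rule frobenius[of r Y' S]) (use r sY comp inv in \<open>auto simp: Y'_def\<close>)
  show thesis
  proof (rule that[of \<delta> C \<Phi>])
    fix x :: "real^'n" and s assume x: "x \<in> ball 0 \<delta>" and k: "\<And>k. k \<notin> S \<Longrightarrow> x $ k = 0" and s: "s \<in> S"
    have "((\<lambda>t::real. x + t *\<^sub>R axis s 1) has_derivative (\<lambda>t. t *\<^sub>R axis s 1)) (at 0)"
      by (auto intro!: derivative_eq_intros)
    from has_derivative_compose[OF this, of \<Phi>] smooth_on_has_derivative[OF sm x]
    have "((\<lambda>t. \<Phi> (x + t *\<^sub>R axis s 1)) has_derivative (\<lambda>t. frechet_derivative \<Phi> (at x) (t *\<^sub>R axis s 1))) (at 0)"
      by simp
    moreover have op: "open ((\<lambda>t::real. x + t *\<^sub>R axis s 1) -` ball 0 \<delta>)"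
      by (intro open_vimage open_ball continuous_intros)
    \<comment> \<open>The line in direction \<open>axis s 1\<close> stays in the transversal, on
      which \<open>\<Phi>\<close> is the identity.\<close>
    have "((\<lambda>t. \<Phi> (x + t *\<^sub>R axis s 1)) has_derivative (\<lambda>t. t *\<^sub>R axis s 1)) (at 0)"
    proof (rule has_derivative_transform_within_open[OF _ op])
      show "((\<lambda>t::real. x + t *\<^sub>R axis s 1) has_derivative (\<lambda>t. t *\<^sub>R axis s 1)) (at 0)"
        by (auto intro!: derivative_eq_intros)
      show "x + t *\<^sub>R axis s 1 = \<Phi> (x + t *\<^sub>R axis s 1)" if "t \<in> (\<lambda>t::real. x + t *\<^sub>R axis s 1) -` ball 0 \<delta>" for t
        by (rule id[symmetric]) (use that k s in \<open>auto simp: axis_def\<close>)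
    qed (use x in simp)
    ultimately have "(\<lambda>t. frechet_derivative \<Phi> (at x) (t *\<^sub>R axis s 1)) = (\<lambda>t. t *\<^sub>R axis s 1)"
      by (rule has_derivative_unique)
    from fun_cong[OF this, of 1] show "frechet_derivative \<Phi> (at x) (axis s 1) = axis s 1" by simp
  next
    fix x :: "real^'n" and j assume "x \<in> ball 0 \<delta>" "j \<notin> S"
    then show "frechet_derivative \<Phi> (at x) (Y j x) = 0" using d[of x j] by (simp add: Y'_def)
  next
    fix q' :: "real^'n \<Rightarrow> complex" and e and x :: "real^'n"
    assume "x \<in> ball 0 \<delta>" "C * norm x < e" "\<And>x. x \<in> ball 0 e \<Longrightarrow> q' differentiable (at x)"
      "\<And>x j. x \<in> ball 0 e \<Longrightarrow> j \<notin> S \<Longrightarrow> frechet_derivative q' (at x) (Y j x) = 0"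
    then show "q' (\<Phi> x) = q' x" by (intro q) (auto simp: Y'_def)
  qed (use \<delta> sm bd z in auto)
qed

text \<open>The differential of \<omega> vanishes on pairs of kernel vectors; where \<omega> is
  nonzero this is the Frobenius condition that its wedge product with its differential be zero. The
  vectors are complex because a complex covector may have too few real vectors in its
  kernel.\<close>

definition kernel_closed :: "('n::finite \<Rightarrow> real^'n \<Rightarrow> complex) \<Rightarrow> (real^'n) set \<Rightarrow> bool" where
  "kernel_closed \<omega> U \<longleftrightarrow> (\<forall>u\<in>U. \<forall>v w :: 'n \<Rightarrow> complex.
     (\<Sum>k\<in>UNIV. \<omega> k u * v k) = 0 \<longrightarrow> (\<Sum>k\<in>UNIV. \<omega> k u * w k) = 0 \<longrightarrow>
     (\<Sum>k\<in>UNIV. \<Sum>l\<in>UNIV. (partial k (\<omega> l) u - partial l (\<omega> k) u) * v k * w l) = 0)"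

definition kernel_constant :: "('n::finite \<Rightarrow> real^'n \<Rightarrow> complex) \<Rightarrow> (real^'n \<Rightarrow> complex) \<Rightarrow> (real^'n) set \<Rightarrow> bool" where
  "kernel_constant \<omega> \<mu> U \<longleftrightarrow> (\<forall>u\<in>U. \<forall>v :: 'n \<Rightarrow> complex.
     (\<Sum>k\<in>UNIV. \<omega> k u * v k) = 0 \<longrightarrow> (\<Sum>k\<in>UNIV. partial k \<mu> u * v k) = 0)"

lemma kernel_constantD:
  "kernel_constant \<omega> \<mu> U \<Longrightarrow> u \<in> U \<Longrightarrow> (\<Sum>k\<in>UNIV. \<omega> k u * v k) = 0 \<Longrightarrow> (\<Sum>k\<in>UNIV. partial k \<mu> u * v k) = 0"
  unfolding kernel_constant_def by blast

text \<open>Holomorphy is asked on the image of \<phi> only. For a real \<phi> that image lies in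
  the real line and the condition is differentiability along it; for a \<phi> with independent real
  and imaginary differentials it is complex differentiability.\<close>

definition integrated_by :: "('n::finite \<Rightarrow> real^'n \<Rightarrow> complex) \<Rightarrow> (real^'n \<Rightarrow> complex) \<Rightarrow>
    (real^'n \<Rightarrow> complex) \<Rightarrow> (complex \<Rightarrow> complex) \<Rightarrow> (real^'n) set \<Rightarrow> bool" where
  "integrated_by \<omega> \<mu> \<phi> f V \<longleftrightarrow> smooth_on \<phi> V \<and>
     (\<forall>u\<in>V. \<exists>\<rho>. \<rho> \<noteq> 0 \<and> (\<forall>k. partial k \<phi> u = \<rho> * \<omega> k u)) \<and>
     (\<forall>u\<in>V. \<mu> u = f (\<phi> u)) \<and> f holomorphic_on (\<phi> ` V)"

text \<open>Closedness as an exchange of two directional derivatives, the form that can be compared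
  with commutation of vector fields in the kernel.\<close>

lemma kernel_closed_exterior:
  assumes c: "kernel_closed \<omega> U" and u: "u \<in> U"
    and v: "(\<Sum>k\<in>UNIV. \<omega> k u * v k) = 0" and w: "(\<Sum>k\<in>UNIV. \<omega> k u * w k) = 0"
  shows "(\<Sum>l\<in>UNIV. (\<Sum>k\<in>UNIV. partial k (\<omega> l) u * v k) * w l)
    = (\<Sum>l\<in>UNIV. (\<Sum>k\<in>UNIV. partial k (\<omega> l) u * w k) * v l)"
proof -
  have "(\<Sum>k\<in>UNIV. \<Sum>l\<in>UNIV. (partial k (\<omega> l) u - partial l (\<omega> k) u) * v k * w l) = 0"
    using c u v w unfolding kernel_closed_def by blast
  moreover have "(\<Sum>k\<in>UNIV. \<Sum>l\<in>UNIV. (partial k (\<omega> l) u - partial l (\<omega> k) u) * v k * w l)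
     = (\<Sum>k\<in>UNIV. \<Sum>l\<in>UNIV. partial k (\<omega> l) u * v k * w l) - (\<Sum>k\<in>UNIV. \<Sum>l\<in>UNIV. partial l (\<omega> k) u * w l * v k)"
    by (simp add: sum_subtractf algebra_simps)
  moreover have "(\<Sum>k\<in>UNIV. \<Sum>l\<in>UNIV. partial k (\<omega> l) u * v k * w l) = (\<Sum>l\<in>UNIV. (\<Sum>k\<in>UNIV. partial k (\<omega> l) u * v k) * w l)"
    by (subst sum.swap) (simp add: sum_distrib_right)
  moreover have "(\<Sum>k\<in>UNIV. \<Sum>l\<in>UNIV. partial l (\<omega> k) u * w l * v k) = (\<Sum>l\<in>UNIV. (\<Sum>k\<in>UNIV. partial k (\<omega> l) u * w k) * v l)"
    by (simp add: sum_distrib_right)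
  ultimately show ?thesis by simp
qed

section \<open>Integration of a real covector field\<close>

lemma continuous_nonzero_near:
  assumes "continuous_on (ball 0 r) f" "f 0 \<noteq> (0 :: 'b::real_normed_vector)" "r > 0"
  obtains d where "d > 0" "d \<le> r" "\<And>x. x \<in> ball (0::'a::real_normed_vector) d \<Longrightarrow> f x \<noteq> 0"
proof -
  obtain e where e: "e > 0" "\<And>x. x \<in> ball 0 r \<Longrightarrow> dist x 0 < e \<Longrightarrow> dist (f x) (f 0) < norm (f 0)"
    using assms unfolding continuous_on_iff by (metis centre_in_ball zero_less_norm_iff)
  show thesis
  proof (rule that[of "min r e"])
    fix x :: 'a assume "x \<in> ball 0 (min r e)"
    then show "f x \<noteq> 0" using e(2)[of x] by (auto simp: dist_norm)
  qed (use assms e in auto)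
qed

lemma sum_axis_left:
  fixes f :: "'n::finite \<Rightarrow> 'b::real_normed_field"
  shows "(\<Sum>k\<in>UNIV. f k * of_real (axis a c $ k)) = f a * of_real c"
  by (simp add: axis_def if_distrib[of "\<lambda>c. _ * c"] if_distrib[of of_real] cong: if_cong)

text \<open>Within a set of reals only real increments are tested, so a derivative in the real
  variable already serves as a complex one. It provides the holomorphy demanded by
  \<open>integrated_by\<close> for a real coordinate.\<close>

lemma differentiable_real_field_derivative:
  assumes h: "(h has_vector_derivative h') (at t)" and S: "S \<subseteq> \<real>"
  shows "((\<lambda>w. h (Re w)) has_field_derivative h') (at (complex_of_real t) within S)"
  unfolding has_field_derivative_def has_derivative_within_alt
proof (intro conjI allI impI bounded_linear_mult_right)
  fix e :: real assume "e > 0"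
  then obtain d where d: "d > 0" "\<And>y. norm (y - t) < d \<Longrightarrow> norm (h y - h t - (y - t) *\<^sub>R h') \<le> e * norm (y - t)"
    using h unfolding has_vector_derivative_def has_derivative_within_alt by blast
  show "\<exists>d>0. \<forall>y\<in>S. norm (y - of_real t) < d \<longrightarrow>
      norm (h (Re y) - h (Re (of_real t)) - h' * (y - of_real t)) \<le> e * norm (y - of_real t)"
  proof (intro exI[of _ d] conjI ballI impI d(1))
    fix y assume "y \<in> S" and y: "norm (y - of_real t) < d"
    then obtain s where s: "y = of_real s" using S by (auto elim: Reals_cases)
    have n: "norm (y - of_real t) = norm (s - t)" unfolding s by (metis norm_of_real of_real_diff real_norm_def)
    then show "norm (h (Re y) - h (Re (of_real t)) - h' * (y - of_real t)) \<le> e * norm (y - of_real t)"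
      using d(2)[of s] y by (simp add: s scaleR_conv_of_real mult.commute)
  qed
qed

text \<open>The normalisation of component \<open>a\<close> presents the kernel as a graph over the
  other coordinates. The new coordinate is the position at which the leaf through a point meets the
  \<open>a\<close> axis, and \<mu>, being constant on leaves, can be read off there.\<close>

lemma integrated_real:
  fixes \<omega> :: "'n::finite \<Rightarrow> real^'n \<Rightarrow> complex"
  assumes r: "r > 0" and \<omega>: "\<And>k. smooth_on (\<omega> k) (ball 0 r)"
    and a: "\<And>x. x \<in> ball 0 r \<Longrightarrow> \<omega> a x = 1"
    and re: "\<And>k x. x \<in> ball 0 r \<Longrightarrow> Im (\<omega> k x) = 0"
    and cl: "kernel_closed \<omega> (ball 0 r)" and \<mu>: "smooth_on \<mu> (ball 0 r)" "kernel_constant \<omega> \<mu> (ball 0 r)"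
  obtains \<delta> \<phi> f where "\<delta> > 0" "\<delta> \<le> r" "integrated_by \<omega> \<mu> \<phi> f (ball 0 \<delta>)" "\<And>x. \<phi> x \<in> \<real>"
proof -
  define B where "B j s x = - Re (\<omega> j x)" for j s :: 'n and x
  define Y :: "'n \<Rightarrow> real^'n \<Rightarrow> real^'n" where "Y j x = axis j 1 + (\<Sum>s\<in>{a}. B j s x *\<^sub>R axis s 1)" for j x
  have Yc: "(\<Sum>k\<in>UNIV. f k * of_real (Y j x $ k)) = f j - of_real (Re (\<omega> j x)) * f a" for f :: "'n \<Rightarrow> complex" and j x
  proof -
    have "(\<Sum>k\<in>UNIV. f k * of_real (Y j x $ k)) = (\<Sum>k\<in>UNIV. f k * of_real (axis j 1 $ k)) + of_real (B j a x) * (\<Sum>k\<in>UNIV. f k * of_real (axis a 1 $ k))"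
      by (simp add: Y_def sum.distrib sum_distrib_left algebra_simps)
    then show ?thesis unfolding sum_axis_left by (simp add: B_def)
  qed
  have om: "\<omega> k x = of_real (Re (\<omega> k x))" if "x \<in> ball 0 r" for k x
    using re[OF that] by (simp add: complex_eq_iff)
  have ker: "(\<Sum>k\<in>UNIV. \<omega> k x * of_real (Y j x $ k)) = 0" if "x \<in> ball 0 r" for j x
    unfolding Yc using om[OF that, of j] a[OF that] by simp
  have sRe: "smooth_on (\<lambda>x. Re (\<omega> j x)) (ball 0 r)" for j
    by (rule smooth_on_linear_compose[OF bounded_linear_Re open_ball \<omega>])
  have sB: "smooth_on (B j s) (ball 0 r)" for j s
    unfolding B_def by (rule smooth_on_minus[OF open_ball sRe])
  note fd = frechet_partial_sum_complex
  have Da: "partial k (\<omega> a) x = 0" if "x \<in> ball 0 r" for k x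
    using frechet_derivative_cong[OF open_ball that, of "\<omega> a" "\<lambda>_. 1"] a by (simp add: partial_def)
  obtain \<delta> C \<Phi> where \<delta>: "\<delta> > 0" "\<delta> \<le> r" "C > 0" and sm: "smooth_on \<Phi> (ball 0 \<delta>)"
    and bd: "\<And>x. x \<in> ball 0 \<delta> \<Longrightarrow> norm (\<Phi> x) \<le> C * norm x"
    and z: "\<And>x k. x \<in> ball 0 \<delta> \<Longrightarrow> k \<notin> {a} \<Longrightarrow> \<Phi> x $ k = 0"
    and id: "\<And>x s. x \<in> ball 0 \<delta> \<Longrightarrow> (\<And>k. k \<notin> {a} \<Longrightarrow> x $ k = 0) \<Longrightarrow> s \<in> {a} \<Longrightarrow>
      frechet_derivative \<Phi> (at x) (axis s 1) = axis s 1"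
    and d: "\<And>x j. x \<in> ball 0 \<delta> \<Longrightarrow> j \<notin> {a} \<Longrightarrow> frechet_derivative \<Phi> (at x) (Y j x) = 0"
    and q: "\<And>(q :: real^'n \<Rightarrow> complex) e x. x \<in> ball 0 \<delta> \<Longrightarrow> C * norm x < e \<Longrightarrow>
      (\<And>x. x \<in> ball 0 e \<Longrightarrow> q differentiable (at x)) \<Longrightarrow>
      (\<And>x j. x \<in> ball 0 e \<Longrightarrow> j \<notin> {a} \<Longrightarrow> frechet_derivative q (at x) (Y j x) = 0) \<Longrightarrow> q (\<Phi> x) = q x"
    unfolding Y_def
  proof (rule frobenius_graph[of r B "{a}"])
    fix j k s and x :: "real^'n" assume x: "x \<in> ball 0 r"
    have dB: "of_real (frechet_derivative (B k s) (at x) v) = - (\<Sum>l\<in>UNIV. partial l (\<omega> k) x * of_real (v $ l))" for k v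
    proof -
      have "frechet_derivative (B k s) (at x) v = - Re (frechet_derivative (\<omega> k) (at x) v)"
        unfolding B_def
        by (rule frechet_derivative_linear_compose[OF bounded_linear_minus[OF bounded_linear_Re] smooth_on_differentiable[OF \<omega> x]])
      moreover have "Im (frechet_derivative (\<omega> k) (at x) v) = 0"
      proof -
        have "frechet_derivative (\<lambda>x. Im (\<omega> k x)) (at x) v = Im (frechet_derivative (\<omega> k) (at x) v)"
          by (rule frechet_derivative_linear_compose[OF bounded_linear_Im smooth_on_differentiable[OF \<omega> x]])
        moreover have "frechet_derivative (\<lambda>x. Im (\<omega> k x)) (at x) = frechet_derivative (\<lambda>_. 0) (at x)"
          by (rule frechet_derivative_cong[OF open_ball x]) (rule re)
        ultimately show ?thesis by simp
      qed
      ultimately show ?thesis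
        unfolding fd[OF smooth_on_differentiable[OF \<omega> x], symmetric] by (simp add: complex_eq_iff)
    qed
    let ?v = "\<lambda>l. complex_of_real (Y j x $ l)" and ?w = "\<lambda>l. complex_of_real (Y k x $ l)"
    \<comment> \<open>As \<open>\<omega> a\<close> is constantly 1, its derivatives drop out, and
      closedness on the pair \<open>Y j\<close>, \<open>Y k\<close> becomes the equality of the two
      directional derivatives of the coefficients.\<close>
    have "complex_of_real (frechet_derivative (B k s) (at x) (Y j x)) = complex_of_real (frechet_derivative (B j s) (at x) (Y k x))"
      using kernel_closed_exterior[OF cl x ker[OF x, of j] ker[OF x, of k]]
      unfolding Yc[of "\<lambda>l. \<Sum>i\<in>UNIV. partial i (\<omega> l) x * of_real (Y _ x $ i)"] dB by (simp add: Da[OF x])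
    then show "frechet_derivative (B k s) (at x) (axis j 1 + (\<Sum>s\<in>{a}. B j s x *\<^sub>R axis s 1)) =
        frechet_derivative (B j s) (at x) (axis k 1 + (\<Sum>s\<in>{a}. B k s x *\<^sub>R axis s 1))"
      unfolding Y_def by (simp only: of_real_eq_iff)
  qed (use r sB in auto)
  define \<phi> where "\<phi> x = complex_of_real (\<Phi> x $ a)" for x
  have bl: "bounded_linear (\<lambda>v::real^'n. complex_of_real (v $ a))"
    by (rule bounded_linear_compose[OF bounded_linear_of_real bounded_linear_vec_nth])
  have s\<phi>: "smooth_on \<phi> (ball 0 \<delta>)" unfolding \<phi>_def by (rule smooth_on_linear_compose[OF bl open_ball sm])
  have d\<phi>: "frechet_derivative \<phi> (at x) v = of_real (frechet_derivative \<Phi> (at x) v $ a)" if "x \<in> ball 0 \<delta>" for x v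
    unfolding \<phi>_def by (rule frechet_derivative_linear_compose[OF bl smooth_on_differentiable[OF sm that]])
  have pk: "partial k \<phi> x = partial a \<phi> x * \<omega> k x" if x: "x \<in> ball 0 \<delta>" for k x
  proof (cases "k = a")
    case True
    then show ?thesis using a x \<delta> by simp
  next
    case False
    have "frechet_derivative \<phi> (at x) (Y k x) = 0" using d[OF x, of k] False by (simp add: d\<phi>[OF x])
    then have "partial k \<phi> x - of_real (Re (\<omega> k x)) * partial a \<phi> x = 0"
      unfolding fd[OF smooth_on_differentiable[OF s\<phi> x]] Yc .
    then show ?thesis using om[of x k] x \<delta> by (simp add: mult.commute)
  qed
  have "partial a \<phi> 0 = 1" using id[of 0 a] \<delta> by (simp add: partial_def d\<phi>)
  then obtain \<delta>1 where \<delta>1: "\<delta>1 > 0" "\<delta>1 \<le> \<delta>" "\<And>x. x \<in> ball 0 \<delta>1 \<Longrightarrow> partial a \<phi> x \<noteq> 0"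
    using continuous_nonzero_near[OF smooth_on_continuous[OF smooth_on_partial[OF s\<phi>]], of a] \<delta> by auto
  \<comment> \<open>Within this radius the curve leading to the transversal stays in the ball of
    radius \<open>r\<close>, on which \<mu> is known to be constant along the fields.\<close>
  define \<delta>2 where "\<delta>2 = min \<delta>1 (r / (C + 1))"
  have \<delta>2: "\<delta>2 > 0" "\<delta>2 \<le> \<delta>1" "\<delta>2 \<le> r / (C + 1)" using \<delta>1 r \<delta> by (auto simp: \<delta>2_def)
  have Cr: "C * norm x < r" if "x \<in> ball 0 \<delta>2" for x :: "real^'n"
    using ball_scale_less[OF \<delta>(3)] \<delta>2(3) that by (meson subsetD subset_ball)
  define h where "h t = \<mu> (t *\<^sub>R axis a 1)" for t
  have \<Phi>a: "\<Phi> x = (\<Phi> x $ a) *\<^sub>R axis a 1" if "x \<in> ball 0 \<delta>" for x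
    using z[OF that] by (auto simp: vec_eq_iff axis_def)
  have \<mu>eq: "\<mu> x = h (Re (\<phi> x))" if x: "x \<in> ball 0 \<delta>2" for x
  proof -
    have x': "x \<in> ball 0 \<delta>" using x \<delta>2 \<delta>1 by auto
    have "\<mu> (\<Phi> x) = \<mu> x"
    proof (rule q[OF x' Cr[OF x]])
      fix y :: "real^'n" and j assume y: "y \<in> ball 0 r"
      show "\<mu> differentiable at y" by (rule smooth_on_differentiable[OF \<mu>(1) y])
      show "frechet_derivative \<mu> (at y) (Y j y) = 0"
        unfolding fd[OF smooth_on_differentiable[OF \<mu>(1) y]]
        by (rule kernel_constantD[OF \<mu>(2) y ker[OF y]])
    qed
    then show ?thesis using \<Phi>a[OF x'] by (simp add: h_def \<phi>_def)
  qed
  show thesis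
  proof (rule that[of \<delta>2 \<phi> "\<lambda>w. h (Re w)"])
    show "integrated_by \<omega> \<mu> \<phi> (\<lambda>w. h (Re w)) (ball 0 \<delta>2)"
      unfolding integrated_by_def
    proof (intro conjI ballI)
      show "smooth_on \<phi> (ball 0 \<delta>2)" by (rule smooth_on_subset[OF s\<phi>]) (use \<delta>1 \<delta>2 in auto)
      fix u :: "real^'n" assume u: "u \<in> ball 0 \<delta>2"
      show "\<exists>\<rho>. \<rho> \<noteq> 0 \<and> (\<forall>k. partial k \<phi> u = \<rho> * \<omega> k u)"
      proof (intro exI conjI allI)
        show "partial a \<phi> u \<noteq> 0" by (rule \<delta>1(3)) (use \<delta>2 u in auto)
        show "partial k \<phi> u = partial a \<phi> u * \<omega> k u" for k by (rule pk) (use \<delta>1 \<delta>2 u in auto)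
      qed
      show "\<mu> u = h (Re (\<phi> u))" by (rule \<mu>eq[OF u])
    next
      show "(\<lambda>w. h (Re w)) holomorphic_on \<phi> ` ball 0 \<delta>2"
        unfolding holomorphic_on_def
      proof
        fix w assume "w \<in> \<phi> ` ball 0 \<delta>2"
        then obtain x where x: "x \<in> ball 0 \<delta>2" "w = \<phi> x" by blast
        have x': "x \<in> ball 0 \<delta>" using x \<delta>2 \<delta>1 by auto
        have "\<Phi> x \<in> ball 0 r" using bd[OF x'] Cr[OF x(1)] by simp
        then have *: "(\<Phi> x $ a) *\<^sub>R (axis a 1 :: real^'n) \<in> ball 0 r" by (subst (asm) \<Phi>a[OF x'])
        have "((\<lambda>t::real. t *\<^sub>R axis a 1 :: real^'n) has_derivative (\<lambda>t. t *\<^sub>R axis a 1)) (at (\<Phi> x $ a))"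
          by (auto intro!: derivative_eq_intros)
        from has_derivative_compose[OF this smooth_on_has_derivative[OF \<mu>(1) *]]
        have "((\<lambda>t. \<mu> (t *\<^sub>R axis a 1)) has_derivative (\<lambda>t. frechet_derivative \<mu> (at ((\<Phi> x $ a) *\<^sub>R axis a 1)) (t *\<^sub>R axis a 1))) (at (\<Phi> x $ a))"
          .
        then have "(h has_vector_derivative frechet_derivative \<mu> (at ((\<Phi> x $ a) *\<^sub>R axis a 1)) (axis a 1)) (at (\<Phi> x $ a))"
          unfolding has_vector_derivative_def h_def
          using linear_cmul[OF linear_frechet_derivative[OF smooth_on_differentiable[OF \<mu>(1) *]]] by simp
        moreover have "\<phi> ` ball 0 \<delta>2 \<subseteq> \<real>" by (auto simp: \<phi>_def)
        ultimately show "(\<lambda>w. h (Re w)) field_differentiable at w within \<phi> ` ball 0 \<delta>2"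
          unfolding field_differentiable_def x(2) \<phi>_def[of x] by (intro exI differentiable_real_field_derivative)
      qed
    qed
  qed (use \<delta> \<delta>1 \<delta>2 in \<open>auto simp: \<phi>_def\<close>)
qed

section \<open>Integration of a complex covector field\<close>

lemma cnj_independent_zero:
  assumes "of_real s + w * of_real t = (0 :: complex)" "Im w \<noteq> 0"
  shows "s = 0" "t = 0"
proof -
  show "t = 0" using arg_cong[OF assms(1), of Im] assms(2) by simp
  then show "s = 0" using arg_cong[OF assms(1), of Re] by simp
qed

text \<open>Frobenius reduces to the transversal plane of the variables \<open>a\<close>, \<open>b\<close>, identified with the
  complex numbers, where the required coordinate solves a Beltrami equation with coefficient \<open>\<omega> b\<close>.\<close>

lemma integrated_complex:
  fixes \<omega> :: "'n::finite \<Rightarrow> real^'n \<Rightarrow> complex"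
  assumes r: "r > 0" and \<omega>: "\<And>k. smooth_on (\<omega> k) (ball 0 r)"
    and a: "\<And>x. x \<in> ball 0 r \<Longrightarrow> \<omega> a x = 1"
    and im: "\<And>x. x \<in> ball 0 r \<Longrightarrow> Im (\<omega> b x) \<noteq> 0"
    and cl: "kernel_closed \<omega> (ball 0 r)" and \<mu>: "smooth_on \<mu> (ball 0 r)" "kernel_constant \<omega> \<mu> (ball 0 r)"
  obtains \<delta> \<phi> f where "\<delta> > 0" "\<delta> \<le> r" "integrated_by \<omega> \<mu> \<phi> f (ball 0 \<delta>)"
proof -
  have r0: "0 \<in> ball (0::real^'n) r" using r by simp
  have ab: "a \<noteq> b" using a[OF r0] im[OF r0] by auto
  \<comment> \<open>\<open>Y j\<close> is to be a real vector in the kernel. The imaginary and the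
    real part of the single equation \<open>rel\<close> determine the two real coefficients \<beta>
    and \<alpha>, which is possible because \<open>Im (\<omega> b x) \<noteq> 0\<close>.\<close>
  define \<beta> where "\<beta> j x = - Im (\<omega> j x) / Im (\<omega> b x)" for j x
  define \<alpha> where "\<alpha> j x = - Re (\<omega> j x) - \<beta> j x * Re (\<omega> b x)" for j x
  define B where "B j s x = (if s = a then \<alpha> j x else \<beta> j x)" for j s x
  define Y :: "'n \<Rightarrow> real^'n \<Rightarrow> real^'n" where "Y j x = axis j 1 + (\<Sum>s\<in>{a, b}. B j s x *\<^sub>R axis s 1)" for j x
  have Y_eq: "Y j x = axis j 1 + \<alpha> j x *\<^sub>R axis a 1 + \<beta> j x *\<^sub>R axis b 1" for j x
    using ab by (simp add: Y_def B_def)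
  have rel: "\<omega> j x + of_real (\<alpha> j x) + \<omega> b x * of_real (\<beta> j x) = 0" if "x \<in> ball 0 r" for j x
    using im[OF that] by (simp add: complex_eq_iff \<alpha>_def \<beta>_def)
  have Yc: "(\<Sum>k\<in>UNIV. f k * of_real (Y j x $ k)) = f j + of_real (\<alpha> j x) * f a + of_real (\<beta> j x) * f b"
    for f :: "'n \<Rightarrow> complex" and j x
  proof -
    have "(\<Sum>k\<in>UNIV. f k * of_real (Y j x $ k)) = (\<Sum>k\<in>UNIV. f k * of_real (axis j 1 $ k)) +
        of_real (\<alpha> j x) * (\<Sum>k\<in>UNIV. f k * of_real (axis a 1 $ k)) + of_real (\<beta> j x) * (\<Sum>k\<in>UNIV. f k * of_real (axis b 1 $ k))"
      by (simp add: Y_eq sum.distrib sum_distrib_left algebra_simps)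
    then show ?thesis unfolding sum_axis_left by simp
  qed
  have ker: "(\<Sum>k\<in>UNIV. \<omega> k x * of_real (Y j x $ k)) = 0" if "x \<in> ball 0 r" for j x
    unfolding Yc using rel[OF that, of j] a[OF that] by (simp add: mult.commute)
  \<comment> \<open>The vector \<open>axis b 1 - \<omega> b x * axis a 1\<close>: the one direction
    of the complex kernel that the real vectors \<open>Y j\<close> leave out.\<close>
  define Z where "Z x k = (if k = b then 1 else if k = a then - \<omega> b x else 0)" for x k
  have Zc: "(\<Sum>k\<in>UNIV. f k * Z x k) = f b - \<omega> b x * f a" for f :: "'n \<Rightarrow> complex" and x
  proof -
    have "(\<Sum>k\<in>UNIV. f k * Z x k) = (\<Sum>k\<in>UNIV. (if k = b then f b else 0) + (if k = a then - \<omega> b x * f a else 0))"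
      by (rule sum.cong) (use ab in \<open>auto simp: Z_def\<close>)
    then show ?thesis by (simp add: sum.distrib)
  qed
  have kerZ: "(\<Sum>k\<in>UNIV. \<omega> k x * Z x k) = 0" if "x \<in> ball 0 r" for x
    unfolding Zc using a[OF that] by simp
  have sRe: "smooth_on (\<lambda>x. Re (\<omega> j x)) (ball 0 r)" and sIm: "smooth_on (\<lambda>x. Im (\<omega> j x)) (ball 0 r)" for j
    by (rule smooth_on_linear_compose[OF _ open_ball \<omega>], rule bounded_linear_Re bounded_linear_Im)+
  have s\<beta>: "smooth_on (\<beta> j) (ball 0 r)" for j
    unfolding \<beta>_def by (intro smooth_intros sIm open_ball im)
  have s\<alpha>: "smooth_on (\<alpha> j) (ball 0 r)" for j
    unfolding \<alpha>_def by (intro smooth_intros sRe s\<beta> open_ball)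
  have sB: "smooth_on (B j s) (ball 0 r)" for j s
    unfolding B_def using s\<alpha> s\<beta> by (cases "s = a") auto
  note fd = frechet_partial_sum_complex
  have Da: "partial k (\<omega> a) x = 0" if "x \<in> ball 0 r" for k x
    using frechet_derivative_cong[OF open_ball that, of "\<omega> a" "\<lambda>_. 1"] a by (simp add: partial_def)
  have drel: "partial k (\<omega> j) x = - of_real (partial k (\<alpha> j) x) - partial k (\<omega> b) x * of_real (\<beta> j x) - \<omega> b x * of_real (partial k (\<beta> j) x)"
    if x: "x \<in> ball 0 r" for j k x
  proof -
    have "((\<lambda>x. - of_real (\<alpha> j x) - \<omega> b x * of_real (\<beta> j x)) has_derivative
       (\<lambda>v. - of_real (frechet_derivative (\<alpha> j) (at x) v) - (\<omega> b x * of_real (frechet_derivative (\<beta> j) (at x) v) + frechet_derivative (\<omega> b) (at x) v * of_real (\<beta> j x)))) (at x)"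
      by (intro has_derivative_diff has_derivative_minus has_derivative_mult has_derivative_of_real
          smooth_on_has_derivative[OF s\<alpha> x] smooth_on_has_derivative[OF s\<beta> x] smooth_on_has_derivative[OF \<omega> x])
    from frechet_derivative_at[OF this]
    have D: "frechet_derivative (\<lambda>x. - of_real (\<alpha> j x) - \<omega> b x * of_real (\<beta> j x)) (at x) =
      (\<lambda>v. - of_real (frechet_derivative (\<alpha> j) (at x) v) - (\<omega> b x * of_real (frechet_derivative (\<beta> j) (at x) v) + frechet_derivative (\<omega> b) (at x) v * of_real (\<beta> j x)))" ..
    have "\<omega> j y = - of_real (\<alpha> j y) - \<omega> b y * of_real (\<beta> j y)" if "y \<in> ball 0 r" for y
      using rel[OF that, of j] by (simp add: add_eq_0_iff2 add.assoc)
    from frechet_derivative_cong[OF open_ball x this] D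
    have "frechet_derivative (\<omega> j) (at x) = (\<lambda>v. - of_real (frechet_derivative (\<alpha> j) (at x) v) - (\<omega> b x * of_real (frechet_derivative (\<beta> j) (at x) v) + frechet_derivative (\<omega> b) (at x) v * of_real (\<beta> j x)))"
      by (rule trans)
    then show ?thesis by (simp add: partial_def algebra_simps)
  qed
  have dRe: "(\<Sum>k\<in>UNIV. of_real (partial k q x) * of_real (v $ k)) = complex_of_real (frechet_derivative q (at x) v)"
    if "q differentiable at x" for q :: "real^'n \<Rightarrow> real" and x v
  proof -
    have "frechet_derivative q (at x) v = (\<Sum>k\<in>UNIV. partial k q x * v $ k)"
      unfolding frechet_partial_sum[OF that, of v] by (simp add: mult.commute)
    then show ?thesis by simp
  qed
  have dwY: "(\<Sum>k\<in>UNIV. partial k (\<omega> j) x * of_real (v $ k)) = - of_real (frechet_derivative (\<alpha> j) (at x) v)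
     - (\<Sum>k\<in>UNIV. partial k (\<omega> b) x * of_real (v $ k)) * of_real (\<beta> j x) - \<omega> b x * of_real (frechet_derivative (\<beta> j) (at x) v)"
    if x: "x \<in> ball 0 r" for j x v
  proof -
    have "(\<Sum>k\<in>UNIV. partial k (\<omega> j) x * of_real (v $ k)) =
      - (\<Sum>k\<in>UNIV. of_real (partial k (\<alpha> j) x) * of_real (v $ k)) - (\<Sum>k\<in>UNIV. partial k (\<omega> b) x * of_real (v $ k)) * of_real (\<beta> j x)
      - \<omega> b x * (\<Sum>k\<in>UNIV. of_real (partial k (\<beta> j) x) * of_real (v $ k))"
      unfolding sum_distrib_left sum_distrib_right sum_negf[symmetric] sum_subtractf[symmetric]
      by (rule sum.cong[OF refl]) (simp add: drel[OF x, of _ j] algebra_simps)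
    then show ?thesis
      unfolding dRe[OF smooth_on_differentiable[OF s\<alpha> x]] dRe[OF smooth_on_differentiable[OF s\<beta> x]] .
  qed
  obtain \<delta> C \<Phi> where \<delta>: "\<delta> > 0" "\<delta> \<le> r" "C > 0" and sm: "smooth_on \<Phi> (ball 0 \<delta>)"
    and bd: "\<And>x. x \<in> ball 0 \<delta> \<Longrightarrow> norm (\<Phi> x) \<le> C * norm x"
    and z: "\<And>x k. x \<in> ball 0 \<delta> \<Longrightarrow> k \<notin> {a, b} \<Longrightarrow> \<Phi> x $ k = 0"
    and id: "\<And>x s. x \<in> ball 0 \<delta> \<Longrightarrow> (\<And>k. k \<notin> {a, b} \<Longrightarrow> x $ k = 0) \<Longrightarrow> s \<in> {a, b} \<Longrightarrow>
      frechet_derivative \<Phi> (at x) (axis s 1) = axis s 1"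
    and d: "\<And>x j. x \<in> ball 0 \<delta> \<Longrightarrow> j \<notin> {a, b} \<Longrightarrow> frechet_derivative \<Phi> (at x) (Y j x) = 0"
    and q: "\<And>(q :: real^'n \<Rightarrow> complex) e x. x \<in> ball 0 \<delta> \<Longrightarrow> C * norm x < e \<Longrightarrow>
      (\<And>x. x \<in> ball 0 e \<Longrightarrow> q differentiable (at x)) \<Longrightarrow>
      (\<And>x j. x \<in> ball 0 e \<Longrightarrow> j \<notin> {a, b} \<Longrightarrow> frechet_derivative q (at x) (Y j x) = 0) \<Longrightarrow> q (\<Phi> x) = q x"
    unfolding Y_def
  proof (rule frobenius_graph[of r B "{a, b}"])
    fix j k s and x :: "real^'n" assume x: "x \<in> ball 0 r"
    have "of_real (frechet_derivative (\<alpha> k) (at x) (Y j x) - frechet_derivative (\<alpha> j) (at x) (Y k x))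
      + \<omega> b x * of_real (frechet_derivative (\<beta> k) (at x) (Y j x) - frechet_derivative (\<beta> j) (at x) (Y k x)) = 0"
      using kernel_closed_exterior[OF cl x ker[OF x, of j] ker[OF x, of k]]
      unfolding Yc[of "\<lambda>l. \<Sum>i\<in>UNIV. partial i (\<omega> l) x * of_real (Y _ x $ i)"] dwY[OF x, of j] dwY[OF x, of k]
      by (simp add: Da[OF x] algebra_simps)
    from cnj_independent_zero[OF this im[OF x]]
    show "frechet_derivative (B k s) (at x) (axis j 1 + (\<Sum>s\<in>{a, b}. B j s x *\<^sub>R axis s 1)) =
        frechet_derivative (B j s) (at x) (axis k 1 + (\<Sum>s\<in>{a, b}. B k s x *\<^sub>R axis s 1))"
      unfolding Y_def[symmetric] unfolding B_def by (cases "s = a") simp_all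
  qed (use r sB in auto)
  note C0 = ball_scale_less[OF \<delta>(3)]
  define P where "P x = Complex (\<Phi> x $ a) (\<Phi> x $ b)" for x
  define \<iota> where "\<iota> y = Re y *\<^sub>R axis a 1 + Im y *\<^sub>R (axis b 1 :: real^'n)" for y
  have bl\<iota>: "bounded_linear \<iota>" unfolding \<iota>_def
    by (intro bounded_linear_add bounded_linear_compose[OF bounded_linear_scaleR_left] bounded_linear_Re bounded_linear_Im)
  have \<iota>1: "\<iota> 1 = axis a 1" "\<iota> \<i> = axis b 1" by (simp_all add: \<iota>_def)
  have \<iota>P: "\<iota> (P x) = \<Phi> x" if "x \<in> ball 0 \<delta>" for x
    using z[OF that] ab by (auto simp: \<iota>_def P_def vec_eq_iff axis_def)
  have n\<iota>: "norm (\<iota> y) \<le> 2 * norm y" for y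
  proof -
    have "norm (\<iota> y) \<le> \<bar>Re y\<bar> + \<bar>Im y\<bar>" unfolding \<iota>_def by (rule order_trans[OF norm_triangle_ineq]) simp
    then show ?thesis using abs_Re_le_cmod[of y] abs_Im_le_cmod[of y] by linarith
  qed
  have \<iota>r: "\<iota> y \<in> ball 0 r" if "y \<in> ball 0 (r / 2)" for y using n\<iota>[of y] that by simp
  have blP: "bounded_linear (\<lambda>v::real^'n. Complex (v $ a) (v $ b))"
    unfolding Complex_eq
    by (intro bounded_linear_add bounded_linear_const_mult bounded_linear_compose[OF bounded_linear_of_real bounded_linear_vec_nth])
  have sP: "smooth_on P (ball 0 \<delta>)" unfolding P_def by (rule smooth_on_linear_compose[OF blP open_ball sm])
  have dP: "frechet_derivative P (at x) v = Complex (frechet_derivative \<Phi> (at x) v $ a) (frechet_derivative \<Phi> (at x) v $ b)"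
    if "x \<in> ball 0 \<delta>" for x v
    unfolding P_def by (rule frechet_derivative_linear_compose[OF blP smooth_on_differentiable[OF sm that]])
  have nP: "norm (P x) \<le> 2 * (C * norm x)" if "x \<in> ball 0 \<delta>" for x
  proof -
    have "norm (P x) \<le> \<bar>\<Phi> x $ a\<bar> + \<bar>\<Phi> x $ b\<bar>" using cmod_le[of "P x"] by (simp add: P_def)
    then show ?thesis using component_le_norm_cart[of "\<Phi> x" a] component_le_norm_cart[of "\<Phi> x" b] bd[OF that] by linarith
  qed
  define \<psi> where "\<psi> s x = complex_of_real (\<Phi> x $ s)" for s x
  have bls: "bounded_linear (\<lambda>v::real^'n. complex_of_real (v $ s))" for s
    by (rule bounded_linear_compose[OF bounded_linear_of_real bounded_linear_vec_nth])
  have s\<psi>: "smooth_on (\<psi> s) (ball 0 \<delta>)" for s unfolding \<psi>_def by (rule smooth_on_linear_compose[OF bls open_ball sm])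
  have d\<psi>: "frechet_derivative (\<psi> s) (at x) v = of_real (frechet_derivative \<Phi> (at x) v $ s)" if "x \<in> ball 0 \<delta>" for s x v
    unfolding \<psi>_def by (rule frechet_derivative_linear_compose[OF bls smooth_on_differentiable[OF sm that]])
  \<comment> \<open>The equation expressing that \<open>\<psi> s\<close> is constant along
    \<open>Y j\<close>, in components. Its derivatives in \<open>dE\<close> show how
    \<open>Y j\<close> acts on the partial derivatives of \<open>\<psi> s\<close>.\<close>
  have E: "partial j (\<psi> s) x + of_real (\<alpha> j x) * partial a (\<psi> s) x + of_real (\<beta> j x) * partial b (\<psi> s) x = 0"
    if x: "x \<in> ball 0 \<delta>" and j: "j \<notin> {a, b}" for j s x
  proof -
    have "frechet_derivative (\<psi> s) (at x) (Y j x) = 0" using d[OF x j] by (simp add: d\<psi>[OF x])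
    then show ?thesis unfolding fd[OF smooth_on_differentiable[OF s\<psi> x]] Yc .
  qed
  have r\<delta>: "x \<in> ball 0 r" if "x \<in> ball 0 \<delta>" for x :: "real^'n" using that \<delta> by simp
  have sa\<delta>: "smooth_on (\<alpha> j) (ball 0 \<delta>)" "smooth_on (\<beta> j) (ball 0 \<delta>)" "smooth_on (\<omega> j) (ball 0 \<delta>)" for j
    using smooth_on_subset[OF s\<alpha>] smooth_on_subset[OF s\<beta>] smooth_on_subset[OF \<omega>] r\<delta> by blast+
  have dE: "partial j (partial c (\<psi> s)) x + of_real (\<alpha> j x) * partial a (partial c (\<psi> s)) x + of_real (\<beta> j x) * partial b (partial c (\<psi> s)) x
      = - (of_real (partial c (\<alpha> j) x) * partial a (\<psi> s) x + of_real (partial c (\<beta> j) x) * partial b (\<psi> s) x)"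
    if x: "x \<in> ball 0 \<delta>" and j: "j \<notin> {a, b}" for j c s x
  proof -
    let ?F = "\<lambda>x. partial j (\<psi> s) x + of_real (\<alpha> j x) * partial a (\<psi> s) x + of_real (\<beta> j x) * partial b (\<psi> s) x"
    note h = smooth_on_has_derivative[OF smooth_on_partial[OF s\<psi>] x]
    have "(?F has_derivative (\<lambda>v. frechet_derivative (partial j (\<psi> s)) (at x) v
       + (of_real (\<alpha> j x) * frechet_derivative (partial a (\<psi> s)) (at x) v + of_real (frechet_derivative (\<alpha> j) (at x) v) * partial a (\<psi> s) x)
       + (of_real (\<beta> j x) * frechet_derivative (partial b (\<psi> s)) (at x) v + of_real (frechet_derivative (\<beta> j) (at x) v) * partial b (\<psi> s) x))) (at x)"
      by (intro has_derivative_add has_derivative_mult has_derivative_of_real h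
          smooth_on_has_derivative[OF sa\<delta>(1) x] smooth_on_has_derivative[OF sa\<delta>(2) x])
    from fun_cong[OF frechet_derivative_at[OF this], of "axis c 1"]
    have 1: "partial c ?F x = partial c (partial j (\<psi> s)) x
       + (of_real (\<alpha> j x) * partial c (partial a (\<psi> s)) x + of_real (partial c (\<alpha> j) x) * partial a (\<psi> s) x)
       + (of_real (\<beta> j x) * partial c (partial b (\<psi> s)) x + of_real (partial c (\<beta> j) x) * partial b (\<psi> s) x)"
      unfolding partial_def[of c] by simp
    have "partial c ?F x = 0"
      unfolding partial_def[of c] using frechet_derivative_cong[OF open_ball x, of ?F "\<lambda>_. 0"] E[OF _ j] by simp
    moreover note partial_commute[OF open_ball s\<psi> x, of c]
    ultimately show ?thesis using 1 by (simp add: eq_neg_iff_add_eq_0 algebra_simps)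
  qed
  \<comment> \<open>The derivative of \<open>\<psi> s\<close> along \<open>Z\<close>. The coordinate
    will be \<open>zz\<close> composed with \<open>P\<close>, and for it to be killed by
    \<open>Z\<close> one needs
    \<open>\<kappa> a x + \<omega> b (\<Phi> x) * \<kappa> b x = 0\<close>.\<close>
  define \<kappa> where "\<kappa> s x = partial b (\<psi> s) x - \<omega> b x * partial a (\<psi> s) x" for s x
  have s\<kappa>: "smooth_on (\<kappa> s) (ball 0 \<delta>)" for s
    unfolding \<kappa>_def by (intro smooth_intros s\<psi> sa\<delta> open_ball)
  \<comment> \<open>Closedness on the pair \<open>Y j\<close>, \<open>Z\<close>; it says that the
    bracket of these two fields is a multiple of \<open>Z\<close>.\<close>
  have YZ: "partial j (\<omega> b) x + of_real (\<alpha> j x) * partial a (\<omega> b) x + of_real (\<beta> j x) * partial b (\<omega> b) x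
      = - (of_real (partial b (\<alpha> j) x) - \<omega> b x * of_real (partial a (\<alpha> j) x))
        - \<omega> b x * (of_real (partial b (\<beta> j) x) - \<omega> b x * of_real (partial a (\<beta> j) x))"
    if x: "x \<in> ball 0 r" for j x
    using kernel_closed_exterior[OF cl x ker[OF x, of j] kerZ[OF x]]
    unfolding Yc Zc drel[OF x, of _ j]
    by (simp add: Da[OF x] algebra_simps)
  \<comment> \<open>Because \<open>Y j\<close> kills \<open>\<psi> s\<close>, differentiating
    \<open>\<kappa> s\<close> along \<open>Y j\<close> amounts to applying the bracket, a multiple
    of \<open>Z\<close>. The factor does not depend on \<open>s\<close>, so the quotient of
    \<open>\<kappa> a\<close> and \<open>\<kappa> b\<close> is constant on leaves.\<close>
  have Y\<kappa>: "frechet_derivative (\<kappa> s) (at x) (Y j x) =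
      - (of_real (partial b (\<beta> j) x) - \<omega> b x * of_real (partial a (\<beta> j) x)) * \<kappa> s x"
    if x: "x \<in> ball 0 \<delta>" and j: "j \<notin> {a, b}" for j s x
  proof -
    note h = smooth_on_has_derivative[OF smooth_on_partial[OF s\<psi>] x]
    have "(\<kappa> s has_derivative (\<lambda>v. frechet_derivative (partial b (\<psi> s)) (at x) v -
        (\<omega> b x * frechet_derivative (partial a (\<psi> s)) (at x) v + frechet_derivative (\<omega> b) (at x) v * partial a (\<psi> s) x))) (at x)"
      unfolding \<kappa>_def
      by (intro has_derivative_diff has_derivative_mult h smooth_on_has_derivative[OF sa\<delta>(3) x])
    from fun_cong[OF frechet_derivative_at[OF this], of "Y j x", symmetric]
    have "frechet_derivative (\<kappa> s) (at x) (Y j x) = frechet_derivative (partial b (\<psi> s)) (at x) (Y j x) -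
        (\<omega> b x * frechet_derivative (partial a (\<psi> s)) (at x) (Y j x) + frechet_derivative (\<omega> b) (at x) (Y j x) * partial a (\<psi> s) x)" .
    then show ?thesis
      unfolding fd[OF smooth_on_differentiable[OF smooth_on_partial[OF s\<psi>] x]] fd[OF smooth_on_differentiable[OF sa\<delta>(3) x]] Yc
        dE[OF x j] YZ[OF r\<delta>[OF x]]
      by (simp add: \<kappa>_def algebra_simps)
  qed
  have \<Phi>S: "partial a (\<psi> s) x = (if s = a then 1 else 0)" "partial b (\<psi> s) x = (if s = b then 1 else 0)"
    if "x \<in> ball 0 \<delta>" "\<And>k. k \<notin> {a, b} \<Longrightarrow> x $ k = 0" for s x
    using id[OF that, of a] id[OF that, of b] unfolding partial_def d\<psi>[OF that(1)] by (auto simp: axis_def)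
  have "\<kappa> b 0 = 1" using \<Phi>S[of 0] \<delta> ab by (simp add: \<kappa>_def)
  then obtain e1 where e1: "e1 > 0" "e1 \<le> \<delta>" "\<And>x. x \<in> ball 0 e1 \<Longrightarrow> \<kappa> b x \<noteq> 0"
    using continuous_nonzero_near[OF smooth_on_continuous[OF s\<kappa>]] \<delta> by (metis zero_neq_one)
  \<comment> \<open>The constant quotient is evaluated at the foot point \<open>\<Phi> x\<close>:
    there \<open>\<psi> a\<close> and \<open>\<psi> b\<close> have the derivatives of the
    coordinates themselves, and the quotient is \<open>- \<omega> b (\<Phi> x)\<close>.\<close>
  have \<kappa>eq: "\<kappa> a x = - \<omega> b (\<Phi> x) * \<kappa> b x" if x: "x \<in> ball 0 \<delta>" "x \<in> ball 0 (e1 / (C + 1))" "\<kappa> b x \<noteq> 0" for x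
  proof -
    let ?q = "\<lambda>x. \<kappa> a x / \<kappa> b x"
    have "?q (\<Phi> x) = ?q x"
    proof (rule q[OF x(1) C0[OF x(2)]])
      fix y :: "real^'n" and j assume y: "y \<in> ball 0 e1"
      then have y': "y \<in> ball 0 \<delta>" using e1 by simp
      have D: "(?q has_derivative (\<lambda>v. (frechet_derivative (\<kappa> a) (at y) v * \<kappa> b y - \<kappa> a y * frechet_derivative (\<kappa> b) (at y) v) / (\<kappa> b y * \<kappa> b y))) (at y)"
        by (intro has_derivative_divide' smooth_on_has_derivative[OF s\<kappa> y'] e1(3) y)
      then show "?q differentiable at y" by (auto simp: differentiable_def)
      assume j: "j \<notin> {a, b}"
      show "frechet_derivative ?q (at y) (Y j y) = 0"
        using fun_cong[OF frechet_derivative_at[OF D], of "Y j y"] by (simp add: Y\<kappa>[OF y' j])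
    qed
    moreover have "\<Phi> x \<in> ball 0 \<delta>" using bd[OF x(1)] C0[OF x(2)] e1 by simp
    then have "?q (\<Phi> x) = - \<omega> b (\<Phi> x)" using \<Phi>S[of "\<Phi> x"] z[OF x(1)] ab by (simp add: \<kappa>_def)
    ultimately show ?thesis using x(3) by (simp add: field_simps)
  qed
  have sm\<iota>: "smooth_on (\<lambda>y. F (\<iota> y)) (ball 0 (r / 2))" if "smooth_on F (ball 0 r)" for F :: "real^'n \<Rightarrow> complex"
    by (rule smooth_on_compose[OF open_ball open_ball \<iota>r that smooth_on_linear[OF bl\<iota> open_ball]])
  have dm\<iota>: "frechet_derivative (\<lambda>y. F (\<iota> y)) (at y) v = frechet_derivative F (at (\<iota> y)) (\<iota> v)"
    if "smooth_on F (ball 0 r)" "y \<in> ball 0 (r / 2)" for F :: "real^'n \<Rightarrow> complex" and y v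
    using fun_cong[OF frechet_derivative_at[OF has_derivative_compose[OF bounded_linear_imp_has_derivative[OF bl\<iota>]
          smooth_on_has_derivative[OF that(1) \<iota>r[OF that(2)]]]], of v] by simp
  \<comment> \<open>On the transversal plane the covector has components 1 and
    \<open>\<omega> b\<close>, and the Beltrami equation says that the differential of
    \<open>zz\<close> is a multiple of it.\<close>
  obtain \<rho> zz where \<rho>: "\<rho> > 0" "\<rho> \<le> r / 2" and szz: "smooth_on zz (ball 0 \<rho>)"
    and dzz: "\<And>y. y \<in> ball 0 \<rho> \<Longrightarrow> frechet_derivative zz (at y) \<i> = \<omega> b (\<iota> y) * frechet_derivative zz (at y) 1"
    "\<And>y. y \<in> ball 0 \<rho> \<Longrightarrow> frechet_derivative zz (at y) 1 \<noteq> (0::complex)"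
  proof (rule beltrami[OF sm\<iota>[OF \<omega>, of b]])
    have "\<iota> 0 = 0" by (simp add: \<iota>_def)
    then show "Im (\<omega> b (\<iota> 0)) \<noteq> 0" using im[OF r0] by simp
  qed (use r in auto)
  have lzz: "frechet_derivative zz (at y) v = frechet_derivative zz (at y) 1 * (of_real (Re v) + \<omega> b (\<iota> y) * of_real (Im v))"
    if y: "y \<in> ball 0 \<rho>" for y v
  proof -
    have l: "linear (frechet_derivative zz (at y))" by (rule linear_frechet_derivative[OF smooth_on_differentiable[OF szz y]])
    have "v = Re v *\<^sub>R 1 + Im v *\<^sub>R \<i>" by (simp add: complex_eq_iff)
    then have "frechet_derivative zz (at y) v = Re v *\<^sub>R frechet_derivative zz (at y) 1 + Im v *\<^sub>R frechet_derivative zz (at y) \<i>"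
      by (metis linear_add[OF l] linear_cmul[OF l])
    then show ?thesis by (simp add: dzz(1)[OF y] scaleR_conv_of_real algebra_simps)
  qed
  \<comment> \<open>Since \<open>\<omega> b\<close> is not real, 1 and \<open>\<omega> b\<close> are
    independent over the reals, so \<open>zz\<close> is a local diffeomorphism of the plane.\<close>
  have inj0: "v = 0" if "frechet_derivative zz (at 0) v = 0" for v
  proof -
    have "of_real (Re v) + \<omega> b (\<iota> 0) * of_real (Im v) = 0" using that lzz[of 0 v] dzz(2)[of 0] \<rho> by simp
    from cnj_independent_zero[OF this] show ?thesis
      using im[OF \<iota>r[of 0]] r by (simp add: complex_eq_iff)
  qed
  obtain U V K where U: "open U" "U \<subseteq> ball 0 \<rho>" "0 \<in> U" "open V" "homeomorphism U V zz K" "smooth_on K V"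
  proof (rule smooth_inverse_function[OF open_ball szz])
    show "0 \<in> ball (0 :: complex) \<rho>" using \<rho> by simp
  qed (use inj0 in auto)
  define h where "h y = \<mu> (\<iota> y)" for y
  have dh: "frechet_derivative h (at y) v = frechet_derivative h (at y) 1 * (of_real (Re v) + \<omega> b (\<iota> y) * of_real (Im v))"
    if y: "y \<in> ball 0 (r / 2)" for y v
  proof -
    note d\<mu> = smooth_on_differentiable[OF \<mu>(1) \<iota>r[OF y]]
    have "(\<Sum>k\<in>UNIV. partial k \<mu> (\<iota> y) * Z (\<iota> y) k) = 0"
      by (rule kernel_constantD[OF \<mu>(2) \<iota>r[OF y] kerZ[OF \<iota>r[OF y]]])
    then have b': "partial b \<mu> (\<iota> y) = \<omega> b (\<iota> y) * partial a \<mu> (\<iota> y)" unfolding Zc by simp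
    have l: "linear (frechet_derivative \<mu> (at (\<iota> y)))" by (rule linear_frechet_derivative[OF d\<mu>])
    have "frechet_derivative h (at y) v = Re v *\<^sub>R partial a \<mu> (\<iota> y) + Im v *\<^sub>R partial b \<mu> (\<iota> y)"
      unfolding h_def dm\<iota>[OF \<mu>(1) y] unfolding \<iota>_def[of v] by (simp add: linear_add[OF l] linear_cmul[OF l] partial_def)
    moreover have "frechet_derivative h (at y) 1 = partial a \<mu> (\<iota> y)"
      unfolding h_def dm\<iota>[OF \<mu>(1) y] by (simp add: \<iota>1 partial_def)
    ultimately show ?thesis by (simp add: b' scaleR_conv_of_real algebra_simps)
  qed
  \<comment> \<open>By \<open>lzz\<close> and \<open>dh\<close> the differentials of
    \<open>zz\<close> and \<open>h\<close> are complex multiples of the same covector. Hence the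
    derivative of \<open>h\<close> after the local inverse \<open>K\<close> of \<open>zz\<close> is
    multiplication by a complex number.\<close>
  have hol: "(\<lambda>w. h (K w)) holomorphic_on V"
    unfolding holomorphic_on_def
  proof
    fix w assume w: "w \<in> V"
    have Kw: "K w \<in> U" "zz (K w) = w" using U(5) w by (auto simp: homeomorphism_def)
    have K\<rho>: "K w \<in> ball 0 \<rho>" "K w \<in> ball 0 (r / 2)" using Kw(1) U(2) \<rho>(2) by auto
    let ?k = "frechet_derivative K (at w)" and ?h1 = "frechet_derivative h (at (K w)) 1" and ?z1 = "frechet_derivative zz (at (K w)) 1"
    have dK: "(K has_derivative ?k) (at w)" by (rule smooth_on_has_derivative[OF U(6) w])
    have "((\<lambda>w. zz (K w)) has_derivative (\<lambda>v. frechet_derivative zz (at (K w)) (?k v))) (at w)"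
      by (rule has_derivative_compose[OF dK smooth_on_has_derivative[OF szz K\<rho>(1)]])
    moreover have "((\<lambda>w. zz (K w)) has_derivative (\<lambda>v. v)) (at w)"
      by (rule has_derivative_transform_within_open[OF has_derivative_ident U(4) w]) (use U(5) in \<open>auto simp: homeomorphism_def\<close>)
    ultimately have zk: "frechet_derivative zz (at (K w)) (?k v) = v" for v by (metis has_derivative_unique)
    have "((\<lambda>w. h (K w)) has_derivative (\<lambda>v. frechet_derivative h (at (K w)) (?k v))) (at w)"
    proof (rule has_derivative_compose[OF dK smooth_on_has_derivative])
      show "smooth_on h (ball 0 (r / 2))" unfolding h_def by (rule sm\<iota>[OF \<mu>(1)])
    qed (rule K\<rho>)
    moreover have "(\<lambda>v. frechet_derivative h (at (K w)) (?k v)) = (*) (?h1 / ?z1)"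
    proof
      fix v
      let ?t = "of_real (Re (?k v)) + \<omega> b (\<iota> (K w)) * of_real (Im (?k v))"
      have "?z1 * ?t = v" using zk[of v] lzz[OF K\<rho>(1), of "?k v"] by simp
      then have "?t = v / ?z1" using dzz(2)[OF K\<rho>(1)] by (simp add: field_simps)
      then show "frechet_derivative h (at (K w)) (?k v) = ?h1 / ?z1 * v" using dh[OF K\<rho>(2), of "?k v"] by simp
    qed
    ultimately have "((\<lambda>w. h (K w)) has_derivative (*) (?h1 / ?z1)) (at w)" by simp
    then show "(\<lambda>w. h (K w)) field_differentiable at w within V"
      unfolding field_differentiable_def has_field_derivative_def using has_derivative_at_withinI by blast
  qed
  obtain u0 where u0: "u0 > 0" "ball 0 u0 \<subseteq> U" using U(1,3) open_contains_ball by blast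
  define \<phi> where "\<phi> x = zz (P x)" for x
  \<comment> \<open>The radii in turn: \<open>\<Phi>\<close> is available; the curve stays where
    \<open>\<kappa> b\<close> is nonzero; \<open>P x\<close> lies in the domain of the local
    inverse, with \<open>u0 / 2\<close> because of the factor 2 in \<open>nP\<close>; the curve
    stays where \<mu> is known; \<open>\<kappa> b\<close> is nonzero at \<open>x\<close>
    itself.\<close>
  define \<delta>1 where "\<delta>1 = Min {\<delta>, e1 / (C + 1), (u0 / 2) / (C + 1), r / (C + 1), e1}"
  have \<delta>1: "\<delta>1 > 0" "\<delta>1 \<le> \<delta>" "\<delta>1 \<le> e1 / (C + 1)" "\<delta>1 \<le> (u0 / 2) / (C + 1)" "\<delta>1 \<le> r / (C + 1)" "\<delta>1 \<le> e1"
    using \<delta> e1 u0 r by (auto simp: \<delta>1_def)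
  have PU: "P x \<in> U" if "x \<in> ball 0 \<delta>1" for x
  proof -
    have "C * norm x < u0 / 2" by (rule C0) (use that \<delta>1 u0 in auto)
    then have "P x \<in> ball 0 u0" using nP[of x] that \<delta>1 by simp
    then show ?thesis using u0 by blast
  qed
  have s\<phi>: "smooth_on \<phi> (ball 0 \<delta>1)"
    unfolding \<phi>_def
  proof (rule smooth_on_compose[OF open_ball open_ball _ szz smooth_on_subset[OF sP]])
    show "P x \<in> ball 0 \<rho>" if "x \<in> ball 0 \<delta>1" for x using PU[OF that] U(2) by blast
  qed (use \<delta>1 in auto)
  have d\<phi>: "frechet_derivative \<phi> (at x) v = frechet_derivative zz (at (P x)) 1 *
      (frechet_derivative (\<psi> a) (at x) v + \<omega> b (\<Phi> x) * frechet_derivative (\<psi> b) (at x) v)"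
    if x: "x \<in> ball 0 \<delta>1" for x v
  proof -
    have x': "x \<in> ball 0 \<delta>" using x \<delta>1 by simp
    have P\<rho>: "P x \<in> ball 0 \<rho>" using PU[OF x] U(2) by blast
    have "frechet_derivative \<phi> (at x) v = frechet_derivative zz (at (P x)) (frechet_derivative P (at x) v)"
      unfolding \<phi>_def
      using fun_cong[OF frechet_derivative_at[OF has_derivative_compose[OF smooth_on_has_derivative[OF sP x'] smooth_on_has_derivative[OF szz P\<rho>]]], of v]
      by simp
    also have "\<dots> = frechet_derivative zz (at (P x)) 1 * (of_real (Re (frechet_derivative P (at x) v)) +
        \<omega> b (\<iota> (P x)) * of_real (Im (frechet_derivative P (at x) v)))" by (rule lzz[OF P\<rho>])
    finally show ?thesis unfolding dP[OF x'] d\<psi>[OF x'] \<iota>P[OF x'] by simp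
  qed
  have pb: "partial b \<phi> x = \<omega> b x * partial a \<phi> x" if x: "x \<in> ball 0 \<delta>1" for x
  proof -
    have "\<kappa> a x = - \<omega> b (\<Phi> x) * \<kappa> b x" by (rule \<kappa>eq) (use x \<delta>1 e1 in auto)
    then have "partial b (\<psi> a) x + \<omega> b (\<Phi> x) * partial b (\<psi> b) x = \<omega> b x * (partial a (\<psi> a) x + \<omega> b (\<Phi> x) * partial a (\<psi> b) x)"
      by (simp add: \<kappa>_def algebra_simps)
    then show ?thesis unfolding partial_def[of _ \<phi>] d\<phi>[OF x] unfolding partial_def by simp
  qed
  have pk: "partial k \<phi> x = partial a \<phi> x * \<omega> k x" if x: "x \<in> ball 0 \<delta>1" for k x
  proof (cases "k \<in> {a, b}")
    case True
    then show ?thesis using pb[OF x] a[of x] x \<delta>1 \<delta> by auto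
  next
    case False
    have x': "x \<in> ball 0 \<delta>" using x \<delta>1 by simp
    have "frechet_derivative (\<psi> s) (at x) (Y k x) = 0" for s using d[OF x' False] by (simp add: d\<psi>[OF x'])
    then have "frechet_derivative \<phi> (at x) (Y k x) = 0" by (simp add: d\<phi>[OF x])
    then have "partial k \<phi> x + of_real (\<alpha> k x) * partial a \<phi> x + of_real (\<beta> k x) * partial b \<phi> x = 0"
      unfolding fd[OF smooth_on_differentiable[OF s\<phi> x]] Yc .
    then have "partial k \<phi> x = - (of_real (\<alpha> k x) + \<omega> b x * of_real (\<beta> k x)) * partial a \<phi> x"
      unfolding pb[OF x] by (simp add: eq_neg_iff_add_eq_0 algebra_simps)
    moreover have "- (of_real (\<alpha> k x) + \<omega> b x * of_real (\<beta> k x)) = \<omega> k x"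
      using rel[OF r\<delta>[OF x'], of k] by (simp add: add_eq_0_iff2 add.assoc)
    ultimately show ?thesis by simp
  qed
  have z0: "0 \<in> ball (0::real^'n) \<delta>1" using \<delta>1 by simp
  have "partial a \<phi> 0 \<noteq> 0"
  proof -
    have "P 0 \<in> ball 0 \<rho>" using PU[OF z0] U(2) by blast
    then show ?thesis
      unfolding partial_def d\<phi>[OF z0] unfolding partial_def[symmetric] using \<Phi>S[of 0] \<delta> ab dzz(2)[of "P 0"] by simp
  qed
  then obtain \<delta>2 where \<delta>2: "\<delta>2 > 0" "\<delta>2 \<le> \<delta>1" "\<And>x. x \<in> ball 0 \<delta>2 \<Longrightarrow> partial a \<phi> x \<noteq> 0"
    using continuous_nonzero_near[OF smooth_on_continuous[OF smooth_on_partial[OF s\<phi>]], of a] \<delta>1 by auto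
  have \<delta>21: "x \<in> ball 0 \<delta>1" if "x \<in> ball 0 \<delta>2" for x :: "real^'n" using that \<delta>2 by simp
  show thesis
  proof (rule that[of \<delta>2 \<phi> "\<lambda>w. h (K w)"])
    show "integrated_by \<omega> \<mu> \<phi> (\<lambda>w. h (K w)) (ball 0 \<delta>2)"
      unfolding integrated_by_def
    proof (intro conjI ballI)
      show "smooth_on \<phi> (ball 0 \<delta>2)" by (rule smooth_on_subset[OF s\<phi>]) (use \<delta>2 in auto)
      show "(\<lambda>w. h (K w)) holomorphic_on \<phi> ` ball 0 \<delta>2"
        by (rule holomorphic_on_subset[OF hol]) (use PU \<delta>21 U(5) in \<open>auto simp: \<phi>_def homeomorphism_def\<close>)
      fix u :: "real^'n" assume u: "u \<in> ball 0 \<delta>2"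
      show "\<exists>\<rho>. \<rho> \<noteq> 0 \<and> (\<forall>k. partial k \<phi> u = \<rho> * \<omega> k u)"
      proof (intro exI conjI allI)
        show "partial a \<phi> u \<noteq> 0" by (rule \<delta>2(3)[OF u])
        show "partial k \<phi> u = partial a \<phi> u * \<omega> k u" for k by (rule pk[OF \<delta>21[OF u]])
      qed
      have u': "u \<in> ball 0 \<delta>" using u \<delta>1 \<delta>2 by simp
      have "\<mu> (\<Phi> u) = \<mu> u"
      proof (rule q[OF u'])
        show "C * norm u < r" by (rule C0) (use u \<delta>1 \<delta>2 r in auto)
        fix y :: "real^'n" and j assume y: "y \<in> ball 0 r"
        show "\<mu> differentiable at y" by (rule smooth_on_differentiable[OF \<mu>(1) y])
        show "frechet_derivative \<mu> (at y) (Y j y) = 0"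
          unfolding fd[OF smooth_on_differentiable[OF \<mu>(1) y]]
          by (rule kernel_constantD[OF \<mu>(2) y ker[OF y]])
      qed
      moreover have "K (\<phi> u) = P u" using PU[OF \<delta>21[OF u]] U(5) by (auto simp: \<phi>_def homeomorphism_def)
      ultimately show "\<mu> u = h (K (\<phi> u))" by (simp add: h_def \<iota>P[OF u'])
    qed
  qed (use \<delta> \<delta>1 \<delta>2 in auto)
qed

section \<open>Contravariant metrics\<close>

lemma contravariant_metric_onD:
  assumes "contravariant_metric_on U g" "u \<in> U"
  shows "g u $ i $ j = g u $ j $ i" "det (g u) \<noteq> 0"
  using assms unfolding contravariant_metric_on_def transpose_def vec_eq_iff by auto

lemma metric_smooth: "contravariant_metric_on U g \<Longrightarrow> smooth_on (\<lambda>u. g u $ i $ j) U"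
  by (simp add: contravariant_metric_on_def)

lemma metric_inverse:
  fixes g :: "'n::finite tensor2"
  assumes "contravariant_metric_on U g" "u \<in> U"
  shows "(\<Sum>s\<in>UNIV. g u $ i $ s * lower g s j u) = (if i = j then 1 else 0)"
    and "(\<Sum>s\<in>UNIV. lower g i s u * g u $ s $ j) = (if i = j then 1 else 0)"
    and "lower g i j u = lower g j i u"
proof -
  have inv: "invertible (g u)" using contravariant_metric_onD(2)[OF assms] by (simp add: invertible_det_nz)
  have m: "matrix_inv (g u) ** g u = mat 1" "g u ** matrix_inv (g u) = mat 1"
    using someI_ex[OF inv[unfolded invertible_def]] unfolding matrix_inv_def by auto
  show 1: "(\<Sum>s\<in>UNIV. g u $ i $ s * lower g s j u) = (if i = j then 1 else 0)" for i j
    using m(2) by (simp add: lower_def matrix_matrix_mult_def mat_def vec_eq_iff)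
  show 2: "(\<Sum>s\<in>UNIV. lower g i s u * g u $ s $ j) = (if i = j then 1 else 0)" for i j
    using m(1) by (simp add: lower_def matrix_matrix_mult_def mat_def vec_eq_iff)
  have "transpose (matrix_inv (g u)) = matrix_inv (g u)"
  proof -
    have t: "transpose (g u) = g u" using assms by (simp add: contravariant_metric_on_def)
    have "g u ** transpose (matrix_inv (g u)) = mat 1"
      using m(1) t by (metis matrix_transpose_mul transpose_mat)
    then show ?thesis by (metis m(1) matrix_mul_assoc matrix_mul_lid matrix_mul_rid)
  qed
  then show "lower g i j u = lower g j i u"
    unfolding lower_def transpose_def by (metis (no_types, lifting) vec_lambda_beta)
qed

text \<open>Cramer's rule shows the entries of the inverse matrix as quotients of determinants with
  smooth entries.\<close>

lemma smooth_on_lower: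
  fixes g :: "'n::finite tensor2"
  assumes U: "open U" and g: "contravariant_metric_on U g"
  shows "smooth_on (lower g i j) U"
proof -
  let ?f = "\<lambda>u. det (\<chi> k l. if l = i then axis j 1 $ k else g u $ k $ l) / det (\<chi> k l. g u $ k $ l)"
  have eq: "?f u = lower g i j u" if u: "u \<in> U" for u
  proof -
    have d: "det (g u) \<noteq> 0" by (rule contravariant_metric_onD(2)[OF g u])
    have "g u *v (\<chi> s. lower g s j u) = axis j 1"
      using metric_inverse(1)[OF g u] by (simp add: matrix_vector_mult_def vec_eq_iff axis_def)
    then have "(\<chi> s. lower g s j u) = (\<chi> k. det (\<chi> i l. if l = k then axis j 1 $ i else g u $ i $ l) / det (g u))"
      by (rule cramer[OF d, THEN iffD1])
    then show ?thesis by (simp add: vec_eq_iff)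
  qed
  have "smooth_on ?f U"
  proof (rule smooth_on_divide[OF U])
    have "smooth_on (\<lambda>u. if l = i then axis j 1 $ k else g u $ k $ l) U" for k l
      by (cases "l = i") (auto intro: smooth_on_const U metric_smooth[OF g])
    then show "smooth_on (\<lambda>u. det (\<chi> k l. if l = i then axis j 1 $ k else g u $ k $ l)) U"
      by (rule smooth_on_det[OF U])
    show "smooth_on (\<lambda>u. det (\<chi> k l. g u $ k $ l)) U" by (rule smooth_on_det[OF U metric_smooth[OF g]])
    show "det (\<chi> k l. g u $ k $ l) \<noteq> 0" if "u \<in> U" for u using contravariant_metric_onD(2)[OF g that] by simp
  qed
  then show ?thesis by (rule smooth_on_cong[OF U eq, rotated])
qed

lemma partial_cong:
  assumes "open S" "x \<in> S" "\<And>y. y \<in> S \<Longrightarrow> f y = g y"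
  shows "partial k f x = partial k g x"
  unfolding partial_def using frechet_derivative_cong[OF assms] by simp

lemma partial_add:
  assumes "f differentiable at x" "g differentiable at x"
  shows "partial k (\<lambda>x. f x + g x) x = partial k f x + partial k g x"
  unfolding partial_def
  using fun_cong[OF frechet_derivative_at[OF has_derivative_add[OF assms[unfolded frechet_derivative_works]]], of "axis k 1"]
  by simp

lemma partial_sum:
  assumes "\<And>i. i \<in> I \<Longrightarrow> f i differentiable at x"
  shows "partial k (\<lambda>x. \<Sum>i\<in>I. f i x) x = (\<Sum>i\<in>I. partial k (f i) x)"
proof -
  have "((\<lambda>x. \<Sum>i\<in>I. f i x) has_derivative (\<lambda>v. \<Sum>i\<in>I. frechet_derivative (f i) (at x) v)) (at x)"
    by (rule has_derivative_sum) (use assms in \<open>simp add: frechet_derivative_works\<close>)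
  from fun_cong[OF frechet_derivative_at[OF this], of "axis k 1"] show ?thesis unfolding partial_def by simp
qed

lemma partial_mult:
  fixes f g :: "real^'n::finite \<Rightarrow> 'b::real_normed_algebra"
  assumes "f differentiable at x" "g differentiable at x"
  shows "partial k (\<lambda>x. f x * g x) x = f x * partial k g x + partial k f x * g x"
  unfolding partial_def
  using fun_cong[OF frechet_derivative_at[OF has_derivative_mult[OF assms[unfolded frechet_derivative_works]]], of "axis k 1"]
  by simp

lemma partial_of_real:
  assumes "f differentiable at x"
  shows "partial k (\<lambda>x. complex_of_real (f x)) x = complex_of_real (partial k f x)"
  unfolding partial_def by (rule frechet_derivative_linear_compose[OF bounded_linear_of_real assms])

lemma partial_const [simp]: "partial k (\<lambda>_. c) x = 0"
  by (simp add: partial_def)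

lemma metric_partial_inverse:
  fixes g :: "'n::finite tensor2"
  assumes U: "open U" and g: "contravariant_metric_on U g" and u: "u \<in> U"
  shows "(\<Sum>s\<in>UNIV. \<Sum>t\<in>UNIV. g u $ i $ s * g u $ j $ t * partial k (lower g s t) u) = - partial k (\<lambda>u. g u $ i $ j) u"
proof -
  note dg = smooth_on_differentiable[OF metric_smooth[OF g] u] and dl = smooth_on_differentiable[OF smooth_on_lower[OF U g] u]
  have D: "(\<Sum>s\<in>UNIV. g u $ i $ s * partial k (lower g s t) u) = - (\<Sum>s\<in>UNIV. partial k (\<lambda>u. g u $ i $ s) u * lower g s t u)" for t
  proof -
    have "partial k (\<lambda>u. \<Sum>s\<in>UNIV. g u $ i $ s * lower g s t u) u = partial k (\<lambda>u. if i = t then 1 else 0) u"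
      by (rule partial_cong[OF U u]) (rule metric_inverse(1)[OF g])
    then have "(\<Sum>s\<in>UNIV. g u $ i $ s * partial k (lower g s t) u + partial k (\<lambda>u. g u $ i $ s) u * lower g s t u) = 0"
      by (simp add: partial_sum partial_mult dg dl)
    then show ?thesis by (simp add: sum.distrib eq_neg_iff_add_eq_0)
  qed
  have "(\<Sum>s\<in>UNIV. \<Sum>t\<in>UNIV. g u $ i $ s * g u $ j $ t * partial k (lower g s t) u)
      = (\<Sum>t\<in>UNIV. g u $ j $ t * (\<Sum>s\<in>UNIV. g u $ i $ s * partial k (lower g s t) u))"
    by (subst sum.swap) (simp add: sum_distrib_left mult_ac)
  also have "\<dots> = - (\<Sum>t\<in>UNIV. \<Sum>s\<in>UNIV. partial k (\<lambda>u. g u $ i $ s) u * (lower g s t u * g u $ t $ j))"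
    unfolding D by (simp add: sum_negf sum_distrib_left mult_ac contravariant_metric_onD(1)[OF g u, of j])
  also have "\<dots> = - (\<Sum>s\<in>UNIV. partial k (\<lambda>u. g u $ i $ s) u * (\<Sum>t\<in>UNIV. lower g s t u * g u $ t $ j))"
    by (subst sum.swap) (simp add: sum_distrib_left)
  also have "\<dots> = - partial k (\<lambda>u. g u $ i $ j) u"
    unfolding metric_inverse(2)[OF g u] by (simp add: if_distrib cong: if_cong)
  finally show ?thesis .
qed

lemma lower_partial_sym:
  fixes g :: "'n::finite tensor2"
  assumes U: "open U" and g: "contravariant_metric_on U g" and u: "u \<in> U"
  shows "partial k (lower g i j) u = partial k (lower g j i) u"
  by (rule partial_cong[OF U u metric_inverse(3)[OF g]])

lemma christoffel_sym:
  fixes g :: "'n::finite tensor2"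
  assumes U: "open U" and g: "contravariant_metric_on U g" and u: "u \<in> U"
  shows "christoffel g i j k u = christoffel g i k j u"
  unfolding christoffel_def
  by (rule sum.cong[OF refl])
    (use lower_partial_sym[OF U g u] in \<open>simp add: add.commute\<close>)

lemma smooth_on_christoffel:
  fixes g :: "'n::finite tensor2"
  assumes U: "open U" and g: "contravariant_metric_on U g"
  shows "smooth_on (christoffel g i j k) U"
  unfolding christoffel_def[abs_def]
  by (intro smooth_intros U metric_smooth[OF g] smooth_on_lower[OF U g])

lemma smooth_on_contra_christoffel:
  fixes g :: "'n::finite tensor2"
  assumes U: "open U" and g: "contravariant_metric_on U g"
  shows "smooth_on (contra_christoffel g i j k) U"
  unfolding contra_christoffel_def[abs_def]
  by (intro smooth_intros U metric_smooth[OF g] smooth_on_christoffel[OF U g])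

text \<open>In the sum of both terms the differences of first derivatives of \<open>lower\<close>
  cancel, leaving its derivative in direction \<open>k\<close> with both indices raised; this is
  minus the derivative of the contravariant metric. It is the vanishing of the covariant derivative
  of the metric, in the sign convention of \<open>contra_christoffel\<close>.\<close>

lemma contra_christoffel_compatible:
  fixes g :: "'n::finite tensor2"
  assumes U: "open U" and g: "contravariant_metric_on U g" and u: "u \<in> U"
  shows "contra_christoffel g i j k u + contra_christoffel g j i k u = - partial k (\<lambda>u. g u $ i $ j) u"
proof -
  let ?g = "\<lambda>i j. g u $ i $ j"
  let ?T = "\<lambda>s t. partial s (lower g t k) u + partial k (lower g s t) u - partial t (lower g s k) u"
  have C: "contra_christoffel g i j k u = (\<Sum>s\<in>UNIV. \<Sum>t\<in>UNIV. 1/2 * (?g i s * ?g j t * ?T s t))" for i j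
    unfolding contra_christoffel_def christoffel_def sum_distrib_left
    by (intro sum.cong refl) (simp add: algebra_simps)
  have C': "contra_christoffel g j i k u = (\<Sum>s\<in>UNIV. \<Sum>t\<in>UNIV. 1/2 * (?g i s * ?g j t * ?T t s))"
    unfolding C by (subst sum.swap) (simp add: mult_ac)
  have "contra_christoffel g i j k u + contra_christoffel g j i k u =
     (\<Sum>s\<in>UNIV. \<Sum>t\<in>UNIV. ?g i s * ?g j t * partial k (lower g s t) u)"
    unfolding C[of i j] C' sum.distrib[symmetric]
    by (intro sum.cong refl) (simp add: lower_partial_sym[OF U g u, of k _ _] algebra_simps)
  then show ?thesis unfolding metric_partial_inverse[OF U g u] .
qed

text \<open>Moving \<open>g\<close> inside the derivative of the Christoffel symbols costs a
  derivative of \<open>g\<close>, which \<open>contra_christoffel_compatible\<close> expresses by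
  Christoffel symbols; half of these products cancel against the original quadratic terms.
  Derivatives now act on \<open>contra_christoffel\<close>, so linearity of the curvature is a
  question about the products alone.\<close>

lemma contra_riemann_formula:
  fixes g :: "'n::finite tensor2"
  assumes U: "open U" and g: "contravariant_metric_on U g" and u: "u \<in> U"
  shows "contra_riemann g i j k l u = partial k (contra_christoffel g i j l) u - partial l (contra_christoffel g i j k) u
    + (\<Sum>s\<in>UNIV. contra_christoffel g s i k u * christoffel g j s l u)
    - (\<Sum>s\<in>UNIV. contra_christoffel g s i l u * christoffel g j s k u)"
proof -
  note dg = smooth_on_differentiable[OF metric_smooth[OF g] u]
    and dc = smooth_on_differentiable[OF smooth_on_christoffel[OF U g] u]
  let ?K = "\<lambda>i j k. contra_christoffel g i j k u" and ?C = "\<lambda>i j k. christoffel g i j k u"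
  have P: "(\<Sum>s\<in>UNIV. g u $ i $ s * partial k (christoffel g j s l) u) =
      partial k (contra_christoffel g i j l) u + (\<Sum>s\<in>UNIV. (?K i s k + ?K s i k) * ?C j s l)" for k l
  proof -
    have "partial k (contra_christoffel g i j l) u = (\<Sum>s\<in>UNIV. g u $ i $ s * partial k (christoffel g j s l) u + partial k (\<lambda>u. g u $ i $ s) u * ?C j s l)"
      unfolding contra_christoffel_def[abs_def] by (simp add: partial_sum partial_mult dg dc)
    moreover have "partial k (\<lambda>u. g u $ i $ s) u = - (?K i s k + ?K s i k)" for s
      using contra_christoffel_compatible[OF U g u, of i s k] by simp
    ultimately show ?thesis by (simp add: sum.distrib sum_subtractf sum_negf algebra_simps)
  qed
  have Q: "(\<Sum>s\<in>UNIV. g u $ i $ s * (\<Sum>p\<in>UNIV. ?C j p k * ?C p s l)) = (\<Sum>p\<in>UNIV. ?K i p l * ?C j p k)" for k l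
  proof -
    have "(\<Sum>s\<in>UNIV. g u $ i $ s * (\<Sum>p\<in>UNIV. ?C j p k * ?C p s l)) = (\<Sum>p\<in>UNIV. \<Sum>s\<in>UNIV. g u $ i $ s * ?C p s l * ?C j p k)"
      unfolding sum_distrib_left by (subst sum.swap) (simp add: mult_ac)
    then show ?thesis by (simp add: contra_christoffel_def sum_distrib_right)
  qed
  have "contra_riemann g i j k l u = (\<Sum>s\<in>UNIV. g u $ i $ s * partial k (christoffel g j s l) u) -
     (\<Sum>s\<in>UNIV. g u $ i $ s * partial l (christoffel g j s k) u)
     + (\<Sum>s\<in>UNIV. g u $ i $ s * (\<Sum>p\<in>UNIV. ?C j p k * ?C p s l)) - (\<Sum>s\<in>UNIV. g u $ i $ s * (\<Sum>p\<in>UNIV. ?C j p l * ?C p s k))"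
    unfolding contra_riemann_def riemann_def by (simp add: sum_subtractf sum.distrib algebra_simps)
  then show ?thesis unfolding P Q by (simp add: sum.distrib algebra_simps)
qed

section \<open>Complex-linear extension of metric and connection\<close>

definition cdot :: "('n::finite \<Rightarrow> complex) \<Rightarrow> ('n \<Rightarrow> complex) \<Rightarrow> complex" where
  "cdot a v = (\<Sum>k\<in>UNIV. a k * v k)"

text \<open>No conjugation enters here or in the neighbouring operations: they extend the real
  tensors complex-linearly, so identities between real components remain valid for complex
  eigencovectors and coordinate differentials.\<close>

definition raise :: "'n::finite tensor2 \<Rightarrow> real^'n \<Rightarrow> ('n \<Rightarrow> complex) \<Rightarrow> 'n \<Rightarrow> complex" where
  "raise g u a s = (\<Sum>i\<in>UNIV. of_real (g u $ i $ s) * a i)"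

definition gamma :: "'n::finite tensor2 \<Rightarrow> real^'n \<Rightarrow> ('n \<Rightarrow> complex) \<Rightarrow> ('n \<Rightarrow> complex) \<Rightarrow> 'n \<Rightarrow> complex" where
  "gamma g u v w j = (\<Sum>s\<in>UNIV. \<Sum>t\<in>UNIV. of_real (christoffel g j s t u) * v s * w t)"

definition contra_gamma ::
  "'n::finite tensor2 \<Rightarrow> real^'n \<Rightarrow> ('n \<Rightarrow> complex) \<Rightarrow> ('n \<Rightarrow> complex) \<Rightarrow> ('n \<Rightarrow> complex) \<Rightarrow> complex" where
  "contra_gamma g u a b w = (\<Sum>i\<in>UNIV. \<Sum>j\<in>UNIV. \<Sum>k\<in>UNIV. of_real (contra_christoffel g i j k u) * a i * b j * w k)"

lemma raise_inj:
  assumes g: "contravariant_metric_on U g" "u \<in> U" and z: "\<And>k. raise g u a k = 0"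
  shows "a i = 0"
proof -
  have "(\<Sum>s\<in>UNIV. of_real (lower g s i u) * raise g u a s) = (\<Sum>j\<in>UNIV. of_real (\<Sum>s\<in>UNIV. g u $ j $ s * lower g s i u) * a j)"
    unfolding raise_def of_real_sum sum_distrib_left sum_distrib_right by (subst sum.swap) (simp add: mult_ac)
  then show ?thesis using z unfolding metric_inverse(1)[OF g]
    by (simp add: mult_delta_left if_distrib[of complex_of_real] cong: if_cong)
qed

lemma raise_sym:
  assumes "contravariant_metric_on U g" "u \<in> U"
  shows "cdot b (raise g u a) = cdot a (raise g u b)"
  unfolding cdot_def raise_def sum_distrib_left
  by (subst sum.swap) (simp add: contravariant_metric_onD(1)[OF assms] mult_ac)

lemma contra_gamma_eq: "contra_gamma g u a b w = cdot b (gamma g u (raise g u a) w)"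
proof -
  have "contra_gamma g u a b w = (\<Sum>i\<in>UNIV. \<Sum>j\<in>UNIV. \<Sum>k\<in>UNIV. \<Sum>s\<in>UNIV. b j * (of_real (christoffel g j s k u) * (of_real (g u $ i $ s) * a i) * w k))"
    unfolding contra_gamma_def contra_christoffel_def of_real_sum sum_distrib_right
    by (intro sum.cong refl) (simp add: mult_ac)
  also have "\<dots> = (\<Sum>j\<in>UNIV. \<Sum>i\<in>UNIV. \<Sum>k\<in>UNIV. \<Sum>s\<in>UNIV. b j * (of_real (christoffel g j s k u) * (of_real (g u $ i $ s) * a i) * w k))"
    by (rule sum.swap)
  also have "\<dots> = (\<Sum>j\<in>UNIV. \<Sum>s\<in>UNIV. \<Sum>k\<in>UNIV. \<Sum>i\<in>UNIV. b j * (of_real (christoffel g j s k u) * (of_real (g u $ i $ s) * a i) * w k))"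
  proof (rule sum.cong[OF refl])
    fix j
    have "(\<Sum>i\<in>UNIV. \<Sum>k\<in>UNIV. \<Sum>s\<in>UNIV. F i k s) = (\<Sum>s\<in>UNIV. \<Sum>k\<in>UNIV. \<Sum>i\<in>UNIV. F i k s)" for F :: "'a \<Rightarrow> 'a \<Rightarrow> 'a \<Rightarrow> complex"
    proof -
      have "(\<Sum>i\<in>UNIV. \<Sum>k\<in>UNIV. \<Sum>s\<in>UNIV. F i k s) = (\<Sum>i\<in>UNIV. \<Sum>s\<in>UNIV. \<Sum>k\<in>UNIV. F i k s)"
        by (rule sum.cong[OF refl]) (rule sum.swap)
      also have "\<dots> = (\<Sum>s\<in>UNIV. \<Sum>i\<in>UNIV. \<Sum>k\<in>UNIV. F i k s)" by (rule sum.swap)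
      also have "\<dots> = (\<Sum>s\<in>UNIV. \<Sum>k\<in>UNIV. \<Sum>i\<in>UNIV. F i k s)" by (rule sum.cong[OF refl]) (rule sum.swap)
      finally show ?thesis .
    qed
    then show "(\<Sum>i\<in>UNIV. \<Sum>k\<in>UNIV. \<Sum>s\<in>UNIV. b j * (of_real (christoffel g j s k u) * (of_real (g u $ i $ s) * a i) * w k)) =
      (\<Sum>s\<in>UNIV. \<Sum>k\<in>UNIV. \<Sum>i\<in>UNIV. b j * (of_real (christoffel g j s k u) * (of_real (g u $ i $ s) * a i) * w k))" .
  qed
  also have "\<dots> = cdot b (gamma g u (\<lambda>s. \<Sum>i\<in>UNIV. of_real (g u $ i $ s) * a i) w)"
    unfolding cdot_def gamma_def by (simp add: sum_distrib_left sum_distrib_right mult_ac)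
  finally show ?thesis by (simp add: raise_def[abs_def])
qed


lemma gamma_sym:
  fixes g :: "'n::finite tensor2"
  assumes U: "open U" and g: "contravariant_metric_on U g" and u: "u \<in> U"
  shows "gamma g u v w = gamma g u w v"
  unfolding gamma_def
  by (rule ext, subst sum.swap) (simp add: christoffel_sym[OF U g u] mult_ac)

lemma cdot_add: "cdot a (\<lambda>k. v k + w k) = cdot a v + cdot a w" "cdot (\<lambda>k. a k + b k) v = cdot a v + cdot b v"
  by (simp_all add: cdot_def sum.distrib algebra_simps)

lemma cdot_scale: "cdot a (\<lambda>k. c * v k) = c * cdot a v" "cdot (\<lambda>k. c * a k) v = c * cdot a v"
  by (simp_all add: cdot_def sum_distrib_left mult_ac)

lemma gamma_scale: "gamma g u (\<lambda>k. c * v k) w = (\<lambda>j. c * gamma g u v w j)" "gamma g u v (\<lambda>k. c * w k) = (\<lambda>j. c * gamma g u v w j)"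
  by (simp_all add: gamma_def sum_distrib_left mult_ac fun_eq_iff)

lemma contra_gamma_linear:
  "contra_gamma g u a b (\<lambda>k. c * w k + d * w' k) = c * contra_gamma g u a b w + d * contra_gamma g u a b w'"
  by (simp add: contra_gamma_def sum.distrib sum_distrib_left algebra_simps)

text \<open>Vanishing torsion with both lower indices raised: either side pairs \<open>b\<close>
  with the connection applied to the raised \<open>p\<close> and the raised
  \<open>q\<close>.\<close>

lemma contra_gamma_raise_sym:
  fixes g :: "'n::finite tensor2"
  assumes "open U" and "contravariant_metric_on U g" and "u \<in> U"
  shows "contra_gamma g u q b (raise g u p) = contra_gamma g u p b (raise g u q)"
  unfolding contra_gamma_eq using gamma_sym[OF assms] by metis

lemma contra_gamma_compatible:
  fixes g :: "'n::finite tensor2"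
  assumes U: "open U" and g: "contravariant_metric_on U g" and u: "u \<in> U"
  shows "(\<Sum>i\<in>UNIV. \<Sum>j\<in>UNIV. \<Sum>k\<in>UNIV. of_real (partial k (\<lambda>u. g u $ i $ j) u) * a i * b j * w k)
    = - (contra_gamma g u a b w + contra_gamma g u b a w)"
proof -
  have "contra_gamma g u b a w = (\<Sum>i\<in>UNIV. \<Sum>j\<in>UNIV. \<Sum>k\<in>UNIV. of_real (contra_christoffel g j i k u) * a i * b j * w k)"
    unfolding contra_gamma_def by (subst sum.swap) (simp add: mult_ac)
  then have "contra_gamma g u a b w + contra_gamma g u b a w = (\<Sum>i\<in>UNIV. \<Sum>j\<in>UNIV. \<Sum>k\<in>UNIV.
      of_real (contra_christoffel g i j k u + contra_christoffel g j i k u) * a i * b j * w k)"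
    by (simp add: contra_gamma_def sum.distrib algebra_simps)
  then show ?thesis unfolding contra_christoffel_compatible[OF U g u] by (simp add: sum_negf)
qed

lemma pencil_metric:
  fixes g1 g2 :: "'n::finite tensor2" and l1 l2 :: real
  assumes U: "open U" and g: "contravariant_metric_on U g1" "contravariant_metric_on U g2"
  defines "W \<equiv> {u\<in>U. det (pencil l1 l2 g1 g2 u) \<noteq> 0}"
  shows "open W" "contravariant_metric_on W (pencil l1 l2 g1 g2)" "W \<subseteq> U"
proof -
  let ?P = "pencil l1 l2 g1 g2"
  have P: "?P u $ i $ j = l1 * g1 u $ i $ j + l2 * g2 u $ i $ j" for u i j by (simp add: pencil_def)
  have s: "smooth_on (\<lambda>u. ?P u $ i $ j) U" for i j
    unfolding P by (intro smooth_intros U metric_smooth[OF g(1)] metric_smooth[OF g(2)])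
  have "smooth_on (\<lambda>u. det (\<chi> i j. ?P u $ i $ j)) U" by (rule smooth_on_det[OF U s])
  then have "continuous_on U (\<lambda>u. det (?P u))" using smooth_on_continuous by fastforce
  then have "open (U \<inter> (\<lambda>u. det (?P u)) -` (- {0}))" by (rule continuous_open_preimage[OF _ U]) (simp add: open_Compl)
  moreover have "W = U \<inter> (\<lambda>u. det (?P u)) -` (- {0})" by (auto simp: W_def)
  ultimately show "open W" by simp
  show WU: "W \<subseteq> U" by (auto simp: W_def)
  show "contravariant_metric_on W ?P"
    unfolding contravariant_metric_on_def
  proof (intro conjI allI ballI)
    show "smooth_on (\<lambda>u. ?P u $ i $ j) W" for i j by (rule smooth_on_subset[OF s WU])
    fix u assume u: "u \<in> W"
    show "det (?P u) \<noteq> 0" using u by (simp add: W_def)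
    have "u \<in> U" using u WU by blast
    then show "transpose (?P u) = ?P u"
      using contravariant_metric_onD(1)[OF g(1), of u] contravariant_metric_onD(1)[OF g(2), of u]
      by (simp add: vec_eq_iff transpose_def P)
  qed
qed

section \<open>Diagonal metrics\<close>

lemma cdot_sum: "cdot a (\<lambda>k. \<Sum>r\<in>I. v r k) = (\<Sum>r\<in>I. cdot a (v r))"
  unfolding cdot_def sum_distrib_left by (rule sum.swap)

lemma cdot_sum_left: "cdot (\<lambda>k. \<Sum>r\<in>I. v r k) a = (\<Sum>r\<in>I. cdot (v r) a)"
  unfolding cdot_def sum_distrib_right by (rule sum.swap)

lemma cdot_scale_right: "cdot (\<lambda>k. a k * c) v = cdot a v * c"
  by (simp add: cdot_def sum_distrib_left mult_ac)

text \<open>Everything takes place at one point \<open>u\<close>. The differentials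
  \<open>w p\<close> of the possibly complex coordinates and the dual vectors
  \<open>\<epsilon> q\<close> are bases of the complexified cotangent and tangent spaces, in which
  the real tensors are expanded.\<close>

locale coframe =
  fixes V :: "(real^'n::finite) set" and \<phi> :: "real^'n \<Rightarrow> complex^'n" and u :: "real^'n"
  assumes V: "open V" and \<phi>: "smooth_on \<phi> V" and u: "u \<in> V"
    and det: "det (\<chi> i k. partial k (\<lambda>x. \<phi> x $ i) u) \<noteq> 0"
begin

definition \<omega> :: "'n \<Rightarrow> 'n \<Rightarrow> real^'n \<Rightarrow> complex" where
  "\<omega> p k x = partial k (\<lambda>x. \<phi> x $ p) x"

definition \<epsilon> :: "'n \<Rightarrow> 'n \<Rightarrow> complex" where
  "\<epsilon> q k = matrix_inv (\<chi> i k. \<omega> i k u) $ k $ q"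

abbreviation w :: "'n \<Rightarrow> 'n \<Rightarrow> complex" where "w p \<equiv> \<lambda>k. \<omega> p k u"

definition along :: "'n \<Rightarrow> (real^'n \<Rightarrow> complex) \<Rightarrow> complex" where
  "along q f = (\<Sum>k\<in>UNIV. \<epsilon> q k * partial k f u)"

text \<open>The second derivative of the coordinate with index \<open>p\<close> on the vectors
  \<open>\<epsilon> a\<close> and \<open>\<epsilon> c\<close>: the inhomogeneous term in the
  transformation law of Christoffel symbols. It depends on the coordinates and on no metric.\<close>

definition flat :: "'n \<Rightarrow> 'n \<Rightarrow> 'n \<Rightarrow> complex" where
  "flat c p a = (\<Sum>m\<in>UNIV. \<Sum>k\<in>UNIV. \<epsilon> a m * partial m (\<omega> p k) u * \<epsilon> c k)"

lemma smooth_on_\<omega>: "smooth_on (\<omega> p k) V"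
  unfolding \<omega>_def[abs_def] by (intro smooth_on_partial smooth_on_vec_nth V \<phi>)

lemma frame_inverse:
  "cdot (w p) (\<epsilon> q) = (if p = q then 1 else 0)"
  "(\<Sum>q\<in>UNIV. w q k * \<epsilon> q l) = (if k = l then 1 else 0)"
proof -
  let ?A = "\<chi> i k. \<omega> i k u"
  have "invertible ?A" using det by (simp add: invertible_det_nz \<omega>_def)
  then have "?A ** matrix_inv ?A = mat 1" "matrix_inv ?A ** ?A = mat 1"
    unfolding invertible_def matrix_inv_def by (metis (mono_tags, lifting) someI_ex)+
  then show "cdot (w p) (\<epsilon> q) = (if p = q then 1 else 0)" "(\<Sum>q\<in>UNIV. w q k * \<epsilon> q l) = (if k = l then 1 else 0)"
    by (simp_all add: vec_eq_iff matrix_matrix_mult_def mat_def cdot_def \<epsilon>_def mult.commute)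
qed

lemma vector_expand: "v k = (\<Sum>r\<in>UNIV. cdot (w r) v * \<epsilon> r k)"
proof -
  have "(\<Sum>r\<in>UNIV. cdot (w r) v * \<epsilon> r k) = (\<Sum>l\<in>UNIV. \<Sum>r\<in>UNIV. (w r l * \<epsilon> r k) * v l)"
    unfolding cdot_def sum_distrib_right by (subst sum.swap) (simp add: mult_ac)
  then show ?thesis by (simp add: frame_inverse mult_delta_left flip: sum_distrib_right)
qed

lemma pairing_expand: "cdot y x = (\<Sum>c\<in>UNIV. cdot (w c) x * cdot y (\<epsilon> c))"
proof -
  have "cdot y x = cdot y (\<lambda>k. \<Sum>c\<in>UNIV. cdot (w c) x * \<epsilon> c k)" using vector_expand[of x] by (metis (no_types, lifting) ext)
  then show ?thesis by (simp add: cdot_sum cdot_scale)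
qed

lemma covector_zero:
  assumes "\<And>q. cdot y (\<epsilon> q) = 0"
  shows "y k = 0"
proof -
  have "cdot y (\<lambda>l. if l = k then 1 else 0) = 0" by (subst pairing_expand) (simp add: assms)
  then show ?thesis by (simp add: cdot_def mult_delta_right)
qed

lemma vector_zero: "(\<And>p. cdot (w p) v = 0) \<Longrightarrow> v k = 0"
  by (subst vector_expand) simp

lemma trilinear_zero:
  assumes "\<And>p r q. (\<Sum>i\<in>UNIV. \<Sum>j\<in>UNIV. \<Sum>k\<in>UNIV. X i j k * w p i * w r j * \<epsilon> q k) = 0"
  shows "X i j k = 0"
proof -
  have 1: "cdot (\<lambda>k. cdot (w p) (\<lambda>i. cdot (w r) (\<lambda>j. X i j k))) (\<epsilon> q) = 0" for p r q
  proof -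
    have "cdot (\<lambda>k. cdot (w p) (\<lambda>i. cdot (w r) (\<lambda>j. X i j k))) (\<epsilon> q) = (\<Sum>k\<in>UNIV. \<Sum>i\<in>UNIV. \<Sum>j\<in>UNIV. X i j k * w p i * w r j * \<epsilon> q k)"
      by (simp add: cdot_def sum_distrib_left sum_distrib_right mult_ac)
    also have "\<dots> = (\<Sum>i\<in>UNIV. \<Sum>k\<in>UNIV. \<Sum>j\<in>UNIV. X i j k * w p i * w r j * \<epsilon> q k)" by (rule sum.swap)
    also have "\<dots> = (\<Sum>i\<in>UNIV. \<Sum>j\<in>UNIV. \<Sum>k\<in>UNIV. X i j k * w p i * w r j * \<epsilon> q k)"
      by (rule sum.cong[OF refl]) (rule sum.swap)
    finally show ?thesis by (simp add: assms)
  qed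
  have "cdot (w p) (\<lambda>i. cdot (w r) (\<lambda>j. X i j k)) = 0" for p r k
    using covector_zero[OF 1] by simp
  then have "cdot (w r) (\<lambda>j. X i j k) = 0" for r i k
    using vector_zero[of "\<lambda>i. cdot (w r) (\<lambda>j. X i j k)"] by simp
  then show ?thesis using vector_zero[of "\<lambda>j. X i j k"] by simp
qed

text \<open>Frame components of a tensor with two upper indices \<open>i\<close>, \<open>j\<close>
  and two lower indices \<open>k\<close>, \<open>l\<close>; \<open>p\<close> and \<open>r\<close>
  belong to the upper ones, \<open>a\<close> to \<open>k\<close> and \<open>b\<close> to
  \<open>l\<close>.\<close>

definition quad :: "('n \<Rightarrow> 'n \<Rightarrow> 'n \<Rightarrow> 'n \<Rightarrow> complex) \<Rightarrow> 'n \<Rightarrow> 'n \<Rightarrow> 'n \<Rightarrow> 'n \<Rightarrow> complex" where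
  "quad X p r a b = cdot (\<lambda>k. cdot (\<lambda>l. cdot (w p) (\<lambda>i. cdot (w r) (\<lambda>j. X i j k l))) (\<epsilon> b)) (\<epsilon> a)"

lemma quad_zero:
  assumes "\<And>p r a b. quad X p r a b = 0"
  shows "X i j k l = 0"
proof -
  have "cdot (\<lambda>l. cdot (w p) (\<lambda>i. cdot (w r) (\<lambda>j. X i j k l))) (\<epsilon> b) = 0" for p r b k
    by (rule covector_zero) (use assms in \<open>simp add: quad_def\<close>)
  then have "cdot (w p) (\<lambda>i. cdot (w r) (\<lambda>j. X i j k l)) = 0" for p r k l
    by (rule covector_zero)
  then have "cdot (w r) (\<lambda>j. X i j k l) = 0" for r i k l
    by (rule vector_zero)
  then show ?thesis by (rule vector_zero)
qed

lemma flat_sym: "flat c p a = flat a p c"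
proof -
  have "partial m (\<omega> p k) u = partial k (\<omega> p m) u" for m k
    unfolding \<omega>_def[abs_def] by (rule partial_commute[OF V smooth_on_vec_nth[OF V \<phi>] u])
  then have "flat c p a = (\<Sum>m\<in>UNIV. \<Sum>k\<in>UNIV. \<epsilon> a m * partial k (\<omega> p m) u * \<epsilon> c k)" by (simp add: flat_def)
  then show ?thesis unfolding flat_def by (subst sum.swap) (simp add: mult_ac)
qed

end

locale diagonal_metric = coframe V \<phi> u for V :: "(real^'n::finite) set" and \<phi> u +
  fixes W :: "(real^'n::finite) set" and g :: "'n tensor2" and H :: "'n \<Rightarrow> real^'n \<Rightarrow> complex"
  assumes W: "open W" "W \<subseteq> V" "u \<in> W" and g: "contravariant_metric_on W g"
    and diag: "\<And>x p r. x \<in> W \<Longrightarrow> components_in \<phi> g p r x = (if p = r then H p x else 0)"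
begin

text \<open>\<open>T c p a\<close> is the contravariant Christoffel symbol $\Gamma^{cp}_a$ of \<open>g\<close> in the coordinates \<open>\<phi>\<close>.\<close>

definition N :: "'n \<Rightarrow> 'n \<Rightarrow> 'n \<Rightarrow> complex" where
  "N c p a = contra_gamma g u (w c) (w p) (\<epsilon> a)"

definition T :: "'n \<Rightarrow> 'n \<Rightarrow> 'n \<Rightarrow> complex" where
  "T c p a = N c p a - H c u * flat c p a"

lemma components_raise: "components_in \<phi> g p r u = cdot (w r) (raise g u (w p))"
  unfolding components_in_def cdot_def raise_def \<omega>_def sum_distrib_left
  by (subst sum.swap) (simp add: mult_ac)

lemma raise_coframe: "raise g u (w p) k = H p u * \<epsilon> p k"
proof -
  have "cdot (w r) (raise g u (w p)) * \<epsilon> r k = (if r = p then H p u * \<epsilon> p k else 0)" for r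
    using diag[OF W(3), of p r] by (auto simp: components_raise)
  then show ?thesis by (subst vector_expand) simp
qed

lemma H_nonzero: "H p u \<noteq> 0"
proof
  assume "H p u = 0"
  then have "raise g u (w p) k = 0" for k by (simp add: raise_coframe)
  then have "w p i = 0" for i by (rule raise_inj[OF g W(3)])
  then show False using frame_inverse(1)[of p p] by (simp add: cdot_def)
qed

text \<open>The product rule for \<open>components_in\<close> yields a derivative of
  \<open>g\<close>, rewritten by metric compatibility, and two terms with second derivatives of the
  coordinates. The correction by \<open>flat\<close> in \<open>T\<close> absorbs exactly the latter,
  leaving the compatibility relation familiar from a chart.\<close>

lemma T_compatible: "(if p = r then along q (H p) else 0) = - (T p r q + T r p q)"
proof -
  have dw: "\<omega> p k differentiable at u" for p k by (rule smooth_on_differentiable[OF smooth_on_\<omega> u])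
  have dg: "(\<lambda>x. g x $ k $ l) differentiable at u" for k l by (rule smooth_on_differentiable[OF metric_smooth[OF g] W(3)])
  have dgc: "(\<lambda>x. complex_of_real (g x $ k $ l)) differentiable at u" for k l
    by (rule smooth_on_differentiable[OF smooth_on_of_real[OF W(1) metric_smooth[OF g]] W(3)])
  have comp: "components_in \<phi> g p r = (\<lambda>x. \<Sum>k\<in>UNIV. \<Sum>l\<in>UNIV. \<omega> p k x * \<omega> r l x * of_real (g x $ k $ l))"
    by (simp add: components_in_def \<omega>_def fun_eq_iff)
  have sm: "(\<lambda>x. \<omega> p k x * \<omega> r l x * of_real (g x $ k $ l)) differentiable at u" for k l
    by (intro differentiable_mult dw dgc)
  have D: "partial m (components_in \<phi> g p r) u = (\<Sum>k\<in>UNIV. \<Sum>l\<in>UNIV. \<omega> p k u * \<omega> r l u * of_real (partial m (\<lambda>x. g x $ k $ l) u)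
      + (\<omega> p k u * partial m (\<omega> r l) u + partial m (\<omega> p k) u * \<omega> r l u) * of_real (g u $ k $ l))" for m
    unfolding comp
    by (simp add: partial_sum differentiable_sum sm partial_mult differentiable_mult dw dgc partial_of_real[OF dg])
  have "partial m (components_in \<phi> g p r) u = (if p = r then partial m (H p) u else 0)" for m
    using partial_cong[OF W(1,3), of "components_in \<phi> g p r" "H p" m] partial_cong[OF W(1,3), of "components_in \<phi> g p r" "\<lambda>_. 0" m] diag
    by auto
  then have "(if p = r then along q (H p) else 0) = (\<Sum>m\<in>UNIV. \<epsilon> q m * partial m (components_in \<phi> g p r) u)"
    by (simp add: along_def)
  also have "\<dots> = (\<Sum>m\<in>UNIV. \<Sum>k\<in>UNIV. \<Sum>l\<in>UNIV. of_real (partial m (\<lambda>x. g x $ k $ l) u) * w p k * w r l * \<epsilon> q m)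
     + (\<Sum>m\<in>UNIV. \<Sum>k\<in>UNIV. \<Sum>l\<in>UNIV. \<epsilon> q m * partial m (\<omega> r l) u * (of_real (g u $ k $ l) * w p k))
     + (\<Sum>m\<in>UNIV. \<Sum>k\<in>UNIV. \<Sum>l\<in>UNIV. \<epsilon> q m * partial m (\<omega> p k) u * (of_real (g u $ k $ l) * w r l))"
    unfolding D sum_distrib_left sum.distrib[symmetric] by (intro sum.cong refl) (simp add: algebra_simps)
  also have "(\<Sum>m\<in>UNIV. \<Sum>k\<in>UNIV. \<Sum>l\<in>UNIV. of_real (partial m (\<lambda>x. g x $ k $ l) u) * w p k * w r l * \<epsilon> q m)
      = - (N p r q + N r p q)"
  proof -
    have "(\<Sum>m\<in>UNIV. \<Sum>k\<in>UNIV. \<Sum>l\<in>UNIV. F m k l) = (\<Sum>k\<in>UNIV. \<Sum>l\<in>UNIV. \<Sum>m\<in>UNIV. F m k l)" for F :: "'n \<Rightarrow> 'n \<Rightarrow> 'n \<Rightarrow> complex"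
      by (subst sum.swap) (rule sum.cong[OF refl], rule sum.swap)
    then show ?thesis unfolding N_def contra_gamma_compatible[OF W(1) g W(3), symmetric] by simp
  qed
  also have "(\<Sum>m\<in>UNIV. \<Sum>k\<in>UNIV. \<Sum>l\<in>UNIV. \<epsilon> q m * partial m (\<omega> r l) u * (of_real (g u $ k $ l) * w p k)) = H p u * flat p r q"
  proof -
    have "(\<Sum>k\<in>UNIV. \<Sum>l\<in>UNIV. \<epsilon> q m * partial m (\<omega> r l) u * (of_real (g u $ k $ l) * w p k)) =
        (\<Sum>l\<in>UNIV. \<epsilon> q m * partial m (\<omega> r l) u * raise g u (w p) l)" for m
      unfolding raise_def sum_distrib_left by (rule sum.swap)
    then show ?thesis unfolding raise_coframe flat_def sum_distrib_left by (simp add: mult_ac)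
  qed
  also have "(\<Sum>m\<in>UNIV. \<Sum>k\<in>UNIV. \<Sum>l\<in>UNIV. \<epsilon> q m * partial m (\<omega> p k) u * (of_real (g u $ k $ l) * w r l)) = H r u * flat r p q"
  proof -
    have "(\<Sum>l\<in>UNIV. \<epsilon> q m * partial m (\<omega> p k) u * (of_real (g u $ k $ l) * w r l)) =
        \<epsilon> q m * partial m (\<omega> p k) u * raise g u (w r) k" for m k
      unfolding raise_def sum_distrib_left by (simp add: contravariant_metric_onD(1)[OF g W(3), of k])
    then show ?thesis unfolding raise_coframe flat_def sum_distrib_left by (simp add: mult_ac)
  qed
  finally show ?thesis by (simp add: T_def)
qed

text \<open>Torsion-freeness in the frame, where raising \<open>w p\<close> gives
  \<open>H p u\<close> times \<open>\<epsilon> p\<close>. The second derivatives of the coordinates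
  cancel because \<open>flat\<close> is symmetric.\<close>

lemma T_exchange: "H q u * T p r q = H p u * T q r p"
proof -
  have sc: "contra_gamma g u a b (\<lambda>k. c * v k) = c * contra_gamma g u a b v" for a b c v
    using contra_gamma_linear[of g u a b c v 0 v] by simp
  have "contra_gamma g u (w q) (w r) (raise g u (w p)) = contra_gamma g u (w p) (w r) (raise g u (w q))"
    by (rule contra_gamma_raise_sym[OF W(1) g W(3)])
  then have "H p u * N q r p = H q u * N p r q"
    unfolding N_def sc[symmetric] raise_coframe[abs_def] by (simp add: raise_coframe[abs_def])
  then show ?thesis unfolding T_def using flat_sym[of p r q] by (simp add: algebra_simps)
qed

text \<open>The Christoffel symbols of an orthogonal metric. \<open>T_compatible\<close> determines
  the terms with equal upper indices and gives antisymmetry otherwise; \<open>T_exchange\<close>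
  carries this over to the remaining terms with a repeated index.\<close>

lemma T_eq:
  "T p r q = (if p = r then - (1/2) * along q (H p)
     else if q = r then - (1/2) * (H p u / H r u) * along p (H r)
     else if q = p then (1/2) * (H r u / H p u) * along r (H p) else 0)"
proof -
  have pp: "T p p q = - (1/2) * along q (H p)" for p q
    using T_compatible[of p p q] by (simp add: field_simps)
  have rr: "T p r r = - (1/2) * (H p u / H r u) * along p (H r)" if "p \<noteq> r" for p r
    using T_exchange[of r p r] pp[of r p] H_nonzero[of r] by (simp add: field_simps)
  have anti: "T p r q = - T r p q" if "p \<noteq> r" for p r q
    using T_compatible[of p r q] that by (simp add: eq_neg_iff_add_eq_0 del: minus_add_distrib)
  show ?thesis
  proof (cases "p = r \<or> q = r \<or> q = p")
    case True
    then consider "p = r" | "p \<noteq> r" "q = r" | "p \<noteq> r" "q \<noteq> r" "q = p" by blast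
    then show ?thesis using pp[of r q] rr[of p r] rr[of r p] anti[of p r p] by cases simp_all
  next
    case False
    then have d: "p \<noteq> r" "q \<noteq> r" "q \<noteq> p" by auto
    \<comment> \<open>Symmetric in the first two arguments and antisymmetric in the last two when
      these differ. Using both alternately, three times each, returns to the same term with the
      opposite sign.\<close>
    define S where "S q p r = H q u * T p r q" for q p r
    have s1: "S q p r = S p q r" for q p r unfolding S_def by (rule T_exchange)
    have s2: "S q p r = - S q r p" if "p \<noteq> r" for q p r unfolding S_def using anti[OF that] by simp
    have "S q p r = - S q p r"
      using s1 s2 d by (metis minus_minus)
    then have "S q p r = 0" by (simp add: eq_neg_iff_add_eq_0)
    then show ?thesis using d H_nonzero[of q] by (simp add: S_def)
  qed
qed

text \<open>The contraction over \<open>s\<close> is rewritten as one over the frame by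
  \<open>pairing_expand\<close>. A Christoffel symbol with its index lowered is the contravariant
  one divided by \<open>H c u\<close>, and this is where the denominator comes from.\<close>

lemma curvature_term:
  "quad (\<lambda>i j k l. of_real (\<Sum>s\<in>UNIV. contra_christoffel g s i k u * christoffel g j s l u)) p r a b
    = (\<Sum>c\<in>UNIV. N c p a * N c r b / H c u)"
proof -
  define x where "x s = cdot (\<lambda>k. cdot (w p) (\<lambda>i. of_real (contra_christoffel g s i k u))) (\<epsilon> a)" for s
  define y where "y s = cdot (\<lambda>l. cdot (w r) (\<lambda>j. of_real (christoffel g j s l u))) (\<epsilon> b)" for s
  have "quad (\<lambda>i j k l. of_real (\<Sum>s\<in>UNIV. contra_christoffel g s i k u * christoffel g j s l u)) p r a b = cdot y x"
  proof -
    have 1: "cdot (w r) (\<lambda>j. of_real (\<Sum>s\<in>UNIV. contra_christoffel g s i k u * christoffel g j s l u))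
       = (\<Sum>s\<in>UNIV. cdot (w r) (\<lambda>j. of_real (christoffel g j s l u)) * of_real (contra_christoffel g s i k u))" for i k l
      unfolding of_real_sum of_real_mult cdot_sum cdot_scale by (simp add: mult.commute)
    have 2: "quad (\<lambda>i j k l. of_real (\<Sum>s\<in>UNIV. contra_christoffel g s i k u * christoffel g j s l u)) p r a b
       = (\<Sum>s\<in>UNIV. x s * y s)"
      unfolding quad_def 1 cdot_sum cdot_scale cdot_sum_left cdot_scale_right x_def y_def by (simp add: mult.commute)
    show ?thesis unfolding 2 by (simp add: cdot_def mult.commute)
  qed
  moreover have "cdot (w c) x = N c p a" for c
  proof -
    have "cdot (w c) x = (\<Sum>s\<in>UNIV. \<Sum>k\<in>UNIV. \<Sum>i\<in>UNIV. of_real (contra_christoffel g s i k u) * w c s * w p i * \<epsilon> a k)"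
      by (simp add: cdot_def x_def sum_distrib_left sum_distrib_right mult_ac)
    also have "\<dots> = N c p a" unfolding N_def contra_gamma_def by (rule sum.cong[OF refl]) (rule sum.swap)
    finally show ?thesis .
  qed
  moreover have "H c u * cdot y (\<epsilon> c) = N c r b" for c
  proof -
    have "N c r b = cdot (w r) (\<lambda>j. H c u * gamma g u (\<epsilon> c) (\<epsilon> b) j)"
      unfolding N_def contra_gamma_eq raise_coframe[abs_def] gamma_scale ..
    also have "\<dots> = H c u * cdot (w r) (gamma g u (\<epsilon> c) (\<epsilon> b))" by (rule cdot_scale)
    also have "cdot (w r) (gamma g u (\<epsilon> c) (\<epsilon> b)) = cdot y (\<epsilon> c)"
    proof -
      have "cdot (w r) (gamma g u (\<epsilon> c) (\<epsilon> b)) = (\<Sum>s\<in>UNIV. \<Sum>j\<in>UNIV. \<Sum>l\<in>UNIV. of_real (christoffel g j s l u) * w r j * \<epsilon> b l * \<epsilon> c s)"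
        unfolding cdot_def gamma_def sum_distrib_left by (subst sum.swap) (simp add: mult_ac)
      also have "\<dots> = (\<Sum>s\<in>UNIV. \<Sum>l\<in>UNIV. \<Sum>j\<in>UNIV. of_real (christoffel g j s l u) * w r j * \<epsilon> b l * \<epsilon> c s)"
        by (rule sum.cong[OF refl]) (rule sum.swap)
      also have "\<dots> = cdot y (\<epsilon> c)"
        by (simp add: cdot_def y_def sum_distrib_left sum_distrib_right mult_ac)
      finally show ?thesis .
    qed
    finally show ?thesis by simp
  qed
  ultimately have "quad (\<lambda>i j k l. of_real (\<Sum>s\<in>UNIV. contra_christoffel g s i k u * christoffel g j s l u)) p r a b = (\<Sum>c\<in>UNIV. N c p a * cdot y (\<epsilon> c))"
    and y: "N c r b = H c u * cdot y (\<epsilon> c)" for c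
    using pairing_expand[of y x] by simp_all
  then show ?thesis using H_nonzero by simp
qed

end

text \<open>\<open>along_h\<close> is the infinitesimal form of dependence of \<open>h p\<close> on
  the coordinate \<open>p\<close> alone. The factor \<gamma> will be common to both metrics and
  their pencil, which then differ only in \<open>h\<close>.\<close>

locale scaled_diagonal = diagonal_metric V \<phi> u W g "\<lambda>p x. h p x * \<gamma> p x"
  for V :: "(real^'n::finite) set" and \<phi> u W g and h \<gamma> :: "'n \<Rightarrow> real^'n \<Rightarrow> complex" +
  assumes h: "\<And>p. h p differentiable at u" and \<gamma>: "\<And>p. \<gamma> p differentiable at u"
    and along_h: "\<And>p q. p \<noteq> q \<Longrightarrow> along q (h p) = 0"

text \<open>\<open>T_eq\<close> read as a function of the values \<open>h p\<close> and of the
  derivatives \<open>d p\<close> along the matching coordinate, with \<gamma> held fixed. The pair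
  enters linearly, and this is the linearity of the connection.\<close>

definition (in coframe) connection_part ::
  "('n \<Rightarrow> real^'n \<Rightarrow> complex) \<Rightarrow> ('n \<Rightarrow> complex) \<Rightarrow> ('n \<Rightarrow> complex) \<Rightarrow> 'n \<Rightarrow> 'n \<Rightarrow> 'n \<Rightarrow> complex" where
  "connection_part \<gamma> h d c p a =
     (if c = p then - (1/2) * h c * along a (\<gamma> c) - (if a = c then (1/2) * \<gamma> c u * d c else 0)
      else if a = p then - (1/2) * h c * (\<gamma> c u / \<gamma> p u) * along c (\<gamma> p)
      else if a = c then (1/2) * h p * (\<gamma> p u / \<gamma> c u) * along p (\<gamma> c) else 0)"

text \<open>In a term such as \<open>H p u / H r u * along p (H r)\<close> of \<open>T_eq\<close>
  the factor \<open>h r u\<close> cancels, because \<open>h r\<close> has no derivative along a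
  different coordinate.\<close>

lemma (in scaled_diagonal) T_scaled:
  "T c p a = connection_part \<gamma> (\<lambda>p. h p u) (\<lambda>p. along p (h p)) c p a" "h p u \<noteq> 0" "\<gamma> p u \<noteq> 0"
proof -
  show nz: "h p u \<noteq> 0" "\<gamma> p u \<noteq> 0" for p using H_nonzero[of p] by auto
  have al: "along q (\<lambda>x. h p x * \<gamma> p x) = h p u * along q (\<gamma> p) + (if p = q then \<gamma> p u * along q (h p) else 0)" for p q
  proof -
    have "along q (\<lambda>x. h p x * \<gamma> p x) = h p u * along q (\<gamma> p) + along q (h p) * \<gamma> p u"
      unfolding along_def partial_mult[OF h \<gamma>] sum_distrib_left sum_distrib_right sum.distrib[symmetric]
      by (intro sum.cong refl) (simp add: algebra_simps)
    then show ?thesis using along_h[of p q] by auto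
  qed
  show "T c p a = connection_part \<gamma> (\<lambda>p. h p u) (\<lambda>p. along p (h p)) c p a"
    unfolding T_eq connection_part_def al using nz[of c] nz[of p]
    by (auto simp: field_simps)
qed

section \<open>Linearity of the connection and of the quadratic curvature terms\<close>

context coframe
begin

lemma connection_part_linear:
  "connection_part \<gamma> (\<lambda>p. l1 * h1 p + l2 * h2 p) (\<lambda>p. l1 * d1 p + l2 * d2 p) c p a
    = l1 * connection_part \<gamma> h1 d1 c p a + l2 * connection_part \<gamma> h2 d2 c p a"
  by (simp add: connection_part_def algebra_simps)

definition quadratic_part ::
  "('n \<Rightarrow> real^'n \<Rightarrow> complex) \<Rightarrow> ('n \<Rightarrow> complex) \<Rightarrow> ('n \<Rightarrow> complex) \<Rightarrow> 'n \<Rightarrow> 'n \<Rightarrow> 'n \<Rightarrow> 'n \<Rightarrow> 'n \<Rightarrow> complex" where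
  "quadratic_part \<gamma> h d c p r a b =
     (connection_part \<gamma> h d c p a * connection_part \<gamma> h d c r b - connection_part \<gamma> h d c p b * connection_part \<gamma> h d c r a) / (h c * \<gamma> c u)"

text \<open>The factor \<open>h c\<close> in the denominator always cancels: the only products without it, of the form
  \<open>h p * h r\<close>, have \<open>a = b = c\<close> and drop out of the antisymmetrisation.\<close>

lemma quadratic_part_linear:
  assumes nz: "\<And>p. h1 p \<noteq> 0" "\<And>p. h2 p \<noteq> 0" "\<And>p. l1 * h1 p + l2 * h2 p \<noteq> 0" "\<And>p. \<gamma> p u \<noteq> 0"
  shows "quadratic_part \<gamma> (\<lambda>p. l1 * h1 p + l2 * h2 p) (\<lambda>p. l1 * d1 p + l2 * d2 p) c p r a b
    = l1 * quadratic_part \<gamma> h1 d1 c p r a b + l2 * quadratic_part \<gamma> h2 d2 c p r a b"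
proof (cases "p = r \<or> a = b")
  case True
  then show ?thesis by (auto simp: quadratic_part_def)
next
  case False
  then have ne: "p \<noteq> r" "a \<noteq> b" by auto
  let ?T = "connection_part \<gamma>"
  define \<alpha> where "\<alpha> c p = - (1/2) * (\<gamma> c u / \<gamma> p u) * along c (\<gamma> p)" for c p
  define \<beta> where "\<beta> c p = (1/2) * (\<gamma> p u / \<gamma> c u) * along p (\<gamma> c)" for c p
  define \<delta> where "\<delta> c a = - (1/2) * along a (\<gamma> c)" for c a
  define \<kappa> where "\<kappa> c = - (1/2) * \<gamma> c u" for c
  have T: "?T h d c p a = (if c = p then h c * \<delta> c a + (if a = c then \<kappa> c * d c else 0)
      else if a = p then h c * \<alpha> c p else if a = c then h p * \<beta> c p else 0)" for h d c p a
    by (simp add: connection_part_def \<alpha>_def \<beta>_def \<delta>_def \<kappa>_def)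
  \<comment> \<open>When \<open>b = p\<close>, distinctness of \<open>a\<close> and \<open>b\<close>
    excludes the term with \<open>d p\<close> from \<open>?T h d p p a\<close>, which is then
    divisible by \<open>h p\<close>; when \<open>b = r\<close>, the other factor is. The denominator
    disappears in both cases.\<close>
  have diag: "quadratic_part \<gamma> h d p p r a b =
     ((if b = r then ?T h d p p a * \<alpha> p r else if b = p then h r * \<beta> p r * \<delta> p a else 0)
      - (if a = r then ?T h d p p b * \<alpha> p r else if a = p then h r * \<beta> p r * \<delta> p b else 0)) / \<gamma> p u"
    if "h p \<noteq> 0" "p \<noteq> r" "a \<noteq> b" for h d p r a b
    using that nz(4)[of p] by (auto simp: quadratic_part_def T field_simps)
  \<comment> \<open>The case \<open>c = r\<close> is the case \<open>c = p\<close> with the pairs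
    \<open>(p, a)\<close> and \<open>(r, b)\<close> exchanged.\<close>
  have swap: "quadratic_part \<gamma> h d r p r a b = quadratic_part \<gamma> h d r r p b a" for h d
    by (simp add: quadratic_part_def mult.commute)
  have off: "quadratic_part \<gamma> h d c p r a b =
     ((if a = p \<and> b = r then h c * \<alpha> c p * \<alpha> c r else 0) + (if a = p \<and> b = c then h r * \<alpha> c p * \<beta> c r else 0)
      + (if a = c \<and> b = r then h p * \<beta> c p * \<alpha> c r else 0)
      - ((if b = p \<and> a = r then h c * \<alpha> c p * \<alpha> c r else 0) + (if b = p \<and> a = c then h r * \<alpha> c p * \<beta> c r else 0)
      + (if b = c \<and> a = r then h p * \<beta> c p * \<alpha> c r else 0))) / \<gamma> c u"
    if "h c \<noteq> 0" "c \<noteq> p" "c \<noteq> r" for h d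
    using ne that nz(4)[of c] by (auto simp: quadratic_part_def T field_simps)
  consider "c = p" | "c = r" | "c \<noteq> p" "c \<noteq> r" by auto
  then show ?thesis
  proof cases
    case 1
    show ?thesis unfolding 1 diag[OF nz(1) ne] diag[OF nz(2) ne] diag[OF nz(3) ne] connection_part_linear
      by (simp add: field_simps nz(4))
  next
    case 2
    show ?thesis
      unfolding 2 swap diag[OF nz(1) ne(1)[symmetric] ne(2)[symmetric]] diag[OF nz(2) ne(1)[symmetric] ne(2)[symmetric]]
        diag[OF nz(3) ne(1)[symmetric] ne(2)[symmetric]] connection_part_linear
      by (simp add: field_simps nz(4))
  next
    case 3
    show ?thesis unfolding off[OF nz(1) 3] off[OF nz(2) 3] off[OF nz(3) 3]
      unfolding times_divide_eq_right add_divide_distrib[symmetric]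
      by (rule arg_cong[where f="\<lambda>x. x / \<gamma> c u"]) (use ne 3 in \<open>auto simp: algebra_simps\<close>)
  qed
qed

lemma quad_swap: "quad (\<lambda>i j k l. X i j l k) p r a b = quad X p r b a"
  unfolding quad_def cdot_def sum_distrib_left sum_distrib_right
  by (subst sum.swap) (simp add: mult_ac)

lemma quad_linear:
  "quad (\<lambda>i j k l. X i j k l + Y i j k l) p r a b = quad X p r a b + quad Y p r a b"
  "quad (\<lambda>i j k l. c * X i j k l) p r a b = c * quad X p r a b"
  unfolding quad_def by (simp_all add: cdot_add cdot_scale)

end

text \<open>The part of \<open>contra_riemann_formula\<close> without derivatives of
  \<open>contra_christoffel\<close>. The derivative part is linear once the connection is linear on
  an open set.\<close>

definition quadratic_curvature :: "'n::finite tensor2 \<Rightarrow> 'n \<Rightarrow> 'n \<Rightarrow> 'n \<Rightarrow> 'n \<Rightarrow> real^'n \<Rightarrow> real" where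
  "quadratic_curvature g i j k l u = (\<Sum>s\<in>UNIV. contra_christoffel g s i k u * christoffel g j s l u)
     - (\<Sum>s\<in>UNIV. contra_christoffel g s i l u * christoffel g j s k u)"

lemma (in scaled_diagonal) N_scaled:
  "N c p a = connection_part \<gamma> (\<lambda>p. h p u) (\<lambda>p. along p (h p)) c p a + h c u * \<gamma> c u * flat c p a"
  using T_scaled(1)[of c p a] unfolding T_def by (simp only: diff_eq_eq)

text \<open>Dividing a product of two sums from \<open>N_scaled\<close> by
  \<open>h c u * \<gamma> c u\<close> leaves a quotient free of \<open>flat\<close>, mixed terms,
  and a multiple of a product of two \<open>flat\<close>. The last two groups are linear in the
  scaling data, so only the quotient needs \<open>quadratic_part_linear\<close>.\<close>

lemma (in scaled_diagonal) quad_curvature: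
  "quad (\<lambda>i j k l. of_real (quadratic_curvature g i j k l u)) p r a b =
     (let S = connection_part \<gamma> (\<lambda>p. h p u) (\<lambda>p. along p (h p)) in
     (\<Sum>c\<in>UNIV. quadratic_part \<gamma> (\<lambda>p. h p u) (\<lambda>p. along p (h p)) c p r a b
       + (S c p a * flat c r b + flat c p a * S c r b - S c p b * flat c r a - flat c p b * S c r a)
       + h c u * \<gamma> c u * (flat c p a * flat c r b - flat c p b * flat c r a)))"
proof -
  let ?X = "\<lambda>i j k l. complex_of_real (\<Sum>s\<in>UNIV. contra_christoffel g s i k u * christoffel g j s l u)"
  have eq: "(\<lambda>i j k l. complex_of_real (quadratic_curvature g i j k l u)) = (\<lambda>i j k l. ?X i j k l + (-1) * ?X i j l k)"
    by (simp add: quadratic_curvature_def fun_eq_iff)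
  have "quad (\<lambda>i j k l. of_real (quadratic_curvature g i j k l u)) p r a b = quad ?X p r a b - quad ?X p r b a"
    unfolding eq quad_linear quad_linear(2)[of "-1" "\<lambda>i j k l. ?X i j l k"] quad_swap[of ?X] by simp
  also have "\<dots> = (\<Sum>c\<in>UNIV. N c p a * N c r b / (h c u * \<gamma> c u) - N c p b * N c r a / (h c u * \<gamma> c u))"
    unfolding curvature_term by (simp add: sum_subtractf)
  finally have *: "quad (\<lambda>i j k l. of_real (quadratic_curvature g i j k l u)) p r a b =
    (\<Sum>c\<in>UNIV. N c p a * N c r b / (h c u * \<gamma> c u) - N c p b * N c r a / (h c u * \<gamma> c u))" .
  have "(S1 + H * F1) * (S2 + H * F2) / H - (S3 + H * F3) * (S4 + H * F4) / H =
      (S1 * S2 - S3 * S4) / H + (S1 * F2 + F1 * S2 - S3 * F4 - F3 * S4) + H * (F1 * F2 - F3 * F4)"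
    if "H \<noteq> 0" for S1 S2 S3 S4 F1 F2 F3 F4 H :: complex
    using that by (simp add: field_simps)
  then show ?thesis
    unfolding N_scaled Let_def quadratic_part_def *
    by (intro sum.cong refl) (simp add: T_scaled(2,3))
qed

context coframe
begin

text \<open>The three metrics share coordinates and \<gamma>, and the scaling function of the third
  is the linear combination of the others. Linearity is verified on all contractions with frame and
  coframe, which determine the real components.\<close>

lemma pencil_linear:
  fixes l1 l2 :: real and h1 h2 :: "'n \<Rightarrow> real^'n \<Rightarrow> complex"
  assumes 1: "scaled_diagonal V \<phi> u W1 g1 h1 \<gamma>" and 2: "scaled_diagonal V \<phi> u W2 g2 h2 \<gamma>"
    and 3: "scaled_diagonal V \<phi> u W g (\<lambda>p x. of_real l1 * h1 p x + of_real l2 * h2 p x) \<gamma>"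
  shows "contra_christoffel g i j k u = l1 * contra_christoffel g1 i j k u + l2 * contra_christoffel g2 i j k u"
    and "quadratic_curvature g i j k l u = l1 * quadratic_curvature g1 i j k l u + l2 * quadratic_curvature g2 i j k l u"
proof -
  interpret d1: scaled_diagonal V \<phi> u W1 g1 h1 \<gamma> by fact
  interpret d2: scaled_diagonal V \<phi> u W2 g2 h2 \<gamma> by fact
  interpret d: scaled_diagonal V \<phi> u W g "\<lambda>p x. of_real l1 * h1 p x + of_real l2 * h2 p x" \<gamma> by fact
  have al: "along p (\<lambda>x. of_real l1 * h1 p x + of_real l2 * h2 p x) = of_real l1 * along p (h1 p) + of_real l2 * along p (h2 p)" for p
  proof -
    have "partial k (\<lambda>x. of_real l1 * h1 p x + of_real l2 * h2 p x) u = of_real l1 * partial k (h1 p) u + of_real l2 * partial k (h2 p) u" for k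
      by (simp add: partial_add partial_mult differentiable_mult d1.h d2.h)
    then show ?thesis by (simp add: along_def sum.distrib sum_distrib_left algebra_simps)
  qed
  have N: "d.N c p a - of_real l1 * d1.N c p a - of_real l2 * d2.N c p a = 0" for c p a
    unfolding d.N_scaled d1.N_scaled d2.N_scaled al connection_part_linear by (simp add: algebra_simps)
  have "complex_of_real (contra_christoffel g i j k u - l1 * contra_christoffel g1 i j k u - l2 * contra_christoffel g2 i j k u) = 0"
  proof (rule trilinear_zero[of "\<lambda>i j k. complex_of_real (contra_christoffel g i j k u - l1 * contra_christoffel g1 i j k u - l2 * contra_christoffel g2 i j k u)"])
    fix p r q
    show "(\<Sum>i\<in>UNIV. \<Sum>j\<in>UNIV. \<Sum>k\<in>UNIV. complex_of_real (contra_christoffel g i j k u - l1 * contra_christoffel g1 i j k u - l2 * contra_christoffel g2 i j k u)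
       * w p i * w r j * \<epsilon> q k) = 0"
      unfolding N[of p r q, symmetric] unfolding d.N_def d1.N_def d2.N_def contra_gamma_def
        sum_distrib_left sum_subtractf[symmetric]
      by (intro sum.cong refl) (simp add: algebra_simps)
  qed
  then show "contra_christoffel g i j k u = l1 * contra_christoffel g1 i j k u + l2 * contra_christoffel g2 i j k u"
    unfolding of_real_eq_0_iff by simp
  let ?X = "\<lambda>g i j k l. complex_of_real (quadratic_curvature g i j k l u)"
  have "complex_of_real (quadratic_curvature g i j k l u) + (of_real (- l1) * complex_of_real (quadratic_curvature g1 i j k l u)
     + of_real (- l2) * complex_of_real (quadratic_curvature g2 i j k l u)) = 0"
  proof (rule quad_zero[of "\<lambda>i j k l. ?X g i j k l + (of_real (- l1) * ?X g1 i j k l + of_real (- l2) * ?X g2 i j k l)"])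
    fix p r a b
    show "quad (\<lambda>i j k l. ?X g i j k l + (of_real (- l1) * ?X g1 i j k l + of_real (- l2) * ?X g2 i j k l)) p r a b = 0"
      unfolding quad_linear d.quad_curvature d1.quad_curvature d2.quad_curvature Let_def al connection_part_linear
        quadratic_part_linear[of "\<lambda>p. h1 p u" "\<lambda>p. h2 p u" "of_real l1" "of_real l2" \<gamma>, OF d1.T_scaled(2) d2.T_scaled(2) d.T_scaled(2) d.T_scaled(3)]
        sum_distrib_left sum.distrib[symmetric]
      by (rule sum.neutral) (simp add: algebra_simps)
  qed
  then have "complex_of_real (quadratic_curvature g i j k l u) = complex_of_real (l1 * quadratic_curvature g1 i j k l u + l2 * quadratic_curvature g2 i j k l u)"
    by (simp add: algebra_simps)
  then show "quadratic_curvature g i j k l u = l1 * quadratic_curvature g1 i j k l u + l2 * quadratic_curvature g2 i j k l u"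
    unfolding of_real_eq_iff .
qed

end

section \<open>Compatibility of diagonal pairs\<close>

lemma smooth_on_components_in:
  assumes "open V" "smooth_on \<phi> V" "contravariant_metric_on V g"
  shows "smooth_on (components_in \<phi> g i j) V"
  unfolding components_in_def[abs_def]
  by (intro smooth_intros smooth_on_partial smooth_on_vec_nth smooth_on_of_real assms metric_smooth[OF assms(3)])

lemma components_in_pencil:
  "components_in \<phi> (pencil l1 l2 g1 g2) i j u = of_real l1 * components_in \<phi> g1 i j u + of_real l2 * components_in \<phi> g2 i j u"
  unfolding components_in_def sum_distrib_left sum.distrib[symmetric]
  by (intro sum.cong refl) (simp add: pencil_def algebra_simps)

lemma contravariant_metric_on_subset:
  "contravariant_metric_on U g \<Longrightarrow> V \<subseteq> U \<Longrightarrow> contravariant_metric_on V g"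
  unfolding contravariant_metric_on_def by (meson smooth_on_subset subsetD)

text \<open>The derivative of \<open>f\<close> exists only within the image of \<psi>, but the
  points of the open set \<open>V\<close> all map into that image, so the chain rule holds at full
  neighbourhoods in the domain.\<close>

lemma partial_holomorphic_compose:
  fixes \<psi> :: "real^'n::finite \<Rightarrow> complex"
  assumes "f holomorphic_on \<psi> ` V" "open V" "u \<in> V" "\<psi> differentiable at u"
  obtains d where "(\<lambda>x. f (\<psi> x)) differentiable at u" "\<And>k. partial k (\<lambda>x. f (\<psi> x)) u = d * partial k \<psi> u"
proof -
  obtain d where "(f has_field_derivative d) (at (\<psi> u) within \<psi> ` V)"
    using assms(1,3) unfolding holomorphic_on_def field_differentiable_def by blast
  then have "((\<lambda>x. f (\<psi> x)) has_derivative (\<lambda>v. d * frechet_derivative \<psi> (at u) v)) (at u within V)"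
    using has_derivative_in_compose[of \<psi> "frechet_derivative \<psi> (at u)" u V f "(*) d"]
      assms(4)[unfolded frechet_derivative_works] unfolding has_field_derivative_def
    by (simp add: has_derivative_at_withinI)
  then have D: "((\<lambda>x. f (\<psi> x)) has_derivative (\<lambda>v. d * frechet_derivative \<psi> (at u) v)) (at u)"
    using at_within_open[OF assms(3,2)] by simp
  then have "partial k (\<lambda>x. f (\<psi> x)) u = d * partial k \<psi> u" for k
    unfolding partial_def using fun_cong[OF frechet_derivative_at[OF D], of "axis k 1"] by simp
  with D show thesis using that unfolding differentiable_def by blast
qed

text \<open>With \<gamma> read off from \<open>g2\<close>, the scaling function is 1 for
  \<open>g2\<close>, \<open>F\<close> for \<open>g1\<close> and their linear combination for the
  pencil, so \<open>pencil_linear\<close> applies. Since \<open>F p\<close> is a function of one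
  coordinate, its derivative along any other vanishes.\<close>

theorem diagonal_form_compatible:
  assumes U: "open U" and g1: "contravariant_metric_on U g1" and g2: "contravariant_metric_on U g2"
    and V: "V \<subseteq> U" and D: "diagonal_form_on V \<phi> f g g1 g2"
    and u: "u \<in> V" "det (pencil l1 l2 g1 g2 u) \<noteq> 0"
  shows "contra_christoffel (pencil l1 l2 g1 g2) i j k u = l1 * contra_christoffel g1 i j k u + l2 * contra_christoffel g2 i j k u"
    and "contra_riemann (pencil l1 l2 g1 g2) i j k l u = l1 * contra_riemann g1 i j k l u + l2 * contra_riemann g2 i j k l u"
proof -
  let ?P = "pencil l1 l2 g1 g2"
  have coord: "open V" "smooth_on \<phi> V" "\<And>x. x \<in> V \<Longrightarrow> det (\<chi> i k. partial k (\<lambda>x. \<phi> x $ i) x) \<noteq> 0"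
    and hol: "\<And>i. f i holomorphic_on ((\<lambda>u. \<phi> u $ i) ` V)"
    using D unfolding diagonal_form_on_def complex_coordinates_on_def by auto
  have V1: "contravariant_metric_on V g1" and V2: "contravariant_metric_on V g2"
    using contravariant_metric_on_subset[OF _ V] g1 g2 by auto
  \<comment> \<open>An open neighbourhood on which the pencil is a metric. Linearity of the
    connection is needed on all of it, because the curvature contains its derivatives at
    \<open>u\<close>.\<close>
  define W where "W = {x\<in>V. det (?P x) \<noteq> 0}"
  have W: "open W" "contravariant_metric_on W ?P" "W \<subseteq> V" "u \<in> W"
    using pencil_metric[OF coord(1) V1 V2, of l1 l2] u unfolding W_def by auto
  define \<gamma> where "\<gamma> p x = components_in \<phi> g2 p p x" for p x
  define F where "F p x = f p (\<phi> x $ p)" for p x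
  have c2: "components_in \<phi> g2 p r x = (if p = r then 1 * \<gamma> p x else 0)"
    and c1: "components_in \<phi> g1 p r x = (if p = r then F p x * \<gamma> p x else 0)" if "x \<in> V" for p r x
    using D that unfolding diagonal_form_on_def \<gamma>_def F_def by auto
  have cP: "components_in \<phi> ?P p r x = (if p = r then (of_real l1 * F p x + of_real l2 * 1) * \<gamma> p x else 0)" if "x \<in> V" for p r x
    using c1[OF that] c2[OF that] by (simp add: components_in_pencil algebra_simps)
  have cf: "coframe V \<phi> x" if "x \<in> V" for x
    using coord that by unfold_locales auto
  have \<gamma>: "\<gamma> p differentiable at x" if "x \<in> V" for p x
    using smooth_on_differentiable[OF smooth_on_components_in[OF coord(1,2) V2] that] unfolding \<gamma>_def[abs_def] by simp
  have F: "F p differentiable at x" "p \<noteq> q \<Longrightarrow> coframe.along \<phi> x q (F p) = 0" if x: "x \<in> V" for p q x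
  proof -
    interpret coframe V \<phi> x by (rule cf[OF x])
    obtain d where d: "F p differentiable at x" "\<And>k. partial k (F p) x = d * partial k (\<lambda>x. \<phi> x $ p) x"
      using partial_holomorphic_compose[OF hol[of p] coord(1) x smooth_on_differentiable[OF smooth_on_vec_nth[OF coord(1,2)] x]]
      unfolding F_def by metis
    have "along q (F p) = d * cdot (w p) (\<epsilon> q)"
      unfolding along_def cdot_def d(2) sum_distrib_left \<omega>_def by (simp add: mult_ac)
    then show "F p differentiable at x" "p \<noteq> q \<Longrightarrow> along q (F p) = 0" using d(1) frame_inverse(1) by auto
  qed
  have al: "coframe.along \<phi> x q (\<lambda>x. of_real l1 * F p x + of_real l2 * 1) = 0" "coframe.along \<phi> x q (\<lambda>_. 1) = 0"
    if "x \<in> V" "p \<noteq> q" for x p q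
  proof -
    interpret coframe V \<phi> x by (rule cf[OF that(1)])
    have "partial k (\<lambda>x. of_real l1 * F p x + of_real l2 * 1) x = of_real l1 * partial k (F p) x" for k
      by (simp add: partial_add partial_mult F(1)[OF that(1)] differentiable_mult)
    then have "along q (\<lambda>x. of_real l1 * F p x + of_real l2 * 1) = of_real l1 * along q (F p)"
      by (simp add: along_def sum_distrib_left mult_ac)
    then show "along q (\<lambda>x. of_real l1 * F p x + of_real l2 * 1) = 0" "along q (\<lambda>_. 1) = 0"
      using F(2)[OF that] by (simp_all add: along_def)
  qed
  have lin: "contra_christoffel ?P i j k x = l1 * contra_christoffel g1 i j k x + l2 * contra_christoffel g2 i j k x"
    "quadratic_curvature ?P i j k l x = l1 * quadratic_curvature g1 i j k l x + l2 * quadratic_curvature g2 i j k l x"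
    if x: "x \<in> W" for x i j k l
  proof -
    have xV: "x \<in> V" using x W(3) by auto
    interpret coframe V \<phi> x by (rule cf[OF xV])
    have 1: "scaled_diagonal V \<phi> x V g1 F \<gamma>"
      by unfold_locales (use coord(1) xV V1 c1 F \<gamma> in auto)
    have 2: "scaled_diagonal V \<phi> x V g2 (\<lambda>_ _. 1) \<gamma>"
      by unfold_locales (use coord(1) xV V2 c2 al(2) \<gamma> in auto)
    have 3: "scaled_diagonal V \<phi> x W ?P (\<lambda>p x. of_real l1 * F p x + of_real l2 * 1) \<gamma>"
      by unfold_locales (use W x xV cP al(1) F(1)[OF xV] \<gamma> in \<open>auto intro!: differentiable_add differentiable_mult\<close>)
    show "contra_christoffel ?P i j k x = l1 * contra_christoffel g1 i j k x + l2 * contra_christoffel g2 i j k x"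
      "quadratic_curvature ?P i j k l x = l1 * quadratic_curvature g1 i j k l x + l2 * quadratic_curvature g2 i j k l x"
      using pencil_linear[OF 1 2 3] by auto
  qed
  show "contra_christoffel ?P i j k u = l1 * contra_christoffel g1 i j k u + l2 * contra_christoffel g2 i j k u"
    by (rule lin(1)[OF W(4)])
  have pd: "partial m (contra_christoffel ?P i j n) u = l1 * partial m (contra_christoffel g1 i j n) u + l2 * partial m (contra_christoffel g2 i j n) u" for m n
  proof -
    have d: "contra_christoffel g1 i j n differentiable at u" "contra_christoffel g2 i j n differentiable at u"
      using smooth_on_differentiable[OF smooth_on_contra_christoffel[OF coord(1)] u(1)] V1 V2 by auto
    have "partial m (contra_christoffel ?P i j n) u = partial m (\<lambda>x. l1 * contra_christoffel g1 i j n x + l2 * contra_christoffel g2 i j n x) u"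
      by (rule partial_cong[OF W(1,4)]) (rule lin(1))
    also have "\<dots> = l1 * partial m (contra_christoffel g1 i j n) u + l2 * partial m (contra_christoffel g2 i j n) u"
      using d by (simp add: partial_add partial_mult differentiable_mult)
    finally show ?thesis .
  qed
  have R: "contra_riemann h i j k l u = partial k (contra_christoffel h i j l) u - partial l (contra_christoffel h i j k) u
      + quadratic_curvature h i j k l u" if "open S" "contravariant_metric_on S h" "u \<in> S" for S and h :: "'a tensor2"
    unfolding contra_riemann_formula[OF that] quadratic_curvature_def by simp
  show "contra_riemann ?P i j k l u = l1 * contra_riemann g1 i j k l u + l2 * contra_riemann g2 i j k l u"
    unfolding R[OF W(1,2,4)] R[OF coord(1) V1 u(1)] R[OF coord(1) V2 u(1)] pd lin(2)[OF W(4)]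
    by (simp add: algebra_simps)
qed

section \<open>Eigenvectors of a pair of metrics\<close>

lemma det_zero_kernel:
  fixes A :: "complex^'n::finite^'n"
  shows "det A = 0 \<longleftrightarrow> (\<exists>x. x \<noteq> 0 \<and> A *v x = 0)"
proof -
  have "det A \<noteq> 0 \<longleftrightarrow> (\<exists>B. B ** A = mat 1)"
    unfolding invertible_det_nz[symmetric] invertible_def using matrix_left_right_inverse by blast
  then show ?thesis unfolding matrix_left_invertible_ker by blast
qed

lemma pair_eigenvalues_kernel:
  assumes g: "contravariant_metric_on U g1" "contravariant_metric_on U g2" "u \<in> U"
  shows "z \<in> pair_eigenvalues g1 g2 u \<longleftrightarrow> (\<exists>a. (\<exists>k. a k \<noteq> 0) \<and> (\<forall>k. raise g1 u a k = z * raise g2 u a k))"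
proof -
  let ?A = "\<chi> i j. complex_of_real (g1 u $ i $ j) - z * complex_of_real (g2 u $ i $ j)"
  have A: "?A *v (\<chi> k. a k) = (\<chi> k. raise g1 u a k - z * raise g2 u a k)" for a
  proof -
    have "(\<Sum>l\<in>UNIV. (complex_of_real (g1 u $ k $ l) - z * complex_of_real (g2 u $ k $ l)) * a l) = raise g1 u a k - z * raise g2 u a k" for k
      unfolding raise_def sum_distrib_left sum_subtractf[symmetric]
        contravariant_metric_onD(1)[OF g(1,3), of _ k] contravariant_metric_onD(1)[OF g(2,3), of _ k]
      by (intro sum.cong refl) (simp add: algebra_simps)
    then show ?thesis by (simp add: vec_eq_iff matrix_vector_mult_def)
  qed
  have "z \<in> pair_eigenvalues g1 g2 u \<longleftrightarrow> (\<exists>x. x \<noteq> 0 \<and> ?A *v x = 0)"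
    unfolding pair_eigenvalues_def det_zero_kernel[symmetric] by simp
  also have "\<dots> \<longleftrightarrow> (\<exists>a. (\<chi> k. a k) \<noteq> (0::complex^'a) \<and> ?A *v (\<chi> k. a k) = 0)"
  proof -
    have "(\<exists>x. P x) \<longleftrightarrow> (\<exists>a. P (\<chi> k. a k))" for P :: "complex^'a \<Rightarrow> bool"
      by (metis vec_lambda_eta)
    then show ?thesis .
  qed
  finally show ?thesis unfolding A by (simp add: vec_eq_iff)
qed

lemma raise_sum: "raise g u (\<lambda>k. \<Sum>i\<in>I. c i * a i k) k = (\<Sum>i\<in>I. c i * raise g u (a i) k)"
  unfolding raise_def sum_distrib_left by (subst sum.swap) (simp add: mult_ac)

lemma raise_scale: "raise g u (\<lambda>k. c * a k) k = c * raise g u a k"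
  by (simp add: raise_def sum_distrib_left mult_ac)

text \<open>A metric maps covectors to vectors, so \<open>\<mu> i\<close> is an eigenvalue of
  \<open>g1\<close> relative to \<open>g2\<close>, with the eigencovector \<open>a i\<close>. It may
  be complex, and neither metric need be definite.\<close>

locale eigenframe =
  fixes U :: "(real^'n::finite) set" and g1 g2 :: "'n tensor2" and u :: "real^'n"
    and \<mu> :: "'n \<Rightarrow> complex" and a :: "'n \<Rightarrow> 'n \<Rightarrow> complex"
  assumes g1: "contravariant_metric_on U g1" and g2: "contravariant_metric_on U g2" and u: "u \<in> U"
    and inj: "inj \<mu>" and eigen: "\<And>i k. raise g1 u (a i) k = \<mu> i * raise g2 u (a i) k"
    and nonzero: "\<And>i. \<exists>k. a i k \<noteq> 0"
begin

abbreviation \<eta> :: "'n \<Rightarrow> complex" where "\<eta> i \<equiv> cdot (a i) (raise g2 u (a i))"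

lemma raise1: "raise g1 u (a i) = (\<lambda>k. \<mu> i * raise g2 u (a i) k)"
  using eigen by auto

lemma orthogonal:
  assumes "i \<noteq> j"
  shows "cdot (a j) (raise g2 u (a i)) = 0"
proof -
  have "\<mu> i * cdot (a j) (raise g2 u (a i)) = cdot (a j) (raise g1 u (a i))"
    unfolding raise1 by (simp add: cdot_scale)
  also have "\<dots> = cdot (a i) (raise g1 u (a j))" by (rule raise_sym[OF g1 u])
  also have "\<dots> = \<mu> j * cdot (a i) (raise g2 u (a j))" unfolding raise1 by (simp add: cdot_scale)
  also have "cdot (a i) (raise g2 u (a j)) = cdot (a j) (raise g2 u (a i))" by (rule raise_sym[OF g2 u])
  finally show ?thesis using injD[OF inj, of i j] assms by auto
qed

text \<open>A relation between eigencovectors is multiplied by the eigenvalues, through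
  \<open>g1\<close> and injectivity of \<open>g2\<close>, and \<open>\<mu> j\<close> times the
  original relation is subtracted; the term with \<open>a j\<close> disappears and the induction
  hypothesis applies.\<close>

lemma independent:
  assumes "\<And>k. (\<Sum>i\<in>I. c i * a i k) = 0" "i \<in> I"
  shows "c i = 0"
  using finite[of I] assms
proof (induction I arbitrary: c i rule: finite_induct)
  case empty
  then show ?case by simp
next
  case (insert j I)
  have "raise g1 u (\<lambda>k. \<Sum>i\<in>insert j I. c i * a i k) k = raise g2 u (\<lambda>k. \<Sum>i\<in>insert j I. (c i * \<mu> i) * a i k) k" for k
    unfolding raise_sum eigen by (simp add: mult_ac)
  then have "raise g2 u (\<lambda>k. \<Sum>i\<in>insert j I. (c i * \<mu> i) * a i k) k = 0" for k
    unfolding insert.prems(1) by (simp add: raise_def)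
  then have 1: "(\<Sum>i\<in>insert j I. (c i * \<mu> i) * a i k) = 0" for k
    using raise_inj[OF g2 u, of "\<lambda>k. \<Sum>i\<in>insert j I. (c i * \<mu> i) * a i k"] by blast
  have 2: "(\<Sum>i\<in>I. (c i * (\<mu> i - \<mu> j)) * a i k) = 0" for k
  proof -
    have "(\<Sum>i\<in>I. (c i * (\<mu> i - \<mu> j)) * a i k) = (\<Sum>i\<in>insert j I. (c i * \<mu> i) * a i k) - \<mu> j * (\<Sum>i\<in>insert j I. c i * a i k)"
      using insert.hyps by (simp add: sum_distrib_left algebra_simps sum_subtractf)
    then show ?thesis by (simp only: 1 insert.prems(1)) simp
  qed
  have I: "c i = 0" if "i \<in> I" for i
  proof -
    have "\<mu> i \<noteq> \<mu> j" using insert.hyps that injD[OF inj, of i j] by auto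
    then show ?thesis using insert.IH[of "\<lambda>i. c i * (\<mu> i - \<mu> j)" i] 2 that by auto
  qed
  then have "c j * a j k = 0" for k using insert.prems(1)[of k] insert.hyps by simp
  then have "c j = 0" using nonzero[of j] by auto
  then show ?case using I insert.prems(2) by auto
qed

lemma det_frame: "det (\<chi> i k. a i k) \<noteq> 0"
proof
  assume "det (\<chi> i k. a i k) = 0"
  then have "det (transpose (\<chi> i k. a i k)) = 0" by (simp add: det_transpose)
  then obtain x where x: "x \<noteq> 0" "transpose (\<chi> i k. a i k) *v x = 0" unfolding det_zero_kernel by blast
  then have "(\<Sum>i\<in>UNIV. x $ i * a i k) = 0" for k
    by (simp add: vec_eq_iff matrix_vector_mult_def transpose_def mult.commute)
  then have "x $ i = 0" for i using independent[where I = UNIV and c = "\<lambda>i. x $ i"] by simp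
  then show False using x(1) by (simp add: vec_eq_iff)
qed

lemma frame_zero:
  assumes "\<And>i. cdot (a i) v = 0"
  shows "v k = 0"
proof -
  have "(\<chi> i k. a i k) *v (\<chi> k. v k) = 0"
    using assms by (simp add: vec_eq_iff matrix_vector_mult_def cdot_def)
  then have "(\<chi> k. v k) = 0" using det_frame unfolding det_zero_kernel by blast
  then show ?thesis by (simp add: vec_eq_iff)
qed

text \<open>Not automatic for complex covectors and indefinite metrics. If it failed,
  \<open>a i\<close> would be orthogonal for \<open>g2\<close> to the entire frame, contradicting
  nondegeneracy.\<close>

lemma norm_nonzero: "\<eta> i \<noteq> 0"
proof
  assume "\<eta> i = 0"
  then have "cdot (a j) (raise g2 u (a i)) = 0" for j using orthogonal[of i j] by (cases "i = j") auto
  then have "raise g2 u (a i) k = 0" for k by (rule frame_zero)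
  then have "a i k = 0" for k by (rule raise_inj[OF g2 u])
  then show False using nonzero by blast
qed

lemma vector_expand: "v k = (\<Sum>q\<in>UNIV. cdot (a q) v / \<eta> q * raise g2 u (a q) k)"
proof -
  have "cdot (a p) (\<lambda>k. \<Sum>q\<in>UNIV. cdot (a q) v / \<eta> q * raise g2 u (a q) k) = cdot (a p) v" for p
  proof -
    have "cdot (a p) (\<lambda>k. \<Sum>q\<in>UNIV. cdot (a q) v / \<eta> q * raise g2 u (a q) k) = (\<Sum>q\<in>UNIV. if q = p then cdot (a p) v else 0)"
      unfolding cdot_sum cdot_scale by (intro sum.cong refl) (use norm_nonzero orthogonal in auto)
    then show ?thesis by simp
  qed
  then have "cdot (a p) (\<lambda>k. v k - (\<Sum>q\<in>UNIV. cdot (a q) v / \<eta> q * raise g2 u (a q) k)) = 0" for p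
    by (simp add: cdot_def right_diff_distrib sum_subtractf)
  from frame_zero[OF this] show ?thesis by simp
qed

text \<open>An eigencovector for \<open>\<mu> i\<close> is orthogonal for \<open>g2\<close> to every
  other \<open>a q\<close>, as in \<open>orthogonal\<close>. Subtracting its projection onto
  \<open>a i\<close> leaves a covector that annihilates a basis.\<close>

lemma eigenspace:
  assumes "\<And>k. raise g1 u b k = \<mu> i * raise g2 u b k"
  obtains c where "\<And>k. b k = c * a i k"
proof -
  have z: "cdot b (raise g2 u (a q)) = 0" if "q \<noteq> i" for q
  proof -
    have "\<mu> q * cdot b (raise g2 u (a q)) = cdot b (raise g1 u (a q))"
      unfolding raise1 by (simp add: cdot_scale)
    also have "\<dots> = cdot (a q) (raise g1 u b)" by (rule raise_sym[OF g1 u])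
    also have "\<dots> = \<mu> i * cdot (a q) (raise g2 u b)" unfolding cdot_scale(1)[symmetric] by (rule arg_cong[where f="cdot (a q)"], rule ext, rule assms)
    also have "cdot (a q) (raise g2 u b) = cdot b (raise g2 u (a q))" by (rule raise_sym[OF g2 u])
    finally show ?thesis using injD[OF inj, of q i] that by auto
  qed
  define c where "c = cdot b (raise g2 u (a i)) / \<eta> i"
  have "cdot (\<lambda>k. b k - c * a i k) (raise g2 u (a q)) = 0" for q
  proof -
    have "cdot (\<lambda>k. b k - c * a i k) (raise g2 u (a q)) = cdot b (raise g2 u (a q)) - c * cdot (a i) (raise g2 u (a q))"
      unfolding cdot_def sum_distrib_left sum_subtractf[symmetric] by (intro sum.cong refl) (simp add: algebra_simps)
    then show ?thesis using z[of q] norm_nonzero[of i] orthogonal[of q i] by (cases "q = i") (auto simp: c_def)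
  qed
  moreover have "cdot (\<lambda>k. b k - c * a i k) v = 0" if "\<And>q. cdot (\<lambda>k. b k - c * a i k) (raise g2 u (a q)) = 0" for v
  proof -
    have "cdot (\<lambda>k. b k - c * a i k) v = cdot (\<lambda>k. b k - c * a i k) (\<lambda>k. \<Sum>q\<in>UNIV. cdot (a q) v / \<eta> q * raise g2 u (a q) k)"
      by (rule arg_cong[where f = "cdot (\<lambda>k. b k - c * a i k)"], rule ext, rule vector_expand)
    then show ?thesis unfolding cdot_sum cdot_scale that by simp
  qed
  ultimately have z: "cdot (\<lambda>k. b k - c * a i k) v = 0" for v by blast
  have "b k - c * a i k = 0" for k
    using z[of "\<lambda>l. if l = k then 1 else 0"] by (simp add: cdot_def mult_delta_right)
  then show thesis using that[of c] by simp
qed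

end

text \<open>An eigencovector is paired with a dual frame vector on which it does not vanish.
  Symmetry of both metrics moves the eigenvalue equation onto the diagonal components at that
  index.\<close>

lemma diagonal_form_eigenvalues:
  assumes g1: "contravariant_metric_on U g1" and g2: "contravariant_metric_on U g2"
    and V: "V \<subseteq> U" and D: "diagonal_form_on V \<phi> f g g1 g2" and u: "u \<in> V"
  shows "pair_eigenvalues g1 g2 u \<subseteq> range (\<lambda>i. f i (\<phi> u $ i))"
proof
  fix z assume z: "z \<in> pair_eigenvalues g1 g2 u"
  have coord: "open V" "smooth_on \<phi> V" "\<And>x. x \<in> V \<Longrightarrow> det (\<chi> i k. partial k (\<lambda>x. \<phi> x $ i) x) \<noteq> 0"
    using D unfolding diagonal_form_on_def complex_coordinates_on_def by auto
  note V1 = contravariant_metric_on_subset[OF g1 V] and V2 = contravariant_metric_on_subset[OF g2 V]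
  have c: "components_in \<phi> g2 p r x = (if p = r then g p (\<phi> x) else 0)"
    "components_in \<phi> g1 p r x = (if p = r then f p (\<phi> x $ p) * g p (\<phi> x) else 0)" if "x \<in> V" for p r x
    using D that unfolding diagonal_form_on_def by auto
  interpret d1: diagonal_metric V \<phi> u V g1 "\<lambda>p x. f p (\<phi> x $ p) * g p (\<phi> x)"
    by unfold_locales (use coord u V1 c in auto)
  interpret d2: diagonal_metric V \<phi> u V g2 "\<lambda>p x. g p (\<phi> x)"
    by unfold_locales (use coord u V2 c in auto)
  obtain b where b: "\<exists>k. b k \<noteq> 0" "raise g1 u b = (\<lambda>k. z * raise g2 u b k)"
    using z unfolding pair_eigenvalues_kernel[OF V1 V2 u] by auto
  then obtain q where q: "cdot b (d1.\<epsilon> q) \<noteq> 0" using d1.covector_zero[of b] by blast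
  have "f q (\<phi> u $ q) * g q (\<phi> u) * cdot b (d1.\<epsilon> q) = cdot b (raise g1 u (d1.w q))"
    unfolding d1.raise_coframe[abs_def] cdot_scale ..
  also have "\<dots> = z * cdot (d1.w q) (raise g2 u b)"
    unfolding raise_sym[OF V1 u, of b] b(2) cdot_scale ..
  also have "\<dots> = z * (g q (\<phi> u) * cdot b (d1.\<epsilon> q))"
    unfolding raise_sym[OF V2 u, of _ b] d2.raise_coframe[abs_def] cdot_scale ..
  finally have "z = f q (\<phi> u $ q)" using q d2.H_nonzero[of q] by simp
  then show "z \<in> range (\<lambda>i. f i (\<phi> u $ i))" by blast
qed

text \<open>There are as many eigenvalues as indices and each of them occurs among the values of the
  functions \<open>f i\<close>, so no value can occur twice.\<close>

lemma diagonal_form_eigenvalues_distinct: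
  fixes U :: "(real^'n::finite) set"
  assumes "contravariant_metric_on U g1" "contravariant_metric_on U g2" "V \<subseteq> U"
    "diagonal_form_on V \<phi> f g g1 g2" "u \<in> V" and N: "nonsingular_pair_on U g1 g2"
    and "i \<noteq> j"
  shows "f i (\<phi> u $ i) \<noteq> f j (\<phi> u $ j)"
proof -
  have "CARD('n) \<le> card (range (\<lambda>i. f i (\<phi> u $ i)))"
    using card_mono[OF _ diagonal_form_eigenvalues[OF assms(1-5)]] N assms(3,5)
    unfolding nonsingular_pair_on_def by auto
  then have "inj (\<lambda>i. f i (\<phi> u $ i))" using card_image_le[of UNIV "\<lambda>i. f i (\<phi> u $ i)"] by (intro eq_card_imp_inj_on) auto
  then show ?thesis using injD[of "\<lambda>i. f i (\<phi> u $ i)" i j] \<open>i \<noteq> j\<close> by auto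
qed

section \<open>Smooth dependence of eigenvalues and eigencovectors\<close>

lemma smooth_on_Pair:
  fixes f :: "'a::real_normed_vector \<Rightarrow> 'b::real_normed_vector" and g :: "'a \<Rightarrow> 'c::real_normed_vector"
  assumes "open S" "smooth_on f S" "smooth_on g S"
  shows "smooth_on (\<lambda>x. (f x, g x)) S"
proof -
  have "bounded_linear (\<lambda>y :: 'b. (y, 0 :: 'c))" "bounded_linear (\<lambda>y :: 'c. (0 :: 'b, y))"
    by (auto intro: bounded_linear_Pair bounded_linear_ident bounded_linear_zero)
  from this(1)[THEN smooth_on_linear_compose, OF assms(1,2)] this(2)[THEN smooth_on_linear_compose, OF assms(1,3)]
  have "smooth_on (\<lambda>x. (f x, 0) + (0, g x)) S" by (rule smooth_on_add[OF assms(1)])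
  then show ?thesis by simp
qed

lemma raise_cnj: "raise g u (\<lambda>k. cnj (a k)) k = cnj (raise g u a k)"
  by (simp add: raise_def)

lemma raise_add: "raise g u (\<lambda>k. a k + b k) k = raise g u a k + raise g u b k"
  by (simp add: raise_def algebra_simps sum.distrib)

text \<open>Since the eigencovector is normalised by its component \<open>c\<close> being 1, slot \<open>c\<close> of the unknown vector
  \<open>w\<close> is free to carry the eigenvalue, and the eigenvalue equation becomes a square system to which the
  inverse function theorem applies.\<close>

theorem smooth_eigenpair:
  fixes g1 g2 :: "'n::finite tensor2"
  assumes U: "open U" and fr: "eigenframe U g1 g2 p \<mu> a" and c: "a i c = 1"
  obtains W \<kappa> \<omega> where "open W" "p \<in> W" "W \<subseteq> U" "smooth_on \<kappa> W" "\<And>k. smooth_on (\<omega> k) W"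
    "\<kappa> p = \<mu> i" "\<And>k. \<omega> k p = a i k" "\<And>u. u \<in> W \<Longrightarrow> \<omega> c u = 1"
    "\<And>u k. u \<in> W \<Longrightarrow> raise g1 u (\<lambda>k. \<omega> k u) k = \<kappa> u * raise g2 u (\<lambda>k. \<omega> k u) k"
    "\<And>u k. \<mu> i \<in> \<real> \<Longrightarrow> u \<in> W \<Longrightarrow> \<kappa> u \<in> \<real> \<and> \<omega> k u \<in> \<real>"
proof -
  note result = that
  interpret eigenframe U g1 g2 p \<mu> a by (rule fr)
  define E :: "complex^'n \<Rightarrow> 'n \<Rightarrow> complex" where "E w l = (if l = c then 1 else w $ l)" for w l
  define B :: "real^'n \<Rightarrow> complex^'n \<Rightarrow> 'n \<Rightarrow> complex" where
    "B u w k = raise g1 u (E w) k - w $ c * raise g2 u (E w) k" for u w k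
  \<comment> \<open>The point is carried along as first component, so that the inverse function
    theorem acts as an implicit function theorem: the solution over \<open>u\<close> is found in
    \<open>K (u, 0)\<close>.\<close>
  define H :: "(real^'n) \<times> (complex^'n) \<Rightarrow> (real^'n) \<times> (complex^'n)" where
    "H x = (fst x, \<chi> k. B (fst x) (snd x) k)" for x
  define w0 :: "complex^'n" where "w0 = (\<chi> l. if l = c then \<mu> i else a i l)"
  have Ew0: "E w0 = a i" using c by (auto simp: E_def w0_def fun_eq_iff)
  have w0c: "w0 $ c = \<mu> i" by (simp add: w0_def)
  have oU: "open (U \<times> (UNIV :: (complex^'n) set))" using U by (simp add: open_Times)
  have sfst: "smooth_on (fst :: (real^'n) \<times> (complex^'n) \<Rightarrow> _) (U \<times> UNIV)"
    and ssnd: "smooth_on (snd :: (real^'n) \<times> (complex^'n) \<Rightarrow> _) (U \<times> UNIV)"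
    by (rule smooth_on_linear[OF _ oU], rule bounded_linear_fst bounded_linear_snd)+
  have sE: "smooth_on (\<lambda>x. E (snd x) l) (U \<times> UNIV)" for l
    unfolding E_def by (cases "l = c") (use oU ssnd in \<open>auto intro!: smooth_intros smooth_on_vec_nth\<close>)
  have sg: "smooth_on (\<lambda>x :: (real^'n) \<times> (complex^'n). complex_of_real (g (fst x) $ k $ l)) (U \<times> UNIV)"
    if "contravariant_metric_on U g" for g k l
    by (intro smooth_on_of_real oU smooth_on_compose[OF oU U _ metric_smooth[OF that] sfst]) auto
  have sr: "smooth_on (\<lambda>x. raise g (fst x) (E (snd x)) k) (U \<times> UNIV)" if "contravariant_metric_on U g" for g k
    unfolding raise_def by (intro smooth_intros oU sg[OF that] sE)
  have sH: "smooth_on H (U \<times> UNIV)"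
    unfolding H_def[abs_def] B_def
    by (intro smooth_on_Pair oU sfst smooth_on_vec_lambda smooth_intros sr g1 g2 smooth_on_vec_nth ssnd)
  have p0: "(p, w0) \<in> U \<times> UNIV" using u by simp
  have Hp: "H (p, w0) = (p, 0)"
    by (simp add: H_def B_def Ew0 w0c eigen vec_eq_iff)
  have injD: "v = 0" if v: "frechet_derivative H (at (p, w0)) v = 0" for v
  proof -
    let ?D = "frechet_derivative H (at (p, w0))"
    note D = smooth_on_has_derivative[OF sH p0]
    obtain v1 v2 where v12: "v = (v1, v2)" by (cases v)
    have "((\<lambda>x. fst (H x)) has_derivative (\<lambda>v. fst (?D v))) (at (p, w0))"
      by (rule bounded_linear.has_derivative[OF bounded_linear_fst D])
    moreover have "((\<lambda>x. fst (H x)) has_derivative fst) (at (p, w0))"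
      unfolding H_def by (simp add: bounded_linear_imp_has_derivative[OF bounded_linear_fst])
    ultimately have "(\<lambda>v. fst (?D v)) = fst" by (rule has_derivative_unique)
    then have v1: "v1 = 0" using v v12 by (metis fst_conv fst_zero)
    \<comment> \<open>In a variation \<open>v2\<close> the slot \<open>c\<close> moves the
      eigenvalue and the other slots, collected in \<open>d\<close>, move the eigencovector;
      \<open>?X\<close> is the linearised eigenvalue equation.\<close>
    define d where "d l = (if l = c then 0 else v2 $ l)" for l
    let ?X = "\<lambda>k. raise g1 p d k - \<mu> i * raise g2 p d k - v2 $ c * raise g2 p (a i) k"
    have X: "?X k = 0" for k
    proof -
      have line: "((\<lambda>t. (p, w0 + t *\<^sub>R v2)) has_derivative (\<lambda>t. (0, t *\<^sub>R v2))) (at 0)"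
        by (auto intro!: derivative_eq_intros)
      have "(H has_derivative ?D) (at (p, w0 + 0 *\<^sub>R v2))" using D by simp
      from has_derivative_compose[OF line this]
      have "((\<lambda>t. H (p, w0 + t *\<^sub>R v2)) has_derivative (\<lambda>t. ?D (0, t *\<^sub>R v2))) (at 0)" .
      then have "((\<lambda>t. snd (H (p, w0 + t *\<^sub>R v2)) $ k) has_derivative (\<lambda>t. snd (?D (0, t *\<^sub>R v2)) $ k)) (at 0)"
        by (intro bounded_linear.has_derivative[OF bounded_linear_vec_nth] bounded_linear.has_derivative[OF bounded_linear_snd])
      \<comment> \<open>Along a line the equation is quadratic in \<open>t\<close>, and its
        quadratic term does not contribute to the derivative at 0.\<close>
      moreover have "snd (H (p, w0 + t *\<^sub>R v2)) $ k = t *\<^sub>R ?X k - (t * t) *\<^sub>R (v2 $ c * raise g2 p d k)" for t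
      proof -
        have "E (w0 + t *\<^sub>R v2) = (\<lambda>l. a i l + of_real t * d l)"
          using c by (auto simp: E_def w0_def d_def fun_eq_iff scaleR_conv_of_real[where 'a = complex])
        then show ?thesis
          by (simp add: H_def B_def raise_add raise_scale w0c eigen scaleR_conv_of_real[where 'a = complex] algebra_simps)
      qed
      moreover have "((\<lambda>t. t *\<^sub>R ?X k - (t * t) *\<^sub>R (v2 $ c * raise g2 p d k)) has_derivative (\<lambda>t. t *\<^sub>R ?X k)) (at 0)"
        by (auto intro!: derivative_eq_intros)
      ultimately have "((\<lambda>t. t *\<^sub>R ?X k - (t * t) *\<^sub>R (v2 $ c * raise g2 p d k)) has_derivative (\<lambda>t. snd (?D (0, t *\<^sub>R v2)) $ k)) (at 0)"
        and "((\<lambda>t. t *\<^sub>R ?X k - (t * t) *\<^sub>R (v2 $ c * raise g2 p d k)) has_derivative (\<lambda>t. t *\<^sub>R ?X k)) (at 0)"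
        by simp_all
      then have "(\<lambda>t. snd (?D (0, t *\<^sub>R v2)) $ k) = (\<lambda>t. t *\<^sub>R ?X k)"
        by (rule has_derivative_unique)
      from fun_cong[OF this, of 1] show ?thesis using v v12 v1 by simp
    qed
    have eq: "raise g1 p d = (\<lambda>k. \<mu> i * raise g2 p d k + v2 $ c * raise g2 p (a i) k)"
      using X by (auto simp: fun_eq_iff algebra_simps)
    \<comment> \<open>Pairing with \<open>a i\<close>, itself an eigencovector, removes
      \<open>d\<close> from the linearised equation and leaves the variation of the eigenvalue times
      \<open>\<eta> i\<close>.\<close>
    have "cdot (a i) (raise g1 p d) = \<mu> i * cdot (a i) (raise g2 p d)"
      unfolding raise_sym[OF g1 u, of "a i"] raise_sym[OF g2 u, of "a i"] raise1 cdot_scale ..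
    then have "v2 $ c * \<eta> i = 0" unfolding eq cdot_add cdot_scale by simp
    then have v2c: "v2 $ c = 0" using norm_nonzero by simp
    then obtain r where r: "\<And>k. d k = r * a i k" using eigenspace[of d i] eq by auto
    \<comment> \<open>\<open>d\<close> is now an eigencovector for \<open>\<mu> i\<close>, hence a
      multiple of \<open>a i\<close>; the fixed normalisation at \<open>c\<close> makes the multiple
      zero.\<close>
    have "r = 0" using r[of c] c by (simp add: d_def)
    then have "v2 $ l = 0" for l using r[of l] v2c by (cases "l = c") (auto simp: d_def)
    then show ?thesis using v12 v1 by (simp add: vec_eq_iff zero_prod_def)
  qed
  obtain A V K where AVK: "open A" "A \<subseteq> U \<times> UNIV" "(p, w0) \<in> A" "open V" "homeomorphism A V H K" "smooth_on K V"
    using smooth_inverse_function[OF oU sH p0 injD] by metis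
  define w where "w u = snd (K (u, 0))" for u
  define W where "W = {u\<in>U. (u, 0) \<in> V}"
  have W: "open W" "W \<subseteq> U"
  proof -
    have "continuous_on U (\<lambda>u. (u, 0 :: complex^'n))" by (intro continuous_intros)
    from continuous_open_preimage[OF this U AVK(4)] show "open W"
      by (rule back_subst[where P = "open"]) (auto simp: W_def)
  qed (auto simp: W_def)
  have K: "(u, w u) \<in> A" "H (u, w u) = (u, 0)" if "u \<in> W" for u
  proof -
    have "(u, 0) \<in> V" using that by (simp add: W_def)
    then have 1: "K (u, 0) \<in> A" "H (K (u, 0)) = (u, 0)"
      using AVK(5) by (auto simp: homeomorphism_def)
    then have "fst (K (u, 0)) = u" by (metis H_def fst_conv)
    then have "K (u, 0) = (u, w u)" by (metis prod.collapse w_def)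
    with 1 show "(u, w u) \<in> A" "H (u, w u) = (u, 0)" by simp_all
  qed
  have inj: "x = y" if "x \<in> A" "y \<in> A" "H x = H y" for x y
    using AVK(5) that unfolding homeomorphism_def by metis
  have pW: "p \<in> W"
    using u AVK(3,5) Hp unfolding W_def homeomorphism_def by (metis (mono_tags, lifting) image_eqI mem_Collect_eq)
  have wp: "w p = w0" using inj[OF K(1)[OF pW] AVK(3)] K(2)[OF pW] Hp by simp
  have sw: "smooth_on w W"
    unfolding w_def[abs_def]
    by (intro smooth_on_linear_compose[OF bounded_linear_snd W(1)] smooth_on_compose[OF W(1) AVK(4) _ AVK(6)]
        smooth_on_Pair smooth_on_id smooth_on_const W(1)) (auto simp: W_def)
  have sE: "smooth_on (\<lambda>u. E (w u) k) W" for k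
    unfolding E_def by (cases "k = c") (use sw W in \<open>auto intro!: smooth_intros smooth_on_vec_nth\<close>)
  have eig: "raise g1 u (E (w u)) k = w u $ c * raise g2 u (E (w u)) k" if "u \<in> W" for u k
    using K(2)[OF that] by (simp add: H_def B_def vec_eq_iff)
  have fin: thesis if W': "open W'" "p \<in> W'" "W' \<subseteq> W" and re: "\<And>u k. \<mu> i \<in> \<real> \<Longrightarrow> u \<in> W' \<Longrightarrow> w u $ k \<in> \<real>" for W'
  proof (rule result[of W' "\<lambda>u. w u $ c" "\<lambda>k u. E (w u) k"])
    show "smooth_on (\<lambda>u. w u $ c) W'" "smooth_on (\<lambda>u. E (w u) k) W'" for k
      using smooth_on_subset[OF _ W'(3)] smooth_on_vec_nth[OF W(1) sw] sE by auto
    show "w u $ c \<in> \<real> \<and> E (w u) k \<in> \<real>" if "\<mu> i \<in> \<real>" "u \<in> W'" for u k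
      using re[OF that] by (simp add: E_def)
    show "E (w u) c = 1" for u by (simp add: E_def)
  qed (use W' W wp Ew0 w0c eig in auto)
  show thesis
  proof (cases "\<mu> i \<in> \<real>")
    case False
    then show ?thesis using fin[OF W(1) pW] by simp
  next
    case True
    \<comment> \<open>As the metrics are real, the conjugate of a solution is again a solution. For
      a real eigenvalue it starts at the same \<open>w0\<close> and stays near it, so local
      injectivity of \<open>H\<close> identifies the two.\<close>
    define cj :: "complex^'n \<Rightarrow> complex^'n" where "cj x = (\<chi> k. cnj (x $ k))" for x
    have mu: "cnj (\<mu> i) = \<mu> i" using True by (simp add: Reals_cnj_iff)
    have "raise g1 p (\<lambda>k. cnj (a i k)) k = \<mu> i * raise g2 p (\<lambda>k. cnj (a i k)) k" for k
      unfolding raise_cnj eigen by (simp add: mu)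
    then obtain r where r: "\<And>k. cnj (a i k) = r * a i k" using eigenspace[of "\<lambda>k. cnj (a i k)" i] by blast
    have "r = 1" using r[of c] c by simp
    then have cj0: "cj w0 = w0" using r mu by (auto simp: cj_def w0_def vec_eq_iff)
    define W' where "W' = {u\<in>W. (u, cj (w u)) \<in> A}"
    have "continuous_on W (\<lambda>u. (u, cj (w u)))"
      unfolding cj_def using smooth_on_continuous[OF sw] by (intro continuous_intros) auto
    from continuous_open_preimage[OF this W(1) AVK(1)] have "open W'"
      by (rule back_subst[where P = "open"]) (auto simp: W'_def)
    moreover have "p \<in> W'" using pW wp cj0 AVK(3) by (simp add: W'_def)
    moreover have "w u $ k \<in> \<real>" if "u \<in> W'" for u k
    proof -
      have uW: "u \<in> W" "(u, cj (w u)) \<in> A" using that by (auto simp: W'_def)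
      have "E (cj (w u)) = (\<lambda>k. cnj (E (w u) k))" by (auto simp: E_def cj_def)
      then have "H (u, cj (w u)) = (u, \<chi> k. cnj (B u (w u) k))"
        by (simp add: H_def B_def raise_cnj vec_eq_iff cj_def)
      also have "\<dots> = (u, 0)" using K(2)[OF uW(1)] by (simp add: H_def vec_eq_iff)
      finally have "cj (w u) = w u" using inj[OF uW(2) K(1)[OF uW(1)]] K(2)[OF uW(1)] by simp
      then have "cnj (w u $ k) = w u $ k" by (metis cj_def vec_lambda_beta)
      then show ?thesis by (simp add: Reals_cnj_iff)
    qed
    ultimately show ?thesis using fin[of W'] by (auto simp: W'_def)
  qed
qed

section \<open>Compatible pairs\<close>

lemma raise_pencil: "raise (pencil l1 l2 g1 g2) u a k = of_real l1 * raise g1 u a k + of_real l2 * raise g2 u a k"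
  unfolding raise_def sum_distrib_left sum.distrib[symmetric]
  by (intro sum.cong refl) (simp add: pencil_def algebra_simps)

text \<open>The determinant is continuous in \<open>l\<close> and nonzero at \<open>l = 0\<close>. A
  nonzero \<open>l\<close> is asked for because \<open>compatible_gamma\<close> divides by
  it.\<close>

lemma nondegenerate_pencil:
  assumes "det (g2 u) \<noteq> 0"
  obtains l where "l \<noteq> 0" "det (pencil l 1 g1 g2 u) \<noteq> 0"
proof -
  have "continuous_on UNIV (\<lambda>l. det (pencil l 1 g1 g2 u))"
    unfolding det_def pencil_def by (auto intro!: continuous_intros)
  then have "isCont (\<lambda>l. det (pencil l 1 g1 g2 u)) 0" by (simp add: continuous_on_eq_continuous_at)
  then have "\<forall>\<^sub>F l in at 0. det (pencil l 1 g1 g2 u) \<noteq> 0"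
    unfolding isCont_def by (rule tendsto_imp_eventually_ne) (use assms in \<open>simp add: pencil_def\<close>)
  then have "\<forall>\<^sub>F l in at 0. l \<noteq> 0 \<and> det (pencil l 1 g1 g2 u) \<noteq> 0"
    by (auto intro: eventually_conj simp: eventually_at_filter elim: eventually_mono)
  then show thesis using eventually_happens'[OF at_neq_bot] that by blast
qed

text \<open>The mixed terms in the symmetry of the pencil's connection leave the difference of the two sides
  multiplied by \<open>\<mu> p - \<mu> q\<close>.\<close>

lemma (in eigenframe) compatible_gamma:
  assumes U: "open U" and C: "compatible_on U g1 g2" and pq: "p \<noteq> q"
  shows "cdot b (gamma g1 u (raise g2 u (a p)) (raise g2 u (a q))) = cdot b (gamma g2 u (raise g2 u (a p)) (raise g2 u (a q)))"
proof -
  obtain l where l: "l \<noteq> 0" "det (pencil l 1 g1 g2 u) \<noteq> 0"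
    using nondegenerate_pencil[of g2 u g1] contravariant_metric_onD(2)[OF g2 u] by blast
  let ?P = "pencil l 1 g1 g2"
  define L where "L = complex_of_real l"
  define W where "W = {u\<in>U. det (?P u) \<noteq> 0}"
  have W: "open W" "contravariant_metric_on W ?P" "u \<in> W"
    using pencil_metric[OF U g1 g2, of l 1] l u unfolding W_def by auto
  have G: "contra_gamma ?P u x y z = L * contra_gamma g1 u x y z + contra_gamma g2 u x y z" for x y z
  proof -
    have "contra_christoffel ?P i j k u = l * contra_christoffel g1 i j k u + 1 * contra_christoffel g2 i j k u" for i j k
      using C l(2) u unfolding compatible_on_def by blast
    then show ?thesis
      unfolding contra_gamma_def sum_distrib_left sum.distrib[symmetric]
      by (intro sum.cong refl) (simp add: L_def algebra_simps)
  qed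
  let ?v = "\<lambda>i. raise g2 u (a i)"
  let ?x = "cdot b (gamma g1 u (?v p) (?v q))" and ?y = "cdot b (gamma g2 u (?v p) (?v q))"
  have R: "raise ?P u (a i) = (\<lambda>k. (L * \<mu> i + 1) * ?v i k)" for i
    by (simp add: raise_pencil eigen L_def fun_eq_iff algebra_simps)
  have T: "contra_gamma ?P u (a i) b (raise ?P u (a j)) =
      (L * \<mu> j + 1) * (L * \<mu> i * cdot b (gamma g1 u (?v i) (?v j)) + cdot b (gamma g2 u (?v i) (?v j)))" for i j
    unfolding R G unfolding contra_gamma_eq raise1 gamma_scale cdot_scale by (simp add: algebra_simps)
  have "contra_gamma ?P u (a p) b (raise ?P u (a q)) = contra_gamma ?P u (a q) b (raise ?P u (a p))"
    by (rule contra_gamma_raise_sym[OF W])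
  then have "(L * \<mu> q + 1) * (L * \<mu> p * ?x + ?y) = (L * \<mu> p + 1) * (L * \<mu> q * ?x + ?y)"
    unfolding T gamma_sym[OF U g1 u, of "?v q"] gamma_sym[OF U g2 u, of "?v q"] .
  then have "L * (\<mu> p - \<mu> q) * (?x - ?y) = 0" by (simp add: algebra_simps)
  then show ?thesis using l(1) injD[OF inj, of p q] pq by (auto simp: L_def)
qed

text \<open>In the product rule for a raised covector field the derivatives of the metric are
  expressed by Christoffel symbols through \<open>contra_gamma_compatible\<close>. Contraction with
  \<open>b\<close> and \<open>w\<close> puts the result into the form in which two connections can
  be compared.\<close>

lemma raise_derivative:
  fixes g :: "'n::finite tensor2" and \<omega> :: "'n \<Rightarrow> real^'n \<Rightarrow> complex"
  assumes U: "open U" and g: "contravariant_metric_on U g" and u: "u \<in> U" and \<omega>: "\<And>s. \<omega> s differentiable at u"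
  shows "(\<lambda>x. raise g x (\<lambda>s. \<omega> s x) j) differentiable at u"
    and "(\<Sum>j\<in>UNIV. \<Sum>k\<in>UNIV. partial k (\<lambda>x. raise g x (\<lambda>s. \<omega> s x) j) u * b j * w k) =
      cdot b (raise g u (\<lambda>s. \<Sum>k\<in>UNIV. partial k (\<omega> s) u * w k)) - contra_gamma g u (\<lambda>s. \<omega> s u) b w - contra_gamma g u b (\<lambda>s. \<omega> s u) w"
proof -
  have dg: "(\<lambda>x. g x $ k $ l) differentiable at u" for k l by (rule smooth_on_differentiable[OF metric_smooth[OF g] u])
  have dgc: "(\<lambda>x. complex_of_real (g x $ k $ l)) differentiable at u" for k l
    by (rule smooth_on_differentiable[OF smooth_on_of_real[OF U metric_smooth[OF g]] u])
  show "(\<lambda>x. raise g x (\<lambda>s. \<omega> s x) j) differentiable at u" for j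
    unfolding raise_def by (intro differentiable_sum ballI differentiable_mult dgc \<omega>) simp
  have D: "partial k (\<lambda>x. raise g x (\<lambda>s. \<omega> s x) j) u =
     (\<Sum>s\<in>UNIV. of_real (g u $ s $ j) * partial k (\<omega> s) u + of_real (partial k (\<lambda>x. g x $ s $ j) u) * \<omega> s u)" for j k
    unfolding raise_def
    by (simp add: partial_sum differentiable_mult dgc \<omega> partial_mult partial_of_real[OF dg])
  have "(\<Sum>j\<in>UNIV. \<Sum>k\<in>UNIV. partial k (\<lambda>x. raise g x (\<lambda>s. \<omega> s x) j) u * b j * w k) =
     (\<Sum>j\<in>UNIV. \<Sum>k\<in>UNIV. \<Sum>s\<in>UNIV. b j * (of_real (g u $ s $ j) * (partial k (\<omega> s) u * w k))) +
     (\<Sum>j\<in>UNIV. \<Sum>k\<in>UNIV. \<Sum>s\<in>UNIV. of_real (partial k (\<lambda>x. g x $ s $ j) u) * \<omega> s u * b j * w k)"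
    unfolding D sum_distrib_right sum.distrib[symmetric] by (intro sum.cong refl) (simp add: algebra_simps)
  also have "(\<Sum>j\<in>UNIV. \<Sum>k\<in>UNIV. \<Sum>s\<in>UNIV. b j * (of_real (g u $ s $ j) * (partial k (\<omega> s) u * w k)))
     = cdot b (raise g u (\<lambda>s. \<Sum>k\<in>UNIV. partial k (\<omega> s) u * w k))"
    unfolding cdot_def raise_def sum_distrib_left by (rule sum.cong[OF refl]) (rule sum.swap)
  also have "(\<Sum>j\<in>UNIV. \<Sum>k\<in>UNIV. \<Sum>s\<in>UNIV. of_real (partial k (\<lambda>x. g x $ s $ j) u) * \<omega> s u * b j * w k)
     = (\<Sum>s\<in>UNIV. \<Sum>j\<in>UNIV. \<Sum>k\<in>UNIV. of_real (partial k (\<lambda>x. g x $ s $ j) u) * \<omega> s u * b j * w k)"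
    by (rule trans[OF sum.cong[OF refl sum.swap] sum.swap])
  also have "\<dots> = - (contra_gamma g u (\<lambda>s. \<omega> s u) b w + contra_gamma g u b (\<lambda>s. \<omega> s u) w)"
    by (rule contra_gamma_compatible[OF U g u])
  finally show "(\<Sum>j\<in>UNIV. \<Sum>k\<in>UNIV. partial k (\<lambda>x. raise g x (\<lambda>s. \<omega> s x) j) u * b j * w k) =
      cdot b (raise g u (\<lambda>s. \<Sum>k\<in>UNIV. partial k (\<omega> s) u * w k)) - contra_gamma g u (\<lambda>s. \<omega> s u) b w - contra_gamma g u b (\<lambda>s. \<omega> s u) w"
    by simp
qed

locale eigenfield =
  fixes U W :: "(real^'n::finite) set" and g1 g2 :: "'n tensor2"
    and \<kappa> :: "'n \<Rightarrow> real^'n \<Rightarrow> complex" and \<omega> :: "'n \<Rightarrow> 'n \<Rightarrow> real^'n \<Rightarrow> complex"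
  assumes U: "open U" and W: "open W" "W \<subseteq> U"
    and \<kappa>: "\<And>i. smooth_on (\<kappa> i) W" and \<omega>: "\<And>i k. smooth_on (\<omega> i k) W"
    and frame: "\<And>u. u \<in> W \<Longrightarrow> eigenframe U g1 g2 u (\<lambda>i. \<kappa> i u) (\<lambda>i k. \<omega> i k u)"
    and compatible: "compatible_on U g1 g2"
begin

text \<open>The eigenvalue equation for the index \<open>i\<close> is differentiated along the
  raised covector \<open>q\<close> and paired with the covector \<open>j\<close>. By
  \<open>compatible_gamma\<close> the connection terms of the two metrics agree for distinct
  indices. For \<open>j = i\<close> they cancel, leaving the derivative of the eigenvalue times a
  nonzero norm; for \<open>j \<noteq> i\<close> a difference of eigenvalues factors out.\<close>

lemma derivative_identities:
  assumes uW: "u \<in> W"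
  defines "v \<equiv> \<lambda>q. raise g2 u (\<lambda>k. \<omega> q k u)"
  shows "q \<noteq> i \<Longrightarrow> (\<Sum>k\<in>UNIV. partial k (\<kappa> i) u * v q k) = 0"
    and "q \<noteq> i \<Longrightarrow> j \<noteq> i \<Longrightarrow> q \<noteq> j \<Longrightarrow>
      (\<Sum>l\<in>UNIV. (\<Sum>k\<in>UNIV. partial k (\<omega> i l) u * v q k) * v j l) = (\<Sum>l\<in>UNIV. (\<Sum>k\<in>UNIV. partial k (\<omega> i l) u * v j k) * v q l)"
proof -
  interpret eigenframe U g1 g2 u "\<lambda>i. \<kappa> i u" "\<lambda>i k. \<omega> i k u" by (rule frame[OF uW])
  let ?a = "\<lambda>i k. \<omega> i k u" and ?D = "\<lambda>i q s. \<Sum>k\<in>UNIV. partial k (\<omega> i s) u * v q k" and ?d = "\<lambda>i q. \<Sum>k\<in>UNIV. partial k (\<kappa> i) u * v q k"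
  have uU: "u \<in> U" using uW W by auto
  have d\<omega>: "\<omega> i s differentiable at u" and d\<kappa>: "\<kappa> i differentiable at u" for i s
    using smooth_on_differentiable[OF \<omega> uW] smooth_on_differentiable[OF \<kappa> uW] by auto
  define c1 where "c1 j i q = cdot (?a j) (gamma g1 u (v i) (v q))" for j i q
  define c2 where "c2 j i q = cdot (?a j) (gamma g2 u (v i) (v q))" for j i q
  have cc: "c1 j i q = c2 j i q" if "i \<noteq> q" for i j q
    unfolding c1_def c2_def v_def by (rule compatible_gamma[OF U compatible that])
  have G1: "contra_gamma g1 u (?a i) (?a j) (v q) = \<kappa> i u * c1 j i q" for i j q
    unfolding contra_gamma_eq raise1 c1_def gamma_scale cdot_scale v_def ..
  have G2: "contra_gamma g2 u (?a i) (?a j) (v q) = c2 j i q" for i j q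
    unfolding contra_gamma_eq c2_def v_def ..
  have R1: "cdot (?a j) (raise g1 u x) = \<kappa> j u * cdot x (v j)" for j x
    unfolding raise_sym[OF g1 uU, of "?a j"] raise1 cdot_scale v_def ..
  have R2: "cdot (?a j) (raise g2 u x) = cdot x (v j)" for j x
    unfolding raise_sym[OF g2 uU, of "?a j"] v_def ..
  have main: "\<kappa> j u * cdot (?D i q) (v j) - \<kappa> i u * c1 j i q - \<kappa> j u * c1 i j q =
      ?d i q * cdot (?a j) (v i) + \<kappa> i u * (cdot (?D i q) (v j) - c2 j i q - c2 i j q)" for i j q
  proof -
    have "partial k (\<lambda>x. raise g1 x (\<lambda>s. \<omega> i s x) l) u = \<kappa> i u * partial k (\<lambda>x. raise g2 x (\<lambda>s. \<omega> i s x) l) u + partial k (\<kappa> i) u * v i l" for k l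
    proof -
      have "partial k (\<lambda>x. raise g1 x (\<lambda>s. \<omega> i s x) l) u = partial k (\<lambda>x. \<kappa> i x * raise g2 x (\<lambda>s. \<omega> i s x) l) u"
        by (rule partial_cong[OF W(1) uW]) (rule eigenframe.eigen[OF frame])
      then show ?thesis
        unfolding partial_mult[OF d\<kappa> raise_derivative(1)[OF U g2 uU d\<omega>]] v_def .
    qed
    moreover have "?d i q * cdot (?a j) (v i) = (\<Sum>l\<in>UNIV. \<Sum>k\<in>UNIV. partial k (\<kappa> i) u * v i l * ?a j l * v q k)"
      unfolding cdot_def sum_product by (subst sum.swap) (simp add: mult_ac)
    ultimately have "(\<Sum>l\<in>UNIV. \<Sum>k\<in>UNIV. partial k (\<lambda>x. raise g1 x (\<lambda>s. \<omega> i s x) l) u * ?a j l * v q k) =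
      ?d i q * cdot (?a j) (v i) + \<kappa> i u * (\<Sum>l\<in>UNIV. \<Sum>k\<in>UNIV. partial k (\<lambda>x. raise g2 x (\<lambda>s. \<omega> i s x) l) u * ?a j l * v q k)"
      by (simp add: sum_distrib_left sum.distrib algebra_simps)
    then show ?thesis
      unfolding raise_derivative(2)[OF U g1 uU d\<omega>] raise_derivative(2)[OF U g2 uU d\<omega>] R1 R2 G1 G2 .
  qed
  have off: "cdot (?a j) (v i) = 0" if "i \<noteq> j" for i j unfolding v_def by (rule orthogonal[OF that])
  show "?d i q = 0" if "q \<noteq> i"
    using main[of i i q] cc[of i q i] that norm_nonzero[of i] by (auto simp: v_def algebra_simps)
  \<comment> \<open>With three distinct indices all connection terms of the two metrics coincide,
    and \<open>main\<close> becomes a product with the nonzero factor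
    \<open>\<kappa> j u - \<kappa> i u\<close>.\<close>
  have D: "cdot (?D i q) (v j) = c1 i j q" if "q \<noteq> i" "j \<noteq> i" "q \<noteq> j" for q j
  proof -
    have "(\<kappa> j u - \<kappa> i u) * (cdot (?D i q) (v j) - c1 i j q) = 0"
      using main[of j i q] cc[of i q j] cc[of j q i] off[of i j] that by (simp add: algebra_simps)
    then show ?thesis using injD[OF inj, of j i] that by auto
  qed
  show "(\<Sum>l\<in>UNIV. ?D i q l * v j l) = (\<Sum>l\<in>UNIV. ?D i j l * v q l)" if "q \<noteq> i" "j \<noteq> i" "q \<noteq> j"
  proof -
    \<comment> \<open>The expression found in \<open>D\<close> is symmetric in \<open>j\<close> and
      \<open>q\<close> because the connection is torsion-free.\<close>
    have "cdot (?D i q) (v j) = cdot (?D i j) (v q)"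
      unfolding D[OF that] D[OF that(2,1) that(3)[symmetric]] c1_def by (subst gamma_sym[OF U g1 uU]) (rule refl)
    then show ?thesis unfolding cdot_def .
  qed
qed

text \<open>By orthogonality the raised covectors with index different from \<open>i\<close> span
  the kernel of \<open>\<omega> i\<close>; the coefficient at \<open>i\<close> is the vanishing
  pairing itself.\<close>

lemma kernel_expand:
  assumes u: "u \<in> W" and x: "cdot (\<lambda>k. \<omega> i k u) x = 0"
  obtains c where "c i = 0" "x = (\<lambda>k. \<Sum>q\<in>UNIV. c q * raise g2 u (\<lambda>k. \<omega> q k u) k)"
proof -
  interpret eigenframe U g1 g2 u "\<lambda>i. \<kappa> i u" "\<lambda>i k. \<omega> i k u" by (rule frame[OF u])
  show thesis
  proof (rule that)
    show "x = (\<lambda>k. \<Sum>q\<in>UNIV. (cdot (\<lambda>k. \<omega> q k u) x / \<eta> q) * raise g2 u (\<lambda>k. \<omega> q k u) k)"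
      by (rule ext) (rule vector_expand)
  qed (simp add: x)
qed

lemma eigenvalue_kernel_constant: "kernel_constant (\<omega> i) (\<kappa> i) W"
  unfolding kernel_constant_def
proof (intro ballI allI impI)
  fix u and x :: "'n \<Rightarrow> complex"
  assume u: "u \<in> W" and "(\<Sum>k\<in>UNIV. \<omega> i k u * x k) = 0"
  then obtain c where c: "c i = 0" "x = (\<lambda>k. \<Sum>q\<in>UNIV. c q * raise g2 u (\<lambda>k. \<omega> q k u) k)"
    using kernel_expand[OF u, of i x] unfolding cdot_def by blast
  have "cdot (\<lambda>k. partial k (\<kappa> i) u) x = (\<Sum>q\<in>UNIV. c q * cdot (\<lambda>k. partial k (\<kappa> i) u) (raise g2 u (\<lambda>k. \<omega> q k u)))"
    unfolding c(2) cdot_sum cdot_scale ..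
  also have "\<dots> = 0"
  proof (rule sum.neutral, rule ballI)
    fix q
    show "c q * cdot (\<lambda>k. partial k (\<kappa> i) u) (raise g2 u (\<lambda>k. \<omega> q k u)) = 0"
      using derivative_identities(1)[OF u, of q i] c(1) by (cases "q = i") (auto simp: cdot_def)
  qed
  finally show "(\<Sum>k\<in>UNIV. partial k (\<kappa> i) u * x k) = 0" unfolding cdot_def .
qed

lemma eigencovector_kernel_closed: "kernel_closed (\<omega> i) W"
  unfolding kernel_closed_def
proof (intro ballI allI impI)
  fix u and x y :: "'n \<Rightarrow> complex"
  assume u: "u \<in> W" and "(\<Sum>k\<in>UNIV. \<omega> i k u * x k) = 0" "(\<Sum>k\<in>UNIV. \<omega> i k u * y k) = 0"
  then have xy: "cdot (\<lambda>k. \<omega> i k u) x = 0" "cdot (\<lambda>k. \<omega> i k u) y = 0" by (simp_all add: cdot_def)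
  obtain c where c: "c i = 0" "x = (\<lambda>k. \<Sum>q\<in>UNIV. c q * raise g2 u (\<lambda>k. \<omega> q k u) k)"
    using kernel_expand[OF u xy(1)] by blast
  obtain d where d: "d i = 0" "y = (\<lambda>k. \<Sum>q\<in>UNIV. d q * raise g2 u (\<lambda>k. \<omega> q k u) k)"
    using kernel_expand[OF u xy(2)] by blast
  define v where "v q = raise g2 u (\<lambda>k. \<omega> q k u)" for q
  define A where "A k l = partial k (\<omega> i l) u - partial l (\<omega> i k) u" for k l
  \<comment> \<open>On the spanning vectors of the kernel: the case of distinct indices is the
    second identity of \<open>derivative_identities\<close>, the case \<open>q = j\<close> is
    antisymmetry.\<close>
  have A: "cdot (\<lambda>l. cdot (\<lambda>k. A k l) (v q)) (v j) = 0" if "q \<noteq> i" "j \<noteq> i" for q j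
  proof -
    let ?S = "\<lambda>q j. \<Sum>l\<in>UNIV. (\<Sum>k\<in>UNIV. partial k (\<omega> i l) u * v q k) * v j l"
    have "cdot (\<lambda>l. cdot (\<lambda>k. A k l) (v q)) (v j) = ?S q j - (\<Sum>l\<in>UNIV. \<Sum>k\<in>UNIV. partial l (\<omega> i k) u * v q k * v j l)"
      by (simp add: cdot_def A_def left_diff_distrib sum_subtractf sum_distrib_right)
    also have "(\<Sum>l\<in>UNIV. \<Sum>k\<in>UNIV. partial l (\<omega> i k) u * v q k * v j l) = ?S j q"
      by (subst sum.swap) (simp add: sum_distrib_left sum_distrib_right mult_ac)
    finally show ?thesis
      using derivative_identities(2)[OF u, of q i j] that unfolding v_def by (cases "q = j") auto
  qed
  have "(\<Sum>k\<in>UNIV. \<Sum>l\<in>UNIV. A k l * x k * y l) = cdot (\<lambda>l. cdot (\<lambda>k. A k l) x) y"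
    unfolding cdot_def sum_distrib_right by (rule sum.swap)
  also have "\<dots> = (\<Sum>j\<in>UNIV. d j * (\<Sum>q\<in>UNIV. c q * cdot (\<lambda>l. cdot (\<lambda>k. A k l) (v q)) (v j)))"
    unfolding c(2) d(2) v_def[symmetric] cdot_sum cdot_sum_left cdot_scale by (simp add: sum_distrib_left)
  also have "\<dots> = 0"
  proof (rule sum.neutral, rule ballI)
    fix j
    have "c q * cdot (\<lambda>l. cdot (\<lambda>k. A k l) (v q)) (v j) = 0" if "j \<noteq> i" for q
      using A[of q j] c(1) that by (cases "q = i") auto
    then have "(\<Sum>q\<in>UNIV. c q * cdot (\<lambda>l. cdot (\<lambda>k. A k l) (v q)) (v j)) = 0" if "j \<noteq> i"
      using that by (intro sum.neutral ballI) blast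
    then show "d j * (\<Sum>q\<in>UNIV. c q * cdot (\<lambda>l. cdot (\<lambda>k. A k l) (v q)) (v j)) = 0"
      using d(1) by (cases "j = i") auto
  qed
  finally show "(\<Sum>k\<in>UNIV. \<Sum>l\<in>UNIV. (partial k (\<omega> i l) u - partial l (\<omega> i k) u) * x k * y l) = 0"
    unfolding A_def .
qed

end

section \<open>Local coordinates from the eigencovectors\<close>

lemma partial_shift:
  assumes "F differentiable at (x + p)"
  shows "partial k (\<lambda>x. F (x + p)) x = partial k F (x + p)"
proof -
  have "((\<lambda>x. x + p) has_derivative (\<lambda>v. v)) (at x)" by (auto intro!: derivative_eq_intros)
  from has_derivative_compose[OF this assms[unfolded frechet_derivative_works]]
  have "((\<lambda>x. F (x + p)) has_derivative frechet_derivative F (at (x + p))) (at x)" .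
  from fun_cong[OF frechet_derivative_at[OF this], of "axis k 1"] show ?thesis unfolding partial_def by simp
qed

lemma smooth_on_shift:
  fixes F :: "real^'n::finite \<Rightarrow> 'b::real_normed_vector"
  assumes "open S" "smooth_on F S" "open T" "\<And>x. x \<in> T \<Longrightarrow> x + p \<in> S"
  shows "smooth_on (\<lambda>x. F (x + p)) T"
proof -
  have "smooth_on (\<lambda>x. x + p) T" by (intro smooth_intros assms(3))
  from smooth_on_compose[OF assms(3,1) assms(4) assms(2) this] show ?thesis by simp
qed

text \<open>Translation to the origin and choice between the two integration results. Either all
  components are real throughout \<open>W\<close>, or one is nonreal at \<open>p\<close> and by
  continuity near \<open>p\<close>; the fields from \<open>smooth_eigenpair\<close> always fall
  under one of these cases.\<close>

lemma integrated_near: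
  fixes \<omega> :: "'n::finite \<Rightarrow> real^'n \<Rightarrow> complex"
  assumes W: "open W" "p \<in> W" and \<omega>: "\<And>k. smooth_on (\<omega> k) W" and c: "\<And>u. u \<in> W \<Longrightarrow> \<omega> c u = 1"
    and cl: "kernel_closed \<omega> W" and \<mu>: "smooth_on \<mu> W" "kernel_constant \<omega> \<mu> W"
    and re: "(\<forall>u\<in>W. \<forall>k. \<omega> k u \<in> \<real>) \<or> (\<exists>b. \<omega> b p \<notin> \<real>)"
  obtains V \<phi> f where "open V" "p \<in> V" "V \<subseteq> W" "integrated_by \<omega> \<mu> \<phi> f V"
    "\<forall>u\<in>W. \<forall>k. \<omega> k u \<in> \<real> \<Longrightarrow> \<forall>u. \<phi> u \<in> \<real>"
proof -
  define \<omega>' where "\<omega>' k x = \<omega> k (x + p)" for k x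
  define \<mu>' where "\<mu>' x = \<mu> (x + p)" for x
  have shifted: "(\<And>k. smooth_on (\<omega>' k) (ball 0 r))" "\<And>x. x \<in> ball 0 r \<Longrightarrow> \<omega>' c x = 1"
    "kernel_closed \<omega>' (ball 0 r)" "smooth_on \<mu>' (ball 0 r)" "kernel_constant \<omega>' \<mu>' (ball 0 r)"
    if r: "ball p r \<subseteq> W" for r
  proof -
    have b: "x + p \<in> W" if "x \<in> ball 0 r" for x
      using that r by (auto simp: dist_norm subset_iff)
    show "smooth_on (\<omega>' k) (ball 0 r)" for k
      unfolding \<omega>'_def[abs_def] by (rule smooth_on_shift[OF W(1) \<omega> open_ball b])
    show "smooth_on \<mu>' (ball 0 r)"
      unfolding \<mu>'_def[abs_def] by (rule smooth_on_shift[OF W(1) \<mu>(1) open_ball b])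
    show "\<omega>' c x = 1" if "x \<in> ball 0 r" for x unfolding \<omega>'_def by (rule c[OF b[OF that]])
    have p\<omega>: "partial l (\<omega>' k) x = partial l (\<omega> k) (x + p)" if "x \<in> ball 0 r" for k l x
      unfolding \<omega>'_def[abs_def] by (rule partial_shift[OF smooth_on_differentiable[OF \<omega> b[OF that]]])
    have p\<mu>: "partial l \<mu>' x = partial l \<mu> (x + p)" if "x \<in> ball 0 r" for l x
      unfolding \<mu>'_def[abs_def] by (rule partial_shift[OF smooth_on_differentiable[OF \<mu>(1) b[OF that]]])
    show "kernel_closed \<omega>' (ball 0 r)"
      using cl unfolding kernel_closed_def by (simp add: p\<omega> b \<omega>'_def)
    show "kernel_constant \<omega>' \<mu>' (ball 0 r)"
      using \<mu>(2) unfolding kernel_constant_def by (simp add: p\<mu> b \<omega>'_def)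
  qed
  have fin: "open (ball p \<delta>) \<and> p \<in> ball p \<delta> \<and> ball p \<delta> \<subseteq> W \<and> integrated_by \<omega> \<mu> (\<lambda>u. \<phi> (u - p)) f (ball p \<delta>)"
    if d: "\<delta> > 0" "ball p \<delta> \<subseteq> W" and I: "integrated_by \<omega>' \<mu>' \<phi> f (ball 0 \<delta>)" for \<delta> \<phi> f
  proof -
    have b: "u - p \<in> ball 0 \<delta>" if "u \<in> ball p \<delta>" for u
      using that by (simp add: dist_norm norm_minus_commute)
    have im: "(\<lambda>u. \<phi> (u - p)) ` ball p \<delta> \<subseteq> \<phi> ` ball 0 \<delta>" using b by blast
    have s\<phi>: "smooth_on \<phi> (ball 0 \<delta>)" using I by (simp add: integrated_by_def)
    have "partial k (\<lambda>u. \<phi> (u - p)) u = partial k \<phi> (u - p)" if "u \<in> ball p \<delta>" for k u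
      using partial_shift[of \<phi> u "- p"] smooth_on_differentiable[OF s\<phi> b[OF that]] by simp
    moreover have "smooth_on (\<lambda>u. \<phi> (u - p)) (ball p \<delta>)"
      using smooth_on_shift[OF open_ball s\<phi> open_ball, of p \<delta> "- p"] b by simp
    moreover have "f holomorphic_on (\<lambda>u. \<phi> (u - p)) ` ball p \<delta>"
      using I holomorphic_on_subset[OF _ im] by (simp add: integrated_by_def)
    ultimately have "integrated_by \<omega> \<mu> (\<lambda>u. \<phi> (u - p)) f (ball p \<delta>)"
      using I b unfolding integrated_by_def \<omega>'_def \<mu>'_def by (metis diff_add_cancel)
    then show ?thesis using d by simp
  qed
  show thesis
  proof (cases "\<forall>u\<in>W. \<forall>k. \<omega> k u \<in> \<real>")
    case True
    obtain r where r: "r > 0" "ball p r \<subseteq> W" using W openE by blast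
    have "Im (\<omega>' k x) = 0" if "x \<in> ball 0 r" for k x
      using True r(2) that unfolding \<omega>'_def by (auto simp: dist_norm subset_iff complex_is_Real_iff)
    then obtain \<delta> \<phi> f where *: "\<delta> > 0" "\<delta> \<le> r" "integrated_by \<omega>' \<mu>' \<phi> f (ball 0 \<delta>)" "\<And>x. \<phi> x \<in> \<real>"
      using integrated_real[of r \<omega>' c \<mu>'] r(1) shifted[OF r(2)] by metis
    have "ball p \<delta> \<subseteq> W" using *(2) r(2) by (meson order_trans subset_ball)
    from fin[OF *(1) this *(3)] show ?thesis using *(4) by (intro that[of "ball p \<delta>" "\<lambda>u. \<phi> (u - p)" f]) auto
  next
    case False
    then obtain b where b: "\<omega> b p \<notin> \<real>" using re by blast
    have co: "continuous_on W (\<omega> b)" by (rule smooth_on_continuous[OF \<omega>])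
    have "continuous_on W (\<lambda>u. Im (\<omega> b u))" by (intro continuous_intros co)
    from continuous_open_preimage[OF this W(1) open_Compl[OF closed_singleton[of 0]]]
    have "open (W \<inter> (\<lambda>u. Im (\<omega> b u)) -` (- {0}))" by simp
    moreover have "p \<in> W \<inter> (\<lambda>u. Im (\<omega> b u)) -` (- {0})" using W(2) b by (simp add: complex_is_Real_iff)
    ultimately obtain r where r: "r > 0" "ball p r \<subseteq> W \<inter> (\<lambda>u. Im (\<omega> b u)) -` (- {0})"
      using openE by blast
    have rW: "ball p r \<subseteq> W" using r(2) by blast
    have "Im (\<omega>' b x) \<noteq> 0" if "x \<in> ball 0 r" for x
      using r(2) that unfolding \<omega>'_def by (auto simp: dist_norm subset_iff)
    then obtain \<delta> \<phi> f where *: "\<delta> > 0" "\<delta> \<le> r" "integrated_by \<omega>' \<mu>' \<phi> f (ball 0 \<delta>)"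
      using integrated_complex[of r \<omega>' c b \<mu>'] r(1) shifted[OF rW] by metis
    have "ball p \<delta> \<subseteq> W" using *(2) rW by (meson order_trans subset_ball)
    from fin[OF *(1) this *(3)] show ?thesis using False by (intro that[of "ball p \<delta>" "\<lambda>u. \<phi> (u - p)" f]) auto
  qed
qed

lemma eigenframe_exists:
  fixes g1 g2 :: "'n::finite tensor2"
  assumes g1: "contravariant_metric_on U g1" and g2: "contravariant_metric_on U g2" and p: "p \<in> U"
    and N: "card (pair_eigenvalues g1 g2 p) = CARD('n)"
  obtains \<mu> a c where "eigenframe U g1 g2 p \<mu> a" "\<And>i :: 'n. a i (c i) = 1"
proof -
  have "finite (pair_eigenvalues g1 g2 p)" by (rule card_ge_0_finite) (simp add: N)
  then obtain \<mu> :: "'n \<Rightarrow> complex" where \<mu>: "bij_betw \<mu> UNIV (pair_eigenvalues g1 g2 p)"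
    using finite_same_card_bij[of "UNIV :: 'n set" "pair_eigenvalues g1 g2 p"] N by auto
  have "\<exists>b c. b c = 1 \<and> (\<forall>k. raise g1 p b k = \<mu> i * raise g2 p b k)" for i
  proof -
    obtain b c where b: "b c \<noteq> 0" "\<And>k. raise g1 p b k = \<mu> i * raise g2 p b k"
      using \<mu> unfolding bij_betw_def pair_eigenvalues_kernel[OF g1 g2 p, of "\<mu> i", symmetric, THEN sym]
      by (metis g1 g2 p pair_eigenvalues_kernel rangeI)
    have "raise g1 p (\<lambda>k. (1 / b c) * b k) k = \<mu> i * raise g2 p (\<lambda>k. (1 / b c) * b k) k" for k
      unfolding raise_scale b(2) by simp
    then show ?thesis using b(1) by (intro exI[of _ "\<lambda>k. (1 / b c) * b k"] exI[of _ c]) auto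
  qed
  then obtain a c where a: "\<And>i. a i (c i) = 1" "\<And>i k. raise g1 p (a i) k = \<mu> i * raise g2 p (a i) k" by metis
  have "eigenframe U g1 g2 p \<mu> a"
  proof
    show "inj \<mu>" using \<mu> by (simp add: bij_betw_def)
    show "\<exists>k. a i k \<noteq> 0" for i using a(1)[of i] by (intro exI[of _ "c i"]) simp
  qed (use g1 g2 p a in auto)
  then show thesis using that a(1) by blast
qed

text \<open>The map \<phi> goes into a space of twice the real dimension. Its real derivative is
  injective, since the complex determinant forbids a nonzero real vector killed by all coordinate
  differentials; composing with a linear left inverse \<open>L\<close> gives a map between equal
  dimensions, which is locally injective.\<close>

lemma complex_coordinates_near:
  fixes \<phi> :: "real^'n::finite \<Rightarrow> complex^'n"
  assumes V: "open V" "p \<in> V" and \<phi>: "smooth_on \<phi> V" and det: "\<And>u. u \<in> V \<Longrightarrow> det (\<chi> i k. partial k (\<lambda>x. \<phi> x $ i) u) \<noteq> 0"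
  obtains V' where "p \<in> V'" "V' \<subseteq> V" "complex_coordinates_on V' \<phi>"
proof -
  let ?D = "frechet_derivative \<phi> (at p)"
  have d: "\<phi> differentiable at u" if "u \<in> V" for u by (rule smooth_on_differentiable[OF \<phi> that])
  have lin: "linear ?D" by (rule linear_frechet_derivative[OF d[OF V(2)]])
  have "v = 0" if "?D v = 0" for v
  proof -
    have "(\<Sum>k\<in>UNIV. partial k (\<lambda>x. \<phi> x $ i) p * of_real (v $ k)) = 0" for i
    proof -
      have "frechet_derivative (\<lambda>x. \<phi> x $ i) (at p) v = ?D v $ i"
        by (rule frechet_derivative_linear_compose[OF bounded_linear_vec_nth d[OF V(2)]])
      moreover have "(\<lambda>x. \<phi> x $ i) differentiable at p"
        by (rule smooth_on_differentiable[OF smooth_on_vec_nth[OF V(1) \<phi>] V(2)])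
      ultimately show ?thesis
        using frechet_partial_sum[of "\<lambda>x. \<phi> x $ i" p v] that by (simp add: scaleR_conv_of_real mult.commute)
    qed
    then have "(\<chi> i k. partial k (\<lambda>x. \<phi> x $ i) p) *v (\<chi> k. complex_of_real (v $ k)) = 0"
      by (simp add: vec_eq_iff matrix_vector_mult_def)
    then have "(\<chi> k. complex_of_real (v $ k)) = 0" using det[OF V(2)] det_zero_kernel by blast
    then show ?thesis by (simp add: vec_eq_iff)
  qed
  then have "inj ?D" using lin by (simp add: linear_injective_0)
  then obtain L where L: "linear L" "L \<circ> ?D = id" using linear_injective_left_inverse[OF lin] by blast
  have bl: "bounded_linear L" using L(1) linear_conv_bounded_linear by blast
  have sL: "smooth_on (\<lambda>x. L (\<phi> x)) V" by (rule smooth_on_linear_compose[OF bl V(1) \<phi>])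
  have "frechet_derivative (\<lambda>x. L (\<phi> x)) (at p) v = v" for v
    using frechet_derivative_linear_compose[OF bl d[OF V(2)], of v] fun_cong[OF L(2), of v] by simp
  then obtain A B K where A: "open A" "A \<subseteq> V" "p \<in> A" "homeomorphism A B (\<lambda>x. L (\<phi> x)) K"
    using smooth_inverse_function[OF V(1) sL V(2)] by metis
  have "inj_on \<phi> A"
    using A(4) unfolding homeomorphism_def inj_on_def by metis
  then have "complex_coordinates_on A \<phi>"
    using A det smooth_on_subset[OF \<phi> A(2)] unfolding complex_coordinates_on_def by blast
  then show thesis using that A by blast
qed

lemma det_scaled_rows:
  fixes c :: "'n::finite \<Rightarrow> complex"
  shows "det (\<chi> i k. c i * A i k) = (\<Prod>i\<in>UNIV. c i) * det (\<chi> i k. A i k)"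
proof -
  have "(\<chi> i k. c i * A i k) = (\<chi> i. c i *s (\<chi> k. A i k))" by (simp add: vec_eq_iff)
  then show ?thesis using det_rows_mul[of c "\<lambda>i. \<chi> k. A i k"] by simp
qed

text \<open>Each eigencovector field is integrated separately. The resulting functions are
  coordinates because the eigencovectors form a frame, and they diagonalise both metrics because the
  eigencovectors are orthogonal for both.\<close>

theorem compatible_diagonal_form:
  fixes g1 g2 :: "'n::finite tensor2"
  assumes U: "open U" and g1: "contravariant_metric_on U g1" and g2: "contravariant_metric_on U g2"
    and N: "nonsingular_pair_on U g1 g2" and C: "compatible_on U g1 g2" and p: "p \<in> U"
  obtains V \<phi> f g where "p \<in> V" "V \<subseteq> U" "diagonal_form_on V \<phi> f g g1 g2" "real_for_real_eigenvalues V \<phi> f g"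
proof -
  obtain \<mu> a c where fr: "eigenframe U g1 g2 p \<mu> a" and c: "\<And>i. a i (c i) = 1"
    using eigenframe_exists[OF g1 g2 p] N p unfolding nonsingular_pair_on_def by metis
  interpret p: eigenframe U g1 g2 p \<mu> a by (rule fr)
  define P where "P i W \<kappa> \<omega> \<longleftrightarrow> open W \<and> p \<in> W \<and> W \<subseteq> U \<and> smooth_on \<kappa> W \<and> (\<forall>k. smooth_on (\<omega> k) W) \<and>
    \<kappa> p = \<mu> i \<and> (\<forall>k. \<omega> k p = a i k) \<and> (\<forall>u\<in>W. \<omega> (c i) u = 1) \<and>
    (\<forall>u\<in>W. \<forall>k. raise g1 u (\<lambda>k. \<omega> k u) k = \<kappa> u * raise g2 u (\<lambda>k. \<omega> k u) k) \<and>
    (\<mu> i \<in> \<real> \<longrightarrow> (\<forall>u\<in>W. \<forall>k. \<omega> k u \<in> \<real>))" for i W \<kappa> and \<omega> :: "'n \<Rightarrow> real^'n \<Rightarrow> complex"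
  have "\<exists>W \<kappa> \<omega>. P i W \<kappa> \<omega>" for i
  proof -
    obtain W \<kappa> \<omega> where "open W" "p \<in> W" "W \<subseteq> U" "smooth_on \<kappa> W" "\<And>k. smooth_on (\<omega> k) W"
      "\<kappa> p = \<mu> i" "\<And>k. \<omega> k p = a i k" "\<And>u. u \<in> W \<Longrightarrow> \<omega> (c i) u = 1"
      "\<And>u k. u \<in> W \<Longrightarrow> raise g1 u (\<lambda>k. \<omega> k u) k = \<kappa> u * raise g2 u (\<lambda>k. \<omega> k u) k"
      "\<And>u k. \<mu> i \<in> \<real> \<Longrightarrow> u \<in> W \<Longrightarrow> \<kappa> u \<in> \<real> \<and> \<omega> k u \<in> \<real>"
      by (rule smooth_eigenpair[OF U fr c[of i]]) blast
    then have "P i W \<kappa> \<omega>" unfolding P_def by blast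
    then show ?thesis by blast
  qed
  then obtain W \<kappa> \<omega> where PW: "\<And>i. P i (W i) (\<kappa> i) (\<omega> i)" by metis
  note PD = PW[unfolded P_def]
  define W1 where "W1 = (\<Inter>i. W i)"
  \<comment> \<open>Besides a common domain, this keeps the eigenvalues distinct, as an
    \<open>eigenframe\<close> is required at every point and not only at \<open>p\<close>.\<close>
  define W0 where "W0 = W1 \<inter> (\<Inter>(i, j)\<in>{(i, j). i \<noteq> j}. W1 \<inter> (\<lambda>u. \<kappa> i u - \<kappa> j u) -` (- {0}))"
  have W1: "open W1" "\<And>i. W1 \<subseteq> W i" unfolding W1_def using PD by auto
  have W0: "open W0" "p \<in> W0" "W0 \<subseteq> W1"
  proof -
    have "open (W1 \<inter> (\<lambda>u. \<kappa> i u - \<kappa> j u) -` (- {0}))" for i j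
    proof -
      have "continuous_on W1 (\<kappa> i)" for i using PD W1(2) smooth_on_continuous continuous_on_subset by metis
      then have "continuous_on W1 (\<lambda>u. \<kappa> i u - \<kappa> j u)" by (intro continuous_intros)
      from continuous_open_preimage[OF this W1(1) open_Compl[OF closed_singleton[of 0]]] show ?thesis .
    qed
    then show "open W0" unfolding W0_def using W1(1) by (intro open_Int open_INT) auto
    show "p \<in> W0" unfolding W0_def W1_def using PD injD[OF p.inj] by auto
  qed (auto simp: W0_def)
  have W0i: "W0 \<subseteq> W i" for i using W0(3) W1(2) by blast
  have s\<omega>: "smooth_on (\<omega> i k) W0" and s\<kappa>: "smooth_on (\<kappa> i) W0" for i k
    using smooth_on_subset[OF _ W0i] PD by blast+
  interpret eigenfield U W0 g1 g2 \<kappa> \<omega>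
  proof (rule eigenfield.intro)
    show "eigenframe U g1 g2 u (\<lambda>i. \<kappa> i u) (\<lambda>i k. \<omega> i k u)" if u: "u \<in> W0" for u
    proof
      have uW: "u \<in> W i" for i using u W0i by blast
      show "u \<in> U" using uW PD by blast
      show "inj (\<lambda>i. \<kappa> i u)" using u unfolding W0_def inj_def by force
      show "raise g1 u (\<lambda>k. \<omega> i k u) k = \<kappa> i u * raise g2 u (\<lambda>k. \<omega> i k u) k" for i k
        using PD uW by blast
      show "\<exists>k. \<omega> i k u \<noteq> 0" for i using PD uW by (metis zero_neq_one)
    qed (use g1 g2 in auto)
  qed (use U C W0 W0i PD s\<omega> s\<kappa> in blast)+
  have "\<exists>V \<phi> f. open V \<and> p \<in> V \<and> V \<subseteq> W0 \<and> integrated_by (\<omega> i) (\<kappa> i) \<phi> f V \<and> (\<mu> i \<in> \<real> \<longrightarrow> (\<forall>u. \<phi> u \<in> \<real>))" for i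
  proof -
    \<comment> \<open>A nonreal eigenvalue forces a nonreal component: otherwise both raised
      covectors would be real, and \<open>\<mu> i\<close> would be a real quotient unless
      \<open>raise g2 p (a i)\<close> vanished.\<close>
    have "(\<exists>b. \<omega> i b p \<notin> \<real>)" if "\<mu> i \<notin> \<real>"
    proof (rule ccontr)
      assume "\<nexists>b. \<omega> i b p \<notin> \<real>"
      then have "a i k \<in> \<real>" for k using PD by metis
      then have re: "raise g p (a i) k \<in> \<real>" for g k unfolding raise_def by (intro sum_in_Reals) auto
      have "raise g2 p (a i) k = 0" for k
        using p.eigen[of i k] re[of g1 k] re[of g2 k] that by (metis Reals_divide nonzero_mult_div_cancel_right)
      then have "a i k = 0" for k by (rule raise_inj[OF g2 p])
      then show False using p.nonzero by blast
    qed
    then have re: "(\<forall>u\<in>W0. \<forall>k. \<omega> i k u \<in> \<real>) \<or> (\<exists>b. \<omega> i b p \<notin> \<real>)"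
      using PD W0i by (metis subsetD)
    have one: "\<omega> i (c i) u = 1" if "u \<in> W0" for u using PD W0i that by blast
    have real: "\<forall>u\<in>W0. \<forall>k. \<omega> i k u \<in> \<real>" if "\<mu> i \<in> \<real>" using PD W0i that by blast
    obtain V \<phi> f where "open V" "p \<in> V" "V \<subseteq> W0" "integrated_by (\<omega> i) (\<kappa> i) \<phi> f V"
      "\<forall>u\<in>W0. \<forall>k. \<omega> i k u \<in> \<real> \<Longrightarrow> \<forall>u. \<phi> u \<in> \<real>"
      using integrated_near[OF W0(1,2) s\<omega> one eigencovector_kernel_closed s\<kappa> eigenvalue_kernel_constant re] by metis
    then show ?thesis using real by (intro exI[of _ V] exI[of _ \<phi>] exI[of _ f]) simp
  qed
  then obtain V \<phi> f where V: "\<And>i. open (V i)" "\<And>i. p \<in> V i" "\<And>i. V i \<subseteq> W0"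
    and I: "\<And>i. integrated_by (\<omega> i) (\<kappa> i) (\<phi> i) (f i) (V i)" and re: "\<And>i u. \<mu> i \<in> \<real> \<Longrightarrow> \<phi> i u \<in> \<real>"
    by metis
  define V1 where "V1 = (\<Inter>i. V i)"
  have V1: "open V1" "p \<in> V1" "\<And>i. V1 \<subseteq> V i" "V1 \<subseteq> W0"
    unfolding V1_def using V INF_lower2[of undefined UNIV V W0] by (auto intro!: open_INT simp del: INT_subset_iff)
  define \<Phi> where "\<Phi> u = (\<chi> i. \<phi> i u)" for u
  have s\<phi>: "smooth_on (\<phi> i) V1" for i using I V1(3) smooth_on_subset unfolding integrated_by_def by metis
  have s\<Phi>: "smooth_on \<Phi> V1" unfolding \<Phi>_def[abs_def] by (rule smooth_on_vec_lambda[OF V1(1) s\<phi>])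
  have "\<exists>\<rho>. \<forall>i. \<rho> i \<noteq> 0 \<and> (\<forall>k. partial k (\<phi> i) u = \<rho> i * \<omega> i k u)" if "u \<in> V1" for u
  proof -
    have "\<exists>r. r \<noteq> 0 \<and> (\<forall>k. partial k (\<phi> i) u = r * \<omega> i k u)" for i
      using I[of i] V1(3) that unfolding integrated_by_def by blast
    then show ?thesis by metis
  qed
  then obtain \<rho> where \<rho>: "\<And>u i. u \<in> V1 \<Longrightarrow> \<rho> u i \<noteq> 0" "\<And>u i k. u \<in> V1 \<Longrightarrow> partial k (\<phi> i) u = \<rho> u i * \<omega> i k u"
    by metis
  have det: "det (\<chi> i k. partial k (\<lambda>x. \<Phi> x $ i) u) \<noteq> 0" if u: "u \<in> V1" for u
  proof -
    have "det (\<chi> i k. \<omega> i k u) \<noteq> 0" using eigenframe.det_frame[OF frame] V1(4) u by blast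
    then show ?thesis using \<rho>[OF u] by (simp add: \<Phi>_def det_scaled_rows)
  qed
  obtain V2 where V2: "p \<in> V2" "V2 \<subseteq> V1" "complex_coordinates_on V2 \<Phi>"
    using complex_coordinates_near[OF V1(1,2) s\<Phi> det] by blast
  \<comment> \<open>\<open>diagonal_form_on\<close> wants the diagonal component as a function of
    the coordinates; injectivity of \<open>\<Phi>\<close> on \<open>V2\<close> makes the pull-back
    meaningful.\<close>
  define g where "g i w = components_in \<Phi> g2 i i (inv_into V2 \<Phi> w)" for i w
  have g: "g i (\<Phi> u) = components_in \<Phi> g2 i i u" if "u \<in> V2" for i u
    using V2(3) that by (simp add: g_def complex_coordinates_on_def)
  have fk: "f i (\<Phi> u $ i) = \<kappa> i u" if "u \<in> V2" for i u
    using I[of i] V1(3)[of i] V2(2) that unfolding integrated_by_def by (auto simp: \<Phi>_def)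
  have comp: "components_in \<Phi> h i j u = \<rho> u i * \<rho> u j * cdot (\<lambda>k. \<omega> j k u) (raise h u (\<lambda>k. \<omega> i k u))" if u: "u \<in> V1" for h i j u
  proof -
    have "components_in \<Phi> h i j u = (\<Sum>k\<in>UNIV. \<Sum>l\<in>UNIV. \<rho> u i * \<rho> u j * (\<omega> j l u * (of_real (h u $ k $ l) * \<omega> i k u)))"
      by (simp add: components_in_def \<Phi>_def \<rho>(2)[OF u] mult_ac)
    also have "\<dots> = \<rho> u i * \<rho> u j * cdot (\<lambda>k. \<omega> j k u) (raise h u (\<lambda>k. \<omega> i k u))"
      unfolding cdot_def raise_def sum_distrib_left by (rule sum.swap)
    finally show ?thesis .
  qed
  have diag: "diagonal_form_on V2 \<Phi> f g g1 g2"
    unfolding diagonal_form_on_def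
  proof (intro conjI allI ballI V2(3))
    fix i
    have "(\<lambda>u. \<Phi> u $ i) ` V2 \<subseteq> \<phi> i ` V i" using V1(3) V2(2) by (auto simp: \<Phi>_def)
    then show "f i holomorphic_on (\<lambda>u. \<Phi> u $ i) ` V2"
      using I[of i] holomorphic_on_subset unfolding integrated_by_def by blast
    \<comment> \<open>Nondegeneracy of \<open>g1\<close> excludes the eigenvalue 0 and so shows that
      \<open>f i\<close> is not identically zero.\<close>
    have "\<mu> i \<noteq> 0"
    proof
      assume "\<mu> i = 0"
      then have "raise g1 p (a i) k = 0" for k using p.eigen[of i k] by simp
      then have "a i k = 0" for k by (rule raise_inj[OF g1 p])
      then show False using p.nonzero by blast
    qed
    then have "f i (\<Phi> p $ i) \<noteq> 0" using fk[OF V2(1)] PD by metis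
    then show "\<exists>u\<in>V2. f i (\<Phi> u $ i) \<noteq> 0" using V2(1) by blast
  next
    fix u i j assume u: "u \<in> V2"
    then have u1: "u \<in> V1" using V2(2) by blast
    interpret u: eigenframe U g1 g2 u "\<lambda>i. \<kappa> i u" "\<lambda>i k. \<omega> i k u" by (rule frame) (use u1 V1(4) in blast)
    show c2: "components_in \<Phi> g2 i j u = (if i = j then g i (\<Phi> u) else 0)"
      using g[OF u] u.orthogonal[of i j] comp[OF u1, of g2 i j] by auto
    have "components_in \<Phi> g1 i j u = \<kappa> i u * components_in \<Phi> g2 i j u"
      unfolding comp[OF u1] u.raise1 cdot_scale by simp
    then show "components_in \<Phi> g1 i j u = (if i = j then f i (\<Phi> u $ i) * g i (\<Phi> u) else 0)"
      using c2 fk[OF u, of i] by auto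
  qed
  have "real_for_real_eigenvalues V2 \<Phi> f g"
    unfolding real_for_real_eigenvalues_def
  proof (intro allI impI ballI)
    fix i u assume r: "\<forall>u\<in>V2. f i (\<Phi> u $ i) \<in> \<real>" and u: "u \<in> V2"
    \<comment> \<open>Reality at the point \<open>p\<close> decides which case of the construction
      was used for the index \<open>i\<close>, and in the real case \<open>\<phi> i\<close> is
      real-valued everywhere.\<close>
    have "\<mu> i \<in> \<real>" using r V2(1) fk[OF V2(1)] PD by metis
    then have R: "\<phi> i x \<in> \<real>" for x by (rule re)
    have "partial k (\<phi> i) u \<in> \<real>" for k
    proof -
      have d: "\<phi> i differentiable at u" by (rule smooth_on_differentiable[OF s\<phi>]) (use u V2(2) in blast)
      have "Im (partial k (\<phi> i) u) = partial k (\<lambda>x. Im (\<phi> i x)) u"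
        unfolding partial_def by (rule frechet_derivative_linear_compose[OF bounded_linear_Im d, symmetric])
      also have "(\<lambda>x. Im (\<phi> i x)) = (\<lambda>_. 0)" using R by (simp add: complex_is_Real_iff)
      finally show ?thesis by (simp add: complex_is_Real_iff)
    qed
    then have "components_in \<Phi> g2 i i u \<in> \<real>"
      unfolding components_in_def \<Phi>_def by (auto intro!: sum_in_Reals Reals_mult)
    then show "\<Phi> u $ i \<in> \<real> \<and> g i (\<Phi> u) \<in> \<real>" using R g[OF u] by (simp add: \<Phi>_def)
  qed
  moreover have "V2 \<subseteq> U" using V2(2) V1(4) W(2) by blast
  ultimately show thesis using that V2(1) diag by blast
qed

theorem theorem2p5:
  fixes U :: "(real^'n::finite) set" and g1 g2 :: "'n tensor2"
  assumes "open U"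
    and "contravariant_metric_on U g1"
    and "contravariant_metric_on U g2"
  shows
    "(nonsingular_pair_on U g1 g2 \<longrightarrow>
       (compatible_on U g1 g2 \<longleftrightarrow>
         (\<forall>p\<in>U. \<exists>V \<phi> f g. p \<in> V \<and> V \<subseteq> U \<and> diagonal_form_on V \<phi> f g g1 g2 \<and>
            real_for_real_eigenvalues V \<phi> f g)))
   \<and> (nonsingular_pair_on U g1 g2 \<longrightarrow>
       (\<forall>V \<phi> f g. V \<noteq> {} \<and> V \<subseteq> U \<and> diagonal_form_on V \<phi> f g g1 g2 \<longrightarrow>
         (\<forall>i j. i \<noteq> j \<longrightarrow>
            (\<forall>u\<in>V. f i (\<phi> u $ i) \<noteq> f j (\<phi> u $ j)) \<and>
            \<not> (\<exists>c. \<forall>u\<in>V. f i (\<phi> u $ i) = c \<and> f j (\<phi> u $ j) = c))))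
   \<and> ((\<forall>p\<in>U. \<exists>V \<phi> f g. p \<in> V \<and> V \<subseteq> U \<and> diagonal_form_on V \<phi> f g g1 g2) \<longrightarrow>
       compatible_on U g1 g2)"
proof -
  \<comment> \<open>The compatibility identities are imposed point by point, so every point may use
    its own coordinates.\<close>
  have 1: "compatible_on U g1 g2"
    if "\<forall>p\<in>U. \<exists>V \<phi> f g. p \<in> V \<and> V \<subseteq> U \<and> diagonal_form_on V \<phi> f g g1 g2"
    unfolding compatible_on_def using that diagonal_form_compatible[OF assms] by metis
  have 2: "\<exists>V \<phi> f g. p \<in> V \<and> V \<subseteq> U \<and> diagonal_form_on V \<phi> f g g1 g2 \<and> real_for_real_eigenvalues V \<phi> f g"
    if "nonsingular_pair_on U g1 g2" "compatible_on U g1 g2" "p \<in> U" for p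
    using compatible_diagonal_form[OF assms that] by metis
  have 3: "(\<forall>u\<in>V. f i (\<phi> u $ i) \<noteq> f j (\<phi> u $ j)) \<and> \<not> (\<exists>c. \<forall>u\<in>V. f i (\<phi> u $ i) = c \<and> f j (\<phi> u $ j) = c)"
    if "nonsingular_pair_on U g1 g2" "V \<noteq> {}" "V \<subseteq> U" "diagonal_form_on V \<phi> f g g1 g2" "i \<noteq> j" for V \<phi> f g i j
  proof -
    have "f i (\<phi> u $ i) \<noteq> f j (\<phi> u $ j)" if "u \<in> V" for u
      by (rule diagonal_form_eigenvalues_distinct[OF assms(2,3)]) fact+
    then show ?thesis using \<open>V \<noteq> {}\<close> by (metis all_not_in_conv)
  qed
  show ?thesis
  proof (intro conjI impI iffI)
    show "\<forall>p\<in>U. \<exists>V \<phi> f g. p \<in> V \<and> V \<subseteq> U \<and> diagonal_form_on V \<phi> f g g1 g2 \<and> real_for_real_eigenvalues V \<phi> f g"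
      if "nonsingular_pair_on U g1 g2" "compatible_on U g1 g2"
      using 2[OF that] by blast
    show "compatible_on U g1 g2"
      if T: "\<forall>p\<in>U. \<exists>V \<phi> f g. p \<in> V \<and> V \<subseteq> U \<and> diagonal_form_on V \<phi> f g g1 g2 \<and> real_for_real_eigenvalues V \<phi> f g"
    proof (rule 1, rule ballI)
      fix p assume "p \<in> U"
      then obtain V \<phi> f g where "p \<in> V \<and> V \<subseteq> U \<and> diagonal_form_on V \<phi> f g g1 g2 \<and> real_for_real_eigenvalues V \<phi> f g"
        using T by meson
      then show "\<exists>V \<phi> f g. p \<in> V \<and> V \<subseteq> U \<and> diagonal_form_on V \<phi> f g g1 g2"
        by (intro exI[of _ V] exI[of _ \<phi>] exI[of _ f] exI[of _ g]) simp
    qed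
    show "compatible_on U g1 g2"
      if "\<forall>p\<in>U. \<exists>V \<phi> f g. p \<in> V \<and> V \<subseteq> U \<and> diagonal_form_on V \<phi> f g g1 g2"
      by (rule 1) (rule that)
    show "\<forall>V \<phi> f g. V \<noteq> {} \<and> V \<subseteq> U \<and> diagonal_form_on V \<phi> f g g1 g2 \<longrightarrow>
         (\<forall>i j. i \<noteq> j \<longrightarrow>
            (\<forall>u\<in>V. f i (\<phi> u $ i) \<noteq> f j (\<phi> u $ j)) \<and>
            \<not> (\<exists>c. \<forall>u\<in>V. f i (\<phi> u $ i) = c \<and> f j (\<phi> u $ j) = c))"
      if "nonsingular_pair_on U g1 g2"
      using 3[OF that] by (intro allI impI, elim conjE) (rule conjI; blast)
  qed
qed

end
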